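(* Let $d \ge 3$ be odd and let $n \ge 1$ be an integer. Then: (i) $n \lceil n^{1/(d-1)} \rceil \le \delta_d(n) \le n^2$. (ii) $\delta_d(n) = n \lceil n^{1/(d-1)} \rceil$ for every $n \in \{1, \ldots, 2^{d-1}\} \cup \{3^{d-1}, \ldots, 4^{d-1}\} \cup \{k^{d-1}-1,\ k^{d-1} : k \in \mathbb{N},\ k \ge 2\}$, and $\delta_d(n) \in \{3n, 4n\}$ for every $n \in \{2^{d-1}+1, \ldots, 3^{d-1}\}$.
   Context: The group $G = \mathrm{SL}(n)^{\times d}$ acts on $V = (\mathbb{C}^n)^{\otimes d}$ by $(g_1,\ldots,g_d)\cdot(v_1 \otimes \cdots \otimes v_d) = g_1 v_1 \otimes \cdots \otimes g_d v_d$, extended linearly. Let $\mathbb{C}[V]^G_m$ denote the space of $G$-invariant homogeneous polynomials of degree $m$ on $V$. Define $\delta_d(n)$ to be the smallest positive integer $m$ such that $\mathbb{C}[V]^G_m \neq 0$ (the degree of a fundamental invariant). *)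

theory Defs
  imports Complex_Main "HOL-Library.FuncSet" "Jordan_Normal_Form.Determinant"
begin

text \<open>
  A tensor in \<open>(\<complex>^n)^{\<otimes> d}\<close> is represented by its coordinates with respect to the basis
  \<open>e_{i_0} \<otimes> ... \<otimes> e_{i_{d-1}}\<close>, where the multi-index \<open>i\<close> is a function
  from \<open>{..<d}\<close> to \<open>{..<n}\<close>.  Coordinates outside the index set are set to zero.
\<close>

type_synonym tensor = "(nat \<Rightarrow> nat) \<Rightarrow> complex"

definition idx :: "nat \<Rightarrow> nat \<Rightarrow> (nat \<Rightarrow> nat) set" where
  "idx d n = {..<d} \<rightarrow>\<^sub>E {..<n}"

definition tensor_space :: "nat \<Rightarrow> nat \<Rightarrow> tensor set" where
  "tensor_space d n = {T. \<forall>i. i \<notin> idx d n \<longrightarrow> T i = 0}"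

definition SL :: "nat \<Rightarrow> complex mat set" where
  "SL n = {A \<in> carrier_mat n n. det A = 1}"

definition SL_pow :: "nat \<Rightarrow> nat \<Rightarrow> (nat \<Rightarrow> complex mat) set" where
  "SL_pow d n = {..<d} \<rightarrow>\<^sub>E SL n"

definition pure_tensor :: "nat \<Rightarrow> nat \<Rightarrow> (nat \<Rightarrow> complex vec) \<Rightarrow> tensor" where
  "pure_tensor d n v = (\<lambda>i. if i \<in> idx d n then \<Prod>k<d. v k $ i k else 0)"

text \<open>
  The action of \<open>g_0 \<otimes> ... \<otimes> g_{d-1}\<close> in coordinates; it is visibly linear in \<open>T\<close>, and
  \<open>tensor_act_pure\<close> below shows that it has the prescribed values on pure tensors.
\<close>

definition tensor_act :: "nat \<Rightarrow> nat \<Rightarrow> (nat \<Rightarrow> complex mat) \<Rightarrow> tensor \<Rightarrow> tensor" where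
  "tensor_act d n g T =
     (\<lambda>i. if i \<in> idx d n then \<Sum>j\<in>idx d n. (\<Prod>k<d. g k $$ (i k, j k)) * T j else 0)"

lemma finite_idx: "finite (idx d n)"
  unfolding idx_def by (intro finite_PiE) auto

lemma tensor_act_pure:
  assumes g: "\<And>k. k < d \<Longrightarrow> g k \<in> carrier_mat n n"
    and v: "\<And>k. k < d \<Longrightarrow> v k \<in> carrier_vec n"
  shows "tensor_act d n g (pure_tensor d n v) = pure_tensor d n (\<lambda>k. g k *\<^sub>v v k)"
proof
  fix i
  show "tensor_act d n g (pure_tensor d n v) i = pure_tensor d n (\<lambda>k. g k *\<^sub>v v k) i"
  proof (cases "i \<in> idx d n")
    case False
    then show ?thesis by (simp add: tensor_act_def pure_tensor_def)
  next
    case True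
    have i: "i k < n" if "k < d" for k
      using True that by (auto simp: idx_def PiE_def Pi_def)
    have "tensor_act d n g (pure_tensor d n v) i
        = (\<Sum>j\<in>idx d n. \<Prod>k<d. g k $$ (i k, j k) * v k $ j k)"
      using True by (simp add: tensor_act_def pure_tensor_def prod.distrib)
    also have "\<dots> = (\<Prod>k<d. \<Sum>j<n. g k $$ (i k, j) * v k $ j)"
      unfolding idx_def by (rule prod_sum_PiE[symmetric]) auto
    also have "\<dots> = (\<Prod>k<d. (g k *\<^sub>v v k) $ i k)"
    proof (rule prod.cong[OF refl])
      fix k assume "k \<in> {..<d}"
      then have k: "k < d" by simp
      show "(\<Sum>j<n. g k $$ (i k, j) * v k $ j) = (g k *\<^sub>v v k) $ i k"
        using g[OF k] v[OF k] i[OF k]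
        by (auto simp: scalar_prod_def atLeast0LessThan intro!: sum.cong)
    qed
    finally show ?thesis using True by (simp add: pure_tensor_def)
  qed
qed

definition exponents :: "nat \<Rightarrow> nat \<Rightarrow> nat \<Rightarrow> ((nat \<Rightarrow> nat) \<Rightarrow> nat) set" where
  "exponents d n m = {e \<in> idx d n \<rightarrow>\<^sub>E UNIV. (\<Sum>i\<in>idx d n. e i) = m}"

lemma finite_exponents: "finite (exponents d n m)"
proof (rule finite_subset)
  show "exponents d n m \<subseteq> idx d n \<rightarrow>\<^sub>E {..m}"
  proof
    fix e assume e: "e \<in> exponents d n m"
    have "e i \<le> m" if "i \<in> idx d n" for i
      using e member_le_sum[of i "idx d n" e] that finite_idx[of d n]
      by (auto simp: exponents_def)
    with e show "e \<in> idx d n \<rightarrow>\<^sub>E {..m}"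
      by (auto simp: exponents_def PiE_def)
  qed
  show "finite (idx d n \<rightarrow>\<^sub>E {..m})"
    by (intro finite_PiE finite_idx) auto
qed

text \<open>
  Homogeneous polynomials of degree \<open>m\<close> on \<open>(\<complex>^n)^{\<otimes> d}\<close>, as polynomial functions (which
  over \<open>\<complex>\<close> is the same as formal polynomials).  Such a function only reads the coordinates
  in \<open>idx d n\<close>, so it is determined by its restriction to \<open>tensor_space d n\<close>, and it is
  the zero polynomial if and only if it equals \<open>\<lambda>_. 0\<close>.
\<close>

definition hom_polys :: "nat \<Rightarrow> nat \<Rightarrow> nat \<Rightarrow> (tensor \<Rightarrow> complex) set" where
  "hom_polys d n m =
     {f. \<exists>c. f = (\<lambda>T. \<Sum>e\<in>exponents d n m. c e * (\<Prod>i\<in>idx d n. T i ^ e i))}"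

definition invariants :: "nat \<Rightarrow> nat \<Rightarrow> nat \<Rightarrow> (tensor \<Rightarrow> complex) set" where
  "invariants d n m =
     {f \<in> hom_polys d n m.
        \<forall>g\<in>SL_pow d n. \<forall>T\<in>tensor_space d n. f (tensor_act d n g T) = f T}"

lemma zero_in_invariants: "(\<lambda>_. 0) \<in> invariants d n m"
  by (auto simp: invariants_def hom_polys_def intro!: exI[of _ "\<lambda>_. 0"])

definition \<delta> :: "nat \<Rightarrow> nat \<Rightarrow> nat" where
  "\<delta> d n = (LEAST m. m > 0 \<and> invariants d n m \<noteq> {\<lambda>_. 0})"

end

theory Submission
  imports "HOL-Number_Theory.Residues" "HOL-Library.Discrete_Functions" Defs
    "HOL-Combinatorics.Combinatorics" "Jordan_Normal_Form.Char_Poly"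
begin

text \<open>
  Polarisation turns an invariant of degree \<open>m\<close> into a symmetric \<open>SL n\<close>-invariant tensor on \<open>d\<close>-tuples of
  words of length \<open>m\<close>, and a scalar root of unity shows \<open>m = n * k\<close>. Contracting every direction with the
  determinant form of \<open>\<complex>^n \<otimes> \<complex>^k\<close> exchanges \<open>n\<close> with \<open>k\<close> and, as \<open>d\<close> is odd, symmetric with alternating.
  A nonzero alternating tensor is supported on \<open>n * k\<close> distinct points of \<open>[k]^d\<close>, so \<open>n \<le> k ^ (d - 1)\<close>.

  Conversely, contracting back an alternating \<open>SL k\<close>-invariant tensor gives an invariant of degree \<open>n * k\<close>.
  Such tensors exist for \<open>n = 1\<close>, for \<open>n = k ^ (d - 1)\<close> (the volume form), and with \<open>n\<close> for
  \<open>k ^ (d - 1) - n\<close>. For \<open>d = 3\<close>, \<open>k = p - 1\<close> and \<open>n \<le> 2 * k\<close> they come from cubes of the determinant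
  form: the value at a suitable point is a nonzero multiple of the square of the coefficient of
  \<open>\<Prod> X\<^sub>i\<^sub>j\<close> in \<open>det X ^ (p - 1)\<close>, which Glynn showed to be nonzero modulo \<open>p\<close>. Stacking alternating tensors for
  \<open>d\<close> and for \<open>3\<close> along the rows and columns of an array passes from \<open>d\<close> to \<open>d + 2\<close>. The primes \<open>3\<close> and \<open>5\<close> settle
  \<open>k = 2\<close> and \<open>k = 4\<close>, and Bertrand's postulate supplies some \<open>k = p - 1 \<le> n \<le> 2 * k\<close> for the bound \<open>n ^ 2\<close>.
\<close>

text \<open>The obstacle is cancellation: an invariant tensor is easily written down, but
  antisymmetrising it may give zero. For three factors the survival of a sum of cubes of the
  determinant form becomes a question on signed Latin squares, and \<open>glynn_sum\<close> is the
  sum of their column signs. If \<open>k\<close> is odd and \<open>n \<ge> 2\<close>, exchanging two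
  labels changes the sign of every term, so these sums of cubes vanish identically; this is why
  \<open>k = 3\<close> is not reached and two candidates remain between \<open>2 ^ (d - 1)\<close>
  and \<open>3 ^ (d - 1)\<close>. For \<open>k = p - 1\<close> the sum is nonzero because it is
  nonzero modulo \<open>p\<close>. One copy of the Latin square sum reaches only
  \<open>n \<le> k\<close>; two copies, coupled so that no label can mix them, reach
  \<open>2 * k\<close>. This doubling covers all of \<open>2 ^ 2\<close> for \<open>k = 2\<close>,
  half of \<open>4 ^ 2\<close> for \<open>k = 4\<close>, and matches the factor two in Bertrand's
  postulate. For more factors cancellation is excluded by positivity: what survives is the squared
  norm of a row symmetrisation.\<close>

subsection \<open>Words and symmetric coefficient functions\<close>

text \<open>Terms with equal exponents on \<open>I\<close> belong to one monomial, so this is the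
  vanishing of the coefficients of the zero polynomial function. One variable at a time becomes the
  indeterminate of a univariate polynomial.\<close>

lemma monomial_class_sum_zero:
  fixes H :: "'a \<Rightarrow> complex" and cnt :: "'a \<Rightarrow> 'i \<Rightarrow> nat"
  assumes "finite I" "finite A"
    and "\<And>x :: 'i \<Rightarrow> complex. (\<Sum>a\<in>A. H a * (\<Prod>i\<in>I. x i ^ cnt a i)) = 0"
  shows "(\<Sum>a\<in>{a\<in>A. \<forall>i\<in>I. cnt a i = e i}. H a) = 0"
  using assms
proof (induction I arbitrary: A rule: finite_induct)
  case empty
  then show ?case by simp
next
  case (insert j I)
  let ?A = "{a\<in>A. cnt a j = e j}"
  have "(\<Sum>a\<in>?A. H a * (\<Prod>i\<in>I. x i ^ cnt a i)) = 0" for x :: "'i \<Rightarrow> complex"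
  proof -
    define p where "p = (\<Sum>a\<in>A. Polynomial.monom (H a * (\<Prod>i\<in>I. x i ^ cnt a i)) (cnt a j))"
    have "poly p t = 0" for t
    proof -
      have "poly p t = (\<Sum>a\<in>A. H a * (\<Prod>i\<in>I. x i ^ cnt a i) * t ^ cnt a j)"
        by (simp add: p_def poly_sum poly_monom)
      also have "\<dots> = (\<Sum>a\<in>A. H a * (\<Prod>i\<in>insert j I. (x(j := t)) i ^ cnt a i))"
      proof (rule sum.cong[OF refl])
        fix a
        have "(\<Prod>i\<in>I. (x(j := t)) i ^ cnt a i) = (\<Prod>i\<in>I. x i ^ cnt a i)"
          using insert.hyps by (intro prod.cong) auto
        then show "H a * (\<Prod>i\<in>I. x i ^ cnt a i) * t ^ cnt a j
            = H a * (\<Prod>i\<in>insert j I. (x(j := t)) i ^ cnt a i)"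
          using insert.hyps by simp
      qed
      also have "\<dots> = 0" by (rule insert.prems(2))
      finally show ?thesis .
    qed
    then have "p = 0" using poly_all_0_iff_0 by blast
    then have "coeff p (e j) = 0" by simp
    moreover have "coeff p (e j) = (\<Sum>a\<in>?A. H a * (\<Prod>i\<in>I. x i ^ cnt a i))"
      using insert.prems(1)
      by (simp add: p_def coeff_sum sum.inter_filter[symmetric])
    ultimately show ?thesis by simp
  qed
  from insert.IH[OF _ this] insert.prems(1)
  have "(\<Sum>a\<in>{a\<in>?A. \<forall>i\<in>I. cnt a i = e i}. H a) = 0" by simp
  moreover have "{a\<in>?A. \<forall>i\<in>I. cnt a i = e i} = {a\<in>A. \<forall>i\<in>insert j I. cnt a i = e i}" by auto
  ultimately show ?case by simp
qed

lemma comp_permutes_PiE: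
  assumes "\<sigma> permutes P" "y \<in> P \<rightarrow>\<^sub>E B"
  shows "y \<circ> \<sigma> \<in> P \<rightarrow>\<^sub>E B"
proof (rule PiE_I)
  fix x assume "x \<in> P"
  then show "(y \<circ> \<sigma>) x \<in> B"
    using assms permutes_in_image[OF assms(1)] by (auto simp: PiE_def Pi_def)
next
  fix x assume "x \<notin> P"
  then show "(y \<circ> \<sigma>) x = undefined"
    using assms permutes_not_in[OF assms(1)] by (auto simp: PiE_def extensional_def)
qed

lemma sum_PiE_permutes:
  assumes "\<sigma> permutes P"
  shows "(\<Sum>y\<in>P \<rightarrow>\<^sub>E B. f (y \<circ> \<sigma>)) = (\<Sum>y\<in>P \<rightarrow>\<^sub>E B. f y)"
proof -
  have "bij_betw (\<lambda>y. y \<circ> \<sigma>) (P \<rightarrow>\<^sub>E B) (P \<rightarrow>\<^sub>E B)"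
    by (rule bij_betwI[where g = "\<lambda>y. y \<circ> Hilbert_Choice.inv \<sigma>"])
      (auto simp: comp_assoc permutes_inv_o[OF assms] simp del: o_apply
        intro!: comp_permutes_PiE assms permutes_inv)
  then show ?thesis by (rule sum.reindex_bij_betw)
qed

lemma prod_comp_permutes:
  assumes "\<sigma> permutes P"
  shows "(\<Prod>a\<in>P. f (\<sigma> a)) = (\<Prod>a\<in>P. f a)"
  using prod.permute[OF assms, of f] by (simp add: o_def)

lemma sum_permutations_right:
  assumes "\<sigma> permutes P"
  shows "(\<Sum>p\<in>{p. p permutes P}. f (p \<circ> \<sigma>)) = (\<Sum>p\<in>{p. p permutes P}. f p)"
  using sum_permutations_compose_right[OF assms, of f] by simp

lemma sum_permutations_left:
  assumes "\<sigma> permutes P"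
  shows "(\<Sum>p\<in>{p. p permutes P}. f (\<sigma> \<circ> p)) = (\<Sum>p\<in>{p. p permutes P}. f p)"
proof -
  have "bij_betw (\<lambda>p. \<sigma> \<circ> p) {p. p permutes P} {p. p permutes P}"
    by (rule bij_betwI[where g = "\<lambda>p. Hilbert_Choice.inv \<sigma> \<circ> p"])
      (auto simp: comp_assoc[symmetric] permutes_inv_o[OF assms] simp del: o_apply
        intro!: permutes_compose assms permutes_inv)
  then show ?thesis by (rule sum.reindex_bij_betw)
qed

text \<open>
  The monomials \<open>\<Prod>a\<in>P. g (u a) (y a)\<close> are indexed by the orbits of the stabiliser of \<open>u\<close>
  on the words \<open>y\<close>, so a polynomial determines its stabiliser-symmetric coefficient function.
\<close>

lemma sym_coeffs_eq_zero:
  fixes H :: "('p \<Rightarrow> 'b) \<Rightarrow> complex" and u :: "'p \<Rightarrow> 'i"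
  assumes P: "finite P" and B: "finite B"
    and sym: "\<And>\<sigma> y. \<sigma> permutes P \<Longrightarrow> (\<And>a. a \<in> P \<Longrightarrow> u (\<sigma> a) = u a) \<Longrightarrow> y \<in> P \<rightarrow>\<^sub>E B \<Longrightarrow> H (y \<circ> \<sigma>) = H y"
    and zero: "\<And>g :: 'i \<Rightarrow> 'b \<Rightarrow> complex. (\<Sum>y\<in>P \<rightarrow>\<^sub>E B. H y * (\<Prod>a\<in>P. g (u a) (y a))) = 0"
    and y0: "y0 \<in> P \<rightarrow>\<^sub>E B"
  shows "H y0 = 0"
proof -
  let ?A = "P \<rightarrow>\<^sub>E B" and ?I = "u ` P \<times> B"
  define cnt where "cnt = (\<lambda>y (c :: 'i \<times> 'b). card {a\<in>P. (u a, y a) = c})"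
  have finA: "finite ?A" using P B by (simp add: finite_PiE)
  have "(\<Sum>y\<in>?A. H y * (\<Prod>c\<in>?I. x c ^ cnt y c)) = 0" for x :: "'i \<times> 'b \<Rightarrow> complex"
  proof -
    have "(\<Prod>c\<in>?I. x c ^ cnt y c) = (\<Prod>a\<in>P. x (u a, y a))" if y: "y \<in> ?A" for y
    proof -
      have "(\<Prod>c\<in>?I. \<Prod>a\<in>{a\<in>P. (u a, y a) = c}. x (u a, y a)) = (\<Prod>a\<in>P. x (u a, y a))"
        using P B y by (intro prod.group) auto
      moreover have "(\<Prod>a\<in>{a\<in>P. (u a, y a) = c}. x (u a, y a)) = x c ^ cnt y c" for c
      proof -
        have "(\<Prod>a\<in>{a\<in>P. (u a, y a) = c}. x (u a, y a)) = (\<Prod>a\<in>{a\<in>P. (u a, y a) = c}. x c)"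
          by (rule prod.cong) auto
        then show ?thesis by (simp add: cnt_def)
      qed
      ultimately show ?thesis by simp
    qed
    then have "(\<Sum>y\<in>?A. H y * (\<Prod>c\<in>?I. x c ^ cnt y c))
        = (\<Sum>y\<in>?A. H y * (\<Prod>a\<in>P. curry x (u a) (y a)))"
      by (intro sum.cong) auto
    then show ?thesis using zero by simp
  qed
  from monomial_class_sum_zero[OF _ finA this, of "cnt y0"] P B
  have "(\<Sum>y\<in>{y\<in>?A. \<forall>c\<in>?I. cnt y c = cnt y0 c}. H y) = 0" by simp
  moreover have "H y = H y0" if "y \<in> {y\<in>?A. \<forall>c\<in>?I. cnt y c = cnt y0 c}" for y
  proof -
    from that have y: "y \<in> ?A" and c: "\<And>c. c \<in> ?I \<Longrightarrow> cnt y c = cnt y0 c" by auto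
    \<comment> \<open>Equal exponents mean equal multisets of pairs \<open>(u a, y a)\<close>, so
      \<open>y\<close> is \<open>y0\<close> rearranged by a permutation that preserves
      \<open>u\<close>. Hence \<open>H\<close> is constant on the class and its sum is a positive
      multiple of \<open>H y0\<close>.\<close>
    have "image_mset (\<lambda>a. (u a, y a)) (mset_set P) = image_mset (\<lambda>a. (u a, y0 a)) (mset_set P)"
    proof (rule multiset_eqI)
      fix c
      have "card {a\<in>P. (u a, y a) = c} = card {a\<in>P. (u a, y0 a) = c}"
      proof (cases "c \<in> ?I")
        case True
        then show ?thesis using c by (simp add: cnt_def)
      next
        case False
        then have "{a\<in>P. (u a, y a) = c} = {}" "{a\<in>P. (u a, y0 a) = c} = {}"
          using y y0 by (auto simp: PiE_def Pi_def)
        then show ?thesis by metis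
      qed
      then show "count (image_mset (\<lambda>a. (u a, y a)) (mset_set P)) c
          = count (image_mset (\<lambda>a. (u a, y0 a)) (mset_set P)) c"
        using P by (simp add: count_image_mset_eq_card_vimage)
    qed
    from image_mset_eq_implies_permutes[OF P this]
    obtain p where p: "p permutes P" "\<forall>a\<in>P. (u a, y a) = (u (p a), y0 (p a))" by auto
    have "y = y0 \<circ> p"
    proof
      fix a show "y a = (y0 \<circ> p) a"
        using p y y0 permutes_not_in[OF p(1)] by (cases "a \<in> P") (auto simp: PiE_def extensional_def)
    qed
    with sym[OF p(1) _ y0] p(2) show ?thesis by simp
  qed
  ultimately have "of_nat (card {y\<in>?A. \<forall>c\<in>?I. cnt y c = cnt y0 c}) * H y0 = 0"
    by (simp add: sum.cong)
  moreover have "card {y\<in>?A. \<forall>c\<in>?I. cnt y c = cnt y0 c} \<noteq> 0"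
    using y0 finA by (auto simp: card_eq_0_iff)
  ultimately show ?thesis by simp
qed

lemma prod_sum_PiE':
  assumes "finite P" "finite B"
  shows "(\<Sum>w\<in>P \<rightarrow>\<^sub>E B. \<Prod>a\<in>P. f a (w a)) = (\<Prod>a\<in>P. \<Sum>i\<in>B. f a i :: 'c :: comm_semiring_1)"
  using assms by (subst prod_sum_PiE) auto

section \<open>Invariance under SL(n) and covariance under GL(n)\<close>

abbreviation words :: "'p set \<Rightarrow> nat \<Rightarrow> ('p \<Rightarrow> nat) set" where
  "words P n \<equiv> P \<rightarrow>\<^sub>E {..<n}"

definition sl_inv :: "'p set \<Rightarrow> nat \<Rightarrow> (('p \<Rightarrow> nat) \<Rightarrow> complex) \<Rightarrow> bool" where
  "sl_inv P n \<phi> \<longleftrightarrow> (\<forall>g\<in>SL n. \<forall>w\<in>words P n.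
     (\<Sum>w'\<in>words P n. (\<Prod>a\<in>P. g $$ (w a, w' a)) * \<phi> w') = \<phi> w)"

lemma sl_invD:
  "sl_inv P n \<phi> \<Longrightarrow> g \<in> SL n \<Longrightarrow> w \<in> words P n \<Longrightarrow>
     (\<Sum>w'\<in>words P n. (\<Prod>a\<in>P. g $$ (w a, w' a)) * \<phi> w') = \<phi> w"
  unfolding sl_inv_def by blast

lemma words_lt: "w \<in> words P n \<Longrightarrow> a \<in> P \<Longrightarrow> w a < n"
  by (auto simp: PiE_def Pi_def)

lemma finite_words: "finite P \<Longrightarrow> finite (words P n)"
  by (simp add: finite_PiE)

lemma complex_root_exists:
  fixes z :: complex
  assumes "n > 0"
  obtains w where "w ^ n = z"
proof -
  have "(rcis (root n (cmod z)) (Arg z / n)) ^ n = rcis (cmod z) (Arg z)"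
    using assms by (simp add: DeMoivre2)
  then show ?thesis using that rcis_cmod_Arg by metis
qed

text \<open>Dividing \<open>X\<close> by an \<open>n\<close>-th root \<open>c\<close> of its
  determinant lands in \<open>SL n\<close>; the scalar comes back as
  \<open>c ^ (n * k) = det X ^ k\<close>.\<close>

lemma sl_inv_invertible:
  assumes inv: "sl_inv P n \<phi>" and P: "finite P" "card P = n * k" and n: "n > 0"
    and X: "X \<in> carrier_mat n n" and d: "det X \<noteq> 0" and w: "w \<in> words P n"
  shows "(\<Sum>w'\<in>words P n. (\<Prod>a\<in>P. X $$ (w a, w' a)) * \<phi> w') = det X ^ k * \<phi> w"
proof -
  obtain c where c: "c ^ n = det X" using complex_root_exists[OF n] by metis
  then have c0: "c \<noteq> 0" using d n by (metis power_0_left not_gr_zero)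
  let ?g = "inverse c \<cdot>\<^sub>m X"
  have g: "?g \<in> SL n"
    using X c d c0 by (auto simp: SL_def power_inverse)
  have "(\<Prod>a\<in>P. X $$ (w a, w' a)) = c ^ card P * (\<Prod>a\<in>P. ?g $$ (w a, w' a))"
    if w': "w' \<in> words P n" for w'
  proof -
    have "(\<Prod>a\<in>P. X $$ (w a, w' a)) = (\<Prod>a\<in>P. c * ?g $$ (w a, w' a))"
      using X c0 words_lt[OF w] words_lt[OF w'] by (intro prod.cong) auto
    then show ?thesis by (simp add: prod.distrib)
  qed
  then have "(\<Sum>w'\<in>words P n. (\<Prod>a\<in>P. X $$ (w a, w' a)) * \<phi> w')
      = c ^ card P * (\<Sum>w'\<in>words P n. (\<Prod>a\<in>P. ?g $$ (w a, w' a)) * \<phi> w')"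
    by (simp add: sum_distrib_left mult.assoc)
  also have "\<dots> = (c ^ n) ^ k * \<phi> w"
    using sl_invD[OF inv g w] by (simp add: P(2) power_mult)
  finally show ?thesis by (simp add: c)
qed

text \<open>Up to sign the determinant is the characteristic polynomial of \<open>X\<close> at
  \<open>- t\<close>, which has finitely many roots.\<close>

lemma eventually_det_shift_nonzero:
  fixes X :: "complex mat"
  assumes X: "X \<in> carrier_mat n n"
  shows "eventually (\<lambda>t. det (X + t \<cdot>\<^sub>m 1\<^sub>m n) \<noteq> 0) (at 0)"
proof -
  let ?S = "{t. poly (char_poly X) (- t) = 0}"
  have "char_poly X \<noteq> 0" using degree_monic_char_poly[OF X] by auto
  then have "finite {t. poly (char_poly X) t = 0}" by (rule poly_roots_finite)
  then have "finite (uminus ` {t. poly (char_poly X) t = 0})" by simp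
  then have fin: "finite ?S" by (rule rev_finite_subset) (force simp: image_iff intro: minus_minus[symmetric])
  have "open (- (?S - {0}))" using fin by (intro open_Compl finite_imp_closed) auto
  then have "eventually (\<lambda>t. t \<in> - (?S - {0})) (nhds 0)" by (rule eventually_nhds_in_open) auto
  then have "eventually (\<lambda>t. t \<in> - (?S - {0})) (at 0)" by (rule eventually_at_filter[THEN iffD2, OF eventually_mono]) auto
  moreover have "eventually (\<lambda>t :: complex. t \<noteq> 0) (at 0)" by (simp add: eventually_at_filter)
  ultimately show ?thesis
  proof eventually_elim
    case (elim t)
    then have "poly (char_poly X) (- t) \<noteq> 0" by auto
    then have "\<not> eigenvalue X (- t)" using eigenvalue_root_char_poly[OF X] by simp
    then show ?case using eigenvalue_det[OF X, of "- t"] X by (simp add: char_matrix_def)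
  qed
qed

text \<open>Singular \<open>X\<close> are limits of the invertible matrices \<open>X + t\<close>,
  and both sides are continuous in \<open>t\<close>. Singular matrices have to be included because
  the identity serves later as one between polynomials in all entries of \<open>X\<close>.\<close>

lemma sl_inv_GL:
  assumes inv: "sl_inv P n \<phi>" and P: "finite P" "card P = n * k" and n: "n > 0"
    and X: "X \<in> carrier_mat n n" and w: "w \<in> words P n"
  shows "(\<Sum>w'\<in>words P n. (\<Prod>a\<in>P. X $$ (w a, w' a)) * \<phi> w') = det X ^ k * \<phi> w"
proof -
  define M where "M = (\<lambda>i j t. X $$ (i, j) + t * of_bool (i = j))"
  define h where "h = (\<lambda>t. (\<Sum>w'\<in>words P n. (\<Prod>a\<in>P. M (w a) (w' a) t) * \<phi> w')
    - (\<Sum>p\<in>{p. p permutes {0..<n}}. signof p * (\<Prod>i = 0..<n. M i (p i) t)) ^ k * \<phi> w)"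
  have M: "(X + t \<cdot>\<^sub>m 1\<^sub>m n) $$ (i, j) = M i j t" if "i < n" "j < n" for i j t
    using X that by (simp add: M_def)
  have det: "det (X + t \<cdot>\<^sub>m 1\<^sub>m n) = (\<Sum>p\<in>{p. p permutes {0..<n}}. signof p * (\<Prod>i = 0..<n. M i (p i) t))" for t
  proof -
    have "(\<Prod>i = 0..<n. (X + t \<cdot>\<^sub>m 1\<^sub>m n) $$ (i, p i)) = (\<Prod>i = 0..<n. M i (p i) t)"
      if p: "p permutes {0..<n}" for p
      using permutes_in_image[OF p] by (intro prod.cong refl M) auto
    then show ?thesis using X by (subst det_def'[of _ n]) (auto intro!: sum.cong)
  qed
  have h: "h t = (\<Sum>w'\<in>words P n. (\<Prod>a\<in>P. (X + t \<cdot>\<^sub>m 1\<^sub>m n) $$ (w a, w' a)) * \<phi> w')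
      - det (X + t \<cdot>\<^sub>m 1\<^sub>m n) ^ k * \<phi> w" for t
  proof -
    have "(\<Prod>a\<in>P. (X + t \<cdot>\<^sub>m 1\<^sub>m n) $$ (w a, w' a)) = (\<Prod>a\<in>P. M (w a) (w' a) t)"
      if "w' \<in> words P n" for w'
      using words_lt[OF w] words_lt[OF that] by (intro prod.cong refl M) auto
    then show ?thesis unfolding h_def det by simp
  qed
  have "eventually (\<lambda>t. h t = 0) (at 0)"
    using eventually_det_shift_nonzero[OF X]
  proof eventually_elim
    case (elim t)
    then show ?case using sl_inv_invertible[OF inv P n _ elim w] X by (simp add: h)
  qed
  then have "(h \<longlongrightarrow> 0) (at 0)" by (simp add: tendsto_eventually)
  moreover have "isCont h 0" unfolding h_def M_def by (intro continuous_intros)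
  ultimately have "h 0 = 0" using LIM_unique unfolding isCont_def by blast
  moreover have "X + 0 \<cdot>\<^sub>m 1\<^sub>m n = X" using X by (intro eq_matI) auto
  ultimately show ?thesis by (simp add: h)
qed

subsection \<open>The determinant form on a tensor product\<close>

text \<open>
  The sign of \<open>s\<close> as a permutation of \<open>{..<m}\<close>, and \<open>0\<close> if \<open>s\<close> does not permute \<open>{..<m}\<close>.
\<close>

definition perm_sign :: "nat \<Rightarrow> (nat \<Rightarrow> nat) \<Rightarrow> int" where
  "perm_sign m s = (\<Sum>p | p permutes {..<m}. sign p * of_bool (\<forall>a<m. s a = p a))"

lemma finite_perms: "finite {p. p permutes {..<m :: nat}}"
  by (rule finite_permutations) simp

lemma perm_sign_cong: "(\<And>a. a < m \<Longrightarrow> s a = t a) \<Longrightarrow> perm_sign m s = perm_sign m t"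
  unfolding perm_sign_def by (intro sum.cong) auto

lemma perm_sign_eq_sign:
  assumes "p permutes {..<m}" "\<And>a. a < m \<Longrightarrow> s a = p a"
  shows "perm_sign m s = sign p"
proof -
  have eq: "q = p" if "q permutes {..<m}" "\<forall>a<m. s a = q a" for q
  proof
    fix a show "q a = p a"
      using assms(2) that permutes_not_in[OF assms(1), of a] permutes_not_in[OF that(1), of a]
      by (cases "a < m") auto
  qed
  have "perm_sign m s = (\<Sum>q\<in>{p}. sign q * of_bool (\<forall>a<m. s a = q a))"
    unfolding perm_sign_def
    by (rule sum.mono_neutral_right) (use assms eq finite_perms in auto)
  then show ?thesis using assms(2) by simp
qed

lemma bij_betw_lessThan_permutes:
  assumes "bij_betw s {..<m :: nat} {..<m}"
  obtains p where "p permutes {..<m}" "\<And>a. a < m \<Longrightarrow> s a = p a"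
proof
  show "restrict_id s {..<m} permutes {..<m}"
    using assms by (intro bij_imp_permutes) (auto simp: bij_betw_def inj_on_def restrict_id_def)
qed (auto simp: restrict_id_def)

lemma perm_sign_nonzero_iff: "perm_sign m s \<noteq> 0 \<longleftrightarrow> bij_betw s {..<m} {..<m}"
proof
  assume "perm_sign m s \<noteq> 0"
  then have "\<exists>p. p permutes {..<m} \<and> (\<forall>a<m. s a = p a)"
    unfolding perm_sign_def by (rule contrapos_np) (auto intro!: sum.neutral)
  then obtain p where "p permutes {..<m}" "\<forall>a<m. s a = p a" by blast
  then show "bij_betw s {..<m} {..<m}"
    using permutes_imp_bij[of p "{..<m}"] by (subst bij_betw_cong[of _ _ p]) auto
next
  assume "bij_betw s {..<m} {..<m}"
  then obtain p where p: "p permutes {..<m}" "\<And>a. a < m \<Longrightarrow> s a = p a"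
    by (rule bij_betw_lessThan_permutes) blast
  then show "perm_sign m s \<noteq> 0" using perm_sign_eq_sign[OF p] by (simp add: sign_def)
qed

lemma perm_sign_cases: "perm_sign m s \<in> {0, 1, -1}"
proof (cases "perm_sign m s = 0")
  case False
  then have "bij_betw s {..<m} {..<m}" by (simp add: perm_sign_nonzero_iff)
  then obtain p where p: "p permutes {..<m}" "\<And>a. a < m \<Longrightarrow> s a = p a"
    by (rule bij_betw_lessThan_permutes) blast
  then show ?thesis using perm_sign_eq_sign[OF p] by (simp add: sign_def)
qed simp

lemma sign_permutes_compose:
  "p permutes A \<Longrightarrow> q permutes A \<Longrightarrow> finite A \<Longrightarrow> sign (p \<circ> q) = sign p * sign q"
  by (intro sign_compose permutes_imp_permutation)

lemma sign_mult_self: "sign p * sign p = (1 :: int)"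
  by (simp add: sign_def)

lemma perm_sign_comp_right:
  assumes "\<pi> permutes {..<m}"
  shows "perm_sign m (s \<circ> \<pi>) = sign \<pi> * perm_sign m s"
proof -
  have "perm_sign m (s \<circ> \<pi>)
      = (\<Sum>p | p permutes {..<m}. sign (p \<circ> \<pi>) * of_bool (\<forall>a<m. s (\<pi> a) = (p \<circ> \<pi>) a))"
    using sum_permutations_right[OF assms, of "\<lambda>p. sign p * of_bool (\<forall>a<m. s (\<pi> a) = p a)"]
    unfolding perm_sign_def by simp
  also have "\<dots> = (\<Sum>p | p permutes {..<m}. sign \<pi> * (sign p * of_bool (\<forall>a<m. s a = p a)))"
  proof (rule sum.cong[OF refl])
    fix p assume p: "p \<in> {p. p permutes {..<m}}"
    have "(\<forall>a<m. s (\<pi> a) = (p \<circ> \<pi>) a) \<longleftrightarrow> (\<forall>a\<in>\<pi> ` {..<m}. s a = p a)" by auto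
    also have "\<dots> \<longleftrightarrow> (\<forall>a<m. s a = p a)" using permutes_image[OF assms] by auto
    finally show "sign (p \<circ> \<pi>) * of_bool (\<forall>a<m. s (\<pi> a) = (p \<circ> \<pi>) a)
        = sign \<pi> * (sign p * of_bool (\<forall>a<m. s a = p a))"
      using p assms by (simp add: sign_permutes_compose)
  qed
  finally show ?thesis unfolding perm_sign_def by (simp add: sum_distrib_left)
qed

lemma perm_sign_comp_left:
  assumes "\<rho> permutes {..<m}"
  shows "perm_sign m (\<rho> \<circ> s) = sign \<rho> * perm_sign m s"
proof -
  have "perm_sign m (\<rho> \<circ> s)
      = (\<Sum>p | p permutes {..<m}. sign (\<rho> \<circ> p) * of_bool (\<forall>a<m. \<rho> (s a) = (\<rho> \<circ> p) a))"
    unfolding perm_sign_def o_apply[of \<rho> s]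
    by (rule sum_permutations_left[OF assms, symmetric])
  also have "\<dots> = (\<Sum>p | p permutes {..<m}. sign \<rho> * (sign p * of_bool (\<forall>a<m. s a = p a)))"
    using assms permutes_inj[OF assms] by (intro sum.cong) (auto simp: sign_permutes_compose inj_eq)
  finally show ?thesis unfolding perm_sign_def by (simp add: sum_distrib_left)
qed

text \<open>A bijection \<open>s\<close> of this kind preserves both blocks, and the sign of a
  direct sum is the product of the signs. Conversely, if both pieces are bijections then so is
  \<open>s\<close>, so otherwise both sides vanish.\<close>

lemma perm_sign_append:
  assumes s1: "\<And>a. a < m1 \<Longrightarrow> s a < m1" and s2: "\<And>a. m1 \<le> a \<Longrightarrow> a < m1 + m2 \<Longrightarrow> m1 \<le> s a"
  shows "perm_sign (m1 + m2) s = perm_sign m1 s * perm_sign m2 (\<lambda>a. s (m1 + a) - m1)"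
proof (cases "bij_betw s {..<m1 + m2} {..<m1 + m2}")
  case True
  have un: "{..<m1 + m2} = {..<m1} \<union> {m1..<m1 + m2}" by auto
  have inj: "inj_on s {..<m1 + m2}" using True by (simp add: bij_betw_def)
  have im: "s ` {..<m1} = {..<m1}"
    using s1 inj by (intro endo_inj_surj) (auto simp: inj_on_def)
  have im2: "s ` {m1..<m1 + m2} = {m1..<m1 + m2}"
  proof (rule endo_inj_surj)
    show "s ` {m1..<m1 + m2} \<subseteq> {m1..<m1 + m2}"
      using s2 True by (force simp: bij_betw_def)
  qed (use inj in \<open>auto simp: inj_on_def\<close>)
  have b1: "bij_betw s {..<m1} {..<m1}" using im inj by (auto simp: bij_betw_def inj_on_def)
  have b2: "bij_betw s {m1..<m1 + m2} {m1..<m1 + m2}" using im2 inj by (auto simp: bij_betw_def inj_on_def)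
  have sh: "bij_betw (\<lambda>a. m1 + a) {..<m2} {m1..<m1 + m2}"
    by (rule bij_betwI[where g = "\<lambda>a. a - m1"]) auto
  have hs: "bij_betw (\<lambda>a. a - m1) {m1..<m1 + m2} {..<m2}"
    by (rule bij_betwI[where g = "\<lambda>a. m1 + a"]) auto
  have b3: "bij_betw (\<lambda>a. s (m1 + a) - m1) {..<m2} {..<m2}"
    using bij_betw_trans[OF bij_betw_trans[OF sh b2] hs] by (simp add: o_def)
  obtain p where p: "p permutes {..<m1}" "\<And>a. a < m1 \<Longrightarrow> s a = p a"
    using bij_betw_lessThan_permutes[OF b1] by blast
  obtain q where q: "q permutes {..<m2}" "\<And>a. a < m2 \<Longrightarrow> s (m1 + a) - m1 = q a"
    using bij_betw_lessThan_permutes[OF b3] by blast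
  let ?q = "map_permutation {..<m2} (\<lambda>a. m1 + a) q"
  have Q: "?q permutes {m1..<m1 + m2}" using map_permutation_permutes[OF sh q(1)] .
  have sQ: "sign ?q = sign q" by (rule sign_map_permutation) (use q in \<open>auto simp: inj_on_def\<close>)
  have P': "p permutes {..<m1 + m2}" by (rule permutes_subset[OF p(1)]) auto
  have Q': "?q permutes {..<m1 + m2}" by (rule permutes_subset[OF Q]) auto
  have "s a = (p \<circ> ?q) a" if a: "a < m1 + m2" for a
  proof (cases "a < m1")
    case True
    then have "?q a = a" using permutes_not_in[OF Q, of a] by auto
    then show ?thesis using p(2) True by simp
  next
    case False
    then obtain b where b: "a = m1 + b" "b < m2" using a by (metis add_less_cancel_left le_iff_add not_less)
    have "?q a = m1 + q b" unfolding b(1) using b(2)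
      by (subst map_permutation_apply) (auto simp: inj_on_def)
    moreover have "p (m1 + q b) = m1 + q b" using permutes_not_in[OF p(1)] by simp
    moreover have "s a = m1 + q b" using q(2)[OF b(2)] s2[of a] a b by auto
    ultimately show ?thesis by simp
  qed
  then have "perm_sign (m1 + m2) s = sign (p \<circ> ?q)"
    using P' Q' by (intro perm_sign_eq_sign permutes_compose) auto
  also have "\<dots> = sign p * sign q" using P' Q' sQ by (simp add: sign_permutes_compose)
  finally show ?thesis using perm_sign_eq_sign[OF p] perm_sign_eq_sign[OF q] by simp
next
  case False
  have "\<not> (bij_betw s {..<m1} {..<m1} \<and> bij_betw (\<lambda>a. s (m1 + a) - m1) {..<m2} {..<m2})"
  proof
    assume *: "bij_betw s {..<m1} {..<m1} \<and> bij_betw (\<lambda>a. s (m1 + a) - m1) {..<m2} {..<m2}"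
    have inj: "inj_on s {..<m1 + m2}"
    proof (rule inj_onI)
      fix a b assume ab: "a \<in> {..<m1 + m2}" "b \<in> {..<m1 + m2}" "s a = s b"
      consider "a < m1" "b < m1" | "m1 \<le> a" "m1 \<le> b"
        using s1[of a] s1[of b] s2[of a] s2[of b] ab by force
      then show "a = b"
      proof cases
        case 1
        then show ?thesis using * ab by (auto simp: bij_betw_def inj_on_def)
      next
        case 2
        then have "a - m1 < m2" "b - m1 < m2" "s (m1 + (a - m1)) - m1 = s (m1 + (b - m1)) - m1"
          using ab by auto
        then have "a - m1 = b - m1" using * unfolding bij_betw_def inj_on_def by blast
        then show ?thesis using 2 by simp
      qed
    qed
    have "s a < m1 + m2" if "a < m1 + m2" for a
    proof (cases "a < m1")
      case True then show ?thesis using s1[of a] by simp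
    next
      case False
      then have "a - m1 < m2" using that by simp
      then have "s (m1 + (a - m1)) - m1 < m2" using * unfolding bij_betw_def by blast
      then show ?thesis using False s2[of a] that by simp
    qed
    then have "s ` {..<m1 + m2} \<subseteq> {..<m1 + m2}" by auto
    with inj have "s ` {..<m1 + m2} = {..<m1 + m2}" by (intro endo_inj_surj) auto
    with inj False show False by (simp add: bij_betw_def)
  qed
  then show ?thesis using False perm_sign_nonzero_iff by (metis mult_eq_0_iff)
qed

text \<open>A selection that is not a bijection takes some row twice.\<close>

lemma det_select_rows:
  fixes G :: "complex mat"
  assumes G: "G \<in> carrier_mat m m" and s: "\<And>a. a < m \<Longrightarrow> s a < m"
  shows "det (mat m m (\<lambda>(a, b). G $$ (s a, b))) = of_int (perm_sign m s) * det G"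
proof (cases "bij_betw s {..<m} {..<m}")
  case True
  then obtain p where p: "p permutes {..<m}" "\<And>a. a < m \<Longrightarrow> s a = p a"
    by (rule bij_betw_lessThan_permutes) blast
  have p': "p permutes {0..<m}" using p(1) by (simp add: atLeast0LessThan)
  have "mat m m (\<lambda>(a, b). G $$ (s a, b)) = mat m m (\<lambda>(a, b). G $$ (p a, b))"
    using p(2) by (intro cong_mat) auto
  then show ?thesis using det_permute_rows[OF G p'] perm_sign_eq_sign[OF p] by simp
next
  case False
  have "s ` {..<m} \<subseteq> {..<m}" using s by auto
  then have "\<not> inj_on s {..<m}"
    using False endo_inj_surj[of "{..<m}" s] by (auto simp: bij_betw_def)
  then obtain a b where ab: "a < m" "b < m" "a \<noteq> b" "s a = s b" by (auto simp: inj_on_def)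
  have "det (mat m m (\<lambda>(a, b). G $$ (s a, b))) = 0"
    by (rule det_identical_rows[of _ m a b]) (use ab in \<open>auto intro!: eq_vecI\<close>)
  then show ?thesis using False perm_sign_nonzero_iff[of m s] by simp
qed

text \<open>Row \<open>a\<close> of the matrix combines the unit vectors at \<open>c a i\<close>
  with weights \<open>R a i\<close>. The left side is the multilinear expansion of the determinant
  in its rows, \<open>perm_sign\<close> being the determinant of a choice of unit vectors.\<close>

lemma det_eq_sum_perm_sign:
  fixes R :: "nat \<Rightarrow> 'i \<Rightarrow> complex" and c :: "nat \<Rightarrow> 'i \<Rightarrow> nat"
  assumes B: "finite B"
  shows "(\<Sum>y\<in>{..<m} \<rightarrow>\<^sub>E B. (\<Prod>a<m. R a (y a)) * of_int (perm_sign m (\<lambda>a. c a (y a))))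
    = det (mat m m (\<lambda>(a, b). \<Sum>i\<in>B. R a i * of_bool (c a i = b)))"
proof -
  have ob: "of_bool (\<forall>a<m. Q a) = (\<Prod>a<m. of_bool (Q a) :: complex)" for Q
    by (induction m) (auto simp: less_Suc_eq of_bool_conj)
  have "(\<Sum>y\<in>{..<m} \<rightarrow>\<^sub>E B. (\<Prod>a<m. R a (y a)) * of_int (perm_sign m (\<lambda>a. c a (y a))))
    = (\<Sum>y\<in>{..<m} \<rightarrow>\<^sub>E B. \<Sum>p | p permutes {..<m}. signof p * (\<Prod>a<m. R a (y a) * of_bool (c a (y a) = p a)))"
    unfolding perm_sign_def of_int_sum of_int_mult sum_distrib_left of_int_of_bool ob prod.distrib
    by (simp add: ac_simps)
  also have "\<dots> = (\<Sum>p | p permutes {..<m}. signof p * (\<Sum>y\<in>{..<m} \<rightarrow>\<^sub>E B. \<Prod>a<m. R a (y a) * of_bool (c a (y a) = p a)))"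
    by (subst sum.swap) (simp add: sum_distrib_left)
  also have "\<dots> = (\<Sum>p | p permutes {..<m}. signof p * (\<Prod>a<m. \<Sum>i\<in>B. R a i * of_bool (c a i = p a)))"
    using B by (subst prod_sum_PiE') simp_all
  also have "\<dots> = det (mat m m (\<lambda>(a, b). \<Sum>i\<in>B. R a i * of_bool (c a i = b)))"
  proof -
    have "(\<Prod>a<m. \<Sum>i\<in>B. R a i * of_bool (c a i = p a))
        = (\<Prod>a = 0..<m. mat m m (\<lambda>(a, b). \<Sum>i\<in>B. R a i * of_bool (c a i = b)) $$ (a, p a))"
      if "p permutes {..<m}" for p
    proof (rule prod.cong)
      fix a assume "a \<in> {0..<m}"
      then have "a < m" "p a < m" using permutes_in_image[OF that, of a] by auto
      then show "(\<Sum>i\<in>B. R a i * of_bool (c a i = p a))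
        = mat m m (\<lambda>(a, b). \<Sum>i\<in>B. R a i * of_bool (c a i = b)) $$ (a, p a)" by simp
    qed auto
    then show ?thesis by (subst det_def'[of _ m]) (auto simp: atLeast0LessThan intro!: sum.cong)
  qed
  finally show ?thesis .
qed

text \<open>In the coding \<open>c = (c div k) * k + c mod k\<close> the matrix is
  \<open>1 \<otimes> X\<close> with \<open>n\<close> diagonal blocks \<open>X\<close>; the induction
  splits off the last one.\<close>

lemma det_block_power:
  fixes X :: "complex mat"
  assumes X: "X \<in> carrier_mat k k"
  shows "det (mat (n * k) (n * k) (\<lambda>(c, b). if c div k = b div k then X $$ (c mod k, b mod k) else 0)) = det X ^ n"
    (is "det (?G n) = _")
proof (induction n)
  case 0
  then show ?case by (simp add: det_def)
next
  case (Suc n)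
  have "?G (Suc n) = four_block_mat (?G n) (0\<^sub>m (n * k) k) (0\<^sub>m k (n * k)) X"
  proof (rule eq_matI)
    fix i j
    assume "i < dim_row (four_block_mat (?G n) (0\<^sub>m (n * k) k) (0\<^sub>m k (n * k)) X)"
      "j < dim_col (four_block_mat (?G n) (0\<^sub>m (n * k) k) (0\<^sub>m k (n * k)) X)"
    then have ij: "i < n * k + k" "j < n * k + k" using X by auto
    have big: "a div k = n \<and> a mod k = a - n * k" if "\<not> a < n * k" "a < n * k + k" for a
    proof -
      define b where "b = a - n * k"
      then have "a = b + n * k" "b < k" using that by linarith+
      then show ?thesis by simp
    qed
    have small: "a div k < n" if "a < n * k" for a
      using that by (simp add: less_mult_imp_div_less)
    show "?G (Suc n) $$ (i, j) = four_block_mat (?G n) (0\<^sub>m (n * k) k) (0\<^sub>m k (n * k)) X $$ (i, j)"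
    proof (cases "i < n * k"; cases "j < n * k")
      assume "i < n * k" "j < n * k"
      then show ?thesis using X by simp
    next
      assume a: "i < n * k" "\<not> j < n * k"
      then have "i div k \<noteq> j div k" using big[of j] small[of i] ij by simp
      then show ?thesis using X a ij by (simp add: add.commute[of k])
    next
      assume a: "\<not> i < n * k" "j < n * k"
      then have "i div k \<noteq> j div k" using big[of i] small[of j] ij by simp
      then show ?thesis using X a ij by (simp add: add.commute[of k])
    next
      assume a: "\<not> i < n * k" "\<not> j < n * k"
      then show ?thesis using X ij big[of i] big[of j] by (simp add: add.commute[of k])
    qed
  qed (use X in auto)
  then have "det (?G (Suc n)) = det (?G n) * det X"
    using det_four_block_mat_upper_right_zero[of "?G n" "n * k" "0\<^sub>m (n * k) k" k "0\<^sub>m k (n * k)" X] X by auto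
  then show ?case using Suc by simp
qed

text \<open>
  \<open>Y n k w v\<close> is the value on the basis tensor of \<open>(\<complex>^n \<otimes> \<complex>^k)^{\<otimes> nk}\<close> indexed by \<open>(w, v)\<close> of the
  determinant form on \<open>\<complex>^n \<otimes> \<complex>^k\<close>. As a function of \<open>w\<close> it is an \<open>SL n\<close>-invariant, as a function of
  \<open>v\<close> an \<open>SL k\<close>-invariant, and it exchanges symmetric and alternating behaviour under position
  permutations.
\<close>

definition Y :: "nat \<Rightarrow> nat \<Rightarrow> (nat \<Rightarrow> nat) \<Rightarrow> (nat \<Rightarrow> nat) \<Rightarrow> complex" where
  "Y n k w v = of_int (perm_sign (n * k) (\<lambda>a. w a * k + v a))"

lemma Y_cong:
  "(\<And>a. a < n * k \<Longrightarrow> w a = w' a) \<Longrightarrow> (\<And>a. a < n * k \<Longrightarrow> v a = v' a) \<Longrightarrow> Y n k w v = Y n k w' v'"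
  unfolding Y_def by (intro arg_cong[of _ _ of_int] perm_sign_cong) simp

lemma Y_cases: "Y n k w v \<in> {0, 1, -1}"
  unfolding Y_def using perm_sign_cases[of "n * k" "\<lambda>a. w a * k + v a"] by auto

lemma Y_square: "Y n k w v \<noteq> 0 \<Longrightarrow> Y n k w v * Y n k w v = 1"
  using Y_cases[of n k w v] by auto

lemma Y_perm:
  assumes "\<pi> permutes {..<n * k}"
  shows "Y n k (w \<circ> \<pi>) (v \<circ> \<pi>) = of_int (sign \<pi>) * Y n k w v"
  using perm_sign_comp_right[OF assms, of "\<lambda>a. w a * k + v a"] by (simp add: Y_def o_def)

lemma bij_code:
  "bij_betw (\<lambda>(i, r). i * k + r) ({..<n} \<times> {..<k}) {..<n * k :: nat}"
proof (rule bij_betwI[where g = "\<lambda>a. (a div k, a mod k)"])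
  show "(\<lambda>(i, r). i * k + r) \<in> {..<n} \<times> {..<k} \<rightarrow> {..<n * k}"
  proof clarsimp
    fix i r assume "i < n" "r < k"
    then have "i * k + r < i * k + k" by simp
    also have "\<dots> \<le> n * k" using \<open>i < n\<close> by (metis Suc_leI mult_Suc mult_le_mono1 add.commute)
    finally show "i * k + r < n * k" .
  qed
  show "(\<lambda>a. (a div k, a mod k)) \<in> {..<n * k} \<rightarrow> {..<n} \<times> {..<k}"
    by (cases "k = 0") (auto simp: less_mult_imp_div_less)
qed auto

lemma Y_nonzero_iff:
  assumes w: "w \<in> words {..<n * k} n" and v: "v \<in> words {..<n * k} k"
  shows "Y n k w v \<noteq> 0 \<longleftrightarrow> inj_on (\<lambda>a. (w a, v a)) {..<n * k}"
proof -
  let ?c = "\<lambda>(i, r). i * k + r" and ?f = "\<lambda>a. (w a, v a)"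
  have im: "?f ` {..<n * k} \<subseteq> {..<n} \<times> {..<k}" using words_lt[OF w] words_lt[OF v] by auto
  have "inj_on ?f {..<n * k} \<longleftrightarrow> inj_on (?c \<circ> ?f) {..<n * k}"
  proof -
    have "inj_on ?c (?f ` {..<n * k})"
      using bij_code[of k n] im by (auto simp: bij_betw_def intro: inj_on_subset)
    then show ?thesis using comp_inj_on[of ?f _ ?c] inj_on_imageI2[of ?c ?f] by blast
  qed
  also have "\<dots> \<longleftrightarrow> bij_betw (?c \<circ> ?f) {..<n * k} {..<n * k}"
  proof -
    have "(?c \<circ> ?f) ` {..<n * k} \<subseteq> {..<n * k}"
      using im bij_code[of k n] unfolding bij_betw_def image_comp[symmetric] by blast
    then show ?thesis using endo_inj_surj[of "{..<n * k}" "?c \<circ> ?f"] by (auto simp: bij_betw_def)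
  qed
  finally show ?thesis unfolding Y_def by (simp add: perm_sign_nonzero_iff o_def)
qed

text \<open>Acting by \<open>X\<close> on the second factor of
  \<open>\<complex>^n \<otimes> \<complex>^k\<close> is the block matrix \<open>G\<close>, of
  determinant \<open>det X ^ n\<close>. The pair \<open>(w, v)\<close> selects rows of
  \<open>G\<close>, and the sum over \<open>v'\<close> expands the determinant of the selected
  rows.\<close>

lemma Y_GL_right:
  assumes X: "X \<in> carrier_mat k k" and w: "w \<in> words {..<n * k} n" and v: "v \<in> words {..<n * k} k"
  shows "(\<Sum>v'\<in>words {..<n * k} k. (\<Prod>a<n * k. X $$ (v a, v' a)) * Y n k w v') = det X ^ n * Y n k w v"
proof -
  define G where "G = mat (n * k) (n * k) (\<lambda>(c, b). if c div k = b div k then X $$ (c mod k, b mod k) else 0)"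
  have G: "G \<in> carrier_mat (n * k) (n * k)" by (simp add: G_def)
  have lt: "w a * k + v a < n * k" if "a < n * k" for a
  proof -
    have "(w a, v a) \<in> {..<n} \<times> {..<k}" using that words_lt[OF w] words_lt[OF v] by auto
    from bij_betw_apply[OF bij_code this] show ?thesis by simp
  qed
  have "(\<Sum>v'\<in>words {..<n * k} k. (\<Prod>a<n * k. X $$ (v a, v' a)) * Y n k w v')
    = det (mat (n * k) (n * k) (\<lambda>(a, b). \<Sum>i<k. X $$ (v a, i) * of_bool (w a * k + i = b)))"
    unfolding Y_def by (rule det_eq_sum_perm_sign) simp
  also have "mat (n * k) (n * k) (\<lambda>(a, b). \<Sum>i<k. X $$ (v a, i) * of_bool (w a * k + i = b))
    = mat (n * k) (n * k) (\<lambda>(a, b). G $$ (w a * k + v a, b))"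
  proof (rule cong_mat[OF refl refl], clarify)
    fix a b assume ab: "a < n * k" "b < n * k"
    then have k: "k > 0" by (cases k) auto
    have va: "v a < k" using words_lt[OF v] ab by auto
    have "(\<Sum>i<k. X $$ (v a, i) * of_bool (w a * k + i = b))
        = (\<Sum>i\<in>{i\<in>{..<k}. w a * k + i = b}. X $$ (v a, i))"
      unfolding sum.inter_filter[OF finite_lessThan] by (intro sum.cong) auto
    also have "\<dots> = (if w a = b div k then X $$ (v a, b mod k) else 0)"
    proof (cases "w a = b div k")
      case True
      have "{i\<in>{..<k}. w a * k + i = b} = {b mod k}"
      proof (intro Set.set_eqI iffI)
        fix i assume "i \<in> {i\<in>{..<k}. w a * k + i = b}"
        then have "i < k" "b = w a * k + i" by auto
        then show "i \<in> {b mod k}" by simp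
      next
        fix i assume "i \<in> {b mod k}"
        then show "i \<in> {i\<in>{..<k}. w a * k + i = b}" using k div_mult_mod_eq[of b k] by (simp add: True)
      qed
      then show ?thesis using True by simp
    next
      case False
      have "w a * k + i \<noteq> b" if "i < k" for i
      proof
        assume "w a * k + i = b"
        then have "b div k = w a" using that by (metis div_mult_self3 div_less add.right_neutral add.commute not_less_zero)
        then show False using False by simp
      qed
      then have "{i\<in>{..<k}. w a * k + i = b} = {}" by auto
      then show ?thesis using False by (simp only: sum.empty if_False)
    qed
    finally show "(\<Sum>i<k. X $$ (v a, i) * of_bool (w a * k + i = b)) = G $$ (w a * k + v a, b)"
      using ab lt[OF ab(1)] va by (simp add: G_def)
  qed
  also have "det \<dots> = of_int (perm_sign (n * k) (\<lambda>a. w a * k + v a)) * det G"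
    by (rule det_select_rows[OF G lt])
  also have "det G = det X ^ n" unfolding G_def by (rule det_block_power[OF X])
  finally show ?thesis by (simp add: Y_def)
qed

text \<open>Exchanging the two tensor factors reorders the basis by one fixed permutation
  \<open>\<rho>\<close>, so the sign depends neither on \<open>w\<close> nor on
  \<open>v\<close>.\<close>

lemma Y_swap:
  "\<exists>s \<in> {1, -1 :: complex}. \<forall>w\<in>words {..<n * k} n. \<forall>v\<in>words {..<n * k} k. Y n k w v = s * Y k n v w"
proof -
  define \<rho> where "\<rho> = (\<lambda>c. if c < n * k then (c mod k) * n + c div k else c)"
  have \<rho>: "\<rho> permutes {..<n * k}"
  proof (rule bij_imp_permutes)
    have "bij_betw (\<lambda>a. (a div k, a mod k)) {..<n * k} ({..<n} \<times> {..<k})"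
      by (rule bij_betwI[where g = "\<lambda>(i, r). i * k + r"])
        (use bij_betw_apply[OF bij_code, of _ n k] in \<open>cases "k = 0", auto simp: less_mult_imp_div_less\<close>)
    moreover have "bij_betw prod.swap ({..<n} \<times> {..<k}) ({..<k} \<times> {..<n})"
      by (rule bij_betwI[where g = prod.swap]) auto
    ultimately have "bij_betw ((\<lambda>(i, r). i * n + r) \<circ> (prod.swap \<circ> (\<lambda>a. (a div k, a mod k)))) {..<n * k} {..<k * n}"
      by (intro bij_betw_trans[OF bij_betw_trans bij_code])
    then show "bij_betw \<rho> {..<n * k} {..<n * k}"
      by (subst bij_betw_cong[of _ \<rho>]) (auto simp: \<rho>_def mult.commute)
  qed (simp add: \<rho>_def)
  show ?thesis
  proof (intro bexI[of _ "complex_of_int (sign \<rho>)"] ballI)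
    show "complex_of_int (sign \<rho>) \<in> {1, -1}" by (simp add: sign_def)
    fix w v assume w: "w \<in> words {..<n * k} n" and v: "v \<in> words {..<n * k} k"
    have "v a * n + w a = \<rho> (w a * k + v a)" if a: "a < n * k" for a
    proof -
      have l: "w a < n" "v a < k" using a words_lt[OF w] words_lt[OF v] by auto
      then have "(w a, v a) \<in> {..<n} \<times> {..<k}" by simp
      from bij_betw_apply[OF bij_code this] have "w a * k + v a < n * k" by simp
      then show ?thesis using l by (simp add: \<rho>_def)
    qed
    then have "perm_sign (k * n) (\<lambda>a. v a * n + w a) = perm_sign (n * k) (\<rho> \<circ> (\<lambda>a. w a * k + v a))"
      by (subst mult.commute) (auto intro: perm_sign_cong)
    also have "\<dots> = sign \<rho> * perm_sign (n * k) (\<lambda>a. w a * k + v a)"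
      by (rule perm_sign_comp_left[OF \<rho>])
    finally have "perm_sign (n * k) (\<lambda>a. w a * k + v a) = sign \<rho> * perm_sign (k * n) (\<lambda>a. v a * n + w a)"
      by (simp add: mult.assoc[symmetric] sign_mult_self)
    then show "Y n k w v = complex_of_int (sign \<rho>) * Y k n v w"
      unfolding Y_def by simp
  qed
qed

lemma Y_GL_left:
  assumes X: "X \<in> carrier_mat n n" and w: "w \<in> words {..<n * k} n" and v: "v \<in> words {..<n * k} k"
  shows "(\<Sum>w'\<in>words {..<n * k} n. (\<Prod>a<n * k. X $$ (w a, w' a)) * Y n k w' v) = det X ^ k * Y n k w v"
proof -
  obtain s :: complex where s: "\<forall>w\<in>words {..<n * k} n. \<forall>v\<in>words {..<n * k} k. Y n k w v = s * Y k n v w"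
    using Y_swap[of n k] by (elim bexE)
  have "(\<Sum>w'\<in>words {..<n * k} n. (\<Prod>a<n * k. X $$ (w a, w' a)) * Y n k w' v)
    = s * (\<Sum>w'\<in>words {..<k * n} n. (\<Prod>a<k * n. X $$ (w a, w' a)) * Y k n v w')"
    unfolding sum_distrib_left using v by (intro sum.cong) (auto simp: s mult.commute)
  also have "\<dots> = s * (det X ^ k * Y k n v w)"
    by (subst Y_GL_right[OF X]) (use w v in \<open>auto simp: mult.commute\<close>)
  finally show ?thesis using s w v by simp
qed

text \<open>A weight argument: the diagonal matrix with entry 2 at \<open>i\<close> multiplies the
  coordinate at \<open>w\<close> by 2 to the number of letters \<open>i\<close>, whereas
  \<open>sl_inv_GL\<close> prescribes the factor \<open>2 ^ k\<close>.\<close>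

lemma sl_inv_unbalanced:
  assumes inv: "sl_inv P n \<phi>" and P: "finite P" "card P = n * k" and n: "n > 0"
    and w: "w \<in> words P n" and i: "i < n" "card {a\<in>P. w a = i} \<noteq> k"
  shows "\<phi> w = 0"
proof -
  let ?X = "multrow_mat n i (2 :: complex)"
  have X: "?X $$ (a, b) = (if a = b then if a = i then 2 else 1 else 0)" if "a < n" "b < n" for a b
    using that by auto
  have "(\<Sum>w'\<in>words P n. (\<Prod>a\<in>P. ?X $$ (w a, w' a)) * \<phi> w')
      = (\<Sum>w'\<in>{w}. (\<Prod>a\<in>P. ?X $$ (w a, w' a)) * \<phi> w')"
  proof (rule sum.mono_neutral_right)
    show "\<forall>w'\<in>words P n - {w}. (\<Prod>a\<in>P. ?X $$ (w a, w' a)) * \<phi> w' = 0"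
    proof
      fix w' assume w': "w' \<in> words P n - {w}"
      then obtain a where a: "a \<in> P" "w a \<noteq> w' a" using w PiE_ext[of w P _ w'] by blast
      then have "?X $$ (w a, w' a) = 0" using words_lt[OF w] words_lt[of w' P n] w' by (subst X) auto
      then show "(\<Prod>a\<in>P. ?X $$ (w a, w' a)) * \<phi> w' = 0" using a P by auto
    qed
  qed (use w finite_words[OF P(1)] in auto)
  also have "\<dots> = (\<Prod>a\<in>P. if w a = i then 2 else 1) * \<phi> w"
  proof -
    have "(\<Prod>a\<in>P. ?X $$ (w a, w a)) = (\<Prod>a\<in>P. if w a = i then 2 else 1)"
      using words_lt[OF w] X by (intro prod.cong) auto
    then show ?thesis by simp
  qed
  also have "(\<Prod>a\<in>P. if w a = i then 2 else 1 :: complex) = 2 ^ card {a\<in>P. w a = i}"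
    using P(1) by (simp add: prod.inter_filter[symmetric])
  finally have "2 ^ card {a\<in>P. w a = i} * \<phi> w = (\<Sum>w'\<in>words P n. (\<Prod>a\<in>P. ?X $$ (w a, w' a)) * \<phi> w')"
    by (rule sym)
  also have "\<dots> = 2 ^ k * \<phi> w"
    using sl_inv_GL[OF inv P n _ w, of ?X] det_multrow_mat[OF i(1), of "2 :: complex"] by simp
  finally have "2 ^ card {a\<in>P. w a = i} * \<phi> w = 2 ^ k * \<phi> w" .
  moreover have "(2 :: complex) ^ card {a\<in>P. w a = i} \<noteq> 2 ^ k"
  proof
    assume "(2 :: complex) ^ card {a\<in>P. w a = i} = 2 ^ k"
    then have "complex_of_nat (2 ^ card {a\<in>P. w a = i}) = of_nat (2 ^ k)" by simp
    then have "(2 :: nat) ^ card {a\<in>P. w a = i} = 2 ^ k" by (simp only: of_nat_eq_iff)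
    then show False using i by simp
  qed
  ultimately show ?thesis by simp
qed

lemma exists_Y_nonzero:
  assumes w: "w \<in> words {..<n * k} n" and bal: "\<And>i. i < n \<Longrightarrow> card {a\<in>{..<n * k}. w a = i} = k"
  shows "\<exists>v\<in>words {..<n * k} k. Y n k w v \<noteq> 0"
proof -
  \<comment> \<open>Number the occurrences of each letter from left to right, so that no pair
    \<open>(w a, v a)\<close> repeats.\<close>
  define v where "v = (\<lambda>a\<in>{..<n * k}. card {b\<in>{..<a}. w b = w a})"
  have v: "v \<in> words {..<n * k} k"
  proof (rule PiE_I)
    fix a assume a: "a \<in> {..<n * k}"
    have "{b\<in>{..<a}. w b = w a} \<subset> {b\<in>{..<n * k}. w b = w a}" using a by auto
    then have "card {b\<in>{..<a}. w b = w a} < card {b\<in>{..<n * k}. w b = w a}"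
      by (intro psubset_card_mono) auto
    then show "v a \<in> {..<k}" using a bal words_lt[OF w a] by (simp add: v_def)
  qed (auto simp: v_def)
  have "inj_on (\<lambda>a. (w a, v a)) {..<n * k}"
  proof (rule linorder_inj_onI)
    fix a b assume ab: "a < b" "a \<in> {..<n * k}" "b \<in> {..<n * k}"
    show "(w a, v a) \<noteq> (w b, v b)"
    proof
      assume eq: "(w a, v a) = (w b, v b)"
      then have "{c\<in>{..<a}. w c = w a} \<subset> {c\<in>{..<b}. w c = w b}" using ab by auto
      then have "card {c\<in>{..<a}. w c = w a} < card {c\<in>{..<b}. w c = w b}"
        by (intro psubset_card_mono) auto
      moreover have "v a = v b" using eq by simp
      then have "card {c\<in>{..<a}. w c = w a} = card {c\<in>{..<b}. w c = w b}"
        unfolding v_def restrict_apply'[OF ab(2)] restrict_apply'[OF ab(3)] .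
      ultimately show False by linarith
    qed
  qed auto
  then show ?thesis using Y_nonzero_iff[OF w v] v by blast
qed

text \<open>The \<open>n * k\<close> distinct pairs \<open>(w a, v a)\<close> exhaust the grid, so
  the letter \<open>i\<close> meets every second component exactly once.\<close>

lemma Y_balanced:
  assumes w: "w \<in> words {..<n * k} n" and v: "v \<in> words {..<n * k} k" and nz: "Y n k w v \<noteq> 0"
    and i: "i < n"
  shows "card {a\<in>{..<n * k}. w a = i} = k"
proof -
  have inj: "inj_on (\<lambda>a. (w a, v a)) {..<n * k}" using nz Y_nonzero_iff[OF w v] by simp
  have "(\<lambda>a. (w a, v a)) ` {..<n * k} = {..<n} \<times> {..<k}"
    by (rule card_subset_eq) (use words_lt[OF w] words_lt[OF v] in \<open>auto simp: card_image[OF inj]\<close>)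
  then have "v ` {a\<in>{..<n * k}. w a = i} = {..<k}"
    using i by (auto simp: Set.set_eq_iff image_iff) (metis (no_types, lifting) Pair_inject lessThan_iff mem_Sigma_iff)+
  moreover have "inj_on v {a\<in>{..<n * k}. w a = i}" using inj by (auto simp: inj_on_def)
  ultimately show ?thesis using card_image by fastforce
qed

text \<open>The Young subgroup of the level sets of \<open>u\<close>.\<close>

definition stab :: "'p set \<Rightarrow> ('p \<Rightarrow> 'i) \<Rightarrow> ('p \<Rightarrow> 'p) set" where
  "stab P u = {\<sigma>. \<sigma> permutes P \<and> (\<forall>a\<in>P. u (\<sigma> a) = u a)}"

lemma finite_stab: "finite P \<Longrightarrow> finite (stab P u)"
  unfolding stab_def by (rule finite_subset[OF _ finite_permutations]) auto

lemma id_stab: "id \<in> stab P u"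
  by (simp add: stab_def permutes_id)

lemma stab_comp: "\<sigma> \<in> stab P u \<Longrightarrow> \<tau> \<in> stab P u \<Longrightarrow> \<sigma> \<circ> \<tau> \<in> stab P u"
  by (auto simp: stab_def permutes_compose permutes_in_image)

lemma stab_inv: "\<sigma> \<in> stab P u \<Longrightarrow> Hilbert_Choice.inv \<sigma> \<in> stab P u"
  unfolding stab_def
proof (clarsimp, intro conjI permutes_inv ballI)
  fix a assume \<sigma>: "\<sigma> permutes P" "\<forall>a\<in>P. u (\<sigma> a) = u a" and "a \<in> P"
  then have "Hilbert_Choice.inv \<sigma> a \<in> P" using permutes_in_image[OF permutes_inv[OF \<sigma>(1)]] by blast
  then have "u (\<sigma> (Hilbert_Choice.inv \<sigma> a)) = u (Hilbert_Choice.inv \<sigma> a)" using \<sigma> by blast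
  then show "u (Hilbert_Choice.inv \<sigma> a) = u a" using permutes_inverses[OF \<sigma>(1)] by simp
qed

lemma stab_permutes: "\<sigma> \<in> stab P u \<Longrightarrow> \<sigma> permutes P"
  by (simp add: stab_def)

lemma sum_stab_left:
  assumes "\<tau> \<in> stab P u"
  shows "(\<Sum>\<sigma>\<in>stab P u. f (\<tau> \<circ> \<sigma>)) = (\<Sum>\<sigma>\<in>stab P u. f \<sigma>)"
proof -
  note \<tau> = permutes_inv_o[OF stab_permutes[OF assms]]
  have "bij_betw (\<lambda>\<sigma>. \<tau> \<circ> \<sigma>) (stab P u) (stab P u)"
    by (rule bij_betwI[where g = "\<lambda>\<sigma>. Hilbert_Choice.inv \<tau> \<circ> \<sigma>"])
      (auto simp: comp_assoc[symmetric] \<tau> simp del: o_apply intro!: stab_comp assms stab_inv)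
  then show ?thesis by (rule sum.reindex_bij_betw)
qed

lemma sum_stab_monomial:
  assumes \<sigma>: "\<sigma> \<in> stab P u"
  shows "(\<Sum>w\<in>P \<rightarrow>\<^sub>E B. f (w \<circ> \<sigma>) * (\<Prod>a\<in>P. g (u a) (w a))) = (\<Sum>w\<in>P \<rightarrow>\<^sub>E B. f w * (\<Prod>a\<in>P. g (u a) (w a)) :: complex)"
proof -
  have "(\<Prod>a\<in>P. g (u a) (w a)) = (\<Prod>a\<in>P. g (u a) ((w \<circ> \<sigma>) a))" for w
  proof -
    have "(\<Prod>a\<in>P. g (u a) (w a)) = (\<Prod>a\<in>P. g (u (\<sigma> a)) (w (\<sigma> a)))"
      by (rule prod_comp_permutes[OF stab_permutes[OF \<sigma>], symmetric])
    then show ?thesis using \<sigma> by (simp add: stab_def)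
  qed
  then show ?thesis
    using sum_PiE_permutes[OF stab_permutes[OF \<sigma>], of "\<lambda>w. f w * (\<Prod>a\<in>P. g (u a) (w a))" B] by simp
qed

text \<open>
  Compare \<open>det X ^ k * \<phi> w0 = \<Sum>w. \<Prod>a. X (w0 a) (w a) * \<phi> w\<close> with the same identity for \<open>Y\<close>: after
  symmetrising over the stabiliser of \<open>w0\<close> the coefficient functions agree up to a scalar, and the
  symmetrised \<open>Y\<close> is not orthogonal to \<open>Y\<close>. This is Cayley's \<open>\<Omega>\<close>-process in disguise.
\<close>

lemma sl_inv_nondegenerate:
  assumes inv: "sl_inv {..<n * k} n \<phi>" and n: "n > 0"
    and orth: "\<And>v. v \<in> words {..<n * k} k \<Longrightarrow> (\<Sum>w\<in>words {..<n * k} n. Y n k w v * \<phi> w) = 0"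
    and w0: "w0 \<in> words {..<n * k} n"
  shows "\<phi> w0 = 0"
proof (cases "\<exists>i<n. card {a\<in>{..<n * k}. w0 a = i} \<noteq> k")
  case True
  then obtain i where "i < n" "card {a\<in>{..<n * k}. w0 a = i} \<noteq> k" by blast
  then show ?thesis by (intro sl_inv_unbalanced[OF inv _ _ n w0]) auto
next
  case False
  let ?P = "{..<n * k}" and ?W = "words {..<n * k} n"
  obtain v0 where v0: "v0 \<in> words ?P k" "Y n k w0 v0 \<noteq> 0"
    using exists_Y_nonzero[OF w0] False by blast
  let ?S = "stab ?P w0"
  define y where "y = (\<lambda>w. Y n k w v0)"
  define \<psi> where "\<psi> = (\<lambda>w. \<Sum>\<sigma>\<in>?S. y (w \<circ> \<sigma>))"
  \<comment> \<open>\<open>y w0\<close> is a sign and hence its own inverse, so \<open>c\<close> is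
    the quotient of \<open>\<phi> w0\<close> by \<open>y w0\<close>.\<close>
  define c where "c = \<phi> w0 * y w0"
  have finS: "finite ?S" by (simp add: finite_stab)
  have finW: "finite ?W" by (simp add: finite_PiE)
  define H where "H = (\<lambda>w. (\<Sum>\<sigma>\<in>?S. \<phi> (w \<circ> \<sigma>)) - c * \<psi> w)"
  have H0: "H w = 0" if "w \<in> ?W" for w
  proof (rule sym_coeffs_eq_zero[where P = ?P and B = "{..<n}" and u = w0 and H = H])
    fix \<tau> w assume \<tau>: "\<tau> permutes ?P" "\<And>a. a \<in> ?P \<Longrightarrow> w0 (\<tau> a) = w0 a"
    then have "\<tau> \<in> ?S" by (simp add: stab_def)
    note st = sum_stab_left[OF this]
    show "H (w \<circ> \<tau>) = H w"
      using st[of "\<lambda>\<sigma>. \<phi> (w \<circ> \<sigma>)"] st[of "\<lambda>\<sigma>. y (w \<circ> \<sigma>)"]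
      unfolding H_def \<psi>_def by (simp add: o_assoc)
  next
    fix g :: "nat \<Rightarrow> nat \<Rightarrow> complex"
    let ?X = "mat n n (\<lambda>(i, j). g i j)"
    have X: "?X \<in> carrier_mat n n" by simp
    have m: "(\<Prod>a\<in>?P. ?X $$ (w0 a, w a)) = (\<Prod>a\<in>?P. g (w0 a) (w a))" if "w \<in> ?W" for w
      using words_lt[OF w0] words_lt[OF that] by (intro prod.cong) auto
    have 1: "(\<Sum>w\<in>?W. \<phi> w * (\<Prod>a\<in>?P. g (w0 a) (w a))) = det ?X ^ k * \<phi> w0"
    proof -
      have "(\<Sum>w\<in>?W. \<phi> w * (\<Prod>a\<in>?P. g (w0 a) (w a))) = (\<Sum>w\<in>?W. (\<Prod>a\<in>?P. ?X $$ (w0 a, w a)) * \<phi> w)"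
        by (rule sum.cong[OF refl], subst m, assumption, rule mult.commute)
      then show ?thesis using sl_inv_GL[OF inv _ _ n X w0, of k] by simp
    qed
    have 2: "(\<Sum>w\<in>?W. y w * (\<Prod>a\<in>?P. g (w0 a) (w a))) = det ?X ^ k * y w0"
    proof -
      have "(\<Sum>w\<in>?W. y w * (\<Prod>a\<in>?P. g (w0 a) (w a))) = (\<Sum>w\<in>?W. (\<Prod>a\<in>?P. ?X $$ (w0 a, w a)) * y w)"
        by (rule sum.cong[OF refl], subst m, assumption, rule mult.commute)
      then show ?thesis using Y_GL_left[OF X w0 v0(1)] by (simp only: y_def)
    qed
    have "(\<Sum>w\<in>?W. H w * (\<Prod>a\<in>?P. g (w0 a) (w a)))
        = (\<Sum>w\<in>?W. \<Sum>\<sigma>\<in>?S. \<phi> (w \<circ> \<sigma>) * (\<Prod>a\<in>?P. g (w0 a) (w a)))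
          - c * (\<Sum>w\<in>?W. \<Sum>\<sigma>\<in>?S. y (w \<circ> \<sigma>) * (\<Prod>a\<in>?P. g (w0 a) (w a)))"
      unfolding H_def \<psi>_def left_diff_distrib sum_subtractf sum_distrib_left sum_distrib_right
      by (simp add: mult.assoc)
    also have "\<dots> = (\<Sum>\<sigma>\<in>?S. det ?X ^ k * \<phi> w0) - c * (\<Sum>\<sigma>\<in>?S. det ?X ^ k * y w0)"
      by (subst (1 2) sum.swap) (simp add: sum_stab_monomial 1 2)
    also have "\<dots> = 0"
      using Y_square[OF v0(2)] by (simp add: c_def y_def ac_simps)
    finally show "(\<Sum>w\<in>?W. H w * (\<Prod>a\<in>?P. g (w0 a) (w a))) = 0" .
  qed (use that in auto)
  \<comment> \<open>Moving \<open>\<sigma>\<close> onto \<open>v0\<close> costs a sign and leaves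
    the pairing of \<open>\<phi>\<close> with the determinant form at
    \<open>v0 \<circ> \<sigma>\<close>, which is zero by \<open>orth\<close>.\<close>
  have *: "(\<Sum>w\<in>?W. \<phi> (w \<circ> \<sigma>) * y w) = 0" if \<sigma>: "\<sigma> \<in> ?S" for \<sigma>
  proof -
    note p = stab_permutes[OF \<sigma>]
    have "y w = of_int (sign \<sigma>) * Y n k (w \<circ> \<sigma>) (v0 \<circ> \<sigma>)" for w
      unfolding y_def Y_perm[OF p] by (simp add: mult.assoc[symmetric] sign_mult_self flip: of_int_mult)
    then have "(\<Sum>w\<in>?W. \<phi> (w \<circ> \<sigma>) * y w)
        = of_int (sign \<sigma>) * (\<Sum>w\<in>?W. Y n k (w \<circ> \<sigma>) (v0 \<circ> \<sigma>) * \<phi> (w \<circ> \<sigma>))"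
      by (simp add: sum_distrib_left ac_simps)
    also have "(\<Sum>w\<in>?W. Y n k (w \<circ> \<sigma>) (v0 \<circ> \<sigma>) * \<phi> (w \<circ> \<sigma>)) = 0"
      using sum_PiE_permutes[OF p, of "\<lambda>w. Y n k w (v0 \<circ> \<sigma>) * \<phi> w" "{..<n}"]
        orth[OF comp_permutes_PiE[OF p v0(1)]] by simp
    finally show ?thesis by (simp add: o_def)
  qed
  have "0 = (\<Sum>w\<in>?W. H w * y w)" using H0 by simp
  also have "\<dots> = (\<Sum>w\<in>?W. \<Sum>\<sigma>\<in>?S. \<phi> (w \<circ> \<sigma>) * y w) - c * (\<Sum>w\<in>?W. \<psi> w * y w)"
    unfolding H_def left_diff_distrib sum_subtractf sum_distrib_right sum_distrib_left by (simp add: mult.assoc)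
  also have "(\<Sum>w\<in>?W. \<Sum>\<sigma>\<in>?S. \<phi> (w \<circ> \<sigma>) * y w) = 0"
    by (subst sum.swap, rule sum.neutral) (use * in blast)
  finally have c0: "c * (\<Sum>w\<in>?W. \<psi> w * y w) = 0" by simp
  \<comment> \<open>Averaging over the stabiliser turns the factor of \<open>c\<close> into a sum of
    squares of \<open>\<psi>\<close>, up to a positive multiple. The values of \<open>\<psi>\<close>
    are the integers \<open>z\<close>, and the one at \<open>w0\<close> is nonzero, so the sum is
    positive and \<open>c\<close> must vanish.\<close>
  have "of_nat (card ?S) * (\<Sum>w\<in>?W. \<psi> w * y w) = (\<Sum>\<sigma>\<in>?S. \<Sum>w\<in>?W. \<psi> (w \<circ> \<sigma>) * y (w \<circ> \<sigma>))"
    by (simp add: sum_PiE_permutes[OF stab_permutes, of _ _ w0 "\<lambda>w. \<psi> w * y w"])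
  also have "\<dots> = (\<Sum>\<sigma>\<in>?S. \<Sum>w\<in>?W. \<psi> w * y (w \<circ> \<sigma>))"
  proof (intro sum.cong refl)
    fix \<sigma> w assume "\<sigma> \<in> ?S"
    from sum_stab_left[OF this, of "\<lambda>\<sigma>. y (w \<circ> \<sigma>)"] show "\<psi> (w \<circ> \<sigma>) * y (w \<circ> \<sigma>) = \<psi> w * y (w \<circ> \<sigma>)"
      unfolding \<psi>_def by (simp add: o_assoc)
  qed
  also have "\<dots> = (\<Sum>w\<in>?W. \<psi> w * \<psi> w)"
    by (subst sum.swap) (simp add: \<psi>_def sum_distrib_left)
  finally have eq: "of_nat (card ?S) * (\<Sum>w\<in>?W. \<psi> w * y w) = (\<Sum>w\<in>?W. \<psi> w * \<psi> w)" .
  define z where "z = (\<lambda>w. \<Sum>\<sigma>\<in>?S. perm_sign (n * k) (\<lambda>a. (w \<circ> \<sigma>) a * k + v0 a))"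
  have \<psi>z: "\<psi> w = of_int (z w)" for w by (simp add: \<psi>_def z_def y_def Y_def)
  have "w0 \<circ> \<sigma> = w0" if \<sigma>: "\<sigma> \<in> ?S" for \<sigma>
  proof
    fix a show "(w0 \<circ> \<sigma>) a = w0 a"
      using \<sigma> permutes_not_in[OF stab_permutes[OF \<sigma>], of a] by (cases "a \<in> ?P") (auto simp: stab_def)
  qed
  then have "\<psi> w0 = of_nat (card ?S) * y w0" by (simp add: \<psi>_def)
  moreover have "card ?S \<noteq> 0" using finS id_stab[of ?P w0] by (auto simp: card_eq_0_iff)
  ultimately have "\<psi> w0 \<noteq> 0" using v0(2) by (simp add: y_def)
  then have "z w0 \<noteq> 0" by (simp add: \<psi>z)
  then have "(\<Sum>w\<in>?W. z w * z w) > 0"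
    by (intro sum_pos2[OF finW w0]) (auto simp: zero_less_mult_iff linorder_neq_iff)
  then have "(\<Sum>w\<in>?W. \<psi> w * \<psi> w) \<noteq> 0"
    unfolding \<psi>z of_int_mult[symmetric] of_int_sum[symmetric] of_int_eq_0_iff by linarith
  then have "c = 0" using eq c0 by auto
  then show ?thesis using v0(2) by (simp add: c_def y_def)
qed

subsection \<open>Invariant tensors and duality\<close>

lemma sl_inv_sum:
  assumes "\<And>i. i \<in> I \<Longrightarrow> sl_inv P n (\<phi> i)"
  shows "sl_inv P n (\<lambda>w. \<Sum>i\<in>I. c i * \<phi> i w)"
  unfolding sl_inv_def
proof (intro ballI)
  fix g w assume g: "g \<in> SL n" and w: "w \<in> words P n"
  have "(\<Sum>w'\<in>words P n. (\<Prod>a\<in>P. g $$ (w a, w' a)) * (\<Sum>i\<in>I. c i * \<phi> i w'))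
      = (\<Sum>i\<in>I. c i * (\<Sum>w'\<in>words P n. (\<Prod>a\<in>P. g $$ (w a, w' a)) * \<phi> i w'))"
    unfolding sum_distrib_left by (subst sum.swap) (simp add: ac_simps)
  also have "\<dots> = (\<Sum>i\<in>I. c i * \<phi> i w)"
    using sl_invD[OF assms g w] by (intro sum.cong) auto
  finally show "(\<Sum>w'\<in>words P n. (\<Prod>a\<in>P. g $$ (w a, w' a)) * (\<Sum>i\<in>I. c i * \<phi> i w')) = (\<Sum>i\<in>I. c i * \<phi> i w)" .
qed

lemma sl_inv_cmult:
  assumes "sl_inv P n \<phi>"
  shows "sl_inv P n (\<lambda>w. c * \<phi> w)"
  using sl_inv_sum[of "{()}" P n "\<lambda>_. \<phi>" "\<lambda>_. c"] assms by simp

lemma sl_inv_cong: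
  assumes "\<And>w. w \<in> words P n \<Longrightarrow> \<phi> w = \<phi>' w"
  shows "sl_inv P n \<phi> \<longleftrightarrow> sl_inv P n \<phi>'"
  unfolding sl_inv_def using assms by simp

lemma sl_inv_Y_right:
  assumes "w \<in> words {..<n * k} n"
  shows "sl_inv {..<n * k} k (\<lambda>v. Y n k w v)"
  unfolding sl_inv_def using Y_GL_right[OF _ assms] by (auto simp: SL_def)

text \<open>
  An element of \<open>\<Otimes>\<^sub>l (\<complex>^{N l})^{\<otimes> P}\<close> with \<open>l < d\<close> is given by its coordinates \<open>\<Phi> v\<close>, where the
  \<open>d\<close>-tuple of words \<open>v\<close> has entries \<open>v l : P \<rightarrow> {..<N l}\<close>. We call it an invariant tensor if it is
  nonzero, invariant under every \<open>SL (N l)\<close>, and permuting the positions acts by \<open>sign ^ e\<close>.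
\<close>

definition word_tuples :: "nat \<Rightarrow> (nat \<Rightarrow> nat) \<Rightarrow> 'p set \<Rightarrow> (nat \<Rightarrow> 'p \<Rightarrow> nat) set" where
  "word_tuples d N P = (\<Pi>\<^sub>E l\<in>{..<d}. words P (N l))"

definition act :: "nat \<Rightarrow> ('p \<Rightarrow> 'p) \<Rightarrow> (nat \<Rightarrow> 'p \<Rightarrow> nat) \<Rightarrow> nat \<Rightarrow> 'p \<Rightarrow> nat" where
  "act d \<pi> v = (\<lambda>l\<in>{..<d}. v l \<circ> \<pi>)"

definition inv_tensor ::
  "nat \<Rightarrow> (nat \<Rightarrow> nat) \<Rightarrow> 'p set \<Rightarrow> nat \<Rightarrow> ((nat \<Rightarrow> 'p \<Rightarrow> nat) \<Rightarrow> complex) \<Rightarrow> bool" where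
  "inv_tensor d N P e \<Phi> \<longleftrightarrow>
     (\<forall>\<pi> v. \<pi> permutes P \<longrightarrow> v \<in> word_tuples d N P \<longrightarrow> \<Phi> (act d \<pi> v) = of_int (sign \<pi>) ^ e * \<Phi> v) \<and>
     (\<forall>l<d. \<forall>v\<in>word_tuples d N P. sl_inv P (N l) (\<lambda>w. \<Phi> (v(l := w)))) \<and>
     (\<exists>v\<in>word_tuples d N P. \<Phi> v \<noteq> 0)"

lemma inv_tensor_permD:
  "inv_tensor d N P e \<Phi> \<Longrightarrow> \<pi> permutes P \<Longrightarrow> v \<in> word_tuples d N P \<Longrightarrow>
     \<Phi> (act d \<pi> v) = of_int (sign \<pi>) ^ e * \<Phi> v"
  unfolding inv_tensor_def by blast

lemma inv_tensor_invD:
  "inv_tensor d N P e \<Phi> \<Longrightarrow> l < d \<Longrightarrow> v \<in> word_tuples d N P \<Longrightarrow> sl_inv P (N l) (\<lambda>w. \<Phi> (v(l := w)))"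
  unfolding inv_tensor_def by blast

lemma inv_tensor_nonzeroD:
  "inv_tensor d N P e \<Phi> \<Longrightarrow> \<exists>v\<in>word_tuples d N P. \<Phi> v \<noteq> 0"
  unfolding inv_tensor_def by blast

lemma word_tuplesD: "v \<in> word_tuples d N P \<Longrightarrow> l < d \<Longrightarrow> v l \<in> words P (N l)"
  unfolding word_tuples_def by (auto simp: PiE_def Pi_def)

lemma word_tuples_lt: "v \<in> word_tuples d N P \<Longrightarrow> l < d \<Longrightarrow> a \<in> P \<Longrightarrow> v l a < N l"
  using words_lt word_tuplesD by metis

lemma word_tuples_upd:
  "v \<in> word_tuples d N P \<Longrightarrow> l < d \<Longrightarrow> w \<in> words P n \<Longrightarrow> v(l := w) \<in> word_tuples d (N(l := n)) P"
  unfolding word_tuples_def by (auto simp: PiE_def Pi_def extensional_def)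

lemma word_tuples_upd':
  "v \<in> word_tuples d N P \<Longrightarrow> l < d \<Longrightarrow> w \<in> words P (N l) \<Longrightarrow> v(l := w) \<in> word_tuples d N P"
  using word_tuples_upd[of v d N P l w "N l"] by simp

lemma word_tuples_cong: "(\<And>l. l < d \<Longrightarrow> N l = N' l) \<Longrightarrow> word_tuples d N P = word_tuples d N' P"
  unfolding word_tuples_def by (intro PiE_cong) auto

lemma word_tuples_eqI:
  assumes "v \<in> word_tuples d N P" "v' \<in> word_tuples d N' P"
    and "\<And>l a. l < d \<Longrightarrow> a \<in> P \<Longrightarrow> v l a = v' l a"
  shows "v = v'"
proof
  fix l show "v l = v' l"
  proof (cases "l < d")
    case True
    show ?thesis
    proof
      fix a show "v l a = v' l a"
        using PiE_arb[OF word_tuplesD[OF assms(1) True]] PiE_arb[OF word_tuplesD[OF assms(2) True]]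
          assms(3)[OF True] by (cases "a \<in> P") auto
    qed
  qed (use assms in \<open>auto simp: word_tuples_def PiE_def extensional_def\<close>)
qed

lemma finite_word_tuples: "finite P \<Longrightarrow> finite (word_tuples d N P)"
  unfolding word_tuples_def by (intro finite_PiE) (auto intro: finite_PiE)

lemma act_word_tuples:
  "\<pi> permutes P \<Longrightarrow> v \<in> word_tuples d N P \<Longrightarrow> act d \<pi> v \<in> word_tuples d N P"
  unfolding word_tuples_def act_def using comp_permutes_PiE[of \<pi> P _ "{..<_}"]
  by (auto simp: PiE_def Pi_def)

lemma act_act: "act d \<sigma> (act d \<pi> v) = act d (\<pi> \<circ> \<sigma>) v"
  unfolding act_def by (auto simp: fun_eq_iff)

lemma act_apply: "l < d \<Longrightarrow> act d \<pi> v l a = v l (\<pi> a)"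
  by (simp add: act_def)

lemma act_upd: "l < d \<Longrightarrow> (act d \<pi> v)(l := w \<circ> \<pi>) = act d \<pi> (v(l := w))"
  by (auto simp: act_def fun_eq_iff)

lemma inv_tensor_cong_dims:
  assumes "\<And>l. l < d \<Longrightarrow> N l = N' l"
  shows "inv_tensor d N P e \<Phi> = inv_tensor d N' P e \<Phi>"
proof -
  have "word_tuples d N P = word_tuples d N' P" by (rule word_tuples_cong) (rule assms)
  then show ?thesis unfolding inv_tensor_def using assms by auto
qed

text \<open>Contract direction \<open>l\<close> with the determinant form. The form contributes one
  factor \<open>sign \<pi>\<close>, which raises \<open>e\<close> by one, and
  \<open>sl_inv_nondegenerate\<close> keeps the result nonzero.\<close>

lemma inv_tensor_dual_step:
  assumes T: "inv_tensor d N {..<n * k} e \<Phi>" and l: "l < d" and N: "N l = n" and n: "n > 0"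
  shows "inv_tensor d (N(l := k)) {..<n * k} (Suc e)
    (\<lambda>v. \<Sum>w\<in>words {..<n * k} n. Y n k w (v l) * \<Phi> (v(l := w)))"
proof -
  let ?P = "{..<n * k}" and ?N = "N(l := k)"
  let ?\<Psi> = "\<lambda>v. \<Sum>w\<in>words ?P n. Y n k w (v l) * \<Phi> (v(l := w))"
  have upd: "v(l := w) \<in> word_tuples d N ?P" if "v \<in> word_tuples d ?N ?P" "w \<in> words ?P n" for v w
    using word_tuples_upd[OF that(1) l that(2)] N by (metis fun_upd_triv fun_upd_upd)
  have 1: "?\<Psi> (act d \<pi> v) = of_int (sign \<pi>) ^ Suc e * ?\<Psi> v"
    if p: "\<pi> permutes ?P" and v: "v \<in> word_tuples d ?N ?P" for \<pi> v
  proof -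
    have "?\<Psi> (act d \<pi> v) = (\<Sum>w\<in>words ?P n. Y n k (w \<circ> \<pi>) (act d \<pi> v l) * \<Phi> ((act d \<pi> v)(l := w \<circ> \<pi>)))"
      by (rule sum_PiE_permutes[OF p, symmetric])
    also have "\<dots> = (\<Sum>w\<in>words ?P n. of_int (sign \<pi>) ^ Suc e * (Y n k w (v l) * \<Phi> (v(l := w))))"
    proof (rule sum.cong[OF refl])
      fix w assume w: "w \<in> words ?P n"
      have "act d \<pi> v l = v l \<circ> \<pi>" using l by (simp add: act_def)
      then show "Y n k (w \<circ> \<pi>) (act d \<pi> v l) * \<Phi> ((act d \<pi> v)(l := w \<circ> \<pi>))
          = of_int (sign \<pi>) ^ Suc e * (Y n k w (v l) * \<Phi> (v(l := w)))"
        using inv_tensor_permD[OF T p upd[OF v w]] Y_perm[OF p, of w "v l"] by (simp add: act_upd[OF l])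
    qed
    finally show ?thesis by (simp add: sum_distrib_left)
  qed
  have 2: "sl_inv ?P (?N l') (\<lambda>w'. ?\<Psi> (v(l' := w')))" if l': "l' < d" and v: "v \<in> word_tuples d ?N ?P" for l' v
  proof (cases "l' = l")
    case True
    have "sl_inv ?P k (\<lambda>w'. \<Sum>w\<in>words ?P n. \<Phi> (v(l := w)) * Y n k w w')"
      by (intro sl_inv_sum sl_inv_Y_right)
    then show ?thesis using True by (simp add: mult.commute)
  next
    case False
    have "sl_inv ?P (N l') (\<lambda>w'. \<Sum>w\<in>words ?P n. Y n k w (v l) * \<Phi> ((v(l := w))(l' := w')))"
      by (intro sl_inv_sum inv_tensor_invD[OF T l'] upd v)
    then show ?thesis using False by (simp add: fun_upd_twist)
  qed
  have 3: "\<exists>v\<in>word_tuples d ?N ?P. ?\<Psi> v \<noteq> 0"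
  proof -
    obtain v where v: "v \<in> word_tuples d N ?P" "\<Phi> v \<noteq> 0" using inv_tensor_nonzeroD[OF T] by blast
    have vl: "v l \<in> words ?P n" using word_tuplesD[OF v(1) l] N by simp
    have "\<exists>v'\<in>words ?P k. (\<Sum>w\<in>words ?P n. Y n k w v' * \<Phi> (v(l := w))) \<noteq> 0"
    proof (rule ccontr)
      assume "\<not> ?thesis"
      then have "\<Phi> (v(l := v l)) = 0"
        using inv_tensor_invD[OF T l v(1)] N n vl
        by (intro sl_inv_nondegenerate[where \<phi> = "\<lambda>w. \<Phi> (v(l := w))"]) auto
      then show False using v by simp
    qed
    then obtain v' where v': "v' \<in> words ?P k" "(\<Sum>w\<in>words ?P n. Y n k w v' * \<Phi> (v(l := w))) \<noteq> 0" by blast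
    show ?thesis
      by (rule bexI[of _ "v(l := v')"]) (use v' word_tuples_upd[OF v(1) l v'(1)] in auto)
  qed
  show ?thesis unfolding inv_tensor_def using 1 2 3 by blast
qed

lemma inv_tensor_dual:
  assumes T: "inv_tensor d (\<lambda>_. n) {..<n * k} e \<Phi>" and n: "n > 0"
  shows "\<exists>\<Psi>. inv_tensor d (\<lambda>_. k) {..<n * k} (e + d) \<Psi>"
proof -
  have "\<exists>\<Psi>. inv_tensor d (\<lambda>l. if l < j then k else n) {..<n * k} (e + j) \<Psi>" if "j \<le> d" for j
    using that
  proof (induction j)
    case 0
    then show ?case using T by auto
  next
    case (Suc j)
    then obtain \<Psi> where \<Psi>: "inv_tensor d (\<lambda>l. if l < j then k else n) {..<n * k} (e + j) \<Psi>" by auto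
    have "(\<lambda>l. if l < j then k else n)(j := k) = (\<lambda>l. if l < Suc j then k else n)" by (auto simp: less_Suc_eq)
    then show ?case using inv_tensor_dual_step[OF \<Psi>, of j] Suc.prems n by auto
  qed
  from this[of d] obtain \<Psi> where "inv_tensor d (\<lambda>l. if l < d then k else n) {..<n * k} (e + d) \<Psi>" by auto
  then have "inv_tensor d (\<lambda>_. k) {..<n * k} (e + d) \<Psi>"
    by (subst (asm) inv_tensor_cong_dims[where N' = "\<lambda>_. k"]) auto
  then show ?thesis by blast
qed

text \<open>Exchanging \<open>a\<close> and \<open>b\<close> fixes \<open>v\<close> but changes the
  sign.\<close>

lemma inv_tensor_alternating_zero:
  assumes T: "inv_tensor d N P e \<Phi>" and e: "odd e" and P: "finite P" and v: "v \<in> word_tuples d N P"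
    and ab: "a \<in> P" "b \<in> P" "a \<noteq> b" "\<And>l. l < d \<Longrightarrow> v l a = v l b"
  shows "\<Phi> v = 0"
proof -
  let ?\<pi> = "Transposition.transpose a b"
  have p: "?\<pi> permutes P" using ab by (intro permutes_swap_id)
  have "act d ?\<pi> v = v"
    by (rule word_tuples_eqI[OF act_word_tuples[OF p v] v])
      (use ab in \<open>auto simp: act_apply Transposition.transpose_def\<close>)
  then have "\<Phi> v = of_int (sign ?\<pi>) ^ e * \<Phi> v" using inv_tensor_permD[OF T p v] by simp
  moreover have "sign ?\<pi> = -1" using ab by (simp add: sign_swap_id)
  ultimately show ?thesis using e by simp
qed

lemma inv_tensor_card_le:
  assumes T: "inv_tensor d (\<lambda>_. k) P e \<Phi>" and e: "odd e" and P: "finite P"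
  shows "card P \<le> k ^ d"
proof (rule ccontr)
  assume "\<not> ?thesis"
  then have less: "k ^ d < card P" by simp
  obtain v where v: "v \<in> word_tuples d (\<lambda>_. k) P" "\<Phi> v \<noteq> 0" using inv_tensor_nonzeroD[OF T] by blast
  let ?f = "\<lambda>a. \<lambda>l\<in>{..<d}. v l a"
  have "?f ` P \<subseteq> {..<d} \<rightarrow>\<^sub>E {..<k}"
    using word_tuples_lt[OF v(1)] by (intro image_subsetI restrict_PiE_iff[THEN iffD2]) auto
  then have "card (?f ` P) \<le> card ({..<d} \<rightarrow>\<^sub>E {..<k})" by (intro card_mono finite_PiE) auto
  also have "\<dots> = k ^ d" by (simp add: card_PiE)
  finally have "\<not> inj_on ?f P" using less pigeonhole[of ?f P] by auto
  then obtain a b where ab: "a \<in> P" "b \<in> P" "a \<noteq> b" "?f a = ?f b" by (auto simp: inj_on_def)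
  have "v l a = v l b" if "l < d" for l
    using fun_cong[OF ab(4), of l] that by (simp only: restrict_apply lessThan_iff if_True)
  then have "\<Phi> v = 0" by (intro inv_tensor_alternating_zero[OF T e P v(1) ab(1-3)])
  then show False using v by simp
qed

subsection \<open>Invariant polynomials\<close>

lemma prod_eq_prod_power_card:
  assumes "finite P" "finite C" "h ` P \<subseteq> C"
  shows "(\<Prod>a\<in>P. x (h a) :: 'a :: comm_monoid_mult) = (\<Prod>c\<in>C. x c ^ card {a\<in>P. h a = c})"
proof -
  have "(\<Prod>a\<in>{a\<in>P. h a = c}. x (h a)) = x c ^ card {a\<in>P. h a = c}" for c
  proof -
    have "(\<Prod>a\<in>{a\<in>P. h a = c}. x (h a)) = (\<Prod>a\<in>{a\<in>P. h a = c}. x c)" by (rule prod.cong) auto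
    then show ?thesis by simp
  qed
  then show ?thesis using prod.group[OF assms, of "\<lambda>a. x (h a)"] by simp
qed

lemma sum_card_fibres:
  assumes "finite P" "finite C" "h ` P \<subseteq> C"
  shows "(\<Sum>c\<in>C. card {a\<in>P. h a = c}) = card P"
  using sum.group[OF assms, of "\<lambda>_. 1 :: nat"] by simp

text \<open>A tuple of \<open>d\<close> words and a sequence of multi-indices are the two readings
  of one array; tensors use the first reading, monomials the second.\<close>

definition tuple_of_seq :: "nat \<Rightarrow> 'p set \<Rightarrow> ('p \<Rightarrow> nat \<Rightarrow> nat) \<Rightarrow> nat \<Rightarrow> 'p \<Rightarrow> nat" where
  "tuple_of_seq d P t = (\<lambda>l\<in>{..<d}. \<lambda>a\<in>P. t a l)"

definition seq_of_tuple :: "nat \<Rightarrow> 'p set \<Rightarrow> (nat \<Rightarrow> 'p \<Rightarrow> nat) \<Rightarrow> 'p \<Rightarrow> nat \<Rightarrow> nat" where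
  "seq_of_tuple d P v = (\<lambda>a\<in>P. \<lambda>l\<in>{..<d}. v l a)"

lemma seq_of_tuple_in: "v \<in> word_tuples d (\<lambda>_. n) P \<Longrightarrow> seq_of_tuple d P v \<in> P \<rightarrow>\<^sub>E idx d n"
  using word_tuples_lt[of v d "\<lambda>_. n" P] unfolding seq_of_tuple_def idx_def
  by (intro restrict_PiE_iff[THEN iffD2] ballI) auto

lemma idx_lt: "i \<in> idx d n \<Longrightarrow> l < d \<Longrightarrow> i l < n"
  by (auto simp: idx_def PiE_def Pi_def)

lemma idx_undef: "i \<in> idx d n \<Longrightarrow> \<not> l < d \<Longrightarrow> i l = undefined"
  by (auto simp: idx_def PiE_def extensional_def)

lemma idx_upd: "i \<in> idx d n \<Longrightarrow> l < d \<Longrightarrow> j < n \<Longrightarrow> i(l := j) \<in> idx d n"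
  by (auto simp: idx_def PiE_def Pi_def extensional_def)

lemma tuple_of_seq_in: "t \<in> P \<rightarrow>\<^sub>E idx d n \<Longrightarrow> tuple_of_seq d P t \<in> word_tuples d (\<lambda>_. n) P"
  unfolding tuple_of_seq_def word_tuples_def
  by (intro restrict_PiE_iff[THEN iffD2] ballI) (auto intro: idx_lt)

lemma tuple_seq: "v \<in> word_tuples d (\<lambda>_. n) P \<Longrightarrow> tuple_of_seq d P (seq_of_tuple d P v) = v"
  by (rule word_tuples_eqI[OF tuple_of_seq_in[OF seq_of_tuple_in]])
    (auto simp: tuple_of_seq_def seq_of_tuple_def)

lemma seq_tuple:
  assumes "t \<in> P \<rightarrow>\<^sub>E idx d n"
  shows "seq_of_tuple d P (tuple_of_seq d P t) = t"
proof
  fix a show "seq_of_tuple d P (tuple_of_seq d P t) a = t a"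
  proof (cases "a \<in> P")
    case True
    then have "t a \<in> idx d n" using assms by auto
    then show ?thesis using True
      by (auto simp: seq_of_tuple_def tuple_of_seq_def fun_eq_iff idx_undef)
  next
    case False
    then show ?thesis using assms by (auto simp: seq_of_tuple_def PiE_def extensional_def)
  qed
qed

lemma bij_seq_of_tuple: "bij_betw (seq_of_tuple d P) (word_tuples d (\<lambda>_. n) P) (P \<rightarrow>\<^sub>E idx d n)"
  by (rule bij_betwI[where g = "tuple_of_seq d P"])
    (rule Pi_I seq_of_tuple_in tuple_of_seq_in tuple_seq seq_tuple | assumption)+

lemma transpose_SL: "g \<in> SL n \<Longrightarrow> transpose_mat g \<in> SL n"
  by (auto simp: SL_def det_transpose)

lemma inv_tensor_all_directions:
  assumes T: "inv_tensor d N P e \<Phi>" and P: "finite P"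
    and g: "\<And>l. l < d \<Longrightarrow> g l \<in> SL (N l)" and v: "v \<in> word_tuples d N P"
  shows "(\<Sum>u\<in>word_tuples d N P. (\<Prod>l<d. \<Prod>a\<in>P. g l $$ (v l a, u l a)) * \<Phi> u) = \<Phi> v"
proof -
  let ?W = "\<lambda>l. words P (N l)"
  \<comment> \<open>\<open>h j u\<close> takes its first \<open>j\<close> words from
    \<open>u\<close> and the others from \<open>v\<close>; the induction on \<open>j\<close> applies
    the invariance in one direction at a time.\<close>
  define h where "h = (\<lambda>j u l. if l < j then u l else v l :: _ \<Rightarrow> nat)"
  have "(\<Sum>u\<in>Pi\<^sub>E {..<j} ?W. (\<Prod>l<j. \<Prod>a\<in>P. g l $$ (v l a, u l a)) * \<Phi> (h j u)) = \<Phi> v" if "j \<le> d" for j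
    using that
  proof (induction j)
    case 0
    then show ?case by (simp add: h_def)
  next
    case (Suc j)
    have upd: "h (Suc j) (u(j := w)) = (h j u)(j := w)" for u w
      by (auto simp: h_def fun_eq_iff less_Suc_eq)
    have hj: "h j u \<in> word_tuples d N P" if "u \<in> Pi\<^sub>E {..<j} ?W" for u
      using that v Suc.prems by (auto simp: h_def word_tuples_def PiE_def Pi_def extensional_def)
    have "(\<Sum>u\<in>Pi\<^sub>E {..<Suc j} ?W. (\<Prod>l<Suc j. \<Prod>a\<in>P. g l $$ (v l a, u l a)) * \<Phi> (h (Suc j) u))
      = (\<Sum>(w, u)\<in>?W j \<times> Pi\<^sub>E {..<j} ?W.
          (\<Prod>l<Suc j. \<Prod>a\<in>P. g l $$ (v l a, (u(j := w)) l a)) * \<Phi> ((h j u)(j := w)))"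
      unfolding lessThan_Suc[of j] PiE_insert_eq
      by (subst sum.reindex) (auto intro!: inj_combinator sum.cong simp: upd)
    also have "\<dots> = (\<Sum>(w, u)\<in>?W j \<times> Pi\<^sub>E {..<j} ?W.
          (\<Prod>l<j. \<Prod>a\<in>P. g l $$ (v l a, u l a)) * ((\<Prod>a\<in>P. g j $$ (v j a, w a)) * \<Phi> ((h j u)(j := w))))"
      by (intro sum.cong) auto
    also have "\<dots> = (\<Sum>u\<in>Pi\<^sub>E {..<j} ?W. (\<Prod>l<j. \<Prod>a\<in>P. g l $$ (v l a, u l a)) *
          (\<Sum>w\<in>?W j. (\<Prod>a\<in>P. g j $$ (v j a, w a)) * \<Phi> ((h j u)(j := w))))"
      unfolding sum.cartesian_product[symmetric] by (subst sum.swap) (simp add: sum_distrib_left)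
    also have "\<dots> = (\<Sum>u\<in>Pi\<^sub>E {..<j} ?W. (\<Prod>l<j. \<Prod>a\<in>P. g l $$ (v l a, u l a)) * \<Phi> (h j u))"
    proof (intro sum.cong refl arg_cong2[of _ _ _ _ times])
      fix u assume u: "u \<in> Pi\<^sub>E {..<j} ?W"
      have "(\<Sum>w\<in>?W j. (\<Prod>a\<in>P. g j $$ (v j a, w a)) * \<Phi> ((h j u)(j := w))) = \<Phi> ((h j u)(j := v j))"
        using Suc.prems by (intro sl_invD[OF inv_tensor_invD[OF T _ hj[OF u]]] g word_tuplesD[OF v]) auto
      then show "(\<Sum>w\<in>?W j. (\<Prod>a\<in>P. g j $$ (v j a, w a)) * \<Phi> ((h j u)(j := w))) = \<Phi> (h j u)"
        by (simp add: h_def fun_upd_idem)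
    qed
    also have "\<dots> = \<Phi> v" using Suc by simp
    finally show ?case .
  qed
  from this[of d] have "(\<Sum>u\<in>Pi\<^sub>E {..<d} ?W. (\<Prod>l<d. \<Prod>a\<in>P. g l $$ (v l a, u l a)) * \<Phi> (h d u)) = \<Phi> v" by simp
  moreover have "h d u = u" if "u \<in> Pi\<^sub>E {..<d} ?W" for u
    using that v by (auto simp: h_def word_tuples_def PiE_def extensional_def fun_eq_iff)
  ultimately show ?thesis by (simp add: word_tuples_def)
qed

text \<open>The multilinear form with coefficients \<open>F\<close>, evaluated at \<open>m\<close>
  copies of \<open>T\<close>.\<close>

definition tensor_poly :: "nat \<Rightarrow> nat \<Rightarrow> nat \<Rightarrow> ((nat \<Rightarrow> nat \<Rightarrow> nat) \<Rightarrow> complex) \<Rightarrow> tensor \<Rightarrow> complex" where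
  "tensor_poly d n m F T = (\<Sum>t\<in>{..<m} \<rightarrow>\<^sub>E idx d n. F t * (\<Prod>a<m. T (t a)))"

lemma tensor_poly_hom: "tensor_poly d n m F \<in> hom_polys d n m"
proof -
  let ?A = "{..<m} \<rightarrow>\<^sub>E idx d n"
  define cnt where "cnt = (\<lambda>t :: nat \<Rightarrow> nat \<Rightarrow> nat. \<lambda>i\<in>idx d n. card {a\<in>{..<m}. t a = i})"
  have cnt: "cnt t \<in> exponents d n m" if "t \<in> ?A" for t
    using that sum_card_fibres[of "{..<m}" "idx d n" t] finite_idx[of d n]
    by (auto simp: exponents_def cnt_def)
  have mono: "(\<Prod>a<m. T (t a)) = (\<Prod>i\<in>idx d n. T i ^ cnt t i)" if "t \<in> ?A" for t T
    using that prod_eq_prod_power_card[of "{..<m}" "idx d n" t T] finite_idx[of d n]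
    by (auto simp: cnt_def)
  have "tensor_poly d n m F T = (\<Sum>e\<in>exponents d n m. (\<Sum>t\<in>{t\<in>?A. cnt t = e}. F t) * (\<Prod>i\<in>idx d n. T i ^ e i))" for T
  proof -
    have "tensor_poly d n m F T = (\<Sum>e\<in>exponents d n m. \<Sum>t\<in>{t\<in>?A. cnt t = e}. F t * (\<Prod>a<m. T (t a)))"
      unfolding tensor_poly_def using cnt
      by (intro sum.group[symmetric] finite_PiE finite_idx finite_exponents) auto
    also have "\<dots> = (\<Sum>e\<in>exponents d n m. (\<Sum>t\<in>{t\<in>?A. cnt t = e}. F t) * (\<Prod>i\<in>idx d n. T i ^ e i))"
      unfolding sum_distrib_right by (intro sum.cong refl) (auto simp: mono)
    finally show ?thesis .
  qed
  then show ?thesis unfolding hom_polys_def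
    by (intro CollectI exI[of _ "\<lambda>e. \<Sum>t\<in>{t\<in>?A. cnt t = e}. F t"] ext)
qed

lemma tensor_poly_act:
  assumes g: "\<And>l. l < d \<Longrightarrow> g l \<in> carrier_mat n n"
  shows "tensor_poly d n m F (tensor_act d n g T)
    = tensor_poly d n m (\<lambda>s. \<Sum>t\<in>{..<m} \<rightarrow>\<^sub>E idx d n. F t * (\<Prod>a<m. \<Prod>l<d. g l $$ (t a l, s a l))) T"
proof -
  let ?A = "{..<m} \<rightarrow>\<^sub>E idx d n"
  have "tensor_poly d n m F (tensor_act d n g T)
      = (\<Sum>t\<in>?A. F t * (\<Prod>a<m. \<Sum>j\<in>idx d n. (\<Prod>l<d. g l $$ (t a l, j l)) * T j))"
    unfolding tensor_poly_def by (intro sum.cong refl arg_cong2[of _ _ _ _ times] prod.cong) (auto simp: tensor_act_def)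
  also have "\<dots> = (\<Sum>t\<in>?A. F t * (\<Sum>s\<in>?A. \<Prod>a<m. (\<Prod>l<d. g l $$ (t a l, s a l)) * T (s a)))"
    by (intro sum.cong refl arg_cong2[of _ _ _ _ times] prod_sum_PiE'[symmetric] finite_idx finite_lessThan)
  also have "\<dots> = (\<Sum>s\<in>?A. \<Sum>t\<in>?A. F t * (\<Prod>a<m. \<Prod>l<d. g l $$ (t a l, s a l)) * (\<Prod>a<m. T (s a)))"
    unfolding sum_distrib_left by (subst sum.swap) (simp add: prod.distrib mult.assoc)
  finally show ?thesis unfolding tensor_poly_def by (simp add: sum_distrib_right)
qed

text \<open>Acting on \<open>T\<close> amounts to acting on the coefficients by the transposes,
  which are again in \<open>SL n\<close>. Evenness of \<open>e\<close> makes the coefficients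
  symmetric in the positions, and symmetric coefficients are determined by their polynomial, so it
  is nonzero.\<close>

lemma invariant_of_inv_tensor:
  assumes T: "inv_tensor d (\<lambda>_. n) {..<m} e \<Phi>" and e: "even e"
  shows "invariants d n m \<noteq> {\<lambda>_. 0}"
proof -
  let ?A = "{..<m} \<rightarrow>\<^sub>E idx d n"
  let ?f = "tensor_poly d n m (\<lambda>t. \<Phi> (tuple_of_seq d {..<m} t))"
  have "?f (tensor_act d n g S) = ?f S" if g: "g \<in> SL_pow d n" for g S
  proof -
    have gl: "g l \<in> SL n" if "l < d" for l using g that by (auto simp: SL_pow_def)
    have "(\<Sum>t\<in>?A. \<Phi> (tuple_of_seq d {..<m} t) * (\<Prod>a<m. \<Prod>l<d. g l $$ (t a l, s a l))) = \<Phi> (tuple_of_seq d {..<m} s)"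
      if s: "s \<in> ?A" for s
    proof -
      let ?v = "tuple_of_seq d {..<m} s"
      have v: "?v \<in> word_tuples d (\<lambda>_. n) {..<m}" by (rule tuple_of_seq_in[OF s])
      have "(\<Sum>t\<in>?A. \<Phi> (tuple_of_seq d {..<m} t) * (\<Prod>a<m. \<Prod>l<d. g l $$ (t a l, s a l)))
        = (\<Sum>u\<in>word_tuples d (\<lambda>_. n) {..<m}. \<Phi> (tuple_of_seq d {..<m} (seq_of_tuple d {..<m} u))
            * (\<Prod>a<m. \<Prod>l<d. g l $$ (seq_of_tuple d {..<m} u a l, s a l)))"
        by (rule sum.reindex_bij_betw[OF bij_seq_of_tuple, symmetric])
      also have "\<dots> = (\<Sum>u\<in>word_tuples d (\<lambda>_. n) {..<m}.
          (\<Prod>l<d. \<Prod>a<m. transpose_mat (g l) $$ (?v l a, u l a)) * \<Phi> u)"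
      proof (intro sum.cong refl)
        fix u assume u: "u \<in> word_tuples d (\<lambda>_. n) {..<m}"
        have "(\<Prod>a<m. \<Prod>l<d. g l $$ (seq_of_tuple d {..<m} u a l, s a l))
          = (\<Prod>l<d. \<Prod>a<m. g l $$ (seq_of_tuple d {..<m} u a l, s a l))" by (rule prod.swap)
        also have "\<dots> = (\<Prod>l<d. \<Prod>a<m. transpose_mat (g l) $$ (?v l a, u l a))"
        proof (intro prod.cong refl)
          fix l a assume la: "l \<in> {..<d}" "a \<in> {..<m}"
          have "g l \<in> carrier_mat n n" using gl[of l] la by (simp add: SL_def)
          then show "g l $$ (seq_of_tuple d {..<m} u a l, s a l) = transpose_mat (g l) $$ (?v l a, u l a)"
            using la word_tuples_lt[OF u, of l a] word_tuples_lt[OF v, of l a]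
            by (simp add: seq_of_tuple_def tuple_of_seq_def)
        qed
        finally show "\<Phi> (tuple_of_seq d {..<m} (seq_of_tuple d {..<m} u))
            * (\<Prod>a<m. \<Prod>l<d. g l $$ (seq_of_tuple d {..<m} u a l, s a l))
          = (\<Prod>l<d. \<Prod>a<m. transpose_mat (g l) $$ (?v l a, u l a)) * \<Phi> u"
          by (simp add: tuple_seq[OF u] mult.commute)
      qed
      also have "\<dots> = \<Phi> ?v"
        by (intro inv_tensor_all_directions[OF T] transpose_SL gl v) auto
      finally show ?thesis .
    qed
    then show ?thesis
      using gl by (subst tensor_poly_act) (auto simp: SL_def tensor_poly_def intro!: sum.cong)
  qed
  then have "?f \<in> invariants d n m" using tensor_poly_hom by (auto simp: invariants_def)
  moreover have "?f \<noteq> (\<lambda>_. 0)"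
  proof
    assume f0: "?f = (\<lambda>_. 0)"
    obtain v where v: "v \<in> word_tuples d (\<lambda>_. n) {..<m}" "\<Phi> v \<noteq> 0" using inv_tensor_nonzeroD[OF T] by blast
    have "(\<lambda>t. \<Phi> (tuple_of_seq d {..<m} t)) (seq_of_tuple d {..<m} v) = 0"
    proof (rule sym_coeffs_eq_zero[where P = "{..<m}" and B = "idx d n" and u = "\<lambda>_. ()"
          and H = "\<lambda>t. \<Phi> (tuple_of_seq d {..<m} t)"])
      fix \<sigma> t assume \<sigma>: "\<sigma> permutes {..<m}" and t: "t \<in> ?A"
      have "tuple_of_seq d {..<m} (t \<circ> \<sigma>) = act d \<sigma> (tuple_of_seq d {..<m} t)"
        using permutes_in_image[OF \<sigma>]
        by (intro word_tuples_eqI[OF tuple_of_seq_in[OF comp_permutes_PiE[OF \<sigma> t]] act_word_tuples[OF \<sigma> tuple_of_seq_in[OF t]]])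
          (auto simp: tuple_of_seq_def act_apply)
      then show "\<Phi> (tuple_of_seq d {..<m} (t \<circ> \<sigma>)) = \<Phi> (tuple_of_seq d {..<m} t)"
        using inv_tensor_permD[OF T \<sigma> tuple_of_seq_in[OF t]] e by (simp add: sign_def)
    next
      fix g :: "unit \<Rightarrow> (nat \<Rightarrow> nat) \<Rightarrow> complex"
      show "(\<Sum>y\<in>?A. \<Phi> (tuple_of_seq d {..<m} y) * (\<Prod>a<m. g () (y a))) = 0"
        using fun_cong[OF f0, of "g ()"] by (simp add: tensor_poly_def)
    qed (rule finite_lessThan finite_idx seq_of_tuple_in[OF v(1)])+
    then show False using v by (simp add: tuple_seq)
  qed
  ultimately show ?thesis by blast
qed

section \<open>Polarisation of an invariant polynomial\<close>

lemma exists_seq_with_counts: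
  assumes "finite I" "(\<Sum>i\<in>I. e i) = m"
  shows "\<exists>t\<in>{..<m} \<rightarrow>\<^sub>E I. \<forall>i\<in>I. card {a\<in>{..<m}. t a = i} = e i"
  using assms
proof (induction I arbitrary: m rule: finite_induct)
  case empty
  then show ?case by (auto intro!: exI[of _ "\<lambda>_. undefined"])
next
  case (insert j I)
  define m' where "m' = sum e I"
  have m: "m = m' + e j" using insert by (simp add: m'_def)
  obtain t where t: "t \<in> {..<m'} \<rightarrow>\<^sub>E I" "\<forall>i\<in>I. card {a\<in>{..<m'}. t a = i} = e i"
    using insert.IH[of m'] m'_def by blast
  define s where "s = (\<lambda>a\<in>{..<m}. if a < m' then t a else j)"
  have s: "s \<in> {..<m} \<rightarrow>\<^sub>E insert j I" using PiE_mem[OF t(1)] by (auto simp: s_def)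
  have nj: "t a \<noteq> j" if "a < m'" for a using PiE_mem[OF t(1), of a] insert.hyps that by auto
  have sj: "s a = j \<longleftrightarrow> m' \<le> a" if "a < m" for a using nj[of a] that by (simp add: s_def)
  have "{a\<in>{..<m}. s a = j} = {a\<in>{..<m}. m' \<le> a}" by (rule Collect_cong) (metis sj lessThan_iff)
  also have "\<dots> = {m'..<m}" by auto
  finally have "{a\<in>{..<m}. s a = j} = {m'..<m}" .
  then have "card {a\<in>{..<m}. s a = j} = e j" using m by simp
  moreover have "card {a\<in>{..<m}. s a = i} = e i" if i: "i \<in> I" for i
  proof -
    have "{a\<in>{..<m}. s a = i} = {a\<in>{..<m'}. t a = i}"
      using i insert.hyps m by (auto simp: s_def)
    then show ?thesis using t i by simp
  qed
  ultimately show ?case using s by blast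
qed

text \<open>Each coefficient is put on one sequence \<open>\<tau> e\<close> that realises the
  exponents and is then spread over all rearrangements. Every term is counted \<open>fact m\<close>
  times, which spares dividing by orbit sizes.\<close>

lemma hom_poly_symmetric_coeffs:
  assumes f: "f \<in> hom_polys d n m"
  obtains F where "\<And>T. tensor_poly d n m F T = fact m * f T"
    "\<And>\<sigma> t. \<sigma> permutes {..<m} \<Longrightarrow> F (t \<circ> \<sigma>) = F t"
proof -
  let ?A = "{..<m} \<rightarrow>\<^sub>E idx d n"
  obtain c where c: "f = (\<lambda>T. \<Sum>e\<in>exponents d n m. c e * (\<Prod>i\<in>idx d n. T i ^ e i))"
    using f by (auto simp: hom_polys_def)
  have "\<forall>e\<in>exponents d n m. \<exists>t. t \<in> ?A \<and> (\<forall>i\<in>idx d n. card {a\<in>{..<m}. t a = i} = e i)"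
    unfolding Bex_def[symmetric] by (intro ballI exists_seq_with_counts finite_idx) (auto simp: exponents_def)
  from bchoice[OF this]
  obtain \<tau> where \<tau>: "\<And>e. e \<in> exponents d n m \<Longrightarrow> \<tau> e \<in> ?A"
    "\<And>e i. e \<in> exponents d n m \<Longrightarrow> i \<in> idx d n \<Longrightarrow> card {a\<in>{..<m}. \<tau> e a = i} = e i"
    by auto
  define F0 where "F0 = (\<lambda>t. \<Sum>e\<in>exponents d n m. c e * of_bool (t = \<tau> e))"
  define F where "F = (\<lambda>t. \<Sum>\<pi> | \<pi> permutes {..<m}. F0 (t \<circ> \<pi>))"
  have "F (t \<circ> \<sigma>) = F t" if "\<sigma> permutes {..<m}" for \<sigma> t
    unfolding F_def using sum_permutations_left[OF that, of "\<lambda>\<pi>. F0 (t \<circ> \<pi>)"] by (simp add: o_assoc)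
  moreover have "tensor_poly d n m F T = fact m * f T" for T
  proof -
    have 1: "(\<Sum>t\<in>?A. F0 t * (\<Prod>a<m. T (t a))) = f T"
    proof -
      have "(\<Sum>t\<in>?A. F0 t * (\<Prod>a<m. T (t a)))
          = (\<Sum>e\<in>exponents d n m. \<Sum>t\<in>?A. c e * (of_bool (t = \<tau> e) * (\<Prod>a<m. T (t a))))"
        unfolding F0_def sum_distrib_right by (subst sum.swap) (simp add: mult.assoc)
      also have "\<dots> = (\<Sum>e\<in>exponents d n m. c e * (\<Prod>i\<in>idx d n. T i ^ e i))"
      proof (rule sum.cong[OF refl])
        fix e assume e: "e \<in> exponents d n m"
        have "(\<Sum>t\<in>?A. c e * (of_bool (t = \<tau> e) * (\<Prod>a<m. T (t a))))
          = (\<Sum>t\<in>{\<tau> e}. c e * (of_bool (t = \<tau> e) * (\<Prod>a<m. T (t a))))"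
          using \<tau>(1)[OF e] by (intro sum.mono_neutral_right finite_PiE finite_idx) auto
        also have "\<dots> = c e * (\<Prod>a<m. T (\<tau> e a))" by simp
        also have "(\<Prod>a<m. T (\<tau> e a)) = (\<Prod>i\<in>idx d n. T i ^ e i)"
          using \<tau>(1)[OF e] \<tau>(2)[OF e] prod_eq_prod_power_card[of "{..<m}" "idx d n" "\<tau> e" T] finite_idx[of d n]
          by auto
        finally show "(\<Sum>t\<in>?A. c e * (of_bool (t = \<tau> e) * (\<Prod>a<m. T (t a)))) = c e * (\<Prod>i\<in>idx d n. T i ^ e i)" .
      qed
      finally show ?thesis by (simp add: c)
    qed
    have "tensor_poly d n m F T = (\<Sum>\<pi> | \<pi> permutes {..<m}. \<Sum>t\<in>?A. F0 (t \<circ> \<pi>) * (\<Prod>a<m. T (t a)))"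
      unfolding tensor_poly_def F_def sum_distrib_right by (rule sum.swap)
    also have "\<dots> = (\<Sum>\<pi> | \<pi> permutes {..<m}. f T)"
    proof (rule sum.cong[OF refl])
      fix \<pi> assume "\<pi> \<in> {\<pi>. \<pi> permutes {..<m}}"
      then have "\<pi> \<in> stab {..<m} (\<lambda>_. ())" by (simp add: stab_def)
      from sum_stab_monomial[OF this, of F0 "\<lambda>_. T" "idx d n"]
      show "(\<Sum>t\<in>?A. F0 (t \<circ> \<pi>) * (\<Prod>a<m. T (t a))) = f T" by (simp add: 1)
    qed
    also have "\<dots> = fact m * f T" by (simp add: card_permutations)
    finally show ?thesis .
  qed
  ultimately show thesis using that by blast
qed

lemma tensor_act_single:
  assumes h: "h \<in> carrier_mat n n" and l: "l < d" and j: "j \<in> idx d n"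
  shows "tensor_act d n (\<lambda>k\<in>{..<d}. if k = l then h else 1\<^sub>m n) T j = (\<Sum>i<n. h $$ (j l, i) * T (j(l := i)))"
proof -
  let ?g = "\<lambda>k\<in>{..<d}. if k = l then h else 1\<^sub>m n"
  let ?S = "(\<lambda>i. j(l := i)) ` {..<n}"
  have "tensor_act d n ?g T j = (\<Sum>j'\<in>idx d n. (\<Prod>k<d. ?g k $$ (j k, j' k)) * T j')"
    using j by (simp add: tensor_act_def)
  also have "\<dots> = (\<Sum>j'\<in>?S. (\<Prod>k<d. ?g k $$ (j k, j' k)) * T j')"
  proof (rule sum.mono_neutral_right[OF finite_idx])
    show "?S \<subseteq> idx d n" using idx_upd[OF j l] by auto
    show "\<forall>j'\<in>idx d n - ?S. (\<Prod>k<d. ?g k $$ (j k, j' k)) * T j' = 0"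
    proof
      fix j' assume j': "j' \<in> idx d n - ?S"
      have "j' \<noteq> j(l := j' l)" using j' idx_lt[of j' d n l] l by auto
      then obtain k where k: "j' k \<noteq> (j(l := j' l)) k" by blast
      then have "k \<noteq> l" by auto
      moreover have "k < d" using k j j' \<open>k \<noteq> l\<close> idx_undef[of j' d n k] idx_undef[OF j, of k] by fastforce
      ultimately have "?g k $$ (j k, j' k) = 0"
        using k idx_lt[OF j, of k] idx_lt[of j' d n k] j' by auto
      then show "(\<Prod>k<d. ?g k $$ (j k, j' k)) * T j' = 0"
        using \<open>k < d\<close> by (metis (no_types, lifting) finite_lessThan lessThan_iff mult_zero_left prod_zero)
    qed
  qed
  also have "\<dots> = (\<Sum>i<n. (\<Prod>k<d. ?g k $$ (j k, (j(l := i)) k)) * T (j(l := i)))"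
    by (subst sum.reindex) (auto simp: inj_on_def fun_upd_eqD)
  also have "\<dots> = (\<Sum>i<n. h $$ (j l, i) * T (j(l := i)))"
  proof (rule sum.cong[OF refl])
    fix i
    have "(\<Prod>k<d. ?g k $$ (j k, (j(l := i)) k)) = (\<Prod>k<d. if k = l then h $$ (j l, i) else 1)"
      using idx_lt[OF j] by (intro prod.cong refl) auto
    then show "(\<Prod>k<d. ?g k $$ (j k, (j(l := i)) k)) * T (j(l := i)) = h $$ (j l, i) * T (j(l := i))"
      using l by simp
  qed
  finally show ?thesis .
qed

lemma inv_tensor_of_invariant:
  assumes f: "f \<in> invariants d n m" and nz: "f \<noteq> (\<lambda>_. 0)"
  obtains \<Phi> where "inv_tensor d (\<lambda>_. n) {..<m} 0 \<Phi>"
proof -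
  let ?P = "{..<m}"
  let ?A = "?P \<rightarrow>\<^sub>E idx d n" and ?W = "words ?P n"
  have "f \<in> hom_polys d n m" using f by (simp add: invariants_def)
  then obtain F where F: "\<And>T. tensor_poly d n m F T = fact m * f T"
    and Fsym: "\<And>\<sigma> t. \<sigma> permutes ?P \<Longrightarrow> F (t \<circ> \<sigma>) = F t"
    using hom_poly_symmetric_coeffs by blast
  define upd where "upd = (\<lambda>l (t :: nat \<Rightarrow> nat \<Rightarrow> nat) w. \<lambda>a\<in>?P. (t a)(l := w a))"
  have upd_in: "upd l t w \<in> ?A" if "t \<in> ?A" "w \<in> ?W" "l < d" for l t w
    using that unfolding upd_def by (auto intro!: idx_upd)
  have inv: "(\<Sum>w\<in>?W. (\<Prod>a<m. g $$ (t0 a l, w a)) * F (upd l t0 w)) - F t0 = 0"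
    if g: "g \<in> SL n" and l: "l < d" and t0: "t0 \<in> ?A" for g l t0
  proof -
    \<comment> \<open>\<open>H\<close> is the defect of invariance in direction \<open>l\<close>. It
      is symmetric in the positions, and invariance of \<open>f\<close> under a group element acting
      in this direction only makes its polynomial vanish, so \<open>H\<close> is zero.\<close>
    define H where "H = (\<lambda>t. (\<Sum>w\<in>?W. (\<Prod>a<m. g $$ (t a l, w a)) * F (upd l t w)) - F t)"
    have "H t0 = 0"
    proof (rule sym_coeffs_eq_zero[where P = ?P and B = "idx d n" and u = "\<lambda>_. ()" and H = H])
      fix \<sigma> t assume \<sigma>: "\<sigma> permutes ?P" and t: "t \<in> ?A"
      have 1: "upd l (t \<circ> \<sigma>) (w \<circ> \<sigma>) = upd l t w \<circ> \<sigma>" for w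
        using permutes_in_image[OF \<sigma>] by (auto simp: upd_def fun_eq_iff)
      have "(\<Sum>w\<in>?W. (\<Prod>a<m. g $$ ((t \<circ> \<sigma>) a l, w a)) * F (upd l (t \<circ> \<sigma>) w))
        = (\<Sum>w\<in>?W. (\<Prod>a<m. g $$ (t (\<sigma> a) l, w (\<sigma> a))) * F (upd l (t \<circ> \<sigma>) (w \<circ> \<sigma>)))"
        using sum_PiE_permutes[OF \<sigma>, of "\<lambda>w. (\<Prod>a<m. g $$ ((t \<circ> \<sigma>) a l, w a)) * F (upd l (t \<circ> \<sigma>) w)" "{..<n}"]
        by simp
      also have "\<dots> = (\<Sum>w\<in>?W. (\<Prod>a<m. g $$ (t a l, w a)) * F (upd l t w))"
        unfolding 1 Fsym[OF \<sigma>]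
        using prod_comp_permutes[OF \<sigma>, of "\<lambda>a. g $$ (t a l, _ a)"] by simp
      finally show "H (t \<circ> \<sigma>) = H t" by (simp add: H_def Fsym[OF \<sigma>])
    next
      fix x :: "unit \<Rightarrow> (nat \<Rightarrow> nat) \<Rightarrow> complex"
      define T where "T = (\<lambda>i. if i \<in> idx d n then x () i else 0)"
      let ?g = "\<lambda>k\<in>{..<d}. if k = l then transpose_mat g else 1\<^sub>m n"
      have gc: "transpose_mat g \<in> carrier_mat n n" using g by (auto simp: SL_def)
      have "?g \<in> SL_pow d n" using transpose_SL[OF g] by (auto simp: SL_pow_def SL_def)
      moreover have "T \<in> tensor_space d n" by (simp add: tensor_space_def T_def)
      ultimately have fT: "f (tensor_act d n ?g T) = f T" using f by (auto simp: invariants_def)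
      have "(\<Sum>t\<in>?A. (\<Sum>w\<in>?W. (\<Prod>a<m. g $$ (t a l, w a)) * F (upd l t w)) * (\<Prod>a<m. x () (t a)))
        = (\<Sum>(t, w)\<in>?A \<times> ?W. (\<Prod>a<m. g $$ (t a l, w a)) * F (upd l t w) * (\<Prod>a<m. x () (t a)))"
        by (simp add: sum_distrib_right sum.cartesian_product)
      also have "\<dots> = (\<Sum>(t, w)\<in>?A \<times> ?W. F t * (\<Prod>a<m. g $$ (w a, t a l) * x () ((t a)(l := w a))))"
      proof -
        \<comment> \<open>This involution exchanges the \<open>l\<close>-th components of
          \<open>t\<close> with the word \<open>w\<close>, which moves the group element from the
          coefficients to the variables.\<close>
        let ?j = "\<lambda>(t, w). (upd l t w, \<lambda>a\<in>?P. t a l)"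
        have inA: "?j p \<in> ?A \<times> ?W" if p: "p \<in> ?A \<times> ?W" for p
        proof -
          obtain t w where tw: "p = (t, w)" "t \<in> ?A" "w \<in> ?W" using p by auto
          have "(\<lambda>a\<in>?P. t a l) \<in> ?W" using idx_lt[OF PiE_mem[OF tw(2)] l] by auto
          then show ?thesis using upd_in[OF tw(2,3) l] tw by auto
        qed
        have jj: "?j (?j p) = p" if p: "p \<in> ?A \<times> ?W" for p
          using p by (auto simp: upd_def fun_eq_iff PiE_def extensional_def)
        show ?thesis
        proof (rule sum.reindex_bij_witness[of _ ?j ?j])
          fix p assume p: "p \<in> ?A \<times> ?W"
          obtain t w where tw: "p = (t, w)" "t \<in> ?A" "w \<in> ?W" using p by auto
          have "(\<Prod>a<m. g $$ ((\<lambda>a\<in>?P. t a l) a, upd l t w a l) * x () ((upd l t w a)(l := (\<lambda>a\<in>?P. t a l) a)))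
            = (\<Prod>a<m. g $$ (t a l, w a) * x () (t a))"
            by (intro prod.cong refl) (simp add: upd_def)
          then show "(case ?j p of (t, w) \<Rightarrow> F t * (\<Prod>a<m. g $$ (w a, t a l) * x () ((t a)(l := w a))))
            = (case p of (t, w) \<Rightarrow> (\<Prod>a<m. g $$ (t a l, w a)) * F (upd l t w) * (\<Prod>a<m. x () (t a)))"
            by (simp add: tw prod.distrib)
        qed (use inA jj in auto)
      qed
      also have "\<dots> = (\<Sum>t\<in>?A. F t * (\<Sum>w\<in>?W. \<Prod>a<m. g $$ (w a, t a l) * x () ((t a)(l := w a))))"
        by (simp add: sum_distrib_left sum.cartesian_product)
      also have "\<dots> = (\<Sum>t\<in>?A. F t * (\<Prod>a<m. \<Sum>i<n. g $$ (i, t a l) * x () ((t a)(l := i))))"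
        by (intro sum.cong refl arg_cong2[of _ _ _ _ times] prod_sum_PiE' finite_lessThan)
      also have "\<dots> = (\<Sum>t\<in>?A. F t * (\<Prod>a<m. tensor_act d n ?g T (t a)))"
      proof (intro sum.cong refl arg_cong2[of _ _ _ _ times] prod.cong)
        fix t a assume t: "t \<in> ?A" and a: "a \<in> ?P"
        have ta: "t a \<in> idx d n" using t a by auto
        show "(\<Sum>i<n. g $$ (i, t a l) * x () ((t a)(l := i))) = tensor_act d n ?g T (t a)"
          unfolding tensor_act_single[OF gc l ta]
          using idx_upd[OF ta l] idx_lt[OF ta l] g by (intro sum.cong refl) (auto simp: T_def SL_def)
      qed
      also have "\<dots> = fact m * f T" using F[of "tensor_act d n ?g T"] fT by (simp add: tensor_poly_def)
      also have "\<dots> = (\<Sum>t\<in>?A. F t * (\<Prod>a<m. x () (t a)))"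
        unfolding F[symmetric] tensor_poly_def
        by (intro sum.cong refl arg_cong2[of _ _ _ _ times] prod.cong) (auto simp: T_def)
      finally show "(\<Sum>t\<in>?A. H t * (\<Prod>a<m. x () (t a))) = 0"
        by (simp add: H_def left_diff_distrib sum_subtractf)
    qed (use t0 finite_idx in auto)
    then show ?thesis by (simp add: H_def)
  qed
  let ?\<Phi> = "\<lambda>v. F (seq_of_tuple d ?P v)"
  have "inv_tensor d (\<lambda>_. n) ?P 0 ?\<Phi>"
    unfolding inv_tensor_def
  proof (intro conjI allI impI ballI)
    fix \<pi> v assume \<pi>: "\<pi> permutes ?P" and v: "v \<in> word_tuples d (\<lambda>_. n) ?P"
    have "seq_of_tuple d ?P (act d \<pi> v) = seq_of_tuple d ?P v \<circ> \<pi>"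
      using permutes_in_image[OF \<pi>] by (auto simp: seq_of_tuple_def act_def fun_eq_iff)
    then show "?\<Phi> (act d \<pi> v) = of_int (sign \<pi>) ^ 0 * ?\<Phi> v" by (simp add: Fsym[OF \<pi>])
  next
    fix l v assume l: "l < d" and v: "v \<in> word_tuples d (\<lambda>_. n) ?P"
    show "sl_inv ?P n (\<lambda>w. ?\<Phi> (v(l := w)))"
      unfolding sl_inv_def
    proof (intro ballI)
      fix g w0 assume g: "g \<in> SL n" and w0: "w0 \<in> ?W"
      have v0: "v(l := w0) \<in> word_tuples d (\<lambda>_. n) ?P" using word_tuples_upd'[OF v l w0] .
      define s0 where "s0 = seq_of_tuple d ?P (v(l := w0))"
      have s0: "s0 \<in> ?A" unfolding s0_def by (rule seq_of_tuple_in[OF v0])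
      have 1: "seq_of_tuple d ?P (v(l := w)) = upd l s0 w" for w
        using l by (auto simp: s0_def seq_of_tuple_def upd_def fun_eq_iff)
      have 2: "(\<Prod>a<m. g $$ (w0 a, w a)) = (\<Prod>a<m. g $$ (s0 a l, w a))" for w
        using l by (simp add: s0_def seq_of_tuple_def)
      have "(\<Sum>w\<in>?W. (\<Prod>a<m. g $$ (w0 a, w a)) * ?\<Phi> (v(l := w))) = F s0"
        unfolding 1 2 by (rule iffD2[OF eq_iff_diff_eq_0 inv[OF g l s0]])
      then show "(\<Sum>w\<in>?W. (\<Prod>a<m. g $$ (w0 a, w a)) * ?\<Phi> (v(l := w))) = ?\<Phi> (v(l := w0))"
        by (simp only: s0_def)
    qed
  next
    show "\<exists>v\<in>word_tuples d (\<lambda>_. n) ?P. ?\<Phi> v \<noteq> 0"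
    proof (rule ccontr)
      assume *: "\<not> ?thesis"
      have "F t = 0" if "t \<in> ?A" for t
      proof -
        have "?\<Phi> (tuple_of_seq d ?P t) = 0" using * tuple_of_seq_in[OF that] by blast
        then show ?thesis by (simp only: seq_tuple[OF that])
      qed
      then have "tensor_poly d n m F T = 0" for T by (simp add: tensor_poly_def)
      then have "f = (\<lambda>_. 0)" using F by (simp add: fun_eq_iff)
      then show False using nz by simp
    qed
  qed
  then show thesis by (rule that)
qed

lemma sl_inv_dvd_card:
  assumes inv: "sl_inv P n \<phi>" and n: "n > 0" and P: "finite P" and w: "w \<in> words P n" "\<phi> w \<noteq> 0"
  shows "n dvd card P"
proof -
  define z where "z = cis (2 * pi / n)"
  have zn: "z ^ n = 1" using n by (simp add: z_def DeMoivre)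
  let ?g = "z \<cdot>\<^sub>m 1\<^sub>m n"
  have g: "?g \<in> SL n" using zn by (simp add: SL_def)
  have "(\<Sum>w'\<in>words P n. (\<Prod>a\<in>P. ?g $$ (w a, w' a)) * \<phi> w')
      = (\<Sum>w'\<in>{w}. (\<Prod>a\<in>P. ?g $$ (w a, w' a)) * \<phi> w')"
  proof (rule sum.mono_neutral_right)
    show "\<forall>w'\<in>words P n - {w}. (\<Prod>a\<in>P. ?g $$ (w a, w' a)) * \<phi> w' = 0"
    proof
      fix w' assume w': "w' \<in> words P n - {w}"
      then obtain a where a: "a \<in> P" "w a \<noteq> w' a" using w PiE_ext[of w P _ w'] by blast
      then have "?g $$ (w a, w' a) = 0" using words_lt[OF w(1)] words_lt[of w' P n] w' by auto
      then show "(\<Prod>a\<in>P. ?g $$ (w a, w' a)) * \<phi> w' = 0" using a P by auto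
    qed
  qed (use w finite_words[OF P] in auto)
  also have "\<dots> = z ^ card P * \<phi> w"
  proof -
    have "(\<Prod>a\<in>P. ?g $$ (w a, w a)) = (\<Prod>a\<in>P. z)" using words_lt[OF w(1)] by (intro prod.cong) auto
    then show ?thesis by simp
  qed
  finally have "z ^ card P * \<phi> w = \<phi> w" using sl_invD[OF inv g w(1)] by simp
  then have "cis (real (card P) * (2 * pi / n)) = 1" using w by (simp add: z_def DeMoivre)
  then have "cos (real (card P) * (2 * pi / n)) = 1" by (simp add: complex_eq_iff)
  then obtain j :: int where "real (card P) * (2 * pi / n) = of_int j * 2 * pi"
    using cos_one_2pi_int by auto
  then have "real (card P) = of_int j * real n" using n by (simp add: field_simps)
  then have "int (card P) = j * int n" by (metis of_int_eq_iff of_int_mult of_int_of_nat_eq)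
  then have "int n dvd int (card P)" by simp
  then show ?thesis by (simp only: int_dvd_int_iff)
qed

lemma invariant_degree_lower:
  assumes f: "f \<in> invariants d n m" "f \<noteq> (\<lambda>_. 0)" and m: "m > 0" and n: "n > 0" and d: "odd d"
  shows "\<exists>k > 0. m = n * k \<and> n \<le> k ^ (d - 1)"
proof -
  obtain \<Phi> where \<Phi>: "inv_tensor d (\<lambda>_. n) {..<m} 0 \<Phi>" using inv_tensor_of_invariant[OF f] .
  have d0: "0 < d" using d by (cases d) auto
  obtain v where v: "v \<in> word_tuples d (\<lambda>_. n) {..<m}" "\<Phi> v \<noteq> 0" using inv_tensor_nonzeroD[OF \<Phi>] by blast
  have "n dvd card {..<m}"
    by (rule sl_inv_dvd_card[OF inv_tensor_invD[OF \<Phi> d0 v(1)] n _ word_tuplesD[OF v(1) d0]]) (use v in auto)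
  then obtain k where k: "m = n * k" by auto
  then have k0: "k > 0" using m by (cases k) auto
  obtain \<Psi> where "inv_tensor d (\<lambda>_. k) {..<n * k} (0 + d) \<Psi>" using inv_tensor_dual[of d n k 0 \<Phi>] \<Phi> n k by auto
  from inv_tensor_card_le[OF this] d have "n * k \<le> k ^ d" by simp
  also have "k ^ d = k ^ (d - 1) * k" using d0 by (metis Suc_diff_1 power_Suc2)
  finally have "n \<le> k ^ (d - 1)" using k0 by simp
  then show ?thesis using k k0 by blast
qed

subsection \<open>Change of positions and antisymmetrisation\<close>

text \<open>Both tuples list the same points, as many as there are positions, hence without
  repetition; one list is a rearrangement of the other.\<close>

lemma same_points_act:
  assumes P: "finite P" and v: "v \<in> word_tuples d N P" and v': "v' \<in> word_tuples d N P"
    and inj: "inj_on (seq_of_tuple d P v) P" and im: "seq_of_tuple d P v' ` P = seq_of_tuple d P v ` P"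
  obtains \<pi> where "\<pi> permutes P" "v' = act d \<pi> v"
proof -
  let ?s = "seq_of_tuple d P v" and ?s' = "seq_of_tuple d P v'"
  have "card (?s' ` P) = card P" using im inj by (simp add: card_image)
  then have inj': "inj_on ?s' P" using P by (rule eq_card_imp_inj_on[rotated])
  have b: "bij_betw ?s P (?s ` P)" and b': "bij_betw ?s' P (?s ` P)"
    using inj inj' im by (auto simp: bij_betw_def)
  define f where "f = the_inv_into P ?s \<circ> ?s'"
  have f: "bij_betw f P P"
    unfolding f_def by (rule bij_betw_trans[OF b' bij_betw_the_inv_into[OF b]])
  have sf: "?s (f a) = ?s' a" if "a \<in> P" for a
    unfolding f_def o_apply using that im by (intro f_the_inv_into_f[OF inj]) auto
  let ?\<pi> = "restrict_id f P"
  have \<pi>: "?\<pi> permutes P" using f by (intro bij_imp_permutes) (auto simp: bij_betw_def inj_on_def restrict_id_def)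
  have "v' = act d ?\<pi> v"
  proof (rule word_tuples_eqI[OF v' act_word_tuples[OF \<pi> v]])
    fix l a assume la: "l < d" "a \<in> P"
    have "f a \<in> P" using f la by (auto simp: bij_betw_def)
    then show "v' l a = act d ?\<pi> v l a"
      using fun_cong[OF sf[OF la(2)], of l] la by (simp add: act_apply restrict_id_def seq_of_tuple_def)
  qed
  then show thesis using that \<pi> by blast
qed

lemma seq_of_tuple_eq_iff:
  "a \<in> P \<Longrightarrow> b \<in> P \<Longrightarrow> seq_of_tuple d P v a = seq_of_tuple d P v b \<longleftrightarrow> (\<forall>l<d. v l a = v l b)"
  by (auto simp: seq_of_tuple_def restrict_def fun_eq_iff)

lemma alternating_nonzero_inj:
  assumes T: "inv_tensor d N P e \<Phi>" and e: "odd e" and P: "finite P" and v: "v \<in> word_tuples d N P"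
    and nz: "\<Phi> v \<noteq> 0"
  shows "inj_on (seq_of_tuple d P v) P"
proof (rule inj_onI, rule ccontr)
  fix a b assume ab: "a \<in> P" "b \<in> P" "seq_of_tuple d P v a = seq_of_tuple d P v b" "a \<noteq> b"
  then have "\<Phi> v = 0"
    by (intro inv_tensor_alternating_zero[OF T e P v, of a b]) (auto simp: seq_of_tuple_eq_iff)
  then show False using nz by simp
qed

text \<open>Transport of a word along the bijection \<open>h\<close> of positions. The constructions
  live on intervals and on rows and columns of an array, while \<open>has_alternating\<close> fixes
  the position set \<open>{..<n * k}\<close>.\<close>

definition pull :: "('q \<Rightarrow> 'p) \<Rightarrow> 'q set \<Rightarrow> 'p set \<Rightarrow> ('q \<Rightarrow> 'b) \<Rightarrow> 'p \<Rightarrow> 'b" where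
  "pull h P' P w = (\<lambda>a\<in>P. w (the_inv_into P' h a))"

lemma pull_apply: "bij_betw h P' P \<Longrightarrow> a \<in> P' \<Longrightarrow> pull h P' P w (h a) = w a"
  by (auto simp: pull_def bij_betw_def the_inv_into_f_f)

lemma bij_pull:
  assumes h: "bij_betw h P' P"
  shows "bij_betw (pull h P' P) (P' \<rightarrow>\<^sub>E B) (P \<rightarrow>\<^sub>E B)"
proof (rule bij_betwI[where g = "\<lambda>w. \<lambda>a\<in>P'. w (h a)"])
  note inv_in = bij_betw_apply[OF bij_betw_the_inv_into[OF h]]
  show "pull h P' P \<in> (P' \<rightarrow>\<^sub>E B) \<rightarrow> (P \<rightarrow>\<^sub>E B)"
    using PiE_mem inv_in by (intro Pi_I) (fastforce simp: pull_def)
  show "(\<lambda>w. \<lambda>a\<in>P'. w (h a)) \<in> (P \<rightarrow>\<^sub>E B) \<rightarrow> (P' \<rightarrow>\<^sub>E B)"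
    using PiE_mem bij_betw_apply[OF h] by (intro Pi_I) fastforce
  fix w assume w: "w \<in> P' \<rightarrow>\<^sub>E B"
  show "(\<lambda>a\<in>P'. pull h P' P w (h a)) = w"
    using PiE_arb[OF w] pull_apply[OF h] by (auto simp: fun_eq_iff)
next
  fix w assume w: "w \<in> P \<rightarrow>\<^sub>E B"
  show "pull h P' P (\<lambda>a\<in>P'. w (h a)) = w"
    using PiE_arb[OF w] bij_betw_apply[OF bij_betw_the_inv_into[OF h]] f_the_inv_into_f_bij_betw[OF h]
    by (auto simp: pull_def fun_eq_iff)
qed

lemma prod_pull:
  assumes h: "bij_betw h P' P"
  shows "(\<Prod>a\<in>P. f a (pull h P' P w a)) = (\<Prod>a\<in>P'. f (h a) (w a))"
proof -
  have "(\<Prod>a\<in>P. f a (pull h P' P w a)) = (\<Prod>a\<in>P'. f (h a) (pull h P' P w (h a)))"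
    by (rule prod.reindex_bij_betw[OF h, symmetric])
  then show ?thesis by (simp add: pull_apply[OF h])
qed

lemma sl_inv_pull:
  assumes \<phi>: "sl_inv P n \<phi>" and h: "bij_betw h P' P"
  shows "sl_inv P' n (\<lambda>w. \<phi> (pull h P' P w))"
  unfolding sl_inv_def
proof (intro ballI)
  fix g w assume g: "g \<in> SL n" and w: "w \<in> words P' n"
  have "(\<Sum>w'\<in>words P n. (\<Prod>a\<in>P. g $$ (pull h P' P w a, w' a)) * \<phi> w')
    = (\<Sum>w'\<in>words P' n. (\<Prod>a\<in>P. g $$ (pull h P' P w a, pull h P' P w' a)) * \<phi> (pull h P' P w'))"
    by (rule sum.reindex_bij_betw[OF bij_pull[OF h], symmetric])
  also have "\<dots> = (\<Sum>w'\<in>words P' n. (\<Prod>a\<in>P'. g $$ (w a, w' a)) * \<phi> (pull h P' P w'))"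
    unfolding prod_pull[OF h, of "\<lambda>a b. g $$ (pull h P' P w a, b)"] by (simp add: pull_apply[OF h])
  finally show "(\<Sum>w'\<in>words P' n. (\<Prod>a\<in>P'. g $$ (w a, w' a)) * \<phi> (pull h P' P w')) = \<phi> (pull h P' P w)"
    using sl_invD[OF \<phi> g bij_betw_apply[OF bij_pull[OF h] w]] by simp
qed

lemma pull_comp_perm:
  assumes h: "bij_betw h P' P" and \<pi>: "\<pi> permutes P'" and w: "w \<in> P' \<rightarrow>\<^sub>E B"
  shows "pull h P' P (w \<circ> \<pi>) = pull h P' P w \<circ> map_permutation P' h \<pi>"
proof
  have hinj: "inj_on h P'" and him: "h ` P' = P" using h by (auto simp: bij_betw_def)
  let ?\<pi> = "map_permutation P' h \<pi>"
  have p: "?\<pi> permutes P" by (rule map_permutation_permutes[OF h \<pi>])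
  fix a show "pull h P' P (w \<circ> \<pi>) a = (pull h P' P w \<circ> ?\<pi>) a"
  proof (cases "a \<in> P")
    case True
    then obtain b where b: "b \<in> P'" "a = h b" using him by auto
    have "?\<pi> a = h (\<pi> b)" unfolding b(2) by (rule map_permutation_apply[OF hinj b(1)])
    then show ?thesis using b permutes_in_image[OF \<pi>, of b] by (simp add: pull_apply[OF h])
  next
    case False
    then show ?thesis using permutes_not_in[OF p False] by (simp add: pull_def)
  qed
qed

lemma inv_tensor_transfer:
  assumes T: "inv_tensor d N P e \<Phi>" and h: "bij_betw h P' P" and P: "finite P"
  obtains \<Phi>' where "inv_tensor d N P' e \<Phi>'"
proof -
  have hinj: "inj_on h P'" using h by (auto simp: bij_betw_def)
  have P': "finite P'" using P h bij_betw_finite by blast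
  let ?pull = "pull h P' P"
  have pull_in: "?pull w \<in> words P n" if "w \<in> words P' n" for w n
    by (rule bij_betw_apply[OF bij_pull[OF h] that])
  define Pull where "Pull = (\<lambda>v :: nat \<Rightarrow> _ \<Rightarrow> nat. \<lambda>l\<in>{..<d}. ?pull (v l))"
  have Pull_in: "Pull v \<in> word_tuples d N P" if "v \<in> word_tuples d N P'" for v
    using pull_in[OF word_tuplesD[OF that]] unfolding Pull_def word_tuples_def
    by (intro restrict_PiE_iff[THEN iffD2] ballI) simp
  have upd: "Pull (v(l := w)) = (Pull v)(l := ?pull w)" if "l < d" for v l w
    using that by (auto simp: Pull_def fun_eq_iff)
  have "inv_tensor d N P' e (\<lambda>v. \<Phi> (Pull v))"
    unfolding inv_tensor_def
  proof (intro conjI allI impI ballI)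
    fix \<pi> v assume \<pi>: "\<pi> permutes P'" and v: "v \<in> word_tuples d N P'"
    let ?\<pi> = "map_permutation P' h \<pi>"
    have p: "?\<pi> permutes P" by (rule map_permutation_permutes[OF h \<pi>])
    have s: "sign ?\<pi> = sign \<pi>" by (rule sign_map_permutation[OF hinj \<pi> P'])
    have "Pull (act d \<pi> v) = act d ?\<pi> (Pull v)"
      unfolding Pull_def act_def using pull_comp_perm[OF h \<pi> word_tuplesD[OF v]] by (auto simp: restrict_def fun_eq_iff)
    then show "\<Phi> (Pull (act d \<pi> v)) = of_int (sign \<pi>) ^ e * \<Phi> (Pull v)"
      using inv_tensor_permD[OF T p Pull_in[OF v]] s by simp
  next
    fix l v assume l: "l < d" and v: "v \<in> word_tuples d N P'"
    show "sl_inv P' (N l) (\<lambda>w. \<Phi> (Pull (v(l := w))))"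
      unfolding upd[OF l] by (rule sl_inv_pull[OF inv_tensor_invD[OF T l Pull_in[OF v]] h])
  next
    obtain v where v: "v \<in> word_tuples d N P" "\<Phi> v \<noteq> 0" using inv_tensor_nonzeroD[OF T] by blast
    have "\<exists>w. w \<in> words P' (N l) \<and> ?pull w = v l" if "l < d" for l
      using bij_pull[OF h, of "{..<N l}"] word_tuplesD[OF v(1) that] unfolding bij_betw_def by (metis imageE)
    then obtain W where W: "\<And>l. l < d \<Longrightarrow> W l \<in> words P' (N l)" "\<And>l. l < d \<Longrightarrow> ?pull (W l) = v l" by metis
    let ?v = "restrict W {..<d}"
    have v': "?v \<in> word_tuples d N P'"
      using W(1) unfolding word_tuples_def by (intro restrict_PiE_iff[THEN iffD2] ballI) simp
    have "Pull ?v = v"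
      by (rule word_tuples_eqI[OF Pull_in[OF v'] v(1)]) (simp add: Pull_def W(2))
    then show "\<exists>v\<in>word_tuples d N P'. \<Phi> (Pull v) \<noteq> 0"
      by (intro bexI[OF _ v']) (simp only: v(2) not_False_eq_True)
  qed
  then show thesis by (rule that)
qed

section \<open>Words on disjoint unions of position sets\<close>

definition merge :: "'p set \<Rightarrow> 'p set \<Rightarrow> ('p \<Rightarrow> 'b) \<Rightarrow> ('p \<Rightarrow> 'b) \<Rightarrow> 'p \<Rightarrow> 'b" where
  "merge P1 P2 u w = (\<lambda>a\<in>P1 \<union> P2. if a \<in> P1 then u a else w a)"

lemma merge_in: "u \<in> P1 \<rightarrow>\<^sub>E B \<Longrightarrow> w \<in> P2 \<rightarrow>\<^sub>E B \<Longrightarrow> merge P1 P2 u w \<in> P1 \<union> P2 \<rightarrow>\<^sub>E B"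
  by (auto simp: merge_def)

lemma merge_restrict1:
  assumes "u \<in> P1 \<rightarrow>\<^sub>E B"
  shows "restrict (merge P1 P2 u w) P1 = u"
  using assms by (auto simp: merge_def fun_eq_iff PiE_def extensional_def)

lemma merge_restrict2:
  assumes "w \<in> P2 \<rightarrow>\<^sub>E B" "P1 \<inter> P2 = {}"
  shows "restrict (merge P1 P2 u w) P2 = w"
  using assms by (auto simp: merge_def fun_eq_iff PiE_def extensional_def)

lemma restrict_merge:
  assumes "x \<in> P1 \<union> P2 \<rightarrow>\<^sub>E B"
  shows "merge P1 P2 (restrict x P1) (restrict x P2) = x"
  using assms by (auto simp: merge_def fun_eq_iff PiE_def extensional_def)

lemma sum_PiE_Un:
  assumes "P1 \<inter> P2 = {}"
  shows "(\<Sum>x\<in>P1 \<union> P2 \<rightarrow>\<^sub>E B. f x) = (\<Sum>u\<in>P1 \<rightarrow>\<^sub>E B. \<Sum>w\<in>P2 \<rightarrow>\<^sub>E B. f (merge P1 P2 u w))"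
proof -
  have "bij_betw (\<lambda>(u, w). merge P1 P2 u w) ((P1 \<rightarrow>\<^sub>E B) \<times> (P2 \<rightarrow>\<^sub>E B)) (P1 \<union> P2 \<rightarrow>\<^sub>E B)"
  proof (rule bij_betwI[where g = "\<lambda>x. (restrict x P1, restrict x P2)"])
    show "(\<lambda>(u, w). merge P1 P2 u w) \<in> (P1 \<rightarrow>\<^sub>E B) \<times> (P2 \<rightarrow>\<^sub>E B) \<rightarrow> (P1 \<union> P2 \<rightarrow>\<^sub>E B)"
      by (rule Pi_I) (clarsimp simp del: PiE_iff, rule merge_in)
    show "(\<lambda>x. (restrict x P1, restrict x P2)) \<in> (P1 \<union> P2 \<rightarrow>\<^sub>E B) \<rightarrow> (P1 \<rightarrow>\<^sub>E B) \<times> (P2 \<rightarrow>\<^sub>E B)"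
      by auto
    fix p assume "p \<in> (P1 \<rightarrow>\<^sub>E B) \<times> (P2 \<rightarrow>\<^sub>E B)"
    then obtain u w where p: "p = (u, w)" "u \<in> P1 \<rightarrow>\<^sub>E B" "w \<in> P2 \<rightarrow>\<^sub>E B" by auto
    show "(restrict (case p of (u, w) \<Rightarrow> merge P1 P2 u w) P1, restrict (case p of (u, w) \<Rightarrow> merge P1 P2 u w) P2) = p"
      using merge_restrict1[OF p(2)] merge_restrict2[OF p(3) assms] p(1) by simp
  next
    fix x assume "x \<in> P1 \<union> P2 \<rightarrow>\<^sub>E B"
    then show "(case (restrict x P1, restrict x P2) of (u, w) \<Rightarrow> merge P1 P2 u w) = x"
      by (simp add: restrict_merge)
  qed
  from sum.reindex_bij_betw[OF this, of f] show ?thesis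
    by (simp add: sum.cartesian_product case_prod_unfold)
qed

lemma prod_merge:
  assumes "P1 \<inter> P2 = {}" "finite P1" "finite P2"
  shows "(\<Prod>a\<in>P1 \<union> P2. f a (merge P1 P2 u w a)) = (\<Prod>a\<in>P1. f a (u a)) * (\<Prod>a\<in>P2. f a (w a))"
proof -
  have "(\<Prod>a\<in>P1 \<union> P2. f a (merge P1 P2 u w a)) = (\<Prod>a\<in>P1. f a (merge P1 P2 u w a)) * (\<Prod>a\<in>P2. f a (merge P1 P2 u w a))"
    using assms by (intro prod.union_disjoint)
  also have "(\<Prod>a\<in>P1. f a (merge P1 P2 u w a)) = (\<Prod>a\<in>P1. f a (u a))"
    by (intro prod.cong) (auto simp: merge_def)
  also have "(\<Prod>a\<in>P2. f a (merge P1 P2 u w a)) = (\<Prod>a\<in>P2. f a (w a))"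
    using assms(1) by (intro prod.cong) (auto simp: merge_def)
  finally show ?thesis .
qed

lemma sl_inv_Un:
  assumes 1: "sl_inv P1 n \<phi>1" and 2: "sl_inv P2 n \<phi>2" and P: "P1 \<inter> P2 = {}" "finite P1" "finite P2"
  shows "sl_inv (P1 \<union> P2) n (\<lambda>w. \<phi>1 (restrict w P1) * \<phi>2 (restrict w P2))"
  unfolding sl_inv_def
proof (intro ballI)
  fix g x assume g: "g \<in> SL n" and x: "x \<in> words (P1 \<union> P2) n"
  have x1: "restrict x P1 \<in> words P1 n" and x2: "restrict x P2 \<in> words P2 n"
    using words_lt[OF x] by auto
  have "(\<Sum>y\<in>words (P1 \<union> P2) n. (\<Prod>a\<in>P1 \<union> P2. g $$ (x a, y a)) * (\<phi>1 (restrict y P1) * \<phi>2 (restrict y P2)))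
    = (\<Sum>u\<in>words P1 n. \<Sum>w\<in>words P2 n. ((\<Prod>a\<in>P1. g $$ (restrict x P1 a, u a)) * \<phi>1 u) * ((\<Prod>a\<in>P2. g $$ (restrict x P2 a, w a)) * \<phi>2 w))"
    unfolding sum_PiE_Un[OF P(1)]
  proof (intro sum.cong refl)
    fix u w assume uw: "u \<in> words P1 n" "w \<in> words P2 n"
    have "(\<Prod>a\<in>P1 \<union> P2. g $$ (x a, merge P1 P2 u w a))
      = (\<Prod>a\<in>P1. g $$ (restrict x P1 a, u a)) * (\<Prod>a\<in>P2. g $$ (restrict x P2 a, w a))"
      using prod_merge[OF P, of "\<lambda>a b. g $$ (x a, b)" u w] by simp
    then show "(\<Prod>a\<in>P1 \<union> P2. g $$ (x a, merge P1 P2 u w a)) *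
        (\<phi>1 (restrict (merge P1 P2 u w) P1) * \<phi>2 (restrict (merge P1 P2 u w) P2))
      = ((\<Prod>a\<in>P1. g $$ (restrict x P1 a, u a)) * \<phi>1 u) * ((\<Prod>a\<in>P2. g $$ (restrict x P2 a, w a)) * \<phi>2 w)"
      unfolding merge_restrict1[OF uw(1)] merge_restrict2[OF uw(2) P(1)] by simp
  qed
  also have "\<dots> = (\<Sum>u\<in>words P1 n. (\<Prod>a\<in>P1. g $$ (restrict x P1 a, u a)) * \<phi>1 u)
      * (\<Sum>w\<in>words P2 n. (\<Prod>a\<in>P2. g $$ (restrict x P2 a, w a)) * \<phi>2 w)"
    by (simp add: sum_product)
  also have "\<dots> = \<phi>1 (restrict x P1) * \<phi>2 (restrict x P2)"
    using sl_invD[OF 1 g x1] sl_invD[OF 2 g x2] by simp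
  finally show "(\<Sum>y\<in>words (P1 \<union> P2) n. (\<Prod>a\<in>P1 \<union> P2. g $$ (x a, y a)) * (\<phi>1 (restrict y P1) * \<phi>2 (restrict y P2)))
    = \<phi>1 (restrict x P1) * \<phi>2 (restrict x P2)" .
qed

lemma sl_inv_prod_blocks:
  assumes "finite J" "\<And>j. j \<in> J \<Longrightarrow> sl_inv (B j) n (\<phi> j)" "\<And>j. j \<in> J \<Longrightarrow> finite (B j)"
    and "\<And>i j. i \<in> J \<Longrightarrow> j \<in> J \<Longrightarrow> i \<noteq> j \<Longrightarrow> B i \<inter> B j = {}"
  shows "sl_inv (\<Union>j\<in>J. B j) n (\<lambda>w. \<Prod>j\<in>J. \<phi> j (restrict w (B j)))"
  using assms
proof (induction J rule: finite_induct)
  case empty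
  then show ?case by (simp add: sl_inv_def)
next
  case (insert i J)
  let ?U = "\<Union>j\<in>J. B j"
  have IH: "sl_inv ?U n (\<lambda>w. \<Prod>j\<in>J. \<phi> j (restrict w (B j)))"
    by (rule insert.IH) (use insert.prems in blast)+
  have disj: "B i \<inter> ?U = {}"
  proof -
    have "B i \<inter> B j = {}" if "j \<in> J" for j using that insert.prems(3)[of i j] insert.hyps by auto
    then show ?thesis by blast
  qed
  have "sl_inv (B i \<union> ?U) n (\<lambda>w. \<phi> i (restrict w (B i)) * (\<Prod>j\<in>J. \<phi> j (restrict (restrict w ?U) (B j))))"
    by (intro sl_inv_Un[OF insert.prems(1) IH disj]) (use insert in auto)
  moreover have "(\<Prod>j\<in>J. \<phi> j (restrict (restrict w ?U) (B j))) = (\<Prod>j\<in>J. \<phi> j (restrict w (B j)))" for w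
  proof (rule prod.cong[OF refl])
    fix j assume "j \<in> J"
    then have "restrict (restrict w ?U) (B j) = restrict w (B j)" by (auto simp: restrict_def fun_eq_iff)
    then show "\<phi> j (restrict (restrict w ?U) (B j)) = \<phi> j (restrict w (B j))" by (rule arg_cong)
  qed
  ultimately show ?case by (simp only: UN_insert prod.insert[OF insert.hyps])
qed

lemma sl_inv_comp_perm:
  assumes \<phi>: "sl_inv P n \<phi>" and \<pi>: "\<pi> permutes P"
  shows "sl_inv P n (\<lambda>w. \<phi> (w \<circ> \<pi>))"
  unfolding sl_inv_def
proof (intro ballI)
  fix g w assume g: "g \<in> SL n" and w: "w \<in> words P n"
  have "(\<Sum>w'\<in>words P n. (\<Prod>a\<in>P. g $$ (w a, w' a)) * \<phi> (w' \<circ> \<pi>))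
    = (\<Sum>w'\<in>words P n. (\<Prod>a\<in>P. g $$ ((w \<circ> \<pi>) a, (w' \<circ> \<pi>) a)) * \<phi> (w' \<circ> \<pi>))"
    using prod_comp_permutes[OF \<pi>, of "\<lambda>a. g $$ (w a, _ a)"] by simp
  also have "\<dots> = (\<Sum>w'\<in>words P n. (\<Prod>a\<in>P. g $$ ((w \<circ> \<pi>) a, w' a)) * \<phi> w')"
    by (rule sum_PiE_permutes[OF \<pi>])
  also have "\<dots> = \<phi> (w \<circ> \<pi>)" by (rule sl_invD[OF \<phi> g comp_permutes_PiE[OF \<pi> w]])
  finally show "(\<Sum>w'\<in>words P n. (\<Prod>a\<in>P. g $$ (w a, w' a)) * \<phi> (w' \<circ> \<pi>)) = \<phi> (w \<circ> \<pi>)" .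
qed

definition antisymmetrize :: "nat \<Rightarrow> 'p set \<Rightarrow> ((nat \<Rightarrow> 'p \<Rightarrow> nat) \<Rightarrow> complex) \<Rightarrow> (nat \<Rightarrow> 'p \<Rightarrow> nat) \<Rightarrow> complex" where
  "antisymmetrize d P \<Phi> v = (\<Sum>\<pi> | \<pi> permutes P. of_int (sign \<pi>) * \<Phi> (act d \<pi> v))"

text \<open>Antisymmetrisation may annihilate a tensor, so a point \<open>v0\<close> where it
  survives is part of the data.\<close>

lemma inv_tensor_antisymmetrize:
  assumes P: "finite P"
    and inv: "\<And>l v. l < d \<Longrightarrow> v \<in> word_tuples d N P \<Longrightarrow> sl_inv P (N l) (\<lambda>w. \<Phi> (v(l := w)))"
    and nz: "v0 \<in> word_tuples d N P" "antisymmetrize d P \<Phi> v0 \<noteq> 0"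
  shows "inv_tensor d N P 1 (antisymmetrize d P \<Phi>)"
  unfolding inv_tensor_def
proof (intro conjI allI impI ballI)
  fix \<sigma> v assume \<sigma>: "\<sigma> permutes P" and v: "v \<in> word_tuples d N P"
  have "antisymmetrize d P \<Phi> (act d \<sigma> v) = (\<Sum>\<pi> | \<pi> permutes P. of_int (sign \<sigma>) * (of_int (sign (\<sigma> \<circ> \<pi>)) * \<Phi> (act d (\<sigma> \<circ> \<pi>) v)))"
    unfolding antisymmetrize_def act_act
    by (intro sum.cong refl) (simp add: sign_permutes_compose[OF \<sigma> _ P] mult.assoc[symmetric] sign_mult_self flip: of_int_mult)
  also have "\<dots> = of_int (sign \<sigma>) * antisymmetrize d P \<Phi> v"
    unfolding antisymmetrize_def sum_distrib_left[symmetric]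
    by (subst sum_permutations_left[OF \<sigma>, of "\<lambda>\<pi>. of_int (sign \<pi>) * \<Phi> (act d \<pi> v)"]) simp
  finally show "antisymmetrize d P \<Phi> (act d \<sigma> v) = of_int (sign \<sigma>) ^ 1 * antisymmetrize d P \<Phi> v" by simp
next
  fix l v assume l: "l < d" and v: "v \<in> word_tuples d N P"
  show "sl_inv P (N l) (\<lambda>w. antisymmetrize d P \<Phi> (v(l := w)))"
    unfolding antisymmetrize_def act_upd[OF l, symmetric]
    using sl_inv_comp_perm inv[OF l act_word_tuples[OF _ v]]
    by (intro sl_inv_sum) fastforce
qed (use nz in blast)

subsection \<open>Alternating tensors\<close>

lemma card_idx: "card (idx d n) = n ^ d"
  by (simp add: idx_def card_PiE)

text \<open>The factors have dimension \<open>k\<close> and there are \<open>n * k\<close>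
  positions: for odd \<open>d\<close> and \<open>k > 0\<close>, contracting all directions turns
  such a tensor into an invariant of degree \<open>n * k\<close> on
  \<open>(\<complex>^n)^{\<otimes> d}\<close>.\<close>

definition has_alternating :: "nat \<Rightarrow> nat \<Rightarrow> nat \<Rightarrow> bool" where
  "has_alternating d k n \<longleftrightarrow> (\<exists>\<Phi>. inv_tensor d (\<lambda>_. k) {..<n * k} 1 \<Phi>)"

lemma recode_perm:
  fixes c c' :: "'a \<Rightarrow> nat"
  assumes c: "bij_betw c I {..<m}" and c': "bij_betw c' I {..<m}"
  obtains \<rho> where "\<rho> permutes {..<m}" "\<And>i. i \<in> I \<Longrightarrow> c i = \<rho> (c' i)"
proof -
  have b: "bij_betw (c \<circ> the_inv_into I c') {..<m} {..<m}"
    by (rule bij_betw_trans[OF bij_betw_the_inv_into[OF c'] c])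
  obtain \<rho> where \<rho>: "\<rho> permutes {..<m}" "\<And>a. a < m \<Longrightarrow> (c \<circ> the_inv_into I c') a = \<rho> a"
    using bij_betw_lessThan_permutes[OF b] by blast
  have "c i = \<rho> (c' i)" if "i \<in> I" for i
  proof -
    have "c' i < m" using c' that by (auto simp: bij_betw_def)
    moreover have "the_inv_into I c' (c' i) = i" using c' that by (simp add: bij_betw_def the_inv_into_f_f)
    ultimately show ?thesis using \<rho>(2)[of "c' i"] by simp
  qed
  then show thesis using that \<rho>(1) by blast
qed

text \<open>\<open>E\<close> is the determinant form of the space
  \<open>(\<complex>^k)^{\<otimes> d}\<close> of dimension \<open>k ^ d\<close>, written in an
  arbitrary coding \<open>c\<close> of its basis.\<close>

lemma volume_inv_tensor:
  assumes d: "d > 0"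
  shows "\<exists>E. inv_tensor d (\<lambda>_. k) {..<k ^ d} 1 E"
proof -
  let ?m = "k ^ d"
  let ?P = "{..<?m}" and ?I = "idx d k"
  obtain c where c: "bij_betw c ?I ?P"
    using ex_bij_betw_finite_nat[OF finite_idx[of d k]] by (auto simp: card_idx atLeast0LessThan)
  define E where "E = (\<lambda>v. complex_of_int (perm_sign ?m (\<lambda>a. c (seq_of_tuple d ?P v a))))"
  have m: "?m = k ^ (d - 1) * k" using d by (metis Suc_diff_1 power_Suc2)
  have "inv_tensor d (\<lambda>_. k) ?P 1 E"
    unfolding inv_tensor_def
  proof (intro conjI allI impI ballI)
    fix \<pi> v assume \<pi>: "\<pi> permutes ?P" and v: "v \<in> word_tuples d (\<lambda>_. k) ?P"
    have "perm_sign ?m (\<lambda>a. c (seq_of_tuple d ?P (act d \<pi> v) a)) = perm_sign ?m ((\<lambda>a. c (seq_of_tuple d ?P v a)) \<circ> \<pi>)"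
    proof (rule perm_sign_cong)
      fix a assume a: "a < ?m"
      then have "\<pi> a < ?m" using permutes_in_image[OF \<pi>, of a] by simp
      then have "seq_of_tuple d ?P (act d \<pi> v) a = seq_of_tuple d ?P v (\<pi> a)"
        using a by (auto simp: seq_of_tuple_def act_def fun_eq_iff)
      then show "c (seq_of_tuple d ?P (act d \<pi> v) a) = ((\<lambda>a. c (seq_of_tuple d ?P v a)) \<circ> \<pi>) a" by simp
    qed
    then show "E (act d \<pi> v) = of_int (sign \<pi>) ^ 1 * E v"
      by (simp add: E_def perm_sign_comp_right[OF \<pi>])
  next
    fix l v assume l: "l < d" and v: "v \<in> word_tuples d (\<lambda>_. k) ?P"
    let ?R = "({..<d} - {l}) \<rightarrow>\<^sub>E {..<k}"
    have finR: "finite ?R" by (intro finite_PiE) auto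
    have "card ?R = k ^ (d - 1)" using l by (simp add: card_PiE)
    then obtain h where h: "bij_betw h ?R {..<k ^ (d - 1)}"
      using ex_bij_betw_finite_nat[OF finR] by (auto simp: atLeast0LessThan)
    define r where "r = (\<lambda>i :: nat \<Rightarrow> nat. restrict i ({..<d} - {l}))"
    \<comment> \<open>A second coding with the \<open>l\<close>-th index as lowest digit. It differs
      from \<open>c\<close> by a permutation of the codes and shows that, as a function of the word
      in direction \<open>l\<close>, the volume form is a determinant form \<open>Y\<close> up to
      sign.\<close>
    define c' where "c' = (\<lambda>i. h (r i) * k + i l)"
    have rR: "r i \<in> ?R" if "i \<in> ?I" for i using that by (auto simp: r_def idx_def)
    have c'_in: "c' i \<in> ?P" if i: "i \<in> ?I" for i
    proof -
      have "h (r i) \<in> {..<k ^ (d - 1)}" using h rR[OF i] by (auto simp: bij_betw_def)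
      then have "(h (r i), i l) \<in> {..<k ^ (d - 1)} \<times> {..<k}" using idx_lt[OF i l] by auto
      from bij_betw_apply[OF bij_code this] show ?thesis by (simp add: c'_def m)
    qed
    have c'_inj: "inj_on c' ?I"
    proof (rule inj_onI)
      fix i j assume i: "i \<in> ?I" and j: "j \<in> ?I" and eq: "c' i = c' j"
      have lt: "i l < k" "j l < k" using idx_lt i j l by auto
      have "h (r i) = h (r j)" using arg_cong[OF eq, of "\<lambda>x. x div k"] lt by (simp add: c'_def)
      then have rij: "r i = r j" using h rR[OF i] rR[OF j] by (auto simp: bij_betw_def inj_on_def)
      have "i l = j l" using arg_cong[OF eq, of "\<lambda>x. x mod k"] lt by (simp add: c'_def)
      then have "i x = j x" if "x < d" for x
        using that fun_cong[OF rij, of x] by (cases "x = l") (simp_all only: r_def restrict_apply Diff_iff lessThan_iff singleton_iff simp_thms if_True if_False)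
      then show "i = j" using idx_undef[OF i] idx_undef[OF j] by (metis ext)
    qed
    have c': "bij_betw c' ?I ?P"
      unfolding bij_betw_def
    proof (intro conjI c'_inj card_subset_eq)
      show "c' ` ?I \<subseteq> ?P" using c'_in by blast
    qed (simp_all add: card_image[OF c'_inj] card_idx)
    obtain \<rho> where \<rho>: "\<rho> permutes ?P" "\<And>i. i \<in> ?I \<Longrightarrow> c i = \<rho> (c' i)" using recode_perm[OF c c'] by blast
    define u where "u = (\<lambda>a\<in>?P. h (r (seq_of_tuple d ?P v a)))"
    have sq: "seq_of_tuple d ?P v a \<in> ?I" if "a \<in> ?P" for a
      using seq_of_tuple_in[OF v] that by (rule PiE_mem)
    have u: "u \<in> words {..<k ^ (d - 1) * k} (k ^ (d - 1))"
      unfolding m[symmetric] u_def using bij_betw_apply[OF h rR[OF sq]] by auto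
    have "E (v(l := w)) = of_int (sign \<rho>) * Y (k ^ (d - 1)) k u w" if w: "w \<in> words ?P k" for w
    proof -
      have v': "v(l := w) \<in> word_tuples d (\<lambda>_. k) ?P" by (rule word_tuples_upd'[OF v l w])
      have "c (seq_of_tuple d ?P (v(l := w)) a) = (\<rho> \<circ> (\<lambda>a. u a * k + w a)) a" if a: "a < ?m" for a
      proof -
        have "seq_of_tuple d ?P (v(l := w)) a \<in> ?I" using PiE_mem[OF seq_of_tuple_in[OF v']] a by simp
        moreover have "r (seq_of_tuple d ?P (v(l := w)) a) = r (seq_of_tuple d ?P v a)"
          using a by (auto simp: r_def seq_of_tuple_def restrict_def fun_eq_iff)
        moreover have "seq_of_tuple d ?P (v(l := w)) a l = w a" using a l by (simp add: seq_of_tuple_def)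
        ultimately show ?thesis using \<rho>(2) a by (simp add: c'_def u_def)
      qed
      then have "perm_sign ?m (\<lambda>a. c (seq_of_tuple d ?P (v(l := w)) a)) = sign \<rho> * perm_sign ?m (\<lambda>a. u a * k + w a)"
        unfolding perm_sign_comp_left[OF \<rho>(1), symmetric] by (rule perm_sign_cong)
      then show ?thesis unfolding E_def Y_def m[symmetric] by simp
    qed
    then show "sl_inv ?P k (\<lambda>w. E (v(l := w)))"
      using sl_inv_cmult[OF sl_inv_Y_right[OF u], of "of_int (sign \<rho>)"]
      by (subst sl_inv_cong) (auto simp: m)
  next
    define t where "t = (\<lambda>a\<in>?P. the_inv_into ?I c a)"
    have t: "t \<in> ?P \<rightarrow>\<^sub>E ?I"
      unfolding t_def using bij_betw_apply[OF bij_betw_the_inv_into[OF c]] by auto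
    have "perm_sign ?m (\<lambda>a. c (seq_of_tuple d ?P (tuple_of_seq d ?P t) a)) = sign (id :: nat \<Rightarrow> nat)"
      unfolding seq_tuple[OF t]
      by (rule perm_sign_eq_sign[OF permutes_id]) (simp add: t_def f_the_inv_into_f_bij_betw[OF c])
    then show "\<exists>v\<in>word_tuples d (\<lambda>_. k) ?P. E v \<noteq> 0"
      by (intro bexI[OF _ tuple_of_seq_in[OF t]]) (simp add: E_def sign_id)
  qed
  then show ?thesis by blast
qed

text \<open>With \<open>k ^ d\<close> positions an injective tuple lists all of
  \<open>[k]^d\<close>. Any two such tuples differ by a permutation, so one nonzero value makes all
  of them nonzero.\<close>

lemma alternating_full_nonzero:
  assumes E: "inv_tensor d (\<lambda>_. k) P 1 E" and P: "finite P" "card P = k ^ d"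
    and v: "v \<in> word_tuples d (\<lambda>_. k) P" and inj: "inj_on (seq_of_tuple d P v) P"
  shows "E v \<noteq> 0"
proof -
  obtain v0 where v0: "v0 \<in> word_tuples d (\<lambda>_. k) P" "E v0 \<noteq> 0" using inv_tensor_nonzeroD[OF E] by blast
  have inj0: "inj_on (seq_of_tuple d P v0) P"
    by (rule alternating_nonzero_inj[OF E _ P(1) v0]) simp
  have full: "seq_of_tuple d P u ` P = idx d k"
    if u: "u \<in> word_tuples d (\<lambda>_. k) P" "inj_on (seq_of_tuple d P u) P" for u
    using PiE_mem[OF seq_of_tuple_in[OF u(1)]]
    by (intro card_subset_eq finite_idx) (auto simp: card_image[OF u(2)] card_idx P)
  have "seq_of_tuple d P v ` P = seq_of_tuple d P v0 ` P" using full[OF v inj] full[OF v0(1) inj0] by simp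
  then obtain \<pi> where \<pi>: "\<pi> permutes P" "v = act d \<pi> v0"
    using same_points_act[OF P(1) v0(1) v inj0] by blast
  then show ?thesis using inv_tensor_permD[OF E \<pi>(1) v0(1)] v0(2) by (simp add: sign_def)
qed

text \<open>The Hodge star: contracting the volume form with an alternating tensor on
  \<open>P1\<close> leaves an alternating tensor on the complementary positions.\<close>

lemma inv_tensor_contract:
  assumes E: "inv_tensor d (\<lambda>_. k) (P1 \<union> P2) 1 E" and \<Phi>: "inv_tensor d (\<lambda>_. k) P1 1 \<Phi>"
    and P: "finite P1" "finite P2" "P1 \<inter> P2 = {}" and card: "card (P1 \<union> P2) = k ^ d"
  shows "\<exists>\<Psi>. inv_tensor d (\<lambda>_. k) P2 1 \<Psi>"
proof -
  let ?V = "\<lambda>P. word_tuples d (\<lambda>_. k) P"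
  define M where "M = (\<lambda>(v1 :: nat \<Rightarrow> _ \<Rightarrow> nat) v2. \<lambda>l\<in>{..<d}. merge P1 P2 (v1 l) (v2 l))"
  define \<Psi> where "\<Psi> = (\<lambda>v2. \<Sum>v1\<in>?V P1. \<Phi> v1 * E (M v1 v2))"
  have M_in: "M v1 v2 \<in> ?V (P1 \<union> P2)" if "v1 \<in> ?V P1" "v2 \<in> ?V P2" for v1 v2
    using merge_in[OF word_tuplesD[OF that(1)] word_tuplesD[OF that(2)]]
    unfolding M_def word_tuples_def by (intro restrict_PiE_iff[THEN iffD2] ballI) simp
  have fin: "finite (P1 \<union> P2)" using P by simp
  have actM2: "M v1 (act d \<pi> v2) = act d \<pi> (M v1 v2)" if \<pi>: "\<pi> permutes P2" for \<pi> v1 v2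
  proof (intro ext)
    fix l a show "M v1 (act d \<pi> v2) l a = act d \<pi> (M v1 v2) l a"
      using permutes_in_image[OF \<pi>, of a] permutes_not_in[OF \<pi>, of a] P(3)
      by (cases "l < d"; cases "a \<in> P2") (auto simp: M_def act_def merge_def)
  qed
  have actM1: "M (act d \<pi> v1) v2 = act d \<pi> (M v1 v2)" if \<pi>: "\<pi> permutes P1" for \<pi> v1 v2
  proof (intro ext)
    fix l a show "M (act d \<pi> v1) v2 l a = act d \<pi> (M v1 v2) l a"
      using permutes_in_image[OF \<pi>, of a] permutes_not_in[OF \<pi>, of a] P(3)
      by (cases "l < d"; cases "a \<in> P1") (auto simp: M_def act_def merge_def)
  qed
  have seqM1: "seq_of_tuple d (P1 \<union> P2) (M v1 v2) a = seq_of_tuple d P1 v1 a" if "a \<in> P1" for v1 v2 a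
    using that by (auto simp: seq_of_tuple_def M_def merge_def fun_eq_iff)
  have seqM2: "seq_of_tuple d (P1 \<union> P2) (M v1 v2) a = seq_of_tuple d P2 v2 a" if "a \<in> P2" for v1 v2 a
    using that P(3) by (auto simp: seq_of_tuple_def M_def merge_def fun_eq_iff)
  have "inv_tensor d (\<lambda>_. k) P2 1 \<Psi>"
    unfolding inv_tensor_def
  proof (intro conjI allI impI ballI)
    fix \<pi> v2 assume \<pi>: "\<pi> permutes P2" and v2: "v2 \<in> ?V P2"
    have "\<pi> permutes P1 \<union> P2" by (rule permutes_subset[OF \<pi>]) auto
    then show "\<Psi> (act d \<pi> v2) = of_int (sign \<pi>) ^ 1 * \<Psi> v2"
      unfolding \<Psi>_def actM2[OF \<pi>] sum_distrib_left
      using inv_tensor_permD[OF E _ M_in[OF _ v2]] by (intro sum.cong) auto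
  next
    fix l v2 assume l: "l < d" and v2: "v2 \<in> ?V P2"
    show "sl_inv P2 k (\<lambda>w. \<Psi> (v2(l := w)))"
      unfolding sl_inv_def
    proof (intro ballI)
      fix g w0 assume g: "g \<in> SL k" and w0: "w0 \<in> words P2 k"
      define F where "F = (\<lambda>v1 u w. E (M (v1(l := u)) (v2(l := w))))"
      have F: "F v1 u w = E ((M v1 v2)(l := merge P1 P2 u w))" for v1 u w
        unfolding F_def M_def using l by (intro arg_cong[of _ _ E]) (auto simp: fun_eq_iff)
      \<comment> \<open>Invariance of the volume form moves \<open>g\<close> on both position sets
        at once. The part on \<open>P1\<close> is supplied afterwards by the invariance of
        \<open>\<Phi>\<close> under \<open>transpose_mat g\<close>.\<close>
      have key: "(\<Sum>u\<in>words P1 k. (\<Prod>b\<in>P1. g $$ (u0 b, u b)) * (\<Sum>w\<in>words P2 k. (\<Prod>a\<in>P2. g $$ (w0 a, w a)) * F v1 u w))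
          = F v1 u0 w0" if v1: "v1 \<in> ?V P1" and u0: "u0 \<in> words P1 k" for v1 u0
      proof -
        have "F v1 u0 w0 = (\<Sum>x\<in>words (P1 \<union> P2) k. (\<Prod>a\<in>P1 \<union> P2. g $$ (merge P1 P2 u0 w0 a, x a)) * E ((M v1 v2)(l := x)))"
          unfolding F
          by (rule sl_invD[OF inv_tensor_invD[OF E l M_in[OF v1 v2]] g merge_in[OF u0 w0], symmetric])
        also have "\<dots> = (\<Sum>u\<in>words P1 k. \<Sum>w\<in>words P2 k.
            (\<Prod>a\<in>P1 \<union> P2. g $$ (merge P1 P2 u0 w0 a, merge P1 P2 u w a)) * F v1 u w)"
          unfolding sum_PiE_Un[OF P(3)] F ..
        also have "\<dots> = (\<Sum>u\<in>words P1 k. (\<Prod>b\<in>P1. g $$ (u0 b, u b)) * (\<Sum>w\<in>words P2 k. (\<Prod>a\<in>P2. g $$ (w0 a, w a)) * F v1 u w))"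
        proof -
          have "(\<Prod>a\<in>P1 \<union> P2. g $$ (merge P1 P2 u0 w0 a, merge P1 P2 u w a))
            = (\<Prod>b\<in>P1. g $$ (u0 b, u b)) * (\<Prod>a\<in>P2. g $$ (w0 a, w a))" for u w
            unfolding prod_merge[OF P(3,1,2), of "\<lambda>a b. g $$ (merge P1 P2 u0 w0 a, b)"]
            using P(3) by (intro arg_cong2[of _ _ _ _ times] prod.cong) (auto simp: merge_def)
          then show ?thesis by (simp add: sum_distrib_left mult.assoc)
        qed
        finally show ?thesis by simp
      qed
      define B where "B = (\<lambda>v1 u. \<Sum>w\<in>words P2 k. (\<Prod>a\<in>P2. g $$ (w0 a, w a)) * F v1 u w)"
      have Bupd: "B (v1(l := x)) u = B v1 u" for v1 x u by (simp add: B_def F_def)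
      have MF: "E (M v1 (v2(l := w))) = F v1 (v1 l) w" for v1 w by (simp add: F_def)
      have "(\<Sum>w\<in>words P2 k. (\<Prod>a\<in>P2. g $$ (w0 a, w a)) * \<Psi> (v2(l := w)))
        = (\<Sum>v1\<in>?V P1. \<Phi> v1 * B v1 (v1 l))"
        unfolding \<Psi>_def MF B_def sum_distrib_left by (subst sum.swap) (simp add: ac_simps)
      also have "\<dots> = (\<Sum>v1\<in>?V P1. \<Sum>u\<in>words P1 k. (\<Prod>b\<in>P1. g $$ (u b, v1 l b)) * \<Phi> (v1(l := u)) * B v1 (v1 l))"
      proof (rule sum.cong[OF refl])
        fix v1 assume v1: "v1 \<in> ?V P1"
        have "(\<Sum>u\<in>words P1 k. (\<Prod>b\<in>P1. transpose_mat g $$ (v1 l b, u b)) * \<Phi> (v1(l := u))) = \<Phi> (v1(l := v1 l))"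
          by (rule sl_invD[OF inv_tensor_invD[OF \<Phi> l v1] transpose_SL[OF g] word_tuplesD[OF v1 l]])
        moreover have "(\<Prod>b\<in>P1. transpose_mat g $$ (v1 l b, u b)) = (\<Prod>b\<in>P1. g $$ (u b, v1 l b))"
          if u: "u \<in> words P1 k" for u
          using words_lt[OF u] word_tuples_lt[OF v1 l] g by (intro prod.cong refl) (auto simp: SL_def)
        ultimately show "\<Phi> v1 * B v1 (v1 l) = (\<Sum>u\<in>words P1 k. (\<Prod>b\<in>P1. g $$ (u b, v1 l b)) * \<Phi> (v1(l := u)) * B v1 (v1 l))"
          unfolding sum_distrib_right[symmetric] by simp
      qed
      also have "\<dots> = (\<Sum>(v1, u)\<in>?V P1 \<times> words P1 k. (\<Prod>b\<in>P1. g $$ (u b, v1 l b)) * \<Phi> (v1(l := u)) * B v1 (v1 l))"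
        by (simp add: sum.cartesian_product)
      also have "\<dots> = (\<Sum>(v1, u)\<in>?V P1 \<times> words P1 k. (\<Prod>b\<in>P1. g $$ (v1 l b, u b)) * \<Phi> v1 * B v1 u)"
      proof -
        let ?j = "\<lambda>(v1, u). (v1(l := u), v1 l)"
        have inA: "?j p \<in> ?V P1 \<times> words P1 k" if p: "p \<in> ?V P1 \<times> words P1 k" for p
          using p word_tuples_upd'[OF _ l] word_tuplesD[OF _ l] by fastforce
        show ?thesis
        proof (rule sum.reindex_bij_witness[of _ ?j ?j])
          fix p assume p: "p \<in> ?V P1 \<times> words P1 k"
          obtain v1 u where vu: "p = (v1, u)" using p by auto
          show "(case ?j p of (v1, u) \<Rightarrow> (\<Prod>b\<in>P1. g $$ (v1 l b, u b)) * \<Phi> v1 * B v1 u)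
            = (case p of (v1, u) \<Rightarrow> (\<Prod>b\<in>P1. g $$ (u b, v1 l b)) * \<Phi> (v1(l := u)) * B v1 (v1 l))"
            by (simp add: vu Bupd)
        qed (use inA in auto)
      qed
      also have "\<dots> = (\<Sum>v1\<in>?V P1. \<Phi> v1 * (\<Sum>u\<in>words P1 k. (\<Prod>b\<in>P1. g $$ (v1 l b, u b)) * B v1 u))"
        by (simp add: sum_distrib_left sum.cartesian_product ac_simps)
      also have "\<dots> = (\<Sum>v1\<in>?V P1. \<Phi> v1 * F v1 (v1 l) w0)"
      proof (intro sum.cong refl arg_cong2[of _ _ _ _ times])
        fix v1 assume v1: "v1 \<in> ?V P1"
        show "(\<Sum>u\<in>words P1 k. (\<Prod>b\<in>P1. g $$ (v1 l b, u b)) * B v1 u) = F v1 (v1 l) w0"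
          unfolding B_def by (rule key[OF v1 word_tuplesD[OF v1 l]])
      qed
      also have "\<dots> = \<Psi> (v2(l := w0))" by (simp add: \<Psi>_def MF)
      finally show "(\<Sum>w\<in>words P2 k. (\<Prod>a\<in>P2. g $$ (w0 a, w a)) * \<Psi> (v2(l := w))) = \<Psi> (v2(l := w0))" .
    qed
  next
    obtain v1 where v1: "v1 \<in> ?V P1" "\<Phi> v1 \<noteq> 0" using inv_tensor_nonzeroD[OF \<Phi>] by blast
    let ?s1 = "seq_of_tuple d P1 v1"
    have inj1: "inj_on ?s1 P1" by (rule alternating_nonzero_inj[OF \<Phi> _ P(1) v1]) simp
    \<comment> \<open>The witness \<open>v2\<close> lists the points missed by a tuple
      \<open>v1\<close> at which \<open>\<Phi>\<close> is nonzero.\<close>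
    let ?C = "idx d k - ?s1 ` P1"
    have sub: "?s1 ` P1 \<subseteq> idx d k" using PiE_mem[OF seq_of_tuple_in[OF v1(1)]] by blast
    have "card ?C = k ^ d - card P1"
      using card_Diff_subset[OF _ sub] P(1) by (simp add: card_idx card_image[OF inj1])
    also have "\<dots> = card P2" using card P by (simp add: card_Un_disjoint)
    finally obtain b where b: "bij_betw b P2 ?C"
      using finite_same_card_bij[OF P(2), of ?C] finite_idx by (metis finite_Diff)
    define t where "t = restrict b P2"
    have t: "t \<in> P2 \<rightarrow>\<^sub>E idx d k" using bij_betw_apply[OF b] by (auto simp: t_def)
    define v2 where "v2 = tuple_of_seq d P2 t"
    have v2: "v2 \<in> ?V P2" unfolding v2_def by (rule tuple_of_seq_in[OF t])
    have s2: "seq_of_tuple d P2 v2 a = b a" if "a \<in> P2" for a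
      unfolding v2_def seq_tuple[OF t] using that by (simp add: t_def)
    let ?c = "\<Phi> v1 * E (M v1 v2)"
    have "inj_on (seq_of_tuple d (P1 \<union> P2) (M v1 v2)) (P1 \<union> P2)"
    proof (rule inj_on_Un[THEN iffD2], intro conjI)
      show "inj_on (seq_of_tuple d (P1 \<union> P2) (M v1 v2)) P1"
        using inj1 by (rule inj_on_cong[THEN iffD2, rotated]) (rule seqM1)
      show "inj_on (seq_of_tuple d (P1 \<union> P2) (M v1 v2)) P2"
        using bij_betw_imp_inj_on[OF b] by (rule inj_on_cong[THEN iffD2, rotated]) (simp add: seqM2 s2)
      have 1: "seq_of_tuple d (P1 \<union> P2) (M v1 v2) ` P1 = ?s1 ` P1" by (rule image_cong[OF refl seqM1])
      have 2: "seq_of_tuple d (P1 \<union> P2) (M v1 v2) ` P2 = ?C"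
        using b seqM2 s2 by (auto simp: bij_betw_def)
      have "P1 - P2 = P1" "P2 - P1 = P2" using P(3) by auto
      then show "seq_of_tuple d (P1 \<union> P2) (M v1 v2) ` (P1 - P2) \<inter> seq_of_tuple d (P1 \<union> P2) (M v1 v2) ` (P2 - P1) = {}"
        using 1 2 by auto
    qed
    then have c0: "?c \<noteq> 0"
      using alternating_full_nonzero[OF E fin card M_in[OF v1(1) v2]] v1(2) by simp
    \<comment> \<open>A nonzero term forces \<open>v\<close> to list the same points as
      \<open>v1\<close>, so \<open>v = act d \<pi> v1\<close>. The signs of \<open>\<pi>\<close>
      from \<open>\<Phi>\<close> and from \<open>E\<close> cancel, hence all nonzero terms are equal
      and add up.\<close>
    have "\<Phi> v * E (M v v2) \<in> {0, ?c}" if v: "v \<in> ?V P1" for v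
    proof (cases "E (M v v2) = 0")
      case False
      have inj: "inj_on (seq_of_tuple d (P1 \<union> P2) (M v v2)) (P1 \<union> P2)"
      proof -
        have M: "M v v2 \<in> word_tuples d (\<lambda>_. k) (P1 \<union> P2)" by (rule M_in[OF v v2])
        note X1 = alternating_nonzero_inj[OF E odd_one fin M]
        show ?thesis by (rule X1) (rule False)
      qed
      let ?s = "seq_of_tuple d P1 v"
      have "inj_on (seq_of_tuple d (P1 \<union> P2) (M v v2)) P1" by (rule inj_on_subset[OF inj]) simp
      then have "inj_on ?s P1" by (rule inj_on_cong[THEN iffD1, rotated]) (rule seqM1)
      then have cs: "card (?s ` P1) = card P1" by (rule card_image)
      have "?s a \<in> ?s1 ` P1" if a: "a \<in> P1" for a
      proof (rule ccontr)
        assume n: "?s a \<notin> ?s1 ` P1"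
        have "?s a \<in> ?C" using n PiE_mem[OF seq_of_tuple_in[OF v] a] by blast
        then have "?s a \<in> b ` P2" by (simp only: bij_betw_imp_surj_on[OF b])
        then obtain a2 where a2: "a2 \<in> P2" "b a2 = ?s a" by (elim imageE) simp
        then have "seq_of_tuple d (P1 \<union> P2) (M v v2) a2 = seq_of_tuple d (P1 \<union> P2) (M v v2) a"
          using a by (simp add: seqM1 seqM2 s2)
        then have "a2 = a" using a a2 by (intro inj_onD[OF inj]) simp_all
        then show False using a a2 P(3) by auto
      qed
      then have "?s ` P1 = ?s1 ` P1"
        using P(1) cs card_image[OF inj1] by (intro card_subset_eq) auto
      then obtain \<pi> where \<pi>: "\<pi> permutes P1" "v = act d \<pi> v1"
        using same_points_act[OF P(1) v1(1) v inj1] by blast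
      have p: "\<pi> permutes P1 \<union> P2" by (rule permutes_subset[OF \<pi>(1)]) auto
      have "\<Phi> v * E (M v v2) = (of_int (sign \<pi>) * \<Phi> v1) * (of_int (sign \<pi>) * E (M v1 v2))"
        using inv_tensor_permD[OF \<Phi> \<pi>(1) v1(1)] inv_tensor_permD[OF E p M_in[OF v1(1) v2]]
        unfolding \<pi>(2) actM1[OF \<pi>(1)] by simp
      also have "\<dots> = of_int (sign \<pi> * sign \<pi>) * ?c" unfolding of_int_mult by (simp only: ac_simps)
      finally show ?thesis unfolding sign_mult_self by simp
    qed simp
    then have "\<Psi> v2 = (\<Sum>v\<in>?V P1. of_bool (\<Phi> v * E (M v v2) = ?c) * ?c)"
      unfolding \<Psi>_def using c0 by (intro sum.cong) auto
    also have "\<dots> = of_nat (card {v\<in>?V P1. \<Phi> v * E (M v v2) = ?c}) * ?c"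
      unfolding sum_distrib_right[symmetric] using finite_word_tuples[OF P(1)]
      by (simp add: sum.If_cases of_bool_def Int_def)
    finally have "\<Psi> v2 \<noteq> 0"
      using c0 v1(1) finite_word_tuples[OF P(1), of d "\<lambda>_. k"] by (auto simp: card_eq_0_iff)
    then show "\<exists>v2\<in>?V P2. \<Psi> v2 \<noteq> 0" using v2 by blast
  qed
  then show ?thesis by blast
qed

lemma has_alternating_top:
  assumes "d > 0"
  shows "has_alternating d k (k ^ (d - 1))"
proof -
  have "k ^ (d - 1) * k = k ^ d" using assms by (metis Suc_diff_1 power_Suc2)
  then show ?thesis using volume_inv_tensor[OF assms, of k] by (simp add: has_alternating_def)
qed

lemma has_alternating_complement:
  assumes A: "has_alternating d k n" and d: "d > 0" and n: "n \<le> k ^ (d - 1)"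
  shows "has_alternating d k (k ^ (d - 1) - n)"
proof -
  let ?P1 = "{..<n * k}" and ?P2 = "{n * k..<k ^ d}"
  have kd: "k ^ (d - 1) * k = k ^ d" using d by (metis Suc_diff_1 power_Suc2)
  have le: "n * k \<le> k ^ d" using mult_le_mono1[OF n, of k] unfolding kd .
  have dis: "?P1 \<inter> ?P2 = {}" by auto
  have un: "?P1 \<union> ?P2 = {..<k ^ d}" using le by auto
  obtain E where E: "inv_tensor d (\<lambda>_. k) (?P1 \<union> ?P2) 1 E"
    unfolding un using volume_inv_tensor[OF d] by blast
  obtain \<Phi> where \<Phi>: "inv_tensor d (\<lambda>_. k) ?P1 1 \<Phi>" using A by (auto simp: has_alternating_def)
  obtain \<Psi> where \<Psi>: "inv_tensor d (\<lambda>_. k) ?P2 1 \<Psi>"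
    using inv_tensor_contract[OF E \<Phi> _ _ dis] unfolding un by auto
  have "bij_betw (\<lambda>a. a + n * k) {..<(k ^ (d - 1) - n) * k} ?P2"
    unfolding diff_mult_distrib kd by (rule bij_betwI[where g = "\<lambda>a. a - n * k"]) auto
  from inv_tensor_transfer[OF \<Psi> this] show ?thesis unfolding has_alternating_def by blast
qed

lemma Y_standard_nonzero: "Y n k (\<lambda>a\<in>{..<n * k}. a div k) (\<lambda>a\<in>{..<n * k}. a mod k) \<noteq> 0"
proof -
  have "perm_sign (n * k) (\<lambda>a. (\<lambda>a\<in>{..<n * k}. a div k) a * k + (\<lambda>a\<in>{..<n * k}. a mod k) a) = sign (id :: nat \<Rightarrow> nat)"
    by (rule perm_sign_eq_sign[OF permutes_id]) simp
  then show ?thesis by (simp add: Y_def sign_id)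
qed

lemma standard_words:
  "(\<lambda>a\<in>{..<n * k}. a div k) \<in> words {..<n * k} n" "(\<lambda>a\<in>{..<n * k}. a mod k) \<in> words {..<n * k} k"
  by (cases "k = 0"; auto simp: less_mult_imp_div_less)+

text \<open>\<open>G\<close> is a Gram matrix of the determinant form. Permuting both arguments
  changes both factors by the same sign, so \<open>G\<close> is symmetric in the positions and can
  occupy two extra directions; on the diagonal it counts nonzero values.\<close>

lemma has_alternating_add2:
  assumes A: "has_alternating d k n"
  shows "has_alternating (d + 2) k n"
proof -
  let ?P = "{..<n * k}"
  obtain \<Phi> where \<Phi>: "inv_tensor d (\<lambda>_. k) ?P 1 \<Phi>" using A by (auto simp: has_alternating_def)
  define G where "G = (\<lambda>x y. \<Sum>w\<in>words ?P n. Y n k w x * Y n k w y)"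
  define \<Psi> where "\<Psi> = (\<lambda>v. \<Phi> (restrict v {..<d}) * G (v d) (v (Suc d)))"
  have res: "restrict v {..<d} \<in> word_tuples d (\<lambda>_. k) ?P" if "v \<in> word_tuples (d + 2) (\<lambda>_. k) ?P" for v
    using word_tuplesD[OF that] unfolding word_tuples_def by (intro restrict_PiE_iff[THEN iffD2] ballI) auto
  have "inv_tensor (d + 2) (\<lambda>_. k) ?P 1 \<Psi>"
    unfolding inv_tensor_def
  proof (intro conjI allI impI ballI)
    fix \<pi> v assume \<pi>: "\<pi> permutes ?P" and v: "v \<in> word_tuples (d + 2) (\<lambda>_. k) ?P"
    have "restrict (act (d + 2) \<pi> v) {..<d} = act d \<pi> (restrict v {..<d})"
      by (auto simp: act_def restrict_def fun_eq_iff)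
    moreover have "G (x \<circ> \<pi>) (y \<circ> \<pi>) = G x y" for x y
    proof -
      have "G (x \<circ> \<pi>) (y \<circ> \<pi>) = (\<Sum>w\<in>words ?P n. Y n k (w \<circ> \<pi>) (x \<circ> \<pi>) * Y n k (w \<circ> \<pi>) (y \<circ> \<pi>))"
        unfolding G_def by (rule sum_PiE_permutes[OF \<pi>, symmetric])
      also have "\<dots> = (\<Sum>w\<in>words ?P n. of_int (sign \<pi> * sign \<pi>) * (Y n k w x * Y n k w y))"
        unfolding Y_perm[OF \<pi>] of_int_mult by (intro sum.cong refl) (simp only: ac_simps)
      finally show ?thesis unfolding sign_mult_self G_def by simp
    qed
    ultimately show "\<Psi> (act (d + 2) \<pi> v) = of_int (sign \<pi>) ^ 1 * \<Psi> v"
      using inv_tensor_permD[OF \<Phi> \<pi> res[OF v]] by (simp add: \<Psi>_def act_def)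
  next
    fix l v assume l: "l < d + 2" and v: "v \<in> word_tuples (d + 2) (\<lambda>_. k) ?P"
    consider "l < d" | "l = d" | "l = Suc d" using l by linarith
    then show "sl_inv ?P k (\<lambda>w. \<Psi> (v(l := w)))"
    proof cases
      case 1
      have "restrict (v(l := w)) {..<d} = (restrict v {..<d})(l := w)" for w
        using 1 by (auto simp: restrict_def fun_eq_iff)
      then show ?thesis
        using sl_inv_cmult[OF inv_tensor_invD[OF \<Phi> 1 res[OF v]], of "G (v d) (v (Suc d))"] 1
        by (simp add: \<Psi>_def mult.commute)
    next
      case 2
      have "restrict (v(l := w)) {..<d} = restrict v {..<d}" for w using 2 by (auto simp: restrict_def fun_eq_iff)
      moreover have "sl_inv ?P k (\<lambda>x. \<Sum>w\<in>words ?P n. Y n k w (v (Suc d)) * Y n k w x)"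
        by (intro sl_inv_sum sl_inv_Y_right)
      ultimately show ?thesis using 2 sl_inv_cmult
        by (simp add: \<Psi>_def G_def mult.commute[of "Y n k _ _" "Y n k _ (v (Suc d))"])
    next
      case 3
      have "restrict (v(l := w)) {..<d} = restrict v {..<d}" for w using 3 by (auto simp: restrict_def fun_eq_iff)
      moreover have "sl_inv ?P k (\<lambda>x. \<Sum>w\<in>words ?P n. Y n k w (v d) * Y n k w x)"
        by (intro sl_inv_sum sl_inv_Y_right)
      ultimately show ?thesis using 3 sl_inv_cmult by (simp add: \<Psi>_def G_def)
    qed
  next
    obtain v where v: "v \<in> word_tuples d (\<lambda>_. k) ?P" "\<Phi> v \<noteq> 0" using inv_tensor_nonzeroD[OF \<Phi>] by blast
    let ?x = "\<lambda>a\<in>?P. a mod k" and ?w0 = "\<lambda>a\<in>?P. a div k"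
    let ?v = "v(d := ?x, Suc d := ?x)"
    have v': "?v \<in> word_tuples (d + 2) (\<lambda>_. k) ?P"
      using v(1) standard_words(2)[where n = n and k = k] by (auto simp: word_tuples_def PiE_def Pi_def extensional_def less_Suc_eq)
    have "Y n k w ?x * Y n k w ?x = of_bool (Y n k w ?x \<noteq> 0)" for w
      using Y_square[of n k w ?x] by (cases "Y n k w ?x = 0") auto
    then have "G ?x ?x = of_nat (card {w\<in>words ?P n. Y n k w ?x \<noteq> 0})"
      unfolding G_def using finite_words[of ?P n] by (simp add: sum.If_cases of_bool_def Int_def)
    moreover have "{w\<in>words ?P n. Y n k w ?x \<noteq> 0} \<noteq> {}"
      using Y_standard_nonzero[of n k] standard_words(1)[where n = n and k = k] by blast
    ultimately have "G ?x ?x \<noteq> 0" using finite_words[of ?P n] by (auto simp: card_eq_0_iff)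
    moreover have "restrict ?v {..<d} = v"
      using v(1) by (auto simp: word_tuples_def PiE_def extensional_def restrict_def fun_eq_iff)
    ultimately have "\<Psi> ?v \<noteq> 0" using v(2) by (simp add: \<Psi>_def)
    then show "\<exists>v\<in>word_tuples (d + 2) (\<lambda>_. k) ?P. \<Psi> v \<noteq> 0" using v' by blast
  qed
  then show ?thesis by (auto simp: has_alternating_def)
qed

lemma invariant_of_has_alternating:
  assumes A: "has_alternating d k n" and d: "odd d" and k: "k > 0"
  shows "invariants d n (n * k) \<noteq> {\<lambda>_. 0}"
proof -
  obtain \<Phi> where "inv_tensor d (\<lambda>_. k) {..<k * n} 1 \<Phi>"
    using A by (auto simp: has_alternating_def mult.commute)
  from inv_tensor_dual[OF this k] obtain \<Psi> where "inv_tensor d (\<lambda>_. n) {..<k * n} (1 + d) \<Psi>" by blast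
  then have "inv_tensor d (\<lambda>_. n) {..<n * k} (1 + d) \<Psi>" by (simp add: mult.commute)
  from invariant_of_inv_tensor[OF this] d show ?thesis by simp
qed

subsection \<open>Raising the number of factors by two\<close>

lemma sl_inv_congI:
  "sl_inv P n \<phi> \<Longrightarrow> (\<And>w. w \<in> words P n \<Longrightarrow> \<phi>' w = \<phi> w) \<Longrightarrow> sl_inv P n \<phi>'"
  unfolding sl_inv_def by simp

lemma restrict_id_permutes:
  assumes "inj_on \<rho> B" "finite B" "\<And>a. a \<in> B \<Longrightarrow> \<rho> a \<in> B"
  shows "restrict_id \<rho> B permutes B"
proof (rule bij_imp_permutes)
  have "\<rho> ` B = B" using assms by (intro endo_inj_surj) auto
  then show "bij_betw (restrict_id \<rho> B) B B"
    using assms(1) by (auto simp: bij_betw_def inj_on_def restrict_id_def)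
qed (simp add: restrict_id_def)

lemma sign_eq_prod_blocks:
  assumes "finite J" "\<And>j. j \<in> J \<Longrightarrow> finite (B j)"
    and "\<And>i j. i \<in> J \<Longrightarrow> j \<in> J \<Longrightarrow> i \<noteq> j \<Longrightarrow> B i \<inter> B j = {}"
    and "\<rho> permutes (\<Union>j\<in>J. B j)" "\<And>j a. j \<in> J \<Longrightarrow> a \<in> B j \<Longrightarrow> \<rho> a \<in> B j"
  shows "sign \<rho> = (\<Prod>j\<in>J. sign (restrict_id \<rho> (B j)))"
  using assms
proof (induction J arbitrary: \<rho> rule: finite_induct)
  case empty
  then show ?case by (simp add: sign_id)
next
  case (insert i J)
  let ?U = "\<Union>j\<in>J. B j"
  let ?r1 = "restrict_id \<rho> (B i)" and ?r2 = "restrict_id \<rho> ?U"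
  have inj: "inj_on \<rho> S" for S using permutes_inj[OF insert.prems(3)] by (rule inj_on_subset) simp
  have disj: "B i \<inter> B j = {}" if "j \<in> J" for j using that insert.prems(2)[of i j] insert.hyps by auto
  have finU: "finite ?U" using insert by auto
  have r1: "?r1 permutes B i" by (rule restrict_id_permutes[OF inj]) (use insert.prems in auto)
  have r2: "?r2 permutes ?U"
  proof (rule restrict_id_permutes[OF inj finU])
    fix a assume "a \<in> ?U"
    then obtain j where "j \<in> J" "a \<in> B j" by auto
    then have "\<rho> a \<in> B j" using insert.prems(4) by blast
    then show "\<rho> a \<in> ?U" using \<open>j \<in> J\<close> by blast
  qed
  have eq: "\<rho> = ?r1 \<circ> ?r2"
  proof
    fix a
    show "\<rho> a = (?r1 \<circ> ?r2) a"
    proof (cases "a \<in> ?U")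
      case True
      then obtain j where "j \<in> J" "a \<in> B j" by auto
      then have "\<rho> a \<in> B j" using insert.prems(4) by blast
      then have "\<rho> a \<notin> B i" using disj[OF \<open>j \<in> J\<close>] by auto
      then show ?thesis using True by (simp add: restrict_id_def)
    next
      case False
      then show ?thesis using permutes_not_in[OF insert.prems(3), of a] by (simp add: restrict_id_def)
    qed
  qed
  have IH: "sign ?r2 = (\<Prod>j\<in>J. sign (restrict_id ?r2 (B j)))"
  proof (rule insert.IH[OF _ _ r2])
    fix j a assume j: "j \<in> J" "a \<in> B j"
    then have "a \<in> ?U" by auto
    then show "?r2 a \<in> B j" using j insert.prems(4)[of j a] by (simp add: restrict_id_def)
  qed (use insert.prems in auto)
  have "restrict_id ?r2 (B j) = restrict_id \<rho> (B j)" if "j \<in> J" for j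
    using that by (auto simp: restrict_id_def fun_eq_iff)
  then have "(\<Prod>j\<in>J. sign (restrict_id ?r2 (B j))) = (\<Prod>j\<in>J. sign (restrict_id \<rho> (B j)))" by simp
  moreover have "sign \<rho> = sign ?r1 * sign ?r2"
  proof -
    have "permutation ?r1" "permutation ?r2"
      using permutes_imp_permutation[OF _ r1] permutes_imp_permutation[OF finU r2] insert.prems(1) by auto
    then have "sign (?r1 \<circ> ?r2) = sign ?r1 * sign ?r2" by (rule sign_compose)
    then show ?thesis using eq by simp
  qed
  ultimately show ?case using IH insert.hyps by simp
qed

lemma sum_prod_blocks:
  fixes f :: "'j \<Rightarrow> ('p \<Rightarrow> 'b) \<Rightarrow> 'c :: comm_semiring_1"
  assumes "finite J" "\<And>j. j \<in> J \<Longrightarrow> finite (B j)"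
    and "\<And>i j. i \<in> J \<Longrightarrow> j \<in> J \<Longrightarrow> i \<noteq> j \<Longrightarrow> B i \<inter> B j = {}"
  shows "(\<Sum>y\<in>(\<Union>j\<in>J. B j) \<rightarrow>\<^sub>E S. \<Prod>j\<in>J. f j (restrict y (B j))) = (\<Prod>j\<in>J. \<Sum>y\<in>B j \<rightarrow>\<^sub>E S. f j y)"
  using assms
proof (induction J rule: finite_induct)
  case empty
  then show ?case by simp
next
  case (insert i J)
  let ?U = "\<Union>j\<in>J. B j"
  have disj: "B i \<inter> ?U = {}"
  proof -
    have "B i \<inter> B j = {}" if "j \<in> J" for j using that insert.prems(2)[of i j] insert.hyps by auto
    then show ?thesis by blast
  qed
  have res: "restrict (merge (B i) ?U u w) (B j) = restrict w (B j)" if "j \<in> J" for j u and w :: "'p \<Rightarrow> 'b"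
    using that disj by (auto simp: merge_def restrict_def fun_eq_iff)
  have "(\<Sum>y\<in>(\<Union>j\<in>insert i J. B j) \<rightarrow>\<^sub>E S. \<Prod>j\<in>insert i J. f j (restrict y (B j)))
    = (\<Sum>u\<in>B i \<rightarrow>\<^sub>E S. \<Sum>w\<in>?U \<rightarrow>\<^sub>E S. f i u * (\<Prod>j\<in>J. f j (restrict w (B j))))"
    unfolding UN_insert sum_PiE_Un[OF disj]
  proof (intro sum.cong refl)
    fix u w assume u: "u \<in> B i \<rightarrow>\<^sub>E S"
    have "(\<Prod>j\<in>J. f j (restrict (merge (B i) ?U u w) (B j))) = (\<Prod>j\<in>J. f j (restrict w (B j)))"
      by (intro prod.cong refl arg_cong[of _ _ "f _"] res)
    then show "(\<Prod>j\<in>insert i J. f j (restrict (merge (B i) ?U u w) (B j))) = f i u * (\<Prod>j\<in>J. f j (restrict w (B j)))"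
      unfolding prod.insert[OF insert.hyps] merge_restrict1[OF u] by simp
  qed
  also have "\<dots> = (\<Sum>u\<in>B i \<rightarrow>\<^sub>E S. f i u) * (\<Sum>w\<in>?U \<rightarrow>\<^sub>E S. \<Prod>j\<in>J. f j (restrict w (B j)))"
    by (simp add: sum_product)
  also have "\<dots> = (\<Prod>j\<in>insert i J. \<Sum>y\<in>B j \<rightarrow>\<^sub>E S. f j y)"
  proof -
    have "(\<Sum>w\<in>?U \<rightarrow>\<^sub>E S. \<Prod>j\<in>J. f j (restrict w (B j))) = (\<Prod>j\<in>J. \<Sum>y\<in>B j \<rightarrow>\<^sub>E S. f j y)"
      by (rule insert.IH) (use insert.prems in blast)+
    then show ?thesis using insert.hyps by simp
  qed
  finally show ?case .
qed

text \<open>The form \<open>\<tau>\<close> at the vectors \<open>g (u a)\<close>, which depend on a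
  position only through its label. As a function of \<open>g\<close> it sees only the symmetrisation
  of \<open>\<tau>\<close> over the stabiliser of \<open>u\<close>.\<close>

definition form_val :: "'p set \<Rightarrow> 'b set \<Rightarrow> ('p \<Rightarrow> 'i) \<Rightarrow> (('p \<Rightarrow> 'b) \<Rightarrow> complex) \<Rightarrow> ('i \<Rightarrow> 'b \<Rightarrow> complex) \<Rightarrow> complex" where
  "form_val P B u \<tau> g = (\<Sum>y\<in>P \<rightarrow>\<^sub>E B. \<tau> y * (\<Prod>a\<in>P. g (u a) (y a)))"

lemma form_val_line:
  "\<exists>p. \<forall>t. poly p t = form_val P B u \<tau> (\<lambda>i b. g1 i b + t * (g2 i b - g1 i b))"
  unfolding form_val_def
  by (rule exI[of _ "\<Sum>y\<in>P \<rightarrow>\<^sub>E B. smult (\<tau> y) (\<Prod>a\<in>P. [:g1 (u a) (y a), g2 (u a) (y a) - g1 (u a) (y a):])"])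
    (simp add: poly_sum poly_prod)

text \<open>On the line through \<open>g1\<close> and \<open>g2\<close> both values are polynomials
  in \<open>t\<close>, one nonzero at \<open>t = 0\<close> and the other at \<open>t = 1\<close>;
  together they have finitely many roots.\<close>

lemma form_val_common_nonzero:
  assumes "form_val P1 B u1 \<tau>1 g1 \<noteq> 0" "form_val P2 B u2 \<tau>2 g2 \<noteq> 0"
  shows "\<exists>g. form_val P1 B u1 \<tau>1 g \<noteq> 0 \<and> form_val P2 B u2 \<tau>2 g \<noteq> 0"
proof -
  let ?g = "\<lambda>t i b. g1 i b + t * (g2 i b - g1 i b)"
  obtain p1 where p1: "\<And>t. poly p1 t = form_val P1 B u1 \<tau>1 (?g t)" using form_val_line by blast
  obtain p2 where p2: "\<And>t. poly p2 t = form_val P2 B u2 \<tau>2 (?g t)" using form_val_line by blast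
  have "p1 \<noteq> 0" using p1[of 0] assms(1) by auto
  moreover have "p2 \<noteq> 0" using p2[of 1] assms(2) by auto
  ultimately have "finite ({t. poly p1 t = 0} \<union> {t. poly p2 t = 0})" by (simp add: poly_roots_finite)
  then have "\<exists>t. t \<notin> {t. poly p1 t = 0} \<union> {t. poly p2 t = 0}" by (rule ex_new_if_finite[OF infinite_UNIV_char_0])
  then show ?thesis using p1 p2 by auto
qed

section \<open>Column forms from alternating tensors with three directions\<close>

definition pair_word :: "'p set \<Rightarrow> ('p \<Rightarrow> nat) \<Rightarrow> ('p \<Rightarrow> nat) \<Rightarrow> 'p \<Rightarrow> nat \<times> nat" where
  "pair_word P w w' = (\<lambda>a\<in>P. (w a, w' a))"

text \<open>
  Here \<open>x\<close> assigns a column to every position, and \<open>\<tau>\<close> is an \<open>SL k \<times> SL k\<close>-invariant on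
  \<open>(\<complex>^k \<otimes> \<complex>^k)^{\<otimes> P}\<close> that alternates within each column.
\<close>

definition col_form :: "'p set \<Rightarrow> nat \<Rightarrow> ('p \<Rightarrow> 'x) \<Rightarrow> (('p \<Rightarrow> nat \<times> nat) \<Rightarrow> complex) \<Rightarrow> bool" where
  "col_form P k x \<tau> \<longleftrightarrow>
     (\<forall>w'\<in>words P k. sl_inv P k (\<lambda>w. \<tau> (pair_word P w w'))) \<and>
     (\<forall>w\<in>words P k. sl_inv P k (\<lambda>w'. \<tau> (pair_word P w w'))) \<and>
     (\<forall>\<sigma>\<in>stab P x. \<forall>y\<in>P \<rightarrow>\<^sub>E {..<k} \<times> {..<k}. \<tau> (y \<circ> \<sigma>) = of_int (sign \<sigma>) * \<tau> y)"

text \<open>Fix direction 0 at the column word \<open>z0\<close> and join the other two directions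
  to pairs. If the form vanished at every \<open>g\<close>, so would its row symmetrisation
  \<open>F\<close>; but \<open>F\<close> is, up to sign, the contraction of \<open>\<Psi>\<close> in
  direction 0 with \<open>Y\<close> at the row word \<open>u0\<close>, and nondegeneracy would give
  \<open>\<Psi> = 0\<close>.\<close>

lemma col_form_exists:
  assumes A: "has_alternating 3 k q" and k: "k > 0"
  shows "\<exists>\<tau> g. col_form {..<q * k} k (\<lambda>a. a mod k) \<tau> \<and>
    form_val {..<q * k} ({..<k} \<times> {..<k}) (\<lambda>a. a div k) \<tau> g \<noteq> 0"
proof -
  let ?P = "{..<q * k}" and ?B = "{..<k} \<times> {..<k}"
  let ?V = "word_tuples 3 (\<lambda>_. k) ?P"
  obtain \<Psi> where \<Psi>: "inv_tensor 3 (\<lambda>_. k) ?P 1 \<Psi>" using A by (auto simp: has_alternating_def)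
  define z0 where "z0 = (\<lambda>a\<in>?P. a mod k)"
  define u0 where "u0 = (\<lambda>a\<in>?P. a div k)"
  have z0: "z0 \<in> words ?P k" unfolding z0_def by (rule standard_words)
  have u0: "u0 \<in> words ?P q" unfolding u0_def by (rule standard_words)
  define tup where "tup = (\<lambda>z w w'. (\<lambda>l\<in>{..<3 :: nat}. if l = 0 then z else if l = 1 then w else w' :: nat \<Rightarrow> nat))"
  have tup_in: "tup z w w' \<in> ?V" if "z \<in> words ?P k" "w \<in> words ?P k" "w' \<in> words ?P k" for z w w'
    using that unfolding tup_def word_tuples_def by (intro restrict_PiE_iff[THEN iffD2] ballI) simp
  have tup_act: "act 3 \<sigma> (tup z w w') = tup (z \<circ> \<sigma>) (w \<circ> \<sigma>) (w' \<circ> \<sigma>)" for \<sigma> z w w'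
    by (auto simp: act_def tup_def fun_eq_iff)
  have tup0: "(tup z w w')(0 := x) = tup x w w'" for x z w w' by (auto simp: tup_def fun_eq_iff)
  have tup1: "(tup z w w')(1 := x) = tup z x w'" for x z w w' by (auto simp: tup_def fun_eq_iff)
  have tup2: "(tup z w w')(2 := x) = tup z w x" for x z w w' by (auto simp: tup_def fun_eq_iff)
  have tup_eq: "v = tup (v 0) (v 1) (v 2)" if "v \<in> ?V" for v
  proof
    fix l :: nat
    consider "l = 0" | "l = 1" | "l = 2" | "\<not> l < 3" by linarith
    then show "v l = tup (v 0) (v 1) (v 2) l"
      using that by cases (auto simp: tup_def word_tuples_def PiE_def extensional_def)
  qed
  have z0s: "z0 \<circ> \<sigma> = z0" if \<sigma>: "\<sigma> \<in> stab ?P (\<lambda>a. a mod k)" for \<sigma>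
  proof
    fix a show "(z0 \<circ> \<sigma>) a = z0 a"
      using \<sigma> permutes_in_image[OF stab_permutes[OF \<sigma>], of a] by (cases "a \<in> ?P") (auto simp: z0_def stab_def)
  qed
  define comp1 where "comp1 = (\<lambda>(y :: nat \<Rightarrow> nat \<times> nat). \<lambda>a\<in>?P. fst (y a))"
  define comp2 where "comp2 = (\<lambda>(y :: nat \<Rightarrow> nat \<times> nat). \<lambda>a\<in>?P. snd (y a))"
  have comp_in: "comp1 y \<in> words ?P k" "comp2 y \<in> words ?P k" if "y \<in> ?P \<rightarrow>\<^sub>E ?B" for y
    using PiE_mem[OF that] by (auto simp: comp1_def comp2_def mem_Times_iff)
  have comp_act: "comp1 (y \<circ> \<sigma>) = comp1 y \<circ> \<sigma>" "comp2 (y \<circ> \<sigma>) = comp2 y \<circ> \<sigma>" if \<sigma>: "\<sigma> permutes ?P" for y \<sigma>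
    using permutes_in_image[OF \<sigma>] by (auto simp: comp1_def comp2_def fun_eq_iff)
  have comp_pair: "comp1 (pair_word ?P w w') = w" "comp2 (pair_word ?P w w') = w'"
    if "w \<in> words ?P k" "w' \<in> words ?P k" for w w'
    using PiE_arb[OF that(1)] PiE_arb[OF that(2)] by (auto simp: comp1_def comp2_def pair_word_def fun_eq_iff)
  define \<tau> where "\<tau> = (\<lambda>y. \<Psi> (tup z0 (comp1 y) (comp2 y)))"
  have 1: "col_form ?P k (\<lambda>a. a mod k) \<tau>"
    unfolding col_form_def
  proof (intro conjI ballI)
    fix w' assume w': "w' \<in> words ?P k"
    have "sl_inv ?P k (\<lambda>w. \<Psi> ((tup z0 w' w')(1 := w)))"
      using inv_tensor_invD[OF \<Psi> _ tup_in[OF z0 w' w'], of 1] by simp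
    then show "sl_inv ?P k (\<lambda>w. \<tau> (pair_word ?P w w'))"
      by (rule sl_inv_congI) (simp only: \<tau>_def comp_pair[OF _ w'] tup1)
  next
    fix w assume w: "w \<in> words ?P k"
    have "sl_inv ?P k (\<lambda>w'. \<Psi> ((tup z0 w w)(2 := w')))"
      using inv_tensor_invD[OF \<Psi> _ tup_in[OF z0 w w], of 2] by simp
    then show "sl_inv ?P k (\<lambda>w'. \<tau> (pair_word ?P w w'))"
      by (rule sl_inv_congI) (simp only: \<tau>_def comp_pair[OF w] tup2)
  next
    fix \<sigma> y assume \<sigma>: "\<sigma> \<in> stab ?P (\<lambda>a. a mod k)" and y: "y \<in> ?P \<rightarrow>\<^sub>E ?B"
    have "tup z0 (comp1 (y \<circ> \<sigma>)) (comp2 (y \<circ> \<sigma>)) = act 3 \<sigma> (tup z0 (comp1 y) (comp2 y))"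
      unfolding tup_act comp_act[OF stab_permutes[OF \<sigma>]] z0s[OF \<sigma>] ..
    then show "\<tau> (y \<circ> \<sigma>) = of_int (sign \<sigma>) * \<tau> y"
      unfolding \<tau>_def using inv_tensor_permD[OF \<Psi> stab_permutes[OF \<sigma>] tup_in[OF z0 comp_in[OF y]]] by simp
  qed
  let ?S = "stab ?P (\<lambda>a. a div k)"
  define F where "F = (\<lambda>y. \<Sum>\<rho>\<in>?S. \<tau> (y \<circ> \<rho>))"
  have "\<exists>g. form_val ?P ?B (\<lambda>a. a div k) \<tau> g \<noteq> 0"
  proof (rule ccontr)
    assume "\<not> ?thesis"
    then have zero: "form_val ?P ?B (\<lambda>a. a div k) \<tau> g = 0" for g by blast
    have F0: "F y = 0" if "y \<in> ?P \<rightarrow>\<^sub>E ?B" for y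
    proof (rule sym_coeffs_eq_zero[where P = ?P and B = ?B and u = "\<lambda>a. a div k" and H = F])
      fix \<sigma> y assume "\<sigma> permutes ?P" "\<And>a. a \<in> ?P \<Longrightarrow> \<sigma> a div k = a div k"
      then have "\<sigma> \<in> ?S" by (simp add: stab_def)
      from sum_stab_left[OF this, of "\<lambda>\<rho>. \<tau> (y \<circ> \<rho>)"] show "F (y \<circ> \<sigma>) = F y"
        by (simp add: F_def o_assoc)
    next
      fix g :: "nat \<Rightarrow> nat \<times> nat \<Rightarrow> complex"
      have "(\<Sum>y\<in>?P \<rightarrow>\<^sub>E ?B. F y * (\<Prod>a\<in>?P. g (a div k) (y a)))
        = (\<Sum>\<rho>\<in>?S. \<Sum>y\<in>?P \<rightarrow>\<^sub>E ?B. \<tau> (y \<circ> \<rho>) * (\<Prod>a\<in>?P. g (a div k) (y a)))"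
        unfolding F_def sum_distrib_right by (rule sum.swap)
      also have "\<dots> = 0"
      proof (rule sum.neutral, rule ballI)
        fix \<rho> assume "\<rho> \<in> ?S"
        from sum_stab_monomial[OF this, where f = \<tau> and g = g and B = ?B]
        show "(\<Sum>y\<in>?P \<rightarrow>\<^sub>E ?B. \<tau> (y \<circ> \<rho>) * (\<Prod>a\<in>?P. g (a div k) (y a))) = 0"
          using zero[of g] unfolding form_val_def by (rule trans)
      qed
      finally show "(\<Sum>y\<in>?P \<rightarrow>\<^sub>E ?B. F y * (\<Prod>a\<in>?P. g (a div k) (y a))) = 0" .
    qed (use that in auto)
    \<comment> \<open>The words with \<open>Y q k u0 z\<close> nonzero are the
      \<open>z0 \<circ> \<rho>\<close> with \<open>\<rho>\<close> a row permutation. The signs of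
      \<open>\<rho>\<close> from \<open>Y\<close> and from \<open>\<Psi>\<close> cancel, so the
      contraction is a multiple of \<open>F\<close>.\<close>
    have row0: "(\<Sum>z\<in>words ?P k. Y q k u0 z * \<Psi> (tup z w w')) = 0"
      if w: "w \<in> words ?P k" and w': "w' \<in> words ?P k" for w w'
    proof -
      define contrib where "contrib = (\<lambda>\<rho>. Y q k u0 (z0 \<circ> \<rho>) * \<Psi> (tup (z0 \<circ> \<rho>) w w'))"
      have "(\<Sum>z\<in>words ?P k. Y q k u0 z * \<Psi> (tup z w w')) = (\<Sum>z\<in>(\<lambda>\<rho>. z0 \<circ> \<rho>) ` ?S. Y q k u0 z * \<Psi> (tup z w w'))"
      proof (rule sum.mono_neutral_right)
        show "finite (words ?P k)" by (rule finite_words) simp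
        show "(\<lambda>\<rho>. z0 \<circ> \<rho>) ` ?S \<subseteq> words ?P k" using comp_permutes_PiE[OF stab_permutes z0] by blast
        show "\<forall>z\<in>words ?P k - (\<lambda>\<rho>. z0 \<circ> \<rho>) ` ?S. Y q k u0 z * \<Psi> (tup z w w') = 0"
        proof
          fix z assume z: "z \<in> words ?P k - (\<lambda>\<rho>. z0 \<circ> \<rho>) ` ?S"
          have "Y q k u0 z = 0"
          proof (rule ccontr)
            assume "Y q k u0 z \<noteq> 0"
            then have "bij_betw (\<lambda>a. u0 a * k + z a) ?P ?P" by (simp add: Y_def perm_sign_nonzero_iff)
            then obtain \<rho> where \<rho>: "\<rho> permutes ?P" "\<And>a. a < q * k \<Longrightarrow> u0 a * k + z a = \<rho> a"
              using bij_betw_lessThan_permutes by blast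
            have zk: "z a < k" if "a < q * k" for a using words_lt[of z ?P k a] z that by simp
            have "\<rho> a div k = a div k" if "a < q * k" for a
              using \<rho>(2)[OF that, symmetric] zk[OF that] that by (simp add: u0_def)
            then have "\<rho> \<in> ?S" using \<rho>(1) by (simp add: stab_def)
            moreover have "z = z0 \<circ> \<rho>"
            proof
              fix a show "z a = (z0 \<circ> \<rho>) a"
              proof (cases "a < q * k")
                case True
                then have "\<rho> a < q * k" using permutes_in_image[OF \<rho>(1), of a] by simp
                then show ?thesis using \<rho>(2)[OF True, symmetric] zk[OF True] by (simp add: z0_def)
              next
                case False
                then show ?thesis using permutes_not_in[OF \<rho>(1), of a] z by (auto simp: z0_def)
              qed
            qed
            ultimately show False using z by blast
          qed
          then show "Y q k u0 z * \<Psi> (tup z w w') = 0" by simp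
        qed
      qed
      also have "\<dots> = (\<Sum>\<rho>\<in>?S. contrib \<rho>)"
      proof -
        have inj: "inj_on (\<lambda>\<rho>. z0 \<circ> \<rho>) ?S"
        proof (rule inj_onI)
          fix \<rho> \<sigma> assume \<rho>: "\<rho> \<in> ?S" and \<sigma>: "\<sigma> \<in> ?S" and eq: "z0 \<circ> \<rho> = z0 \<circ> \<sigma>"
          show "\<rho> = \<sigma>"
          proof
            fix a show "\<rho> a = \<sigma> a"
            proof (cases "a \<in> ?P")
              case True
              have m: "\<rho> a \<in> ?P" "\<sigma> a \<in> ?P"
                using True permutes_in_image[OF stab_permutes[OF \<rho>]] permutes_in_image[OF stab_permutes[OF \<sigma>]] by auto
              have "\<rho> a mod k = \<sigma> a mod k" using fun_cong[OF eq, of a] m by (simp add: z0_def)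
              moreover have "\<rho> a div k = \<sigma> a div k" using \<rho> \<sigma> True by (simp add: stab_def)
              ultimately show ?thesis by (metis div_mult_mod_eq)
            next
              case False
              then show ?thesis
                using permutes_not_in[OF stab_permutes[OF \<rho>]] permutes_not_in[OF stab_permutes[OF \<sigma>]] by simp
            qed
          qed
        qed
        show ?thesis
          by (subst sum.reindex[OF inj], rule sum.cong[OF refl], simp only: o_apply contrib_def)
      qed
      also have "\<dots> = (\<Sum>\<rho>\<in>?S. Y q k u0 z0 * \<tau> (pair_word ?P w w' \<circ> Hilbert_Choice.inv \<rho>))"
      proof (rule sum.cong[OF refl])
        fix \<rho> assume \<rho>: "\<rho> \<in> ?S"
        note p = stab_permutes[OF \<rho>]
        let ?i = "Hilbert_Choice.inv \<rho>"
        have ip: "?i permutes ?P" by (rule permutes_inv[OF p])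
        have us: "u0 \<circ> \<rho> = u0"
        proof
          fix a show "(u0 \<circ> \<rho>) a = u0 a"
            using \<rho> permutes_in_image[OF p, of a] by (cases "a \<in> ?P") (auto simp: u0_def stab_def)
        qed
        have "Y q k u0 (z0 \<circ> \<rho>) = of_int (sign \<rho>) * Y q k u0 z0" using Y_perm[OF p, of u0 z0] us by simp
        moreover have "\<Psi> (tup (z0 \<circ> \<rho>) w w') = of_int (sign \<rho>) * \<Psi> (tup z0 (w \<circ> ?i) (w' \<circ> ?i))"
        proof -
          have "tup (z0 \<circ> \<rho>) w w' = act 3 \<rho> (tup z0 (w \<circ> ?i) (w' \<circ> ?i))"
            unfolding tup_act comp_assoc permutes_inv_o[OF p] by simp
          then show ?thesis
            using inv_tensor_permD[OF \<Psi> p tup_in[OF z0 comp_permutes_PiE[OF ip w] comp_permutes_PiE[OF ip w']]] by simp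
        qed
        moreover have "\<tau> (pair_word ?P w w' \<circ> ?i) = \<Psi> (tup z0 (w \<circ> ?i) (w' \<circ> ?i))"
          unfolding \<tau>_def comp_act[OF ip] comp_pair[OF w w'] ..
        ultimately have "contrib \<rho> = of_int (sign \<rho> * sign \<rho>) * (Y q k u0 z0 * \<tau> (pair_word ?P w w' \<circ> ?i))"
          unfolding contrib_def of_int_mult by (simp only: ac_simps)
        then show "contrib \<rho> = Y q k u0 z0 * \<tau> (pair_word ?P w w' \<circ> ?i)" unfolding sign_mult_self by simp
      qed
      also have "\<dots> = Y q k u0 z0 * F (pair_word ?P w w')"
      proof -
        have "bij_betw (\<lambda>\<rho>. Hilbert_Choice.inv \<rho>) ?S ?S"
          by (rule bij_betwI[where g = "\<lambda>\<rho>. Hilbert_Choice.inv \<rho>"])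
            (auto intro: stab_inv simp: permutes_inv_inv[OF stab_permutes])
        from sum.reindex_bij_betw[OF this, of "\<lambda>\<rho>. \<tau> (pair_word ?P w w' \<circ> \<rho>)"]
        show ?thesis by (simp only: F_def sum_distrib_left[symmetric])
      qed
      also have "\<dots> = 0"
      proof -
        have "pair_word ?P w w' \<in> ?P \<rightarrow>\<^sub>E ?B" using words_lt[OF w] words_lt[OF w'] by (auto simp: pair_word_def)
        then show ?thesis by (simp add: F0)
      qed
      finally show ?thesis .
    qed
    obtain v where v: "v \<in> ?V" "\<Psi> v \<noteq> 0" using inv_tensor_nonzeroD[OF \<Psi>] by blast
    have vl: "v 0 \<in> words ?P k" "v 1 \<in> words ?P k" "v 2 \<in> words ?P k" using word_tuplesD[OF v(1)] by auto
    have inv0: "sl_inv ?P k (\<lambda>z. \<Psi> (tup z (v 1) (v 2)))"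
      using inv_tensor_invD[OF \<Psi> _ tup_in[OF vl], of 0] by (simp add: tup0)
    have "\<Psi> (tup (v 0) (v 1) (v 2)) = 0"
    proof (rule sl_inv_nondegenerate[where n = k and k = q and \<phi> = "\<lambda>z. \<Psi> (tup z (v 1) (v 2))", unfolded mult.commute[of k q], OF inv0 k _ vl(1)])
      fix u assume u: "u \<in> words ?P q"
      show "(\<Sum>z\<in>words ?P k. Y k q z u * \<Psi> (tup z (v 1) (v 2))) = 0"
      proof (cases "\<exists>z\<in>words ?P k. Y q k u z \<noteq> 0")
        case False
        obtain s where s: "\<forall>w\<in>words ?P q. \<forall>v\<in>words ?P k. Y q k w v = s * Y k q v w" "s \<in> {1, -1}"
          using Y_swap[of q k] by (elim bexE)
        have "Y k q z u = 0" if "z \<in> words ?P k" for z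
        proof -
          have "Y q k u z = 0" using False that by blast
          then show ?thesis using s u that by auto
        qed
        then show ?thesis by simp
      next
        \<comment> \<open>A nonzero value makes \<open>u\<close> the row word \<open>u0\<close>
          rearranged by some \<open>\<sigma>\<close>; moving \<open>\<sigma>\<close> onto the other
          two words reduces the claim to \<open>row0\<close>.\<close>
        case True
        then obtain z1 where z1: "z1 \<in> words ?P k" "Y q k u z1 \<noteq> 0" by blast
        then have "bij_betw (\<lambda>a. u a * k + z1 a) ?P ?P" by (simp add: Y_def perm_sign_nonzero_iff)
        then obtain \<sigma> where \<sigma>: "\<sigma> permutes ?P" "\<And>a. a < q * k \<Longrightarrow> u a * k + z1 a = \<sigma> a"
          using bij_betw_lessThan_permutes by blast
        let ?i = "Hilbert_Choice.inv \<sigma>"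
        have ip: "?i permutes ?P" by (rule permutes_inv[OF \<sigma>(1)])
        have uu: "u = u0 \<circ> \<sigma>"
        proof
          fix a show "u a = (u0 \<circ> \<sigma>) a"
          proof (cases "a < q * k")
            case True
            then have "\<sigma> a < q * k" "z1 a < k" using permutes_in_image[OF \<sigma>(1), of a] words_lt[OF z1(1), of a] by auto
            then show ?thesis using \<sigma>(2)[OF True, symmetric] by (simp add: u0_def)
          next
            case False
            then show ?thesis using permutes_not_in[OF \<sigma>(1), of a] u by (auto simp: u0_def)
          qed
        qed
        obtain s where s: "\<forall>w\<in>words ?P q. \<forall>v\<in>words ?P k. Y q k w v = s * Y k q v w" "s \<in> {1, -1}"
          using Y_swap[of q k] by (elim bexE)
        have ss: "Y k q z u = s * Y q k u z" if "z \<in> words ?P k" for z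
          using s u that by auto
        have "(\<Sum>z\<in>words ?P k. Y k q z u * \<Psi> (tup z (v 1) (v 2))) = s * (\<Sum>z\<in>words ?P k. Y q k u z * \<Psi> (tup z (v 1) (v 2)))"
          unfolding sum_distrib_left by (intro sum.cong refl) (simp add: ss)
        also have "(\<Sum>z\<in>words ?P k. Y q k u z * \<Psi> (tup z (v 1) (v 2)))
          = (\<Sum>z\<in>words ?P k. Y q k u (z \<circ> \<sigma>) * \<Psi> (tup (z \<circ> \<sigma>) (v 1) (v 2)))"
          by (rule sum_PiE_permutes[OF \<sigma>(1), symmetric])
        also have "\<dots> = (\<Sum>z\<in>words ?P k. Y q k u0 z * \<Psi> (tup z (v 1 \<circ> ?i) (v 2 \<circ> ?i)))"
        proof (rule sum.cong[OF refl])
          fix z assume z: "z \<in> words ?P k"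
          have "tup (z \<circ> \<sigma>) (v 1) (v 2) = act 3 \<sigma> (tup z (v 1 \<circ> ?i) (v 2 \<circ> ?i))"
            unfolding tup_act comp_assoc permutes_inv_o[OF \<sigma>(1)] by simp
          then have "\<Psi> (tup (z \<circ> \<sigma>) (v 1) (v 2)) = of_int (sign \<sigma>) * \<Psi> (tup z (v 1 \<circ> ?i) (v 2 \<circ> ?i))"
            using inv_tensor_permD[OF \<Psi> \<sigma>(1) tup_in[OF z comp_permutes_PiE[OF ip vl(2)] comp_permutes_PiE[OF ip vl(3)]]] by simp
          moreover have "Y q k u (z \<circ> \<sigma>) = of_int (sign \<sigma>) * Y q k u0 z" unfolding uu by (rule Y_perm[OF \<sigma>(1)])
          ultimately have "Y q k u (z \<circ> \<sigma>) * \<Psi> (tup (z \<circ> \<sigma>) (v 1) (v 2))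
            = of_int (sign \<sigma> * sign \<sigma>) * (Y q k u0 z * \<Psi> (tup z (v 1 \<circ> ?i) (v 2 \<circ> ?i)))"
            unfolding of_int_mult by (simp only: ac_simps)
          then show "Y q k u (z \<circ> \<sigma>) * \<Psi> (tup (z \<circ> \<sigma>) (v 1) (v 2)) = Y q k u0 z * \<Psi> (tup z (v 1 \<circ> ?i) (v 2 \<circ> ?i))"
            unfolding sign_mult_self by simp
        qed
        also have "\<dots> = 0" by (rule row0[OF comp_permutes_PiE[OF ip vl(2)] comp_permutes_PiE[OF ip vl(3)]])
        finally show ?thesis by simp
      qed
    qed
    then show False using v tup_eq[OF v(1)] by simp
  qed
  then show ?thesis using 1 by blast
qed

lemma pull_pair_word:
  assumes "bij_betw h P' P"
  shows "pull h P' P (pair_word P' w w') = pair_word P (pull h P' P w) (pull h P' P w')"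
  using bij_betw_apply[OF bij_betw_the_inv_into[OF assms]] by (auto simp: pull_def pair_word_def fun_eq_iff)

lemma col_form_pull:
  assumes \<tau>: "col_form P k x \<tau>" and h: "bij_betw h P' P" and P: "finite P"
    and x': "\<And>a. a \<in> P' \<Longrightarrow> x (h a) = \<xi> (x' a)"
  shows "col_form P' k x' (\<lambda>y. \<tau> (pull h P' P y))"
  unfolding col_form_def
proof (intro conjI ballI)
  have P': "finite P'" using P h bij_betw_finite by blast
  have hinj: "inj_on h P'" and him: "h ` P' = P" using h by (auto simp: bij_betw_def)
  note pull_in = bij_betw_apply[OF bij_pull[OF h]]
  {
    fix w' assume w': "w' \<in> words P' k"
    have "sl_inv P k (\<lambda>w. \<tau> (pair_word P w (pull h P' P w')))"
      using \<tau> pull_in[OF w'] unfolding col_form_def by blast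
    from sl_inv_pull[OF this h] show "sl_inv P' k (\<lambda>w. \<tau> (pull h P' P (pair_word P' w w')))"
      by (simp only: pull_pair_word[OF h])
  }
  {
    fix w assume w: "w \<in> words P' k"
    have "sl_inv P k (\<lambda>w'. \<tau> (pair_word P (pull h P' P w) w'))"
      using \<tau> pull_in[OF w] unfolding col_form_def by blast
    from sl_inv_pull[OF this h] show "sl_inv P' k (\<lambda>w'. \<tau> (pull h P' P (pair_word P' w w')))"
      by (simp only: pull_pair_word[OF h])
  }
  fix \<sigma> y assume \<sigma>: "\<sigma> \<in> stab P' x'" and y: "y \<in> P' \<rightarrow>\<^sub>E {..<k} \<times> {..<k}"
  note p = stab_permutes[OF \<sigma>]
  let ?\<sigma> = "map_permutation P' h \<sigma>"
  have "?\<sigma> \<in> stab P x"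
    unfolding stab_def
  proof (intro CollectI conjI ballI map_permutation_permutes[OF h p])
    fix a assume "a \<in> P"
    then obtain b where b: "b \<in> P'" "a = h b" using him by auto
    have "?\<sigma> a = h (\<sigma> b)" unfolding b(2) by (rule map_permutation_apply[OF hinj b(1)])
    moreover have "\<sigma> b \<in> P'" using permutes_in_image[OF p] b by simp
    ultimately show "x (?\<sigma> a) = x a" using x' b \<sigma> by (simp add: stab_def)
  qed
  then have "\<tau> (pull h P' P y \<circ> ?\<sigma>) = of_int (sign ?\<sigma>) * \<tau> (pull h P' P y)"
    using \<tau> pull_in[OF y] unfolding col_form_def by blast
  then show "\<tau> (pull h P' P (y \<circ> \<sigma>)) = of_int (sign \<sigma>) * \<tau> (pull h P' P y)"
    unfolding pull_comp_perm[OF h p y] sign_map_permutation[OF hinj p P'] .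
qed

lemma form_val_pull:
  assumes h: "bij_betw h P' P" and u': "\<And>a. a \<in> P' \<Longrightarrow> u (h a) = u' a"
  shows "form_val P' B u' (\<lambda>y. \<tau> (pull h P' P y)) g = form_val P B u \<tau> g"
proof -
  have "form_val P B u \<tau> g = (\<Sum>y\<in>P' \<rightarrow>\<^sub>E B. \<tau> (pull h P' P y) * (\<Prod>a\<in>P. g (u a) (pull h P' P y a)))"
    unfolding form_val_def by (rule sum.reindex_bij_betw[OF bij_pull[OF h], symmetric])
  also have "\<dots> = form_val P' B u' (\<lambda>y. \<tau> (pull h P' P y)) g"
    unfolding form_val_def prod_pull[OF h, of "\<lambda>a b. g (u a) b"] using u' by (intro sum.cong refl) simp
  finally show ?thesis by simp
qed

lemma inv_tensor_transfer_ex: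
  assumes "inv_tensor d N P e \<Phi>" "finite P" "finite P'" "card P' = card P"
  shows "\<exists>\<Phi>'. inv_tensor d N P' e \<Phi>'"
proof -
  obtain h where "bij_betw h P' P" using finite_same_card_bij[OF assms(3,2,4)] by blast
  from inv_tensor_transfer[OF assms(1) this assms(2)] show ?thesis by blast
qed

lemma block_alternating:
  fixes A :: "'j \<Rightarrow> 'y \<Rightarrow> complex" and res :: "'j \<Rightarrow> 'y" and res' :: "'j \<Rightarrow> 'y"
  assumes J: "finite J" "\<And>j. j \<in> J \<Longrightarrow> finite (B j)"
    "\<And>i j. i \<in> J \<Longrightarrow> j \<in> J \<Longrightarrow> i \<noteq> j \<Longrightarrow> B i \<inter> B j = {}"
    and \<rho>: "\<rho> permutes (\<Union>j\<in>J. B j)" "\<And>j a. j \<in> J \<Longrightarrow> a \<in> B j \<Longrightarrow> \<rho> a \<in> B j"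
    and A: "\<And>j. j \<in> J \<Longrightarrow> A j (res' j) = of_int (sign (restrict_id \<rho> (B j))) * A j (res j)"
  shows "(\<Prod>j\<in>J. A j (res' j)) = of_int (sign \<rho>) * (\<Prod>j\<in>J. A j (res j))"
proof -
  have "(\<Prod>j\<in>J. A j (res' j)) = (\<Prod>j\<in>J. of_int (sign (restrict_id \<rho> (B j))) * A j (res j))"
    by (rule prod.cong[OF refl A])
  then show ?thesis by (simp add: prod.distrib sign_eq_prod_blocks[OF J \<rho>])
qed

lemma bij_betw_extension:
  assumes "finite A" "finite B" "card A = card B" "D \<subseteq> A" "inj_on f D" "f ` D \<subseteq> B"
  shows "\<exists>g. bij_betw g A B \<and> (\<forall>x\<in>D. g x = f x)"
proof -
  have "card (A - D) = card (B - f ` D)"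
    using assms finite_subset[OF assms(4,1)] by (simp add: card_Diff_subset card_image)
  then obtain h where h: "bij_betw h (A - D) (B - f ` D)"
    using finite_same_card_bij[of "A - D" "B - f ` D"] assms(1,2) by auto
  define g where "g = (\<lambda>x. if x \<in> D then f x else h x)"
  have "bij_betw g D (f ` D)"
    using assms(5) by (auto simp: bij_betw_def g_def inj_on_def)
  moreover have "bij_betw g (A - D) (B - f ` D)"
    using h by (subst bij_betw_cong[of _ g h]) (auto simp: g_def)
  ultimately have "bij_betw g (D \<union> (A - D)) (f ` D \<union> (B - f ` D))"
    by (rule bij_betw_combine) auto
  then have "bij_betw g A B" using assms(4,6) by (simp add: Un_absorb1)
  then show ?thesis by (auto simp: g_def)
qed

text \<open>
  The positions \<open>(b, j, x)\<close> form an array with full rows \<open>b < q\<close> of \<open>k ^ (d - 1)\<close> blocks \<open>j\<close> of size \<open>k\<close> and a last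
  row of \<open>r\<close> blocks. The directions below \<open>d\<close> carry a product of alternating tensors over the rows, the
  last two directions a product of column forms over the columns. Antisymmetrise this product and
  evaluate it where the row tensors are supported on the points \<open>pt (j, x)\<close> of \<open>[k]^d\<close>: only products of
  column and row permutations contribute, which leaves the row-symmetrisation \<open>F\<close> of the column forms.
  It is nonzero, as it has the same polynomial as the product of the column forms.
\<close>

lemma has_alternating_step:
  assumes k: "k > 0" and d: "d > 0" and r: "r < k ^ (d - 1)"
    and Ar: "has_alternating d k r" and Aq: "has_alternating 3 k q"
    and As: "r > 0 \<Longrightarrow> has_alternating 3 k (Suc q)"
  shows "has_alternating (d + 2) k (q * k ^ (d - 1) + r)"
proof -
  define c where "c = k ^ (d - 1)"
  have ck: "c * k = k ^ d" unfolding c_def using d by (metis Suc_diff_1 power_Suc2)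
  have rc: "r < c" using r by (simp add: c_def)
  \<comment> \<open>\<open>rw b\<close> counts the blocks in row \<open>b\<close>, and
    \<open>H j\<close> is the height of block column \<open>j\<close>: only the first
    \<open>r\<close> block columns reach the last row. The same array is cut into the sets
    \<open>row b\<close> and into the sets \<open>copy j\<close>.\<close>
  define rw where "rw = (\<lambda>b. if b < q then c else r)"
  define H where "H = (\<lambda>j. if j < r then Suc q else q)"
  define row where "row = (\<lambda>b. {b} \<times> {..<rw b} \<times> {..<k})"
  define copy where "copy = (\<lambda>j. {..<H j} \<times> {j} \<times> {..<k})"
  define P where "P = (\<Union>b\<in>{..q}. row b)"
  define col where "col = (\<lambda>a :: nat \<times> nat \<times> nat. snd a)"
  let ?B = "{..<k} \<times> {..<k}"
  have P_iff: "(b, j, x) \<in> P \<longleftrightarrow> b \<le> q \<and> j < rw b \<and> x < k" for b j x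
    by (auto simp: P_def row_def)
  have P_copy: "P = (\<Union>j\<in>{..<c}. copy j)"
  proof (rule Set.set_eqI)
    fix a :: "nat \<times> nat \<times> nat"
    obtain b j x where a: "a = (b, j, x)" by (cases a)
    have "b \<le> q \<and> j < rw b \<longleftrightarrow> j < c \<and> b < H j" using rc by (auto simp: rw_def H_def)
    then show "a \<in> P \<longleftrightarrow> a \<in> (\<Union>j\<in>{..<c}. copy j)" unfolding a P_iff by (auto simp: copy_def)
  qed
  have fin_row: "finite (row b)" and fin_copy: "finite (copy b)" for b by (simp_all add: row_def copy_def)
  have finP: "finite P" unfolding P_def using fin_row by simp
  have row_disj: "row b \<inter> row b' = {}" if "b \<noteq> b'" for b b' using that by (auto simp: row_def)
  have copy_disj: "copy b \<inter> copy b' = {}" if "b \<noteq> b'" for b b' using that by (auto simp: copy_def)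
  have row_sub: "row b \<subseteq> P" if "b \<le> q" for b using that by (auto simp: P_def)
  have copy_sub: "copy j \<subseteq> P" if "j < c" for j using that by (auto simp: P_copy)
  have row_iff: "a \<in> row b \<longleftrightarrow> a \<in> P \<and> fst a = b" if "b \<le> q" for a b
    using that by (cases a) (auto simp: P_iff row_def)
  have copy_iff: "a \<in> copy j \<longleftrightarrow> a \<in> P \<and> fst (col a) = j" if "j < c" for a j
    using that unfolding P_copy by (cases a) (auto simp: copy_def col_def)
  have card_row: "card (row b) = rw b * k" for b by (simp add: row_def)
  have "card P = (\<Sum>b\<in>{..q}. rw b * k)"
    unfolding P_def using fin_row row_disj by (subst card_UN_disjoint) (auto simp: card_row)
  also have "\<dots> = (q * c + r) * k"
    by (simp add: rw_def lessThan_Suc_atMost[symmetric] sum_distrib_right[symmetric])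
  finally have cardP: "card P = (q * c + r) * k" .

  have "\<exists>E. inv_tensor d (\<lambda>_. k) (row b) 1 E" for b
  proof (cases "b < q")
    case True
    obtain E where "inv_tensor d (\<lambda>_. k) {..<c * k} 1 E"
      using has_alternating_top[OF d, of k] by (auto simp: has_alternating_def c_def)
    then show ?thesis using True
      by (intro inv_tensor_transfer_ex[OF _ _ fin_row]) (auto simp: card_row rw_def)
  next
    case False
    obtain E where "inv_tensor d (\<lambda>_. k) {..<r * k} 1 E"
      using Ar by (auto simp: has_alternating_def)
    then show ?thesis using False
      by (intro inv_tensor_transfer_ex[OF _ _ fin_row]) (auto simp: card_row rw_def)
  qed
  then obtain Eb where Eb: "\<And>b. inv_tensor d (\<lambda>_. k) (row b) 1 (Eb b)" by metis

  \<comment> \<open>Block columns have height \<open>q\<close> or \<open>Suc q\<close>, and a single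
    \<open>g\<close> has to be a nonvanishing point for both kinds.\<close>
  have "\<exists>\<sigma> g. (\<forall>j<c. col_form {..<H j * k} k (\<lambda>a. a mod k) (\<sigma> j) \<and>
      form_val {..<H j * k} ?B (\<lambda>a. a div k) (\<sigma> j) g \<noteq> 0)"
  proof -
    obtain t1 g1 where 1: "col_form {..<q * k} k (\<lambda>a. a mod k) t1" "form_val {..<q * k} ?B (\<lambda>a. a div k) t1 g1 \<noteq> 0"
      using col_form_exists[OF Aq k] by blast
    show ?thesis
    proof (cases "r = 0")
      case True
      then show ?thesis using 1 by (intro exI[of _ "\<lambda>_. t1"] exI[of _ g1]) (simp add: H_def)
    next
      case False
      then obtain t2 g2 where 2: "col_form {..<Suc q * k} k (\<lambda>a. a mod k) t2" "form_val {..<Suc q * k} ?B (\<lambda>a. a div k) t2 g2 \<noteq> 0"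
        using col_form_exists[OF As k] by blast
      obtain g where "form_val {..<q * k} ?B (\<lambda>a. a div k) t1 g \<noteq> 0" "form_val {..<Suc q * k} ?B (\<lambda>a. a div k) t2 g \<noteq> 0"
        using form_val_common_nonzero[OF 1(2) 2(2)] by blast
      then show ?thesis using 1(1) 2(1)
        by (intro exI[of _ "\<lambda>j. if j < r then t2 else t1"] exI[of _ g]) (auto simp: H_def)
    qed
  qed
  then obtain \<sigma> g where \<sigma>: "\<And>j. j < c \<Longrightarrow> col_form {..<H j * k} k (\<lambda>a. a mod k) (\<sigma> j)"
    "\<And>j. j < c \<Longrightarrow> form_val {..<H j * k} ?B (\<lambda>a. a div k) (\<sigma> j) g \<noteq> 0" by blast
  define h where "h = (\<lambda>a :: nat \<times> nat \<times> nat. fst a * k + snd (snd a))"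
  have h: "bij_betw h (copy j) {..<H j * k}" for j
  proof -
    have "bij_betw (\<lambda>a. (fst a, snd (snd a))) (copy j) ({..<H j} \<times> {..<k})"
      by (rule bij_betwI[where g = "\<lambda>(b, x). (b, j, x)"]) (auto simp: copy_def)
    from bij_betw_trans[OF this bij_code] show ?thesis by (simp add: h_def o_def case_prod_unfold)
  qed
  define \<tau> where "\<tau> = (\<lambda>j y. \<sigma> j (pull h (copy j) {..<H j * k} y))"
  have \<tau>: "col_form (copy j) k col (\<tau> j)" if "j < c" for j
    unfolding \<tau>_def
    by (rule col_form_pull[OF \<sigma>(1)[OF that] h, where \<xi> = snd]) (auto simp: h_def col_def copy_def)
  have \<tau>g: "form_val (copy j) ?B fst (\<tau> j) g \<noteq> 0" if "j < c" for j
  proof -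
    have "form_val (copy j) ?B fst (\<tau> j) g = form_val {..<H j * k} ?B (\<lambda>a. a div k) (\<sigma> j) g"
      unfolding \<tau>_def by (rule form_val_pull[OF h]) (auto simp: h_def copy_def)
    then show ?thesis using \<sigma>(2)[OF that] by simp
  qed

  define restr where "restr = (\<lambda>(v :: nat \<Rightarrow> nat \<times> nat \<times> nat \<Rightarrow> nat) b. \<lambda>l\<in>{..<d}. restrict (v l) (row b))"
  define A where "A = (\<lambda>v. \<Prod>b\<in>{..q}. Eb b (restr v b))"
  define T where "T = (\<lambda>y. \<Prod>j\<in>{..<c}. \<tau> j (restrict y (copy j)))"
  define \<Phi> where "\<Phi> = (\<lambda>v. A v * T (pair_word P (v d) (v (Suc d))))"
  let ?V = "word_tuples (d + 2) (\<lambda>_. k) P"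
  have inv: "sl_inv P k (\<lambda>w. \<Phi> (v(l := w)))" if l: "l < d + 2" and v: "v \<in> ?V" for l v
  proof -
    have vl: "v l' a < k" if "l' < d + 2" "a \<in> P" for l' a using word_tuples_lt[OF v that] .
    have pw: "restrict (pair_word P w w') (copy j) = pair_word (copy j) (restrict w (copy j)) (restrict w' (copy j))"
      if "j < c" for w w' j using copy_sub[OF that] by (auto simp: pair_word_def restrict_def fun_eq_iff)
    consider "l < d" | "l = d" | "l = Suc d" using l by linarith
    then show ?thesis
    proof cases
      case 1
      have "restr (v(l := w)) b = (restr v b)(l := restrict w (row b))" for w b
        using 1 by (auto simp: restr_def fun_eq_iff)
      then have eq: "\<Phi> (v(l := w)) = T (pair_word P (v d) (v (Suc d))) * (\<Prod>b\<in>{..q}. Eb b ((restr v b)(l := restrict w (row b))))" for w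
        using 1 by (simp add: \<Phi>_def A_def)
      have "sl_inv (\<Union>b\<in>{..q}. row b) k (\<lambda>w. \<Prod>b\<in>{..q}. (\<lambda>w. Eb b ((restr v b)(l := w))) (restrict w (row b)))"
      proof (rule sl_inv_prod_blocks)
        fix b assume b: "b \<in> {..q}"
        have "restr v b \<in> word_tuples d (\<lambda>_. k) (row b)"
          using vl row_sub[of b] b unfolding restr_def word_tuples_def
          by (intro restrict_PiE_iff[THEN iffD2] ballI) (auto simp: restrict_PiE_iff)
        from inv_tensor_invD[OF Eb 1 this] show "sl_inv (row b) k (\<lambda>w. Eb b ((restr v b)(l := w)))" .
      qed (use row_disj fin_row in auto)
      then show ?thesis unfolding eq P_def[symmetric] by (rule sl_inv_cmult)
    next
      case 2
      have "restr (v(l := w)) b = restr v b" for w b using 2 by (auto simp: restr_def fun_eq_iff)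
      then have eq: "\<Phi> (v(l := w)) = A v * T (pair_word P w (v (Suc d)))" for w using 2 by (simp add: \<Phi>_def A_def)
      have "sl_inv (\<Union>j\<in>{..<c}. copy j) k (\<lambda>w. \<Prod>j\<in>{..<c}. (\<lambda>w. \<tau> j (pair_word (copy j) w (restrict (v (Suc d)) (copy j)))) (restrict w (copy j)))"
      proof (rule sl_inv_prod_blocks)
        fix j assume j: "j \<in> {..<c}"
        have "restrict (v (Suc d)) (copy j) \<in> words (copy j) k" using vl copy_sub[of j] j by (auto simp: restrict_PiE_iff)
        then show "sl_inv (copy j) k (\<lambda>w. \<tau> j (pair_word (copy j) w (restrict (v (Suc d)) (copy j))))"
          using \<tau>[of j] j unfolding col_form_def by blast
      qed (use copy_disj fin_copy in auto)
      moreover have "T (pair_word P w w') = (\<Prod>j\<in>{..<c}. \<tau> j (pair_word (copy j) (restrict w (copy j)) (restrict w' (copy j))))" for w w'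
        unfolding T_def by (intro prod.cong refl) (simp add: pw)
      ultimately show ?thesis unfolding eq P_copy[symmetric] by (intro sl_inv_cmult) simp
    next
      case 3
      have "restr (v(l := w)) b = restr v b" for w b using 3 by (auto simp: restr_def fun_eq_iff)
      then have eq: "\<Phi> (v(l := w)) = A v * T (pair_word P (v d) w)" for w using 3 by (simp add: \<Phi>_def A_def)
      have "sl_inv (\<Union>j\<in>{..<c}. copy j) k (\<lambda>w. \<Prod>j\<in>{..<c}. (\<lambda>w. \<tau> j (pair_word (copy j) (restrict (v d) (copy j)) w)) (restrict w (copy j)))"
      proof (rule sl_inv_prod_blocks)
        fix j assume j: "j \<in> {..<c}"
        have "restrict (v d) (copy j) \<in> words (copy j) k" using vl copy_sub[of j] j by (auto simp: restrict_PiE_iff)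
        then show "sl_inv (copy j) k (\<lambda>w. \<tau> j (pair_word (copy j) (restrict (v d) (copy j)) w))"
          using \<tau>[of j] j unfolding col_form_def by blast
      qed (use copy_disj fin_copy in auto)
      moreover have "T (pair_word P w w') = (\<Prod>j\<in>{..<c}. \<tau> j (pair_word (copy j) (restrict w (copy j)) (restrict w' (copy j))))" for w w'
        unfolding T_def by (intro prod.cong refl) (simp add: pw)
      ultimately show ?thesis unfolding eq P_copy[symmetric] by (intro sl_inv_cmult) simp
    qed
  qed

  obtain vr where vr: "vr \<in> word_tuples d (\<lambda>_. k) (row q)" "Eb q vr \<noteq> 0" using inv_tensor_nonzeroD[OF Eb[of q]] by (elim bexE)
  let ?s = "seq_of_tuple d (row q) vr"
  have s_inj: "inj_on ?s (row q)" by (rule alternating_nonzero_inj[where \<Phi> = "Eb q" and N = "\<lambda>_. k" and e = 1]) (use Eb[of q] odd_one fin_row[of q] vr in simp_all)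
  have rowq: "(q, j, x) \<in> row q \<longleftrightarrow> j < r \<and> x < k" for j x by (auto simp: row_def rw_def)
  \<comment> \<open>The tensor of the last row is nonzero at certain points; these are extended to
    an enumeration of \<open>[k]^d\<close> by the columns. Every row thus carries the same point in
    the same column, and a full row carries each point once.\<close>
  obtain pt where pt: "bij_betw pt ({..<c} \<times> {..<k}) (idx d k)"
    "\<And>j x. j < r \<Longrightarrow> x < k \<Longrightarrow> pt (j, x) = ?s (q, j, x)"
  proof -
    have "\<exists>g. bij_betw g ({..<c} \<times> {..<k}) (idx d k) \<and> (\<forall>z\<in>{..<r} \<times> {..<k}. g z = ?s (q, z))"
    proof (rule bij_betw_extension)
      show "inj_on (\<lambda>z. ?s (q, z)) ({..<r} \<times> {..<k})"
        using s_inj rowq by (auto simp: inj_on_def)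
      show "(\<lambda>z. ?s (q, z)) ` ({..<r} \<times> {..<k}) \<subseteq> idx d k"
        using PiE_mem[OF seq_of_tuple_in[OF vr(1)]] rowq by auto
    qed (use rc ck in \<open>auto simp: card_idx finite_idx\<close>)
    then show thesis using that by auto
  qed
  have pt_inj: "inj_on pt ({..<c} \<times> {..<k})" using pt(1) by (simp add: bij_betw_def)
  have col_in: "col a \<in> {..<c} \<times> {..<k}" if "a \<in> P" for a
    using that rc by (cases a) (auto simp: P_iff col_def rw_def split: if_splits)
  have pt_idx: "pt (col a) \<in> idx d k" if "a \<in> P" for a by (rule bij_betw_apply[OF pt(1) col_in[OF that]])
  \<comment> \<open>\<open>R \<pi> b\<close> is the tuple that row \<open>b\<close> sees once the
    positions are permuted by \<open>\<pi>\<close>, and \<open>A' \<pi>\<close> is the resulting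
    product of the row tensors.\<close>
  define R where "R = (\<lambda>\<pi> b. \<lambda>l\<in>{..<d}. \<lambda>a\<in>row b. pt (col (\<pi> a)) l)"
  define A' where "A' = (\<lambda>\<pi>. \<Prod>b\<in>{..q}. Eb b (R \<pi> b))"
  have R_in: "R \<pi> b \<in> word_tuples d (\<lambda>_. k) (row b)" if "\<pi> permutes P" "b \<le> q" for \<pi> b
    unfolding R_def word_tuples_def
  proof (intro restrict_PiE_iff[THEN iffD2] ballI, unfold lessThan_iff)
    fix l a assume l: "l < d" and a: "a \<in> row b"
    have "a \<in> P" using a row_sub[OF that(2)] by (rule rev_subsetD)
    then have "\<pi> a \<in> P" by (simp only: permutes_in_image[OF that(1)])
    from idx_lt[OF pt_idx[OF this] l] show "pt (col (\<pi> a)) l < k" .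
  qed
  have R_seq: "seq_of_tuple d (row b) (R \<pi> b) a = pt (col (\<pi> a))" if "\<pi> permutes P" "b \<le> q" "a \<in> row b" for \<pi> b a
  proof -
    have "a \<in> P" using that(3) row_sub[OF that(2)] by (rule rev_subsetD)
    then have "\<pi> a \<in> P" by (simp only: permutes_in_image[OF that(1)])
    from idx_undef[OF pt_idx[OF this]] show ?thesis
      using that by (auto simp: seq_of_tuple_def R_def fun_eq_iff)
  qed
  define vy where "vy = (\<lambda>y. \<lambda>l\<in>{..<d + 2}. if l < d then (\<lambda>a\<in>P. pt (col a) l) else if l = d then (\<lambda>a\<in>P. fst (y a)) else (\<lambda>a\<in>P. snd (y a :: nat \<times> nat)))"
  have vy_in: "vy y \<in> ?V" if y: "y \<in> P \<rightarrow>\<^sub>E ?B" for y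
    unfolding vy_def word_tuples_def
  proof (intro restrict_PiE_iff[THEN iffD2] ballI)
    fix l assume l: "l \<in> {..<d + 2}"
    have 1: "(\<lambda>a\<in>P. pt (col a) l) \<in> words P k" if "l < d"
      using idx_lt[OF pt_idx that] by (intro restrict_PiE_iff[THEN iffD2] ballI) simp
    have 2: "(\<lambda>a\<in>P. fst (y a)) \<in> words P k" "(\<lambda>a\<in>P. snd (y a)) \<in> words P k"
      by (intro restrict_PiE_iff[THEN iffD2] ballI, frule PiE_mem[OF y], simp add: mem_Times_iff)+
    show "(if l < d then (\<lambda>a\<in>P. pt (col a) l) else if l = d then (\<lambda>a\<in>P. fst (y a)) else (\<lambda>a\<in>P. snd (y a))) \<in> words P k"
      using 1 2 by simp
  qed
  have \<Phi>_act: "\<Phi> (act (d + 2) \<pi> (vy y)) = A' \<pi> * T (y \<circ> \<pi>)" if \<pi>: "\<pi> permutes P" and y: "y \<in> P \<rightarrow>\<^sub>E ?B" for \<pi> y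
  proof -
    have m: "\<pi> a \<in> P \<longleftrightarrow> a \<in> P" for a by (rule permutes_in_image[OF \<pi>])
    have "restr (act (d + 2) \<pi> (vy y)) b = R \<pi> b" if "b \<le> q" for b
    proof (intro ext)
      fix l a show "restr (act (d + 2) \<pi> (vy y)) b l a = R \<pi> b l a"
        using m[of a] row_sub[OF that] by (auto simp: restr_def R_def act_def vy_def)
    qed
    then have "A (act (d + 2) \<pi> (vy y)) = A' \<pi>" by (simp add: A_def A'_def)
    moreover have "pair_word P (act (d + 2) \<pi> (vy y) d) (act (d + 2) \<pi> (vy y) (Suc d)) = y \<circ> \<pi>"
    proof
      fix a show "pair_word P (act (d + 2) \<pi> (vy y) d) (act (d + 2) \<pi> (vy y) (Suc d)) a = (y \<circ> \<pi>) a"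
        using m[of a] PiE_arb[OF y, of "\<pi> a"] by (cases "a \<in> P") (auto simp: pair_word_def act_def vy_def)
    qed
    ultimately show ?thesis by (simp add: \<Phi>_def)
  qed

  let ?Rg = "stab P fst" and ?Cg = "stab P col"
  \<comment> \<open>Three symmetries: a row permutation on the right multiplies \<open>A'\<close> by
    its sign; a column permutation on the left leaves \<open>A'\<close> alone, since points depend
    only on columns; a column permutation multiplies \<open>T\<close> by its sign.\<close>
  have F1: "A' (\<pi> \<circ> \<rho>) = of_int (sign \<rho>) * A' \<pi>" if \<pi>: "\<pi> permutes P" and \<rho>: "\<rho> \<in> ?Rg" for \<pi> \<rho>
    unfolding A'_def
  proof (rule block_alternating)
    note p = stab_permutes[OF \<rho>]
    show rr: "\<rho> a \<in> row b" if "b \<in> {..q}" "a \<in> row b" for b a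
    proof -
      have "a \<in> P" "fst a = b" using that row_iff[of b a] by auto
      then have "\<rho> a \<in> P" "fst (\<rho> a) = b" using \<rho> permutes_in_image[OF p] by (auto simp: stab_def)
      then show ?thesis using that row_iff[of b "\<rho> a"] by auto
    qed
    show "\<rho> permutes (\<Union>b\<in>{..q}. row b)" using p by (simp add: P_def)
    fix b assume b: "b \<in> {..q}"
    have pb: "restrict_id \<rho> (row b) permutes row b"
      using permutes_inj[OF p] rr[OF b] by (intro restrict_id_permutes fin_row) (auto intro: inj_on_subset)
    have "R (\<pi> \<circ> \<rho>) b = act d (restrict_id \<rho> (row b)) (R \<pi> b)"
    proof (intro ext)
      fix l a show "R (\<pi> \<circ> \<rho>) b l a = act d (restrict_id \<rho> (row b)) (R \<pi> b) l a"
        using rr[OF b, of a] by (auto simp: R_def act_def restrict_id_def)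
    qed
    then show "Eb b (R (\<pi> \<circ> \<rho>) b) = of_int (sign (restrict_id \<rho> (row b))) * Eb b (R \<pi> b)"
      using inv_tensor_permD[OF Eb pb R_in[OF \<pi>]] b by simp
  qed (use fin_row row_disj in auto)
  have F2: "A' (\<kappa> \<circ> \<pi>) = A' \<pi>" if \<kappa>: "\<kappa> \<in> ?Cg" and \<pi>: "\<pi> permutes P" for \<kappa> \<pi>
  proof -
    have "R (\<kappa> \<circ> \<pi>) b = R \<pi> b" if "b \<le> q" for b
    proof (intro ext)
      fix l a show "R (\<kappa> \<circ> \<pi>) b l a = R \<pi> b l a"
        using row_sub[OF that] permutes_in_image[OF \<pi>, of a] \<kappa> by (auto simp: R_def stab_def)
    qed
    then show ?thesis by (simp add: A'_def)
  qed
  have F3: "T (y \<circ> \<kappa>) = of_int (sign \<kappa>) * T y" if \<kappa>: "\<kappa> \<in> ?Cg" and y: "y \<in> P \<rightarrow>\<^sub>E ?B" for \<kappa> y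
    unfolding T_def
  proof (rule block_alternating)
    note p = stab_permutes[OF \<kappa>]
    show rr: "\<kappa> a \<in> copy j" if "j \<in> {..<c}" "a \<in> copy j" for j a
    proof -
      have "a \<in> P" "fst (col a) = j" using that copy_iff[of j a] by auto
      then have "\<kappa> a \<in> P" "fst (col (\<kappa> a)) = j" using \<kappa> permutes_in_image[OF p] by (auto simp: stab_def)
      then show ?thesis using that copy_iff[of j "\<kappa> a"] by auto
    qed
    show "\<kappa> permutes (\<Union>j\<in>{..<c}. copy j)" using p by (simp add: P_copy)
    fix j assume j: "j \<in> {..<c}"
    have pj: "restrict_id \<kappa> (copy j) permutes copy j"
      using permutes_inj[OF p] rr[OF j] by (intro restrict_id_permutes fin_copy) (auto intro: inj_on_subset)
    have "restrict_id \<kappa> (copy j) \<in> stab (copy j) col"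
      using pj \<kappa> copy_sub[of j] j by (auto simp: stab_def restrict_id_def)
    moreover have "restrict y (copy j) \<in> copy j \<rightarrow>\<^sub>E ?B" using PiE_mem[OF y] copy_sub[of j] j by (auto simp: restrict_PiE_iff)
    ultimately have "\<tau> j (restrict y (copy j) \<circ> restrict_id \<kappa> (copy j)) = of_int (sign (restrict_id \<kappa> (copy j))) * \<tau> j (restrict y (copy j))"
      using \<tau>[of j] j unfolding col_form_def by blast
    moreover have "restrict (y \<circ> \<kappa>) (copy j) = restrict y (copy j) \<circ> restrict_id \<kappa> (copy j)"
      using rr[OF j] by (auto simp: restrict_def restrict_id_def fun_eq_iff)
    ultimately show "\<tau> j (restrict (y \<circ> \<kappa>) (copy j)) = of_int (sign (restrict_id \<kappa> (copy j))) * \<tau> j (restrict y (copy j))"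
      by simp
  qed (use fin_copy copy_disj in auto)
  \<comment> \<open>If \<open>A' \<pi>\<close> is nonzero, \<open>\<pi>\<close> spreads every row
    over distinct columns. Sending \<open>a\<close> to the cell in its own row and in the column of
    \<open>\<pi> a\<close> is then a row permutation \<open>\<rho>\<close>, and what remains of
    \<open>\<pi>\<close> preserves columns.\<close>
  have F4: "\<exists>\<kappa>\<in>?Cg. \<exists>\<rho>\<in>?Rg. \<pi> = \<kappa> \<circ> \<rho>" if \<pi>: "\<pi> permutes P" and nz: "A' \<pi> \<noteq> 0" for \<pi>
  proof -
    have \<pi>P: "\<pi> a \<in> P" if "a \<in> P" for a using that permutes_in_image[OF \<pi>] by simp
    have inj: "inj_on (\<lambda>a. col (\<pi> a)) (row b)" if b: "b \<le> q" for b
    proof (rule inj_onI)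
      fix a a' assume a: "a \<in> row b" "a' \<in> row b" and eq: "col (\<pi> a) = col (\<pi> a')"
      have "Eb b (R \<pi> b) \<noteq> 0" using nz b by (auto simp: A'_def)
      then have "inj_on (seq_of_tuple d (row b) (R \<pi> b)) (row b)"
        by (intro alternating_nonzero_inj[where \<Phi> = "Eb b" and N = "\<lambda>_. k" and e = 1])
           (use Eb[of b] odd_one fin_row[of b] R_in[OF \<pi> b] in simp_all)
      then show "a = a'" using a eq by (auto simp: inj_on_def R_seq[OF \<pi> b])
    qed
    have onto: "(\<lambda>a. col (\<pi> a)) ` row b = {..<c} \<times> {..<k}" if b: "b < q" for b
    proof (rule card_subset_eq)
      show "(\<lambda>a. col (\<pi> a)) ` row b \<subseteq> {..<c} \<times> {..<k}"
        using row_sub[of b] b by (intro image_subsetI col_in \<pi>P) auto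
      show "card ((\<lambda>a. col (\<pi> a)) ` row b) = card ({..<c} \<times> {..<k})"
        using b by (subst card_image[OF inj]) (auto simp: card_row rw_def)
    qed simp
    \<comment> \<open>Every full row sends a position into each column. If the last row also sent
      one into a short column \<open>z\<close>, then \<open>Suc q\<close> distinct images would have
      to fit into its \<open>q\<close> cells.\<close>
    have lastrow: "fst (col (\<pi> a)) < r" if a: "a \<in> row q" for a
    proof (rule ccontr)
      assume nr: "\<not> fst (col (\<pi> a)) < r"
      define z where "z = col (\<pi> a)"
      have aP: "a \<in> P" using a row_sub[of q] by auto
      have z: "z \<in> {..<c} \<times> {..<k}" "\<not> fst z < r" using col_in[OF \<pi>P[OF aP]] nr by (simp_all add: z_def)
      have "\<exists>a'. a' \<in> row b \<and> col (\<pi> a') = z" if "b < q" for b using onto[OF that] z(1) by (metis imageE)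
      then obtain \<alpha> where \<alpha>: "\<And>b. b < q \<Longrightarrow> \<alpha> b \<in> row b" "\<And>b. b < q \<Longrightarrow> col (\<pi> (\<alpha> b)) = z" by metis
      define \<beta> where "\<beta> = (\<lambda>b. if b < q then \<alpha> b else a)"
      have \<beta>: "\<beta> b \<in> row b" "col (\<pi> (\<beta> b)) = z" if "b \<le> q" for b
        using that \<alpha> a by (auto simp: \<beta>_def z_def)
      have "inj_on (\<lambda>b. \<pi> (\<beta> b)) {..q}"
      proof (rule inj_onI)
        fix b b' assume b: "b \<in> {..q}" "b' \<in> {..q}" and eq: "\<pi> (\<beta> b) = \<pi> (\<beta> b')"
        have "\<beta> b = \<beta> b'" using eq permutes_inj[OF \<pi>] by (simp add: inj_eq)
        then show "b = b'" using \<beta>(1)[of b] \<beta>(1)[of b'] b by (auto simp: row_def)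
      qed
      then have "card ((\<lambda>b. \<pi> (\<beta> b)) ` {..q}) = Suc q" by (simp add: card_image)
      moreover have "(\<lambda>b. \<pi> (\<beta> b)) ` {..q} \<subseteq> (\<lambda>b. (b, z)) ` {..<q}"
      proof
        fix p assume "p \<in> (\<lambda>b. \<pi> (\<beta> b)) ` {..q}"
        then obtain b where b: "b \<le> q" "p = \<pi> (\<beta> b)" by auto
        have "\<beta> b \<in> P" using \<beta>(1)[OF b(1)] row_sub[OF b(1)] by auto
        then have p: "p \<in> P" "col p = z" using b \<beta>(2)[OF b(1)] \<pi>P[of "\<beta> b"] by simp_all
        then have "p = (fst p, z)" by (cases p) (simp add: col_def)
        moreover have "fst p < q"
        proof (rule ccontr)
          assume "\<not> fst p < q"
          then show False using p z(2) by (cases p) (auto simp: P_iff rw_def col_def)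
        qed
        ultimately show "p \<in> (\<lambda>b. (b, z)) ` {..<q}" by auto
      qed
      then have "card ((\<lambda>b. \<pi> (\<beta> b)) ` {..q}) \<le> card ((\<lambda>b. (b, z)) ` {..<q})"
        by (rule card_mono[OF finite_imageI[OF finite_lessThan]])
      moreover have "card ((\<lambda>b. (b, z)) ` {..<q}) \<le> q"
        using card_image_le[OF finite_lessThan, of "\<lambda>b. (b, z)" q] by simp
      ultimately show False by simp
    qed
    define \<rho> where "\<rho> = restrict_id (\<lambda>a. (fst a, col (\<pi> a))) P"
    have \<rho>P: "(fst a, col (\<pi> a)) \<in> P" if a: "a \<in> P" for a
    proof -
      obtain b j x where abx: "a = (b, j, x)" by (cases a)
      then have b: "b \<le> q" "a \<in> row b" using a row_iff[of b a] by (auto simp: P_iff)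
      obtain j' x' where z: "col (\<pi> a) = (j', x')" by fastforce
      have "j' < c" "x' < k" using col_in[OF \<pi>P[OF a]] z by auto
      moreover have "j' < r" if "\<not> b < q" using lastrow[of a] b that z by (auto simp: le_less)
      ultimately show ?thesis unfolding abx using z b(1) by (auto simp: P_iff rw_def abx)
    qed
    have \<rho>: "\<rho> permutes P"
      unfolding \<rho>_def
    proof (rule restrict_id_permutes[OF _ finP \<rho>P])
      show "inj_on (\<lambda>a. (fst a, col (\<pi> a))) P"
      proof (rule inj_onI)
        fix a a' assume a: "a \<in> P" "a' \<in> P" and eq: "(fst a, col (\<pi> a)) = (fst a', col (\<pi> a'))"
        have fq: "fst a \<le> q" using a(1) by (cases a) (simp add: P_iff)
        have "a \<in> row (fst a)" "a' \<in> row (fst a)" using a eq row_iff[OF fq] by auto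
        then show "a = a'" using inj[OF fq] eq by (auto simp: inj_on_def)
      qed
    qed
    have \<rho>R: "\<rho> \<in> ?Rg" using \<rho> by (auto simp: stab_def \<rho>_def restrict_id_def)
    define \<kappa> where "\<kappa> = \<pi> \<circ> Hilbert_Choice.inv \<rho>"
    have \<kappa>: "\<kappa> permutes P" unfolding \<kappa>_def by (rule permutes_compose[OF permutes_inv[OF \<rho>] \<pi>])
    have \<pi>eq: "\<pi> = \<kappa> \<circ> \<rho>" unfolding \<kappa>_def comp_assoc permutes_inv_o[OF \<rho>] by simp
    have "col (\<kappa> p) = col p" if p: "p \<in> P" for p
    proof -
      obtain a where a: "a \<in> P" "p = \<rho> a" using p permutes_image[OF \<rho>] by blast
      have "\<kappa> p = \<pi> a" unfolding \<pi>eq a(2) by simp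
      then show ?thesis using a by (simp add: \<rho>_def restrict_id_def col_def)
    qed
    then have "\<kappa> \<in> ?Cg" using \<kappa> by (simp add: stab_def)
    then show ?thesis using \<rho>R \<pi>eq by blast
  qed
  have F5: "A' id \<noteq> 0"
  proof -
    have "Eb b (R id b) \<noteq> 0" if b: "b \<le> q" for b
    proof (cases "b < q")
      case True
      show ?thesis
      proof (rule alternating_full_nonzero[OF Eb fin_row _ R_in[OF permutes_id b]])
        show "card (row b) = k ^ d" using True ck by (simp add: card_row rw_def)
        show "inj_on (seq_of_tuple d (row b) (R id b)) (row b)"
        proof (rule inj_onI)
          fix a a' assume a: "a \<in> row b" "a' \<in> row b"
            and eq: "seq_of_tuple d (row b) (R id b) a = seq_of_tuple d (row b) (R id b) a'"
          have "pt (col a) = pt (col a')" using eq R_seq[OF permutes_id b] a by simp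
          moreover have "a \<in> P" "a' \<in> P" using row_sub[OF b] a by auto
          ultimately have "col a = col a'" by (intro inj_onD[OF pt_inj] col_in)
          then show "a = a'" using a by (auto simp: row_def col_def)
        qed
      qed
    next
      case False
      then have bq: "b = q" using b by simp
      have "R id b = vr" unfolding bq
      proof (rule word_tuples_eqI[OF R_in[OF permutes_id] vr(1)])
        fix l a assume la: "l < d" "a \<in> row q"
        obtain j x where a: "a = (q, j, x)" "j < r" "x < k" using la(2) by (auto simp: row_def rw_def)
        show "R id q l a = vr l a"
          using la pt(2)[OF a(2,3)] by (simp add: R_def col_def a(1) seq_of_tuple_def)
      qed simp
      then show ?thesis using vr(2) bq by simp
    qed
    then show ?thesis by (simp add: A'_def)
  qed
  define F where "F = (\<lambda>y. \<Sum>\<rho>\<in>?Rg. T (y \<circ> \<rho>))"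
  let ?Y = "P \<rightarrow>\<^sub>E ?B"
  have finY: "finite ?Y" using finP by (intro finite_PiE) auto
  have finR: "finite ?Rg" by (rule finite_stab[OF finP])
  have cardR: "of_nat (card ?Rg) \<noteq> (0 :: complex)" using finR id_stab[of P fst] by (auto simp: card_eq_0_iff)
  \<comment> \<open>\<open>F\<close> and \<open>T\<close> define the same polynomial in
    \<open>g\<close> up to the number of row permutations, and for \<open>T\<close> it factors into
    the nonzero values of the column forms.\<close>
  have F6: "\<exists>y\<in>?Y. F y \<noteq> 0"
  proof (rule ccontr)
    assume F0: "\<not> ?thesis"
    have "0 = (\<Sum>y\<in>?Y. F y * (\<Prod>a\<in>P. g (fst a) (y a)))" using F0 by simp
    also have "\<dots> = (\<Sum>\<rho>\<in>?Rg. \<Sum>y\<in>?Y. T (y \<circ> \<rho>) * (\<Prod>a\<in>P. g (fst a) (y a)))"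
      unfolding F_def sum_distrib_right by (rule sum.swap)
    also have "\<dots> = (\<Sum>\<rho>\<in>?Rg. \<Sum>y\<in>?Y. T y * (\<Prod>a\<in>P. g (fst a) (y a)))"
      by (rule sum.cong[OF refl]) (rule sum_stab_monomial)
    also have "\<dots> = of_nat (card ?Rg) * (\<Sum>y\<in>?Y. T y * (\<Prod>a\<in>P. g (fst a) (y a)))" by simp
    also have "(\<Sum>y\<in>?Y. T y * (\<Prod>a\<in>P. g (fst a) (y a)))
      = (\<Sum>y\<in>?Y. \<Prod>j\<in>{..<c}. \<tau> j (restrict y (copy j)) * (\<Prod>a\<in>copy j. g (fst a) (restrict y (copy j) a)))"
    proof (rule sum.cong[OF refl])
      fix y
      have "(\<Prod>a\<in>P. g (fst a) (y a)) = (\<Prod>j\<in>{..<c}. \<Prod>a\<in>copy j. g (fst a) (y a))"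
        unfolding P_copy using fin_copy copy_disj by (intro prod.UNION_disjoint) auto
      then show "T y * (\<Prod>a\<in>P. g (fst a) (y a))
        = (\<Prod>j\<in>{..<c}. \<tau> j (restrict y (copy j)) * (\<Prod>a\<in>copy j. g (fst a) (restrict y (copy j) a)))"
        by (simp add: T_def prod.distrib)
    qed
    also have "\<dots> = (\<Prod>j\<in>{..<c}. form_val (copy j) ?B fst (\<tau> j) g)"
      unfolding form_val_def P_copy
      by (rule sum_prod_blocks[where f = "\<lambda>j y. \<tau> j y * (\<Prod>a\<in>copy j. g (fst a) (y a))"])
        (use fin_copy copy_disj in auto)
    finally show False using \<tau>g cardR by simp
  qed
  \<comment> \<open>The hermitian product of \<open>T\<close> with its row symmetrisation. Since
    \<open>F\<close> is invariant under row permutations, \<open>N\<close> is the squared norm of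
    \<open>F\<close> divided by their number.\<close>
  define N where "N = (\<Sum>y\<in>?Y. cnj (T y) * F y)"
  have FR: "F (y \<circ> \<rho>) = F y" if "\<rho> \<in> ?Rg" for y \<rho>
    unfolding F_def using sum_stab_left[OF that, of "\<lambda>\<rho>. T (y \<circ> \<rho>)"] by (simp add: o_assoc)
  have N0: "N \<noteq> 0"
  proof -
    have "of_nat (card ?Rg) * N = (\<Sum>\<rho>\<in>?Rg. \<Sum>y\<in>?Y. cnj (T (y \<circ> \<rho>)) * F (y \<circ> \<rho>))"
      unfolding N_def by (simp add: sum_PiE_permutes[OF stab_permutes, of _ _ fst "\<lambda>y. cnj (T y) * F y"])
    also have "\<dots> = (\<Sum>\<rho>\<in>?Rg. \<Sum>y\<in>?Y. cnj (T (y \<circ> \<rho>)) * F y)"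
      by (intro sum.cong refl) (simp add: FR)
    also have "\<dots> = (\<Sum>y\<in>?Y. cnj (F y) * F y)"
      by (subst sum.swap) (simp add: F_def sum_distrib_right)
    also have "\<dots> = of_real (\<Sum>y\<in>?Y. (cmod (F y))\<^sup>2)"
      by (simp add: complex_norm_square mult.commute del: of_real_power)
    finally have *: "of_nat (card ?Rg) * N = of_real (\<Sum>y\<in>?Y. (cmod (F y))\<^sup>2)" .
    obtain y0 where y0: "y0 \<in> ?Y" "F y0 \<noteq> 0" using F6 by blast
    have "(\<Sum>y\<in>?Y. (cmod (F y))\<^sup>2) > 0"
      by (rule sum_pos2[OF finY y0(1)]) (use y0(2) in auto)
    then have "of_nat (card ?Rg) * N \<noteq> 0" unfolding * of_real_eq_0_iff by (rule less_imp_neq[symmetric])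
    then show ?thesis by (rule contrapos_nn) simp
  qed
  have "\<exists>y\<in>?Y. antisymmetrize (d + 2) P \<Phi> (vy y) \<noteq> 0"
  proof (rule ccontr)
    assume "\<not> ?thesis"
    then have zero: "antisymmetrize (d + 2) P \<Phi> (vy y) = 0" if "y \<in> ?Y" for y using that by blast
    let ?S = "{\<pi>. \<pi> permutes P}"
    have finS: "finite ?S" by (rule finite_permutations[OF finP])
    \<comment> \<open>Pair the antisymmetrisation with \<open>T\<close> and shift by each row
      permutation \<open>\<rho>\<close>. Summed over \<open>\<rho>\<close>, every
      \<open>\<pi>\<close> with \<open>A' \<pi>\<close> nonzero contributes the same number
      \<open>A' id * N\<close>, because the signs of its row and column parts cancel; so the total
      cannot vanish.\<close>
    define trm where "trm = (\<lambda>\<pi> \<rho>. of_int (sign \<pi>) * A' \<pi> * (\<Sum>y\<in>?Y. cnj (T y) * T (y \<circ> \<pi> \<circ> \<rho>)))"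
    have "0 = (\<Sum>y\<in>?Y. cnj (T y) * antisymmetrize (d + 2) P \<Phi> (vy y))"
      by (rule sum.neutral[symmetric], intro ballI, subst zero) simp_all
    also have "\<dots> = (\<Sum>y\<in>?Y. \<Sum>\<pi>\<in>?S. of_int (sign \<pi>) * A' \<pi> * (cnj (T y) * T (y \<circ> \<pi>)))"
      unfolding antisymmetrize_def sum_distrib_left
      by (intro sum.cong refl, subst \<Phi>_act) (simp_all only: mem_Collect_eq ac_simps)
    also have "\<dots> = (\<Sum>\<pi>\<in>?S. of_int (sign \<pi>) * A' \<pi> * (\<Sum>y\<in>?Y. cnj (T y) * T (y \<circ> \<pi>)))"
      by (subst sum.swap) (simp add: sum_distrib_left)
    finally have z1: "(\<Sum>\<pi>\<in>?S. of_int (sign \<pi>) * A' \<pi> * (\<Sum>y\<in>?Y. cnj (T y) * T (y \<circ> \<pi>))) = 0" by simp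
    have z2: "(\<Sum>\<pi>\<in>?S. trm \<pi> \<rho>) = 0" if \<rho>: "\<rho> \<in> ?Rg" for \<rho>
    proof -
      note p = stab_permutes[OF \<rho>]
      have "(\<Sum>\<pi>\<in>?S. trm \<pi> \<rho>) = (\<Sum>\<pi>\<in>?S. of_int (sign (\<pi> \<circ> \<rho>)) * A' (\<pi> \<circ> \<rho>) * (\<Sum>y\<in>?Y. cnj (T y) * T (y \<circ> (\<pi> \<circ> \<rho>))))"
      proof (rule sum.cong[OF refl])
        fix \<pi> assume "\<pi> \<in> ?S"
        then have \<pi>: "\<pi> permutes P" by simp
        have "of_int (sign (\<pi> \<circ> \<rho>)) * A' (\<pi> \<circ> \<rho>) = of_int (sign \<rho> * sign \<rho>) * (of_int (sign \<pi>) * A' \<pi>)"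
          unfolding F1[OF \<pi> \<rho>] sign_permutes_compose[OF \<pi> p finP] of_int_mult by (simp only: ac_simps)
        then have "of_int (sign (\<pi> \<circ> \<rho>)) * A' (\<pi> \<circ> \<rho>) = of_int (sign \<pi>) * A' \<pi>"
          unfolding sign_mult_self by simp
        then show "trm \<pi> \<rho> = of_int (sign (\<pi> \<circ> \<rho>)) * A' (\<pi> \<circ> \<rho>) * (\<Sum>y\<in>?Y. cnj (T y) * T (y \<circ> (\<pi> \<circ> \<rho>)))"
          unfolding trm_def by (simp only: comp_assoc)
      qed
      also have "\<dots> = 0"
        using sum_permutations_right[OF p, of "\<lambda>\<pi>. of_int (sign \<pi>) * A' \<pi> * (\<Sum>y\<in>?Y. cnj (T y) * T (y \<circ> \<pi>))"] z1 by simp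
      finally show ?thesis .
    qed
    have good: "(\<Sum>\<rho>\<in>?Rg. trm \<pi> \<rho>) = of_bool (A' \<pi> \<noteq> 0) * (A' id * N)" if \<pi>: "\<pi> permutes P" for \<pi>
    proof (cases "A' \<pi> = 0")
      case True
      then show ?thesis by (simp add: trm_def)
    next
      case False
      then obtain \<kappa> \<rho>0 where kr: "\<kappa> \<in> ?Cg" "\<rho>0 \<in> ?Rg" "\<pi> = \<kappa> \<circ> \<rho>0" using F4[OF \<pi>] by blast
      note pk = stab_permutes[OF kr(1)] and pr = stab_permutes[OF kr(2)]
      have a: "of_int (sign \<pi>) * A' \<pi> = of_int (sign \<kappa>) * A' id"
      proof -
        have "A' \<pi> = of_int (sign \<rho>0) * A' id"
          unfolding kr(3) F2[OF kr(1) pr] using F1[OF permutes_id kr(2)] by simp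
        then have "of_int (sign \<pi>) * A' \<pi> = of_int (sign \<rho>0 * sign \<rho>0) * (of_int (sign \<kappa>) * A' id)"
          unfolding kr(3) sign_permutes_compose[OF pk pr finP] of_int_mult by (simp only: ac_simps)
        then show ?thesis unfolding sign_mult_self by simp
      qed
      have "(\<Sum>\<rho>\<in>?Rg. \<Sum>y\<in>?Y. cnj (T y) * T (y \<circ> \<pi> \<circ> \<rho>)) = (\<Sum>y\<in>?Y. cnj (T y) * F (y \<circ> \<pi>))"
        by (subst sum.swap) (simp add: F_def sum_distrib_left)
      also have "\<dots> = (\<Sum>y\<in>?Y. cnj (T y) * F (y \<circ> \<kappa>))"
        unfolding kr(3) o_assoc FR[OF kr(2)] ..
      also have "\<dots> = (\<Sum>y\<in>?Y. of_int (sign \<kappa>) * (cnj (T (y \<circ> \<kappa>)) * F (y \<circ> \<kappa>)))"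
      proof (rule sum.cong[OF refl])
        fix y assume y: "y \<in> ?Y"
        have "of_int (sign \<kappa>) * cnj (T (y \<circ> \<kappa>)) = of_int (sign \<kappa> * sign \<kappa>) * cnj (T y)"
          unfolding F3[OF kr(1) y] of_int_mult by simp
        then have "of_int (sign \<kappa>) * cnj (T (y \<circ> \<kappa>)) = cnj (T y)" unfolding sign_mult_self by simp
        then show "cnj (T y) * F (y \<circ> \<kappa>) = of_int (sign \<kappa>) * (cnj (T (y \<circ> \<kappa>)) * F (y \<circ> \<kappa>))"
          by (simp only: mult.assoc[symmetric])
      qed
      also have "\<dots> = of_int (sign \<kappa>) * N"
        unfolding sum_distrib_left[symmetric] N_def
        by (subst sum_PiE_permutes[OF pk, of "\<lambda>y. cnj (T y) * F y"]) simp
      finally have b: "(\<Sum>\<rho>\<in>?Rg. \<Sum>y\<in>?Y. cnj (T y) * T (y \<circ> \<pi> \<circ> \<rho>)) = of_int (sign \<kappa>) * N" .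
      have "(\<Sum>\<rho>\<in>?Rg. trm \<pi> \<rho>) = (of_int (sign \<kappa>) * A' id) * (of_int (sign \<kappa>) * N)"
        unfolding trm_def sum_distrib_left[symmetric] a b ..
      also have "\<dots> = of_int (sign \<kappa> * sign \<kappa>) * (A' id * N)" unfolding of_int_mult by (simp only: ac_simps)
      finally show ?thesis unfolding sign_mult_self using False by simp
    qed
    have "0 = (\<Sum>\<rho>\<in>?Rg. \<Sum>\<pi>\<in>?S. trm \<pi> \<rho>)" by (simp add: z2)
    also have "\<dots> = (\<Sum>\<pi>\<in>?S. \<Sum>\<rho>\<in>?Rg. trm \<pi> \<rho>)" by (rule sum.swap)
    also have "\<dots> = (\<Sum>\<pi>\<in>?S. of_bool (A' \<pi> \<noteq> 0) * (A' id * N))" by (rule sum.cong) (use good in auto)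
    also have "\<dots> = of_nat (card {\<pi>\<in>?S. A' \<pi> \<noteq> 0}) * (A' id * N)"
      unfolding sum_distrib_right[symmetric] using finS by (simp add: sum.If_cases of_bool_def Int_def)
    finally have "card {\<pi>\<in>?S. A' \<pi> \<noteq> 0} = 0" using F5 N0 by simp
    moreover have "id \<in> {\<pi>\<in>?S. A' \<pi> \<noteq> 0}" using F5 by (simp add: permutes_id)
    ultimately show False using finS by (auto simp: card_eq_0_iff)
  qed
  then obtain y where y: "y \<in> ?Y" "antisymmetrize (d + 2) P \<Phi> (vy y) \<noteq> 0" by blast
  have "inv_tensor (d + 2) (\<lambda>_. k) P 1 (antisymmetrize (d + 2) P \<Phi>)"
    by (rule inv_tensor_antisymmetrize[OF finP _ vy_in[OF y(1)] y(2)]) (rule inv)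
  from inv_tensor_transfer_ex[OF this finP, of "{..<(q * c + r) * k}"] show ?thesis
    by (simp add: has_alternating_def cardP c_def)
qed

subsection \<open>Power sums of the determinant form\<close>

lemma Y_block:
  assumes u1: "\<And>a. a < n * k \<Longrightarrow> u a < n" and u2: "\<And>a. n * k \<le> a \<Longrightarrow> a < (n + m) * k \<Longrightarrow> n \<le> u a"
    and v: "\<And>a. a < n * k \<Longrightarrow> v a < k"
  shows "Y (n + m) k u v = Y n k u v * Y m k (\<lambda>a. u (n * k + a) - n) (\<lambda>a. v (n * k + a))"
proof -
  have 1: "u a * k + v a < n * k" if "a < n * k" for a
  proof -
    have "u a * k + v a < Suc (u a) * k" using v[OF that] by simp
    also have "\<dots> \<le> n * k" using u1[OF that] by (intro mult_le_mono1) simp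
    finally show ?thesis .
  qed
  have 2: "n * k \<le> u a * k + v a" if "n * k \<le> a" "a < n * k + m * k" for a
    using mult_le_mono1[OF u2[OF that(1)], of k] that(2) by (simp only: trans_le_add1 add_mult_distrib)
  have "perm_sign (n * k + m * k) (\<lambda>a. u a * k + v a)
    = perm_sign (n * k) (\<lambda>a. u a * k + v a) * perm_sign (m * k) (\<lambda>a. u (n * k + a) * k + v (n * k + a) - n * k)"
    by (rule perm_sign_append[OF 1 2])
  also have "perm_sign (m * k) (\<lambda>a. u (n * k + a) * k + v (n * k + a) - n * k)
    = perm_sign (m * k) (\<lambda>a. (u (n * k + a) - n) * k + v (n * k + a))"
  proof (rule perm_sign_cong)
    fix a assume "a < m * k"
    then have "n \<le> u (n * k + a)" by (intro u2) (auto simp: add_mult_distrib)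
    then obtain t where "u (n * k + a) = n + t" using le_Suc_ex by blast
    then show "u (n * k + a) * k + v (n * k + a) - n * k = (u (n * k + a) - n) * k + v (n * k + a)"
      by (simp add: add_mult_distrib)
  qed
  finally show ?thesis by (simp add: Y_def add_mult_distrib)
qed

text \<open>The sum over \<open>u\<close> of the \<open>d\<close>-fold tensor powers of the forms
  \<open>Y n k u\<close>; for odd \<open>d\<close> it alternates in the positions.\<close>

definition omega :: "nat \<Rightarrow> nat \<Rightarrow> nat \<Rightarrow> (nat \<Rightarrow> nat \<Rightarrow> nat) \<Rightarrow> complex" where
  "omega d k n v = (\<Sum>u\<in>words {..<n * k} n. \<Prod>l<d. Y n k u (v l))"

lemma omega_cong:
  assumes "\<And>l a. l < d \<Longrightarrow> a < n * k \<Longrightarrow> v l a = v' l a"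
  shows "omega d k n v = omega d k n v'"
  unfolding omega_def using assms by (intro sum.cong prod.cong refl Y_cong) auto

lemma omega_perm:
  assumes \<pi>: "\<pi> permutes {..<n * k}"
  shows "omega d k n (\<lambda>l. v l \<circ> \<pi>) = of_int (sign \<pi>) ^ d * omega d k n v"
proof -
  have "omega d k n (\<lambda>l. v l \<circ> \<pi>) = (\<Sum>u\<in>words {..<n * k} n. \<Prod>l<d. Y n k (u \<circ> \<pi>) (v l \<circ> \<pi>))"
    unfolding omega_def by (rule sum_PiE_permutes[OF \<pi>, symmetric])
  also have "\<dots> = (\<Sum>u\<in>words {..<n * k} n. of_int (sign \<pi>) ^ d * (\<Prod>l<d. Y n k u (v l)))"
    by (simp add: Y_perm[OF \<pi>] prod.distrib)
  finally show ?thesis by (simp add: omega_def sum_distrib_left)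
qed

lemma has_alternating_of_omega:
  assumes d: "odd d" and v: "\<And>l a. l < d \<Longrightarrow> a < n * k \<Longrightarrow> v l a < k" and nz: "omega d k n v \<noteq> 0"
  shows "has_alternating d k n"
proof -
  let ?I = "{..<n * k}" and ?V = "word_tuples d (\<lambda>_. k) {..<n * k}"
  define v' where "v' = (\<lambda>l\<in>{..<d}. \<lambda>a\<in>?I. v l a)"
  have v': "v' \<in> ?V"
    unfolding v'_def word_tuples_def using v by (intro restrict_PiE_iff[THEN iffD2] ballI) simp
  have "omega d k n v' = omega d k n v" by (rule omega_cong) (simp add: v'_def)
  then have nz': "omega d k n v' \<noteq> 0" using nz by simp
  have alt: "omega d k n (act d \<pi> w) = of_int (sign \<pi>) ^ 1 * omega d k n w" if \<pi>: "\<pi> permutes ?I" for \<pi> w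
  proof -
    have "(of_int (sign \<pi>) :: complex) ^ d = of_int (sign \<pi>)"
      using d by (cases rule: sign_cases[of \<pi>]) (auto simp: uminus_power_if)
    moreover have "omega d k n (act d \<pi> w) = omega d k n (\<lambda>l. w l \<circ> \<pi>)"
      by (rule omega_cong) (simp add: act_def)
    ultimately show ?thesis using omega_perm[OF \<pi>, of d w] by simp
  qed
  have inv: "sl_inv ?I k (\<lambda>x. omega d k n (w(l := x)))" if l: "l < d" for l w
  proof (rule sl_inv_congI)
    show "sl_inv ?I k (\<lambda>x. \<Sum>u\<in>words ?I n. (\<Prod>i\<in>{..<d} - {l}. Y n k u (w i)) * Y n k u x)"
      by (intro sl_inv_sum sl_inv_Y_right)
    fix x
    show "omega d k n (w(l := x)) = (\<Sum>u\<in>words ?I n. (\<Prod>i\<in>{..<d} - {l}. Y n k u (w i)) * Y n k u x)"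
      unfolding omega_def
    proof (rule sum.cong[OF refl])
      fix u
      have "(\<Prod>i<d. Y n k u ((w(l := x)) i)) = Y n k u x * (\<Prod>i\<in>{..<d} - {l}. Y n k u ((w(l := x)) i))"
        using l by (subst prod.remove[of _ l]) auto
      also have "(\<Prod>i\<in>{..<d} - {l}. Y n k u ((w(l := x)) i)) = (\<Prod>i\<in>{..<d} - {l}. Y n k u (w i))"
        by (intro prod.cong) auto
      finally show "(\<Prod>i<d. Y n k u ((w(l := x)) i)) = (\<Prod>i\<in>{..<d} - {l}. Y n k u (w i)) * Y n k u x" by simp
    qed
  qed
  have "inv_tensor d (\<lambda>_. k) ?I 1 (omega d k n)"
    unfolding inv_tensor_def
  proof (intro conjI allI impI ballI)
    show "\<exists>v\<in>?V. omega d k n v \<noteq> 0" by (rule bexI[where x = v'], rule nz', rule v')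
  qed (rule alt inv, assumption)+
  then show ?thesis unfolding has_alternating_def by (rule exI[where x = "omega d k n"])
qed

text \<open>On these labelings the determinant form splits into one for the labels below
  \<open>n\<close> and one for the others.\<close>

definition block_words :: "nat \<Rightarrow> nat \<Rightarrow> nat \<Rightarrow> (nat \<Rightarrow> nat) set" where
  "block_words k n m = {u \<in> words {..<(n + m) * k} (n + m). \<forall>a<(n + m) * k. u a < n \<longleftrightarrow> a < n * k}"

lemma sum_block_words:
  assumes v: "\<And>l a. l < d \<Longrightarrow> a < n * k \<Longrightarrow> v l a < k"
  shows "(\<Sum>u\<in>block_words k n m. \<Prod>l<d. Y (n + m) k u (v l))
    = omega d k n v * omega d k m (\<lambda>l a. v l (n * k + a))"
proof -
  let ?W = "words {..<n * k} n \<times> words {..<m * k} m"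
  let ?j = "\<lambda>u. (\<lambda>a\<in>{..<n * k}. u a, \<lambda>a\<in>{..<m * k}. u (n * k + a) - n :: nat)"
  let ?i = "\<lambda>(u1, u2). \<lambda>a\<in>{..<(n + m) * k}. if a < n * k then u1 a else n + u2 (a - n * k) :: nat"
  have "(\<Sum>u\<in>block_words k n m. \<Prod>l<d. Y (n + m) k u (v l))
    = (\<Sum>(u1, u2)\<in>?W. (\<Prod>l<d. Y n k u1 (v l)) * (\<Prod>l<d. Y m k u2 (\<lambda>a. v l (n * k + a))))"
  proof (rule sum.reindex_bij_witness[of _ ?i ?j])
    fix u assume u: "u \<in> block_words k n m"
    have uw: "u \<in> words {..<(n + m) * k} (n + m)" using u by (simp add: block_words_def)
    have 1: "u a < n" if "a < n * k" for a
      using u that by (simp add: block_words_def add_mult_distrib)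
    have 2: "n \<le> u a" if "n * k \<le> a" "a < (n + m) * k" for a
      using u that by (simp add: block_words_def flip: not_less)
    have 3: "u (n * k + a) < n + m" if "a < m * k" for a
      by (rule words_lt[OF uw]) (simp add: that add_mult_distrib)
    show "?j u \<in> ?W"
      unfolding mem_Sigma_iff
    proof (intro conjI restrict_PiE_iff[THEN iffD2] ballI)
      fix a assume "a \<in> {..<m * k}"
      then have a: "a < m * k" by simp
      have "n \<le> u (n * k + a)" using a by (intro 2) (simp_all add: add_mult_distrib)
      then show "u (n * k + a) - n \<in> {..<m}" using 3[OF a] by simp
    qed (use 1 in simp)
    show "?i (?j u) = u"
    proof
      fix a show "?i (?j u) a = u a"
      proof (cases "a < (n + m) * k")
        case True
        then show ?thesis using 2[of a] by (auto simp: add_mult_distrib)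
      next
        case False
        then show ?thesis using PiE_arb[OF uw, of a] by simp
      qed
    qed
    show "(case ?j u of (u1, u2) \<Rightarrow> (\<Prod>l<d. Y n k u1 (v l)) * (\<Prod>l<d. Y m k u2 (\<lambda>a. v l (n * k + a))))
      = (\<Prod>l<d. Y (n + m) k u (v l))"
      unfolding prod.case prod.distrib[symmetric]
    proof (rule prod.cong[OF refl])
      fix l assume "l \<in> {..<d}"
      then have l: "l < d" by simp
      have "Y (n + m) k u (v l) = Y n k u (v l) * Y m k (\<lambda>a. u (n * k + a) - n) (\<lambda>a. v l (n * k + a))"
        by (rule Y_block[OF 1 2 v[OF l]])
      also have "Y n k u (v l) = Y n k (\<lambda>a\<in>{..<n * k}. u a) (v l)" by (rule Y_cong) auto
      also have "Y m k (\<lambda>a. u (n * k + a) - n) (\<lambda>a. v l (n * k + a))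
        = Y m k (\<lambda>a\<in>{..<m * k}. u (n * k + a) - n) (\<lambda>a. v l (n * k + a))" by (rule Y_cong) auto
      finally show "Y n k (\<lambda>a\<in>{..<n * k}. u a) (v l) * Y m k (\<lambda>a\<in>{..<m * k}. u (n * k + a) - n) (\<lambda>a. v l (n * k + a))
        = Y (n + m) k u (v l)" by (rule sym)
    qed
  next
    fix w assume w: "w \<in> ?W"
    obtain u1 u2 where w12: "w = (u1, u2)" by (cases w)
    have u1: "u1 \<in> words {..<n * k} n" and u2: "u2 \<in> words {..<m * k} m" using w by (simp_all add: w12)
    have b1: "u1 a < n" if "a < n * k" for a using words_lt[OF u1] that by simp
    have b2: "u2 a < m" if "a < m * k" for a using words_lt[OF u2] that by simp
    show "?i w \<in> block_words k n m"
      unfolding w12 prod.case block_words_def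
    proof (intro CollectI conjI restrict_PiE_iff[THEN iffD2] ballI allI impI)
      fix a assume "a \<in> {..<(n + m) * k}"
      then show "(if a < n * k then u1 a else n + u2 (a - n * k)) \<in> {..<n + m}"
        using b1[of a] b2[of "a - n * k"] by (auto simp: add_mult_distrib)
    qed (use b1 in auto)
    show "?j (?i w) = w"
      unfolding w12 prod.case prod.inject
    proof (intro conjI ext)
      fix a show "(\<lambda>a\<in>{..<n * k}. (\<lambda>a\<in>{..<(n + m) * k}. if a < n * k then u1 a else n + u2 (a - n * k)) a) a = u1 a"
        using PiE_arb[OF u1, of a] by (simp add: add_mult_distrib)
      show "(\<lambda>a\<in>{..<m * k}. (\<lambda>a\<in>{..<(n + m) * k}. if a < n * k then u1 a else n + u2 (a - n * k)) (n * k + a) - n) a = u2 a"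
        using PiE_arb[OF u2, of a] by (simp add: add_mult_distrib)
    qed
  qed
  then show ?thesis unfolding omega_def sum_product sum.cartesian_product .
qed

text \<open>
  Sort the labels \<open>u\<close> by the set \<open>A\<close> of positions with label below \<open>n\<close>: each class contributes, up to sign, a
  product with a factor \<open>omega d k n\<close>.
\<close>

lemma omega_mono:
  assumes d: "d > 0" and v: "\<And>l a. l < d \<Longrightarrow> a < N * k \<Longrightarrow> v l a < k" and nz: "omega d k N v \<noteq> 0" and n: "n \<le> N"
  shows "\<exists>v'. (\<forall>l<d. \<forall>a<n * k. v' l a < k) \<and> omega d k n v' \<noteq> 0"
proof (rule ccontr)
  assume "\<not> ?thesis"
  then have zero: "omega d k n v' = 0" if "\<And>l a. l < d \<Longrightarrow> a < n * k \<Longrightarrow> v' l a < k" for v'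
    using that by blast
  define m where "m = N - n"
  have N: "N = n + m" using n by (simp add: m_def)
  let ?I = "{..<N * k}"
  have sub: "{..<n * k} \<subseteq> ?I" by (auto simp: N add_mult_distrib)
  define f where "f = (\<lambda>u. \<Prod>l<d. Y N k u (v l))"
  have 0: "(\<Sum>u\<in>words ?I N. of_bool (\<forall>a<N * k. u a < n \<longleftrightarrow> a \<in> A) * f u) = 0" if A: "A \<subseteq> ?I" for A
  proof (cases "card A = n * k")
    case False
    \<comment> \<open>A nonzero term uses every label exactly \<open>k\<close> times, so the labels
      below \<open>n\<close> occupy \<open>n * k\<close> positions.\<close>
    have "f u = 0" if u: "u \<in> words ?I N" and uA: "\<forall>a<N * k. u a < n \<longleftrightarrow> a \<in> A" for u
    proof (rule ccontr)
      assume "f u \<noteq> 0"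
      then have "Y N k u (v 0) \<noteq> 0" using d by (auto simp: f_def)
      moreover have "Y N k u (v 0) = Y N k u (\<lambda>a\<in>?I. v 0 a)" by (rule Y_cong) auto
      moreover have "(\<lambda>a\<in>?I. v 0 a) \<in> words ?I k" using v[OF d] by (intro restrict_PiE_iff[THEN iffD2] ballI) simp
      ultimately have bal: "card {a\<in>?I. u a = i} = k" if "i < N" for i
        by (intro Y_balanced[OF u _ _ that, of "\<lambda>a\<in>?I. v 0 a"]) simp_all
      have "A = (\<Union>i\<in>{..<n}. {a\<in>?I. u a = i})" using A uA by auto
      also have "card \<dots> = (\<Sum>i\<in>{..<n}. card {a\<in>?I. u a = i})" by (rule card_UN_disjoint) auto
      also have "\<dots> = n * k" using bal n by simp
      finally show False using False by simp
    qed
    then show ?thesis by (intro sum.neutral ballI) (simp only: mult_eq_0_iff of_bool_eq_0_iff, blast)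
  next
    case True
    have "finite A" using A finite_subset by blast
    then obtain g where g: "bij_betw g {..<n * k} A" using True finite_same_card_bij[of "{..<n * k}" A] by auto
    have "\<exists>h. bij_betw h ?I ?I \<and> (\<forall>a\<in>{..<n * k}. h a = g a)"
      using g A by (intro bij_betw_extension sub) (auto simp: bij_betw_def)
    then obtain h where h: "bij_betw h ?I ?I" "\<And>a. a < n * k \<Longrightarrow> h a = g a" by auto
    obtain \<pi> where \<pi>: "\<pi> permutes ?I" "\<And>a. a < N * k \<Longrightarrow> h a = \<pi> a" 
    proof (rule bij_betw_lessThan_permutes[OF h(1)], goal_cases)
      case (1 p)
      then show ?case by (intro that[of p])
    qed
    have "\<pi> a = g a" if "a < n * k" for a
      using \<pi>(2)[of a] h(2)[OF that] sub that by (auto simp: subset_iff)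
    then have "\<pi> ` {..<n * k} = g ` {..<n * k}" by (intro image_cong) simp_all
    then have \<pi>A: "\<pi> ` {..<n * k} = A" using g by (simp add: bij_betw_def)
    have \<pi>_iff: "\<pi> a \<in> A \<longleftrightarrow> a < n * k" for a
      unfolding \<pi>A[symmetric] using permutes_inj[OF \<pi>(1)] by (auto simp: inj_eq)
    note ip = permutes_inv[OF \<pi>(1)]
    let ?ip = "Hilbert_Choice.inv \<pi>"
    have f_ip: "f (u \<circ> ?ip) = of_int (sign ?ip) ^ d * (\<Prod>l<d. Y N k u (v l \<circ> \<pi>))" for u
    proof -
      have "Y N k (u \<circ> ?ip) (v l) = of_int (sign ?ip) * Y N k u (v l \<circ> \<pi>)" for l
        using Y_perm[OF ip, of u "v l \<circ> \<pi>"] unfolding comp_assoc permutes_inv_o(1)[OF \<pi>(1)] by simp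
      then show ?thesis by (simp add: f_def prod.distrib)
    qed
    have cond: "(\<forall>a<N * k. (u \<circ> ?ip) a < n \<longleftrightarrow> a \<in> A) \<longleftrightarrow> (\<forall>a<N * k. u a < n \<longleftrightarrow> a < n * k)" (is "?L \<longleftrightarrow> ?R") for u
    proof
      assume L: ?L
      show ?R
      proof (intro allI impI)
        fix a assume "a < N * k"
        then have "\<pi> a < N * k" using permutes_in_image[OF \<pi>(1), of a] by simp
        then show "u a < n \<longleftrightarrow> a < n * k" using L \<pi>_iff[of a] permutes_inverses(2)[OF \<pi>(1), of a] by auto
      qed
    next
      assume R: ?R
      show ?L
      proof (intro allI impI)
        fix a assume "a < N * k"
        then have "?ip a < N * k" using permutes_in_image[OF ip, of a] by simp
        then show "(u \<circ> ?ip) a < n \<longleftrightarrow> a \<in> A" using R \<pi>_iff[of "?ip a"] permutes_inverses(1)[OF \<pi>(1), of a] by auto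
      qed
    qed
    have "(\<Sum>u\<in>words ?I N. of_bool (\<forall>a<N * k. u a < n \<longleftrightarrow> a \<in> A) * f u)
      = (\<Sum>u\<in>words ?I N. of_bool (\<forall>a<N * k. (u \<circ> ?ip) a < n \<longleftrightarrow> a \<in> A) * f (u \<circ> ?ip))"
      by (rule sum_PiE_permutes[OF ip, symmetric])
    also have "\<dots> = (\<Sum>u\<in>words ?I N. of_bool (\<forall>a<N * k. u a < n \<longleftrightarrow> a < n * k) * (of_int (sign ?ip) ^ d * (\<Prod>l<d. Y N k u (v l \<circ> \<pi>))))"
      unfolding cond f_ip ..
    also have "\<dots> = (\<Sum>u\<in>block_words k n m. of_int (sign ?ip) ^ d * (\<Prod>l<d. Y N k u (v l \<circ> \<pi>)))"
      unfolding block_words_def N[symmetric] by (simp add: finite_words sum.inter_filter of_bool_def if_distrib[where f = "\<lambda>x. x * _"] cong: if_cong)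
    also have "\<dots> = of_int (sign ?ip) ^ d * (omega d k n (\<lambda>l. v l \<circ> \<pi>) * omega d k m (\<lambda>l a. (v l \<circ> \<pi>) (n * k + a)))"
      unfolding sum_distrib_left[symmetric] N
    proof (subst sum_block_words)
      fix l a assume l: "l < d" and "a < n * k"
      then have "\<pi> a < N * k" using permutes_in_image[OF \<pi>(1), of a] rev_subsetD[OF _ sub, of a] by simp
      then show "(v l \<circ> \<pi>) a < k" using v[OF l] by simp
    qed simp
    also have "omega d k n (\<lambda>l. v l \<circ> \<pi>) = 0"
    proof (rule zero)
      fix l a assume l: "l < d" and "a < n * k"
      then have "\<pi> a < N * k" using permutes_in_image[OF \<pi>(1), of a] rev_subsetD[OF _ sub, of a] by simp
      then show "(v l \<circ> \<pi>) a < k" using v[OF l] by simp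
    qed
    finally show ?thesis by simp
  qed
  have "omega d k N v = (\<Sum>u\<in>words ?I N. \<Sum>A\<in>Pow ?I. of_bool (\<forall>a<N * k. u a < n \<longleftrightarrow> a \<in> A) * f u)"
    unfolding omega_def
  proof (rule sum.cong[OF refl])
    fix u
    have "(\<Sum>A\<in>Pow ?I. of_bool (\<forall>a<N * k. u a < n \<longleftrightarrow> a \<in> A) * f u) = (\<Sum>A\<in>{{a\<in>?I. u a < n}}. f u)"
      by (rule sum.mono_neutral_cong_right) auto
    then show "(\<Prod>l<d. Y N k u (v l)) = (\<Sum>A\<in>Pow ?I. of_bool (\<forall>a<N * k. u a < n \<longleftrightarrow> a \<in> A) * f u)"
      by (simp add: f_def)
  qed
  also have "\<dots> = 0" by (subst sum.swap) (simp add: 0)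
  finally show False using nz by simp
qed

section \<open>Relabelling letters and the doubled Latin square sum\<close>

lemma det_permutation_rows:
  assumes \<rho>: "\<rho> permutes {..<n}" and k: "even k"
  shows "det (mat n n (\<lambda>(i, j). of_bool (\<rho> i = j)) :: complex mat) ^ k = 1"
proof -
  have lt: "\<rho> i < n" if "i < n" for i using permutes_in_image[OF \<rho>, of i] that by simp
  have "mat n n (\<lambda>(i, j). of_bool (\<rho> i = j)) = mat n n (\<lambda>(i, j). 1\<^sub>m n $$ (\<rho> i, j) :: complex)"
    using lt by (intro eq_matI) auto
  then have "det (mat n n (\<lambda>(i, j). of_bool (\<rho> i = j)) :: complex mat) = of_int (sign \<rho>)"
    using det_select_rows[of "1\<^sub>m n" n \<rho>] lt perm_sign_eq_sign[OF \<rho>, of \<rho>] by simp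
  then show ?thesis using k by (cases rule: sign_cases[of \<rho>]) auto
qed

lemma sum_permutation_rows:
  assumes P: "finite P" and \<rho>: "\<rho> permutes {..<n}" and w: "w \<in> words P n"
  shows "(\<Sum>w'\<in>words P n. (\<Prod>a\<in>P. mat n n (\<lambda>(i, j). of_bool (\<rho> i = j)) $$ (w a, w' a)) * f w')
    = (f (\<lambda>a\<in>P. \<rho> (w a)) :: complex)"
proof -
  let ?X = "mat n n (\<lambda>(i, j). of_bool (\<rho> i = j)) :: complex mat"
  have w': "(\<lambda>a\<in>P. \<rho> (w a)) \<in> words P n"
  proof (intro restrict_PiE_iff[THEN iffD2] ballI)
    fix a assume "a \<in> P"
    then show "\<rho> (w a) \<in> {..<n}" using words_lt[OF w] permutes_in_image[OF \<rho>, of "w a"] by simp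
  qed
  have "(\<Prod>a\<in>P. ?X $$ (w a, w' a)) * f w' = (if w' = (\<lambda>a\<in>P. \<rho> (w a)) then f w' else 0)"
    if "w' \<in> words P n" for w'
  proof (cases "\<forall>a\<in>P. w' a = \<rho> (w a)")
    case True
    then have "w' = (\<lambda>a\<in>P. \<rho> (w a))" using PiE_arb[OF that] by (auto simp: fun_eq_iff)
    moreover have "(\<Prod>a\<in>P. ?X $$ (w a, w' a)) = 1"
      using True words_lt[OF w] words_lt[OF that] by (intro prod.neutral) auto
    ultimately show ?thesis by simp
  next
    case False
    then obtain a where a: "a \<in> P" "w' a \<noteq> \<rho> (w a)" by auto
    then have "?X $$ (w a, w' a) = 0" using words_lt[OF w] words_lt[OF that] by simp
    then have "(\<Prod>a\<in>P. ?X $$ (w a, w' a)) = 0" using a(1) P by (intro prod_zero) auto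
    then show ?thesis using a by auto
  qed
  then have "(\<Sum>w'\<in>words P n. (\<Prod>a\<in>P. ?X $$ (w a, w' a)) * f w')
    = (\<Sum>w'\<in>words P n. if w' = (\<lambda>a\<in>P. \<rho> (w a)) then f w' else 0)" by (intro sum.cong) auto
  also have "\<dots> = f (\<lambda>a\<in>P. \<rho> (w a))" using w' finite_words[OF P] by (simp add: sum.delta)
  finally show ?thesis .
qed

text \<open>A relabelling is the action of a permutation matrix, whose determinant enters with the
  even exponent \<open>k\<close>. For odd \<open>k\<close> an odd relabelling would change the
  sign.\<close>

lemma Y_relabel_left:
  assumes \<rho>: "\<rho> permutes {..<n}" and k: "even k" and w: "\<And>a. a < n * k \<Longrightarrow> w a < n" and v: "\<And>a. a < n * k \<Longrightarrow> v a < k"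
  shows "Y n k (\<lambda>a. \<rho> (w a)) v = Y n k w v"
proof -
  let ?r = "\<lambda>f :: nat \<Rightarrow> nat. restrict f {..<n * k}"
  have w': "?r w \<in> words {..<n * k} n" and v': "?r v \<in> words {..<n * k} k"
    using w v by (intro restrict_PiE_iff[THEN iffD2] ballI; simp)+
  have "Y n k (?r w) (?r v) = Y n k (\<lambda>a\<in>{..<n * k}. \<rho> (?r w a)) (?r v)"
    using Y_GL_left[OF _ w' v', of "mat n n (\<lambda>(i, j). of_bool (\<rho> i = j))"]
    unfolding sum_permutation_rows[OF finite_lessThan \<rho> w'] det_permutation_rows[OF \<rho> k] by simp
  moreover have "Y n k (?r w) (?r v) = Y n k w v" by (rule Y_cong) simp_all
  moreover have "Y n k (\<lambda>a\<in>{..<n * k}. \<rho> (?r w a)) (?r v) = Y n k (\<lambda>a. \<rho> (w a)) v" by (rule Y_cong) simp_all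
  ultimately show ?thesis by simp
qed

lemma Y_relabel_right:
  assumes \<rho>: "\<rho> permutes {..<k}" and n: "even n" and w: "\<And>a. a < n * k \<Longrightarrow> w a < n" and v: "\<And>a. a < n * k \<Longrightarrow> v a < k"
  shows "Y n k w (\<lambda>a. \<rho> (v a)) = Y n k w v"
proof -
  let ?r = "\<lambda>f :: nat \<Rightarrow> nat. restrict f {..<n * k}"
  have w': "?r w \<in> words {..<n * k} n" and v': "?r v \<in> words {..<n * k} k"
    using w v by (intro restrict_PiE_iff[THEN iffD2] ballI; simp)+
  have "Y n k (?r w) (?r v) = Y n k (?r w) (\<lambda>a\<in>{..<n * k}. \<rho> (?r v a))"
    using Y_GL_right[OF _ w' v', of "mat k k (\<lambda>(i, j). of_bool (\<rho> i = j))"]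
    unfolding sum_permutation_rows[OF finite_lessThan \<rho> v'] det_permutation_rows[OF \<rho> n] by simp
  moreover have "Y n k (?r w) (?r v) = Y n k w v" by (rule Y_cong) simp_all
  moreover have "Y n k (?r w) (\<lambda>a\<in>{..<n * k}. \<rho> (?r v a)) = Y n k w (\<lambda>a. \<rho> (v a))" by (rule Y_cong) simp_all
  ultimately show ?thesis by simp
qed

lemma Suc_mod_permutes:
  assumes "k > 0"
  shows "(\<lambda>r. if r < k then Suc r mod k else r) permutes {..<k :: nat}"
proof (rule bij_imp_permutes)
  have "(\<lambda>r. if r < k then Suc r mod k else r) ` {..<k} = {..<k}"
  proof (intro subset_antisym subsetI)
    fix y assume y: "y \<in> {..<k}"
    show "y \<in> (\<lambda>r. if r < k then Suc r mod k else r) ` {..<k}"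
    proof (cases y)
      case 0
      then show ?thesis using assms by (intro image_eqI[of _ _ "k - 1"]) auto
    next
      case (Suc z)
      then show ?thesis using y by (intro image_eqI[of _ _ z]) auto
    qed
  qed (use assms in auto)
  then show "bij_betw (\<lambda>r. if r < k then Suc r mod k else r) {..<k} {..<k}"
    unfolding bij_betw_def by (intro conjI eq_card_imp_inj_on) auto
qed auto

lemma cyclic_closed_eq:
  assumes S: "S \<subseteq> {..<k :: nat}" "x \<in> S" and step: "\<And>x. x \<in> S \<Longrightarrow> Suc x mod k \<in> S"
  shows "S = {..<k}"
proof (intro subset_antisym S(1) subsetI)
  have it: "(x + i) mod k \<in> S" for i
  proof (induction i)
    case 0
    then show ?case using S by (auto simp: subset_iff)
  next
    case (Suc i)
    then show ?case using step[OF Suc] by (simp add: mod_Suc_eq)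
  qed
  fix y assume "y \<in> {..<k}"
  moreover have "x < k" using S by auto
  ultimately have "(x + (y + (k - x))) mod k = y" by simp
  then show "y \<in> S" using it[of "y + (k - x)"] by simp
qed

text \<open>A nonzero term requires \<open>u\<close>, read as a \<open>k\<close> by \<open>k\<close>
  array, to be a Latin square. The two factors at \<open>a div k\<close> have equal signs, and the
  factor at \<open>a mod k\<close> is the product of the signs of the columns, so this is the
  Alon-Tarsi sum for order \<open>k\<close>. Up to sign it is the coefficient of
  \<open>\<Prod> X\<^sub>i\<^sub>j\<close> in \<open>det X ^ k\<close>.\<close>

definition glynn_sum :: "nat \<Rightarrow> complex" where
  "glynn_sum k = omega 3 k k (\<lambda>l a. if l < 2 then a div k else a mod k)"

text \<open>
  Two copies of the word triple of \<open>glynn_sum\<close>, the second with its middle word shifted cyclically.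
  The shift forces every label of a nonzero term to lie in a single copy.
\<close>

definition shifted_pair :: "nat \<Rightarrow> nat \<Rightarrow> nat \<Rightarrow> nat" where
  "shifted_pair k l a =
     (if a < k * k then if l < 2 then a div k else a mod k
      else if l = 0 then (a - k * k) div k else if l = 1 then Suc ((a - k * k) div k) mod k
      else (a - k * k) mod k)"

lemma lt_square_div: "a < k * k \<Longrightarrow> a div k < (k :: nat)"
  by (simp add: less_mult_imp_div_less)

lemma shifted_pair_lt:
  assumes "a < (k + k) * k"
  shows "shifted_pair k l a < k"
proof -
  have k: "k > 0" using assms by (cases k) auto
  have "a - k * k < k * k" if "\<not> a < k * k" using assms that by (simp add: add_mult_distrib)
  then show ?thesis using k lt_square_div[of a k] lt_square_div[of "a - k * k" k] by (auto simp: shifted_pair_def)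
qed

text \<open>Each of the three words maps the class \<open>C\<close> of a label bijectively to the
  letters. Where word 0 has the value \<open>x\<close> in the second copy, word 1 has
  \<open>Suc x mod k\<close>. The position of \<open>C\<close> at which word 0 has
  \<open>Suc x mod k\<close> cannot lie in the first copy: words 0 and 1 agree there, and word 1
  would repeat a value. So the values of word 0 on the second copy are closed under cyclic
  succession and leave none for the first.\<close>

lemma shifted_pair_pure:
  assumes k: "k > 0" and u: "u \<in> words {..<(k + k) * k} (k + k)"
    and nz: "\<And>l. l < 3 \<Longrightarrow> Y (k + k) k u (shifted_pair k l) \<noteq> 0"
    and ab: "a < (k + k) * k" "b < (k + k) * k" "u a = u b" "\<not> a < k * k"
  shows "\<not> b < k * k"
proof
  assume bP: "b < k * k"
  let ?I = "{..<(k + k) * k}"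
  let ?v = "shifted_pair k"
  let ?r = "\<lambda>l. \<lambda>a\<in>?I. ?v l a"
  define C where "C = {c\<in>?I. u c = u a}"
  have rw: "?r l \<in> words ?I k" for l
    using shifted_pair_lt by (intro restrict_PiE_iff[THEN iffD2] ballI) simp
  have nz': "Y (k + k) k u (?r l) \<noteq> 0" if "l < 3" for l
  proof -
    have "Y (k + k) k u (?r l) = Y (k + k) k u (?v l)" by (rule Y_cong) simp_all
    then show ?thesis using nz[OF that] by simp
  qed
  have inj: "inj_on (?v l) C" if "l < 3" for l
  proof (rule inj_onI)
    fix c c' assume c: "c \<in> C" "c' \<in> C" "?v l c = ?v l c'"
    have "inj_on (\<lambda>a. (u a, ?r l a)) ?I" using Y_nonzero_iff[OF u rw] nz'[OF that] by simp
    then show "c = c'" by (rule inj_onD) (use c in \<open>auto simp: C_def\<close>)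
  qed
  have ua: "u a < k + k" by (rule words_lt[OF u]) (use ab in simp)
  have card: "card C = k" unfolding C_def by (rule Y_balanced[OF u rw nz'[of 0] ua]) simp
  have onto: "?v l ` C = {..<k}" if "l < 3" for l
  proof (rule card_subset_eq)
    show "?v l ` C \<subseteq> {..<k}" using shifted_pair_lt by (auto simp: C_def)
    show "card (?v l ` C) = card {..<k}" using card_image[OF inj[OF that]] card by simp
  qed simp
  define S where "S = ?v 0 ` {c\<in>C. \<not> c < k * k}"
  have "S = {..<k}"
  proof (rule cyclic_closed_eq)
    show "S \<subseteq> {..<k}" using onto[of 0] by (auto simp: S_def)
    show "?v 0 a \<in> S" using ab by (auto simp: S_def C_def)
    fix x assume "x \<in> S"
    then obtain c where c: "c \<in> C" "\<not> c < k * k" "x = ?v 0 c" by (auto simp: S_def)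
    have "Suc x mod k \<in> ?v 0 ` C" unfolding onto[of 0, simplified] using k by simp
    then obtain c' where c': "c' \<in> C" "?v 0 c' = Suc x mod k" by (metis imageE)
    have "\<not> c' < k * k"
    proof
      assume P: "c' < k * k"
      have "?v 1 c' = ?v 0 c'" using P by (simp add: shifted_pair_def)
      moreover have "?v 1 c = Suc x mod k" using c(2,3) by (simp add: shifted_pair_def)
      ultimately have "?v 1 c' = ?v 1 c" using c'(2) by simp
      then have "c' = c" using inj_onD[OF inj[of 1]] c'(1) c(1) by simp
      then show False using P c(2) by simp
    qed
    then show "Suc x mod k \<in> S" using c' by (force simp: S_def)
  qed
  moreover have bC: "b \<in> C" using ab by (simp add: C_def)
  then have "?v 0 b \<in> {..<k}" using onto[of 0] by auto
  ultimately obtain c where c: "c \<in> C" "\<not> c < k * k" "?v 0 b = ?v 0 c" unfolding S_def by auto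
  have "b = c" by (rule inj_onD[OF inj[of 0]]) (use c bC in simp_all)
  then show False using c(2) bP by simp
qed

lemma sum_relabel:
  assumes \<rho>: "\<rho> permutes {..<n}"
  shows "(\<Sum>u\<in>words P n. f (\<lambda>a\<in>P. \<rho> (u a))) = (\<Sum>u\<in>words P n. f u)"
proof (rule sum.reindex_bij_witness[of _ "\<lambda>u. \<lambda>a\<in>P. Hilbert_Choice.inv \<rho> (u a)" "\<lambda>u. \<lambda>a\<in>P. \<rho> (u a)"])
  have *: "(\<lambda>a\<in>P. p (u a)) \<in> words P n" if "p permutes {..<n}" "u \<in> words P n" for p u
  proof (intro restrict_PiE_iff[THEN iffD2] ballI)
    fix a assume "a \<in> P"
    then show "p (u a) \<in> {..<n}" using words_lt[OF that(2)] permutes_in_image[OF that(1), of "u a"] by simp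
  qed
  fix u assume u: "u \<in> words P n"
  show "(\<lambda>a\<in>P. \<rho> (u a)) \<in> words P n" by (rule *[OF \<rho> u])
  show "(\<lambda>a\<in>P. Hilbert_Choice.inv \<rho> (u a)) \<in> words P n" by (rule *[OF permutes_inv[OF \<rho>] u])
  show "(\<lambda>a\<in>P. Hilbert_Choice.inv \<rho> ((\<lambda>a\<in>P. \<rho> (u a)) a)) = u"
    using PiE_arb[OF u] by (auto simp: permutes_inverses(2)[OF \<rho>] restrict_def fun_eq_iff)
  show "(\<lambda>a\<in>P. \<rho> ((\<lambda>a\<in>P. Hilbert_Choice.inv \<rho> (u a)) a)) = u"
    using PiE_arb[OF u] by (auto simp: permutes_inverses(1)[OF \<rho>] restrict_def fun_eq_iff)
qed simp

text \<open>The labels of a nonzero term split into a set \<open>J\<close> of size \<open>k\<close>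
  for the first copy and its complement for the second. As \<open>k\<close> is even, relabelling
  makes all \<open>J\<close> contribute equally, and for \<open>J = {..<k}\<close> the sum factors;
  the cyclic shift in the second factor is a relabelling of letters and disappears as well.\<close>

lemma omega_shifted_pair:
  assumes k: "k > 0" "even k"
  shows "omega 3 k (k + k) (shifted_pair k) = of_nat (card {J. J \<subseteq> {..<k + k} \<and> card J = k}) * glynn_sum k ^ 2"
proof -
  let ?I = "{..<(k + k) * k}"
  let ?Js = "{J. J \<subseteq> {..<k + k} \<and> card J = k}"
  define f where "f = (\<lambda>u. \<Prod>l<3. Y (k + k) k u (shifted_pair k l))"
  define cond where "cond = (\<lambda>(J :: nat set) (u :: nat \<Rightarrow> nat). \<forall>a<(k + k) * k. u a \<in> J \<longleftrightarrow> a < k * k)"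
  have sub: "{..<k * k} \<subseteq> ?I" by (auto simp: add_mult_distrib)
  have finJs: "finite ?Js" by (rule finite_subset[of _ "Pow {..<k + k}"]) auto
  have split: "f u = (\<Sum>J\<in>?Js. of_bool (cond J u) * f u)" if u: "u \<in> words ?I (k + k)" for u
  proof (cases "f u = 0")
    case False
    have nz: "Y (k + k) k u (shifted_pair k l) \<noteq> 0" if "l < 3" for l
      using False that by (auto simp: f_def)
    let ?r = "\<lambda>a\<in>?I. shifted_pair k 0 a"
    have rw: "?r \<in> words ?I k" using shifted_pair_lt by (intro restrict_PiE_iff[THEN iffD2] ballI) simp
    have "Y (k + k) k u ?r = Y (k + k) k u (shifted_pair k 0)" by (rule Y_cong) simp_all
    then have bal: "card {a\<in>?I. u a = i} = k" if "i < k + k" for i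
      using nz[of 0] by (intro Y_balanced[OF u rw _ that]) simp
    define J0 where "J0 = u ` {..<k * k}"
    have J0: "cond J0 u"
      unfolding cond_def
    proof (intro allI impI iffI)
      fix a assume a: "a < (k + k) * k" "u a \<in> J0"
      then obtain b where b: "b < k * k" "u a = u b" by (auto simp: J0_def)
      have "b < (k + k) * k" using b(1) by (simp add: add_mult_distrib)
      then show "a < k * k" using shifted_pair_pure[OF k(1) u nz a(1) _ b(2)] b(1) by blast
    qed (simp add: J0_def)
    have J0_sub: "J0 \<subseteq> {..<k + k}"
      unfolding J0_def using sub words_lt[OF u] by (intro image_subsetI) (auto simp: subset_iff)
    have cls: "{a\<in>?I. u a = j} \<noteq> {}" if "j < k + k" for j using bal[OF that] k(1) by (metis card.empty less_numeral_extra(3))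
    have uniq: "J = J0" if J: "J \<subseteq> {..<k + k}" "cond J u" for J
    proof (rule Set.set_eqI)
      fix j
      show "j \<in> J \<longleftrightarrow> j \<in> J0"
      proof (cases "j < k + k")
        case True
        then obtain a where a: "a < (k + k) * k" "u a = j" using cls by auto
        then show ?thesis using J(2) J0 unfolding cond_def by auto
      qed (use J(1) J0_sub in auto)
    qed
    have "{..<k * k} = (\<Union>j\<in>J0. {a\<in>?I. u a = j})"
    proof (rule Set.set_eqI)
      fix a show "a \<in> {..<k * k} \<longleftrightarrow> a \<in> (\<Union>j\<in>J0. {a\<in>?I. u a = j})"
        using J0 rev_subsetD[OF _ sub, of a] unfolding cond_def by (cases "a < (k + k) * k") auto
    qed
    from arg_cong[OF this, of card] have "k * k = card (\<Union>j\<in>J0. {a\<in>?I. u a = j})" by (simp only: card_lessThan)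
    also have "\<dots> = (\<Sum>j\<in>J0. card {a\<in>?I. u a = j})" by (rule card_UN_disjoint) (auto simp: J0_def)
    also have "\<dots> = (\<Sum>j\<in>J0. k)" using bal J0_sub by (intro sum.cong) auto
    finally have cardJ0: "card J0 = k" using k(1) by simp
    have "of_bool (cond J u) * f u = (if J = J0 then f u else 0)" if "J \<in> ?Js" for J
    proof (cases "J = J0")
      case True
      then show ?thesis using J0 by simp
    next
      case False
      then have "\<not> cond J u" using uniq[of J] that by (elim contrapos_nn) simp
      then show ?thesis using False by simp
    qed
    then have "(\<Sum>J\<in>?Js. of_bool (cond J u) * f u) = (\<Sum>J\<in>?Js. if J = J0 then f u else 0)"
      by (rule sum.cong[OF refl])
    also have "\<dots> = f u" using finJs J0_sub cardJ0 by (subst sum.delta) simp_all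
    finally show ?thesis by simp
  qed simp
  have inner: "(\<Sum>u\<in>words ?I (k + k). of_bool (cond J u) * f u) = glynn_sum k ^ 2" if J: "J \<in> ?Js" for J
  proof -
    have finJ: "finite J" using J finite_subset by blast
    obtain g where g: "bij_betw g J {..<k}" using J finJ finite_same_card_bij[of J "{..<k}"] by auto
    have "\<exists>h. bij_betw h {..<k + k} {..<k + k} \<and> (\<forall>a\<in>J. h a = g a)"
      using g J by (intro bij_betw_extension) (auto simp: bij_betw_def)
    then obtain h where h: "bij_betw h {..<k + k} {..<k + k}" "\<And>a. a \<in> J \<Longrightarrow> h a = g a" by auto
    obtain \<rho> where \<rho>: "\<rho> permutes {..<k + k}" "\<And>a. a < k + k \<Longrightarrow> h a = \<rho> a"
    proof (rule bij_betw_lessThan_permutes[OF h(1)], goal_cases)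
      case (1 p)
      then show ?case by (intro that[of p])
    qed
    have "\<rho> a = g a" if "a \<in> J" for a using \<rho>(2)[of a] h(2)[OF that] J that by auto
    then have "\<rho> ` J = g ` J" by (intro image_cong) simp_all
    then have \<rho>J: "\<rho> ` J = {..<k}" using g by (simp add: bij_betw_def)
    have \<rho>_iff: "\<rho> j < k \<longleftrightarrow> j \<in> J" for j
      unfolding lessThan_iff[symmetric] \<rho>J[symmetric] using permutes_inj[OF \<rho>(1)] by (auto simp: inj_eq)
    have fr: "f (\<lambda>a\<in>?I. \<rho> (u a)) = f u" if u: "u \<in> words ?I (k + k)" for u
      unfolding f_def
    proof (rule prod.cong[OF refl])
      fix l
      have "Y (k + k) k (\<lambda>a\<in>?I. \<rho> (u a)) (shifted_pair k l) = Y (k + k) k (\<lambda>a. \<rho> (u a)) (shifted_pair k l)"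
        by (rule Y_cong) simp_all
      also have "\<dots> = Y (k + k) k u (shifted_pair k l)"
        by (rule Y_relabel_left[OF \<rho>(1) k(2)]) (simp_all add: words_lt[OF u] shifted_pair_lt)
      finally show "Y (k + k) k (\<lambda>a\<in>?I. \<rho> (u a)) (shifted_pair k l) = Y (k + k) k u (shifted_pair k l)" .
    qed
    have "(\<Sum>u\<in>words ?I (k + k). of_bool (cond J u) * f u)
      = (\<Sum>u\<in>words ?I (k + k). of_bool (cond {..<k} (\<lambda>a\<in>?I. \<rho> (u a))) * f (\<lambda>a\<in>?I. \<rho> (u a)))"
      by (rule sum.cong[OF refl]) (simp add: fr cond_def \<rho>_iff)
    also have "\<dots> = (\<Sum>u\<in>words ?I (k + k). of_bool (cond {..<k} u) * f u)"
      by (rule sum_relabel[OF \<rho>(1), of "\<lambda>u. of_bool (cond {..<k} u) * f u"])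
    also have "\<dots> = (\<Sum>u\<in>block_words k k k. f u)"
      unfolding block_words_def cond_def
      by (simp add: finite_words sum.inter_filter of_bool_def if_distrib[where f = "\<lambda>x. x * _"] cong: if_cong)
    also have "\<dots> = omega 3 k k (shifted_pair k) * omega 3 k k (\<lambda>l a. shifted_pair k l (k * k + a))"
      unfolding f_def by (rule sum_block_words) (auto intro!: shifted_pair_lt simp: add_mult_distrib)
    also have "omega 3 k k (shifted_pair k) = glynn_sum k"
      unfolding glynn_sum_def by (rule omega_cong) (simp add: shifted_pair_def)
    also have "omega 3 k k (\<lambda>l a. shifted_pair k l (k * k + a)) = glynn_sum k"
      unfolding glynn_sum_def omega_def
    proof (intro sum.cong prod.cong refl)
      fix u l assume u: "u \<in> words {..<k * k} k"
      let ?\<sigma> = "\<lambda>r. if r < k then Suc r mod k else r"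
      show "Y k k u (\<lambda>a. shifted_pair k l (k * k + a)) = Y k k u (\<lambda>a. if l < 2 then a div k else a mod k)"
      proof (cases "l = 1")
        case True
        have "Y k k u (\<lambda>a. shifted_pair k l (k * k + a)) = Y k k u (\<lambda>a. ?\<sigma> (a div k))"
          by (rule Y_cong) (simp_all add: True shifted_pair_def lt_square_div)
        also have "\<dots> = Y k k u (\<lambda>a. a div k)"
          by (rule Y_relabel_right[OF Suc_mod_permutes[OF k(1)] k(2)]) (simp_all add: words_lt[OF u] lt_square_div)
        finally show ?thesis by (simp add: True)
      next
        case False
        then show ?thesis by (intro Y_cong) (simp_all add: shifted_pair_def)
      qed
    qed
    finally show ?thesis by (simp add: power2_eq_square)
  qed
  have "omega 3 k (k + k) (shifted_pair k) = (\<Sum>u\<in>words ?I (k + k). \<Sum>J\<in>?Js. of_bool (cond J u) * f u)"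
    unfolding omega_def f_def[symmetric] by (rule sum.cong[OF refl split])
  also have "\<dots> = (\<Sum>J\<in>?Js. glynn_sum k ^ 2)" by (subst sum.swap) (rule sum.cong[OF refl inner])
  finally show ?thesis by simp
qed

lemma has_alternating_3:
  assumes k: "k > 0" "even k" and G: "glynn_sum k \<noteq> 0" and n: "n \<le> 2 * k"
  shows "has_alternating 3 k n"
proof -
  have fin: "finite {J. J \<subseteq> {..<k + k} \<and> card J = k}"
    by (rule finite_subset[of _ "Pow {..<k + k}"]) auto
  have "{..<k} \<in> {J. J \<subseteq> {..<k + k} \<and> card J = k}" by auto
  then have "card {J. J \<subseteq> {..<k + k} \<and> card J = k} \<noteq> 0" using fin by (auto simp only: card_0_eq)
  then have "omega 3 k (k + k) (shifted_pair k) \<noteq> 0"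
    using G unfolding omega_shifted_pair[OF k] by simp
  then have "\<exists>v'. (\<forall>l<3. \<forall>a<n * k. v' l a < k) \<and> omega 3 k n v' \<noteq> 0"
    using n by (intro omega_mono[of 3 "k + k" k "shifted_pair k"]) (simp_all add: shifted_pair_lt)
  then show ?thesis by (elim exE conjE) (rule has_alternating_of_omega, auto)
qed

subsection \<open>Determinants modulo a prime\<close>

lemma fermat_theorem_int:
  fixes a :: int
  assumes p: "prime p" and a: "\<not> int p dvd a"
  shows "[a ^ (p - 1) = 1] (mod int p)"
proof -
  define b where "b = nat (a mod int p)"
  have p0: "int p > 0" using prime_gt_0_nat[OF p] by simp
  have b: "int b = a mod int p" using p0 by (simp add: b_def)
  have "\<not> int p dvd int b" unfolding b using a by (simp add: dvd_mod_iff)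
  then have "[b ^ (p - 1) = 1] (mod p)" by (intro fermat_theorem[OF p]) simp
  then have "[int b ^ (p - 1) = 1] (mod int p)" using cong_int_iff[of "b ^ (p - 1)" 1 p] by simp
  moreover have "[int b = a] (mod int p)" unfolding b by (simp add: cong_def)
  ultimately show ?thesis by (meson cong_pow cong_sym cong_trans)
qed

lemma sum_power_pred_prime:
  assumes p: "prime p"
  shows "[(\<Sum>t<p. int t ^ (p - 1)) = -1] (mod int p)"
proof -
  have p1: "p > 1" by (rule prime_gt_1_nat[OF p])
  have "(\<Sum>t<p. int t ^ (p - 1)) = (\<Sum>t\<in>{1..<p}. int t ^ (p - 1))"
    using p1 by (intro sum.mono_neutral_right) auto
  also have "[\<dots> = (\<Sum>t\<in>{1..<p}. 1)] (mod int p)"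
  proof (rule cong_sum)
    fix t assume t: "t \<in> {1..<p}"
    then have "\<not> p dvd t" using dvd_imp_le[of p t] by auto
    then show "[int t ^ (p - 1) = 1] (mod int p)" by (intro fermat_theorem_int p) simp
  qed
  also have "(\<Sum>t\<in>{1..<p}. 1) = int p - 1" using p1 by simp
  also have "[int p - 1 = -1] (mod int p)" by (simp add: cong_iff_dvd_diff)
  finally show ?thesis .
qed

text \<open>Replacing \<open>t\<close> by \<open>p - t\<close> negates the sum modulo
  \<open>p\<close>, and 2 is coprime to \<open>p\<close>.\<close>

lemma sum_power_odd:
  assumes p: "odd p" and e: "odd e"
  shows "[(\<Sum>t<p. int t ^ e) = 0] (mod int p)"
proof -
  let ?S = "\<Sum>t<p. int t ^ e"
  have e0: "e > 0" using e by (cases e) auto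
  have p0: "p > 0" using p by (cases p) auto
  have S: "?S = (\<Sum>t\<in>{1..<p}. int t ^ e)" using e0 by (intro sum.mono_neutral_right) auto
  also have "\<dots> = (\<Sum>t\<in>{1..<p}. int (p - t) ^ e)"
    by (rule sum.reindex_bij_witness[of _ "\<lambda>t. p - t" "\<lambda>t. p - t"]) auto
  also have "[\<dots> = (\<Sum>t\<in>{1..<p}. - (int t ^ e))] (mod int p)"
  proof (rule cong_sum)
    fix t assume t: "t \<in> {1..<p}"
    have "[int (p - t) = - int t] (mod int p)" using t by (simp add: of_nat_diff cong_iff_dvd_diff)
    from cong_pow[OF this, of e] show "[int (p - t) ^ e = - (int t ^ e)] (mod int p)" using e by simp
  qed
  also have "(\<Sum>t\<in>{1..<p}. - (int t ^ e)) = - ?S" unfolding S by (simp add: sum_negf)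
  finally have "int p dvd 2 * ?S" by (simp add: cong_iff_dvd_diff)
  moreover have "coprime (int p) 2" using p by simp
  ultimately show ?thesis by (simp add: cong_0_iff coprime_dvd_mult_right_iff)
qed

text \<open>The exponent of \<open>t j\<close> is \<open>p - 2\<close> plus the number of
  \<open>i\<close> with \<open>s i = j\<close>. If \<open>s\<close> is injective, every exponent is
  \<open>p - 1\<close> and every factor is \<open>-1\<close>. Otherwise some \<open>j\<close> is
  missed, and its exponent, the odd number \<open>p - 2\<close>, gives a factor zero.\<close>

lemma sum_monomial_mod_prime:
  assumes p: "prime p" "odd p" and fin: "finite A" "finite J" and card: "card A = card J" and s: "s ` A \<subseteq> J"
  shows "[(\<Sum>t\<in>J \<rightarrow>\<^sub>E {..<p}. (\<Prod>j\<in>J. int (t j) ^ (p - 2)) * (\<Prod>i\<in>A. int (t (s i))))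
    = (if inj_on s A then (-1) ^ card J else 0)] (mod int p)"
proof -
  have p3: "p \<ge> 3" using p prime_ge_2_nat[of p] by (cases "p = 2") auto
  have "(\<Sum>t\<in>J \<rightarrow>\<^sub>E {..<p}. (\<Prod>j\<in>J. int (t j) ^ (p - 2)) * (\<Prod>i\<in>A. int (t (s i))))
    = (\<Sum>t\<in>J \<rightarrow>\<^sub>E {..<p}. \<Prod>j\<in>J. int (t j) ^ (p - 2 + card {i\<in>A. s i = j}))"
    unfolding prod_eq_prod_power_card[OF fin s, of "\<lambda>j. int (_ j)"] by (simp only: power_add prod.distrib)
  also have "\<dots> = (\<Prod>j\<in>J. \<Sum>t<p. int t ^ (p - 2 + card {i\<in>A. s i = j}))"
    by (rule prod_sum_PiE'[OF fin(2) finite_lessThan])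
  also have "[\<dots> = (if inj_on s A then (-1) ^ card J else 0)] (mod int p)"
  proof (cases "inj_on s A")
    case True
    have "s ` A = J" using s fin card card_image[OF True] by (intro card_subset_eq) auto
    have "card {i\<in>A. s i = j} = 1" if "j \<in> J" for j
    proof -
      have "j \<in> s ` A" using that \<open>s ` A = J\<close> by simp
      then obtain i where i: "i \<in> A" "s i = j" by auto
      then have "{i\<in>A. s i = j} = {i}" using True by (auto simp: inj_on_def)
      then show ?thesis by simp
    qed
    then have "p - 2 + card {i\<in>A. s i = j} = p - 1" if "j \<in> J" for j using that p3 by simp
    then have "[(\<Prod>j\<in>J. \<Sum>t<p. int t ^ (p - 2 + card {i\<in>A. s i = j})) = (\<Prod>j\<in>J. -1)] (mod int p)"
      using sum_power_pred_prime[OF p(1)] by (intro cong_prod) simp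
    then show ?thesis using True by simp
  next
    case False
    have "s ` A \<noteq> J" using False fin card by (metis eq_card_imp_inj_on)
    then obtain j where j: "j \<in> J" "j \<notin> s ` A" using s by auto
    have "{i\<in>A. s i = j} = {}" using j by auto
    then have "card {i\<in>A. s i = j} = 0" by (simp only: card.empty)
    then have "[(\<Sum>t<p. int t ^ (p - 2 + card {i\<in>A. s i = j})) = 0] (mod int p)"
      using sum_power_odd[OF p(2), of "p - 2"] p(2) p3 by (simp only: add_0_right) simp
    then have "int p dvd (\<Prod>j\<in>J. \<Sum>t<p. int t ^ (p - 2 + card {i\<in>A. s i = j}))"
      using j(1) fin(2) by (intro dvd_prodI[THEN dvd_trans[rotated]]) (simp_all add: cong_0_iff)
    then show ?thesis using False by (simp add: cong_0_iff)
  qed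
  finally show ?thesis .
qed

lemma det_cong_mod:
  fixes A B :: "int mat"
  assumes A: "A \<in> carrier_mat n n" "B \<in> carrier_mat n n"
    and AB: "\<And>i j. i < n \<Longrightarrow> j < n \<Longrightarrow> [A $$ (i, j) = B $$ (i, j)] (mod m)"
  shows "[det A = det B] (mod m)"
  unfolding det_def'[OF A(1)] det_def'[OF A(2)]
proof (intro cong_sum cong_mult cong_prod cong_refl)
  fix q i assume "q \<in> {q. q permutes {0..<n}}" "i \<in> {0..<n}"
  then have "i < n" "q i < n" using permutes_in_image[of q "{0..<n}" i] by auto
  then show "[A $$ (i, q i) = B $$ (i, q i)] (mod m)" by (rule AB)
qed

text \<open>
  Translating by a nonzero vector \<open>v\<close> permutes the points of \<open>\<int>\<^sub>p\<^sup>k\<close> without fixed points.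
\<close>

lemma sum_translation_invariant_mod_prime:
  fixes h :: "(nat \<Rightarrow> nat) \<Rightarrow> int" and v :: "nat \<Rightarrow> int"
  assumes p: "prime p" and l: "l < k" "\<not> int p dvd v l"
    and h: "\<And>y s. y \<in> words {..<k} p \<Longrightarrow> [h (\<lambda>i\<in>{..<k}. nat ((int (y i) + int s * v i) mod int p)) = h y] (mod int p)"
  shows "[(\<Sum>y\<in>words {..<k} p. h y) = 0] (mod int p)"
proof -
  have p0: "int p > 0" using prime_gt_0_nat[OF p] by simp
  let ?W = "words {..<k} p"
  \<comment> \<open>The points with coordinate \<open>l\<close> equal to zero represent the lines in
    direction \<open>v\<close>, because \<open>v l\<close> is invertible modulo
    \<open>p\<close>.\<close>
  let ?Z = "Pi\<^sub>E {..<k} (\<lambda>i. if i = l then {0} else {..<p})"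
  let ?\<phi> = "\<lambda>(y, s). \<lambda>i\<in>{..<k}. nat ((int (y i) + int s * v i) mod int p)"
  have "?Z \<subseteq> ?W" using p0 by (intro PiE_mono) auto
  then have ZW: "y \<in> ?W" if "y \<in> ?Z" for y using that by (rule subsetD)
  have inj: "inj_on ?\<phi> (?Z \<times> {..<p})"
  proof (rule inj_onI)
    fix a b assume a: "a \<in> ?Z \<times> {..<p}" and b: "b \<in> ?Z \<times> {..<p}" and eq: "?\<phi> a = ?\<phi> b"
    obtain y s where ys: "a = (y, s)" by (cases a)
    obtain y' s' where ys': "b = (y', s')" by (cases b)
    have Z: "y \<in> ?Z" "y' \<in> ?Z" "s < p" "s' < p" using a b by (simp_all add: ys ys')
    have c: "[int (y i) + int s * v i = int (y' i) + int s' * v i] (mod int p)" if "i < k" for i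
      using fun_cong[OF eq, of i] that p0 by (simp add: ys ys' cong_def eq_nat_nat_iff)
    have "y l = 0" "y' l = 0" using PiE_mem[OF Z(1), of l] PiE_mem[OF Z(2), of l] l(1) by auto
    then have "int p dvd (int s - int s') * v l" using c[OF l(1)] by (simp add: cong_iff_dvd_diff left_diff_distrib)
    then have "[s = s'] (mod p)" using l(2) p prime_dvd_mult_iff[of "int p"] by (simp add: cong_iff_dvd_diff flip: cong_int_iff)
    then have s: "s = s'" using Z by (simp add: cong_def)
    have "y = y'"
    proof (rule PiE_ext[OF Z(1,2)])
      fix i assume "i \<in> {..<k}"
      then have i: "i < k" by simp
      have "[int (y i) = int (y' i)] (mod int p)" using c[OF i] unfolding s by (simp add: cong_add_rcancel)
      then show "y i = y' i" using words_lt[OF ZW[OF Z(1)]] words_lt[OF ZW[OF Z(2)]] i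
        by (simp add: cong_int_iff cong_def)
    qed
    then show "a = b" by (simp add: ys ys' s)
  qed
  have "card ?Z = (\<Prod>i\<in>{..<k}. if i = l then 1 else p)" by (subst card_PiE) (auto intro!: prod.cong)
  also have "\<dots> = p ^ (k - 1)" using l(1) by (simp add: prod.If_cases Collect_neg_eq card_Diff_subset_Int Int_absorb1 Int_Diff Diff_eq[symmetric])
  finally have cardZ: "card ?Z = p ^ (k - 1)" .
  have im: "?\<phi> ` (?Z \<times> {..<p}) = ?W"
  proof (rule card_subset_eq)
    show "?\<phi> ` (?Z \<times> {..<p}) \<subseteq> ?W"
    proof (rule image_subsetI)
      fix a :: "(nat \<Rightarrow> nat) \<times> nat"
      obtain y s where "a = (y, s)" by (cases a)
      then show "?\<phi> a \<in> ?W" using p0 by (simp add: restrict_PiE_iff nat_less_iff)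
    qed
    have "card (?\<phi> ` (?Z \<times> {..<p})) = p ^ (k - 1) * p" by (simp add: card_image[OF inj] card_cartesian_product cardZ)
    also have "\<dots> = p ^ k" using l(1) by (cases k) simp_all
    finally show "card (?\<phi> ` (?Z \<times> {..<p})) = card ?W" by (simp add: card_funcsetE)
  qed (simp add: finite_words)
  have "(\<Sum>y\<in>?W. h y) = (\<Sum>a\<in>?Z \<times> {..<p}. h (?\<phi> a))"
    unfolding im[symmetric] by (rule sum.reindex[OF inj, unfolded o_def])
  also have "\<dots> = (\<Sum>y\<in>?Z. \<Sum>s<p. h (?\<phi> (y, s)))"
    by (simp add: sum.cartesian_product case_prod_unfold)
  finally have 1: "(\<Sum>y\<in>?W. h y) = (\<Sum>y\<in>?Z. \<Sum>s<p. h (?\<phi> (y, s)))" .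
  have "[(\<Sum>y\<in>?Z. \<Sum>s<p. h (?\<phi> (y, s))) = (\<Sum>y\<in>?Z. \<Sum>s<p. h y)] (mod int p)"
    unfolding prod.case by (intro cong_sum h ZW)
  moreover have "(\<Sum>y\<in>?Z. \<Sum>s<p. h y) = int p * (\<Sum>y\<in>?Z. h y)" by (simp add: sum_distrib_left)
  ultimately show ?thesis unfolding 1 by (simp add: cong_def)
qed

lemma sum_prod_power_pred_prime:
  assumes "prime p" "finite I" "even (card I)"
  shows "[(\<Sum>y\<in>words I p. \<Prod>i\<in>I. int (y i) ^ (p - 1)) = 1] (mod int p)"
proof -
  have "[(\<Prod>i\<in>I. \<Sum>t<p. int t ^ (p - 1)) = (\<Prod>i\<in>I. -1)] (mod int p)"
    by (intro cong_prod sum_power_pred_prime assms)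
  then show ?thesis
    using prod_sum_PiE'[OF assms(2) finite_lessThan, of "\<lambda>_ t. int t ^ (p - 1)" p] assms(3) by simp
qed

text \<open>If \<open>X\<close> is invertible modulo \<open>p\<close>, then multiplication by
  \<open>X\<close> permutes the vectors \<open>y\<close> and both sides are 1, using that
  \<open>k\<close> is even. Otherwise the summand is invariant under translation by a kernel vector
  and both sides vanish.\<close>

lemma det_power_pred_prime:
  fixes X :: "int mat"
  assumes p: "prime p" and X: "X \<in> carrier_mat k k" and k: "even k"
  shows "[det X ^ (p - 1) = (\<Sum>y\<in>words {..<k} p. \<Prod>i<k. (\<Sum>j<k. X $$ (i, j) * int (y j)) ^ (p - 1))] (mod int p)"
proof -
  have p0: "int p > 0" and p1: "p > 1" using prime_gt_1_nat[OF p] by simp_all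
  let ?W = "words {..<k} p"
  define D where "D = (\<lambda>(y :: nat \<Rightarrow> int) i. \<Sum>j<k. X $$ (i, j) * y j)"
  define L where "L = (\<lambda>y. \<lambda>i\<in>{..<k}. nat (D (\<lambda>j. int (y j)) i mod int p))"
  define h where "h = (\<lambda>y. \<Prod>i<k. D (\<lambda>j. int (y j)) i ^ (p - 1))"
  have LW: "L y \<in> ?W" for y unfolding L_def using p0 by (auto simp: restrict_PiE_iff nat_less_iff)
  have finW: "finite ?W" by (simp add: finite_words)
  have L_eq: "L y = L y' \<longleftrightarrow> (\<forall>i<k. int p dvd D (\<lambda>j. int (y j) - int (y' j)) i)" for y y'
  proof -
    have "D (\<lambda>j. int (y j) - int (y' j)) i = D (\<lambda>j. int (y j)) i - D (\<lambda>j. int (y' j)) i" for i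
      by (simp add: D_def right_diff_distrib sum_subtractf)
    then show ?thesis using p0 by (auto simp: L_def fun_eq_iff restrict_def eq_nat_nat_iff mod_eq_dvd_iff)
  qed
  show ?thesis
  proof (cases "int p dvd det X")
    case False
    have "inj_on L ?W"
    proof (rule inj_onI)
      fix y y' assume y: "y \<in> ?W" "y' \<in> ?W" and eq: "L y = L y'"
      show "y = y'"
      proof (rule PiE_ext[OF y])
        fix j assume "j \<in> {..<k}"
        then have j: "j < k" by simp
        let ?d = "\<lambda>j. int (y j) - int (y' j)"
        note A = adj_mat[OF X]
        have "(\<Sum>i<k. adj_mat X $$ (j, i) * D ?d i) = (\<Sum>l<k. (\<Sum>i<k. adj_mat X $$ (j, i) * X $$ (i, l)) * ?d l)"
          unfolding D_def sum_distrib_left sum_distrib_right by (subst sum.swap) (simp only: mult.assoc)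
        also have "\<dots> = (\<Sum>l<k. (adj_mat X * X) $$ (j, l) * ?d l)"
          using A(1) X j by (intro sum.cong refl) (simp add: scalar_prod_def atLeast0LessThan)
        also have "\<dots> = (\<Sum>l<k. if l = j then det X * ?d l else 0)"
          unfolding A(3) using j by (intro sum.cong) auto
        also have "\<dots> = det X * ?d j" using j by simp
        finally have "int p dvd det X * ?d j"
          using eq unfolding L_eq by (metis (no_types, lifting) dvd_mult dvd_sum lessThan_iff)
        then have "int p dvd ?d j" using False p prime_dvd_mult_iff[of "int p"] by simp
        then have "[y j = y' j] (mod p)" by (simp add: cong_iff_dvd_diff flip: cong_int_iff)
        then show "y j = y' j" using words_lt[OF y(1)] words_lt[OF y(2)] j by (simp add: cong_def)
      qed
    qed
    moreover have "L ` ?W = ?W" using endo_inj_surj[OF finW _ calculation] LW by blast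
    ultimately have bij: "bij_betw L ?W ?W" by (simp add: bij_betw_def)
    have "[(\<Sum>y\<in>?W. h y) = (\<Sum>y\<in>?W. \<Prod>i<k. int (L y i) ^ (p - 1))] (mod int p)"
      unfolding h_def by (intro cong_sum cong_prod cong_pow) (use p0 in \<open>simp add: L_def cong_def\<close>)
    also have "(\<Sum>y\<in>?W. \<Prod>i<k. int (L y i) ^ (p - 1)) = (\<Sum>y\<in>?W. \<Prod>i<k. int (y i) ^ (p - 1))"
      by (rule sum.reindex_bij_betw[OF bij])
    also have "[\<dots> = 1] (mod int p)" by (rule sum_prod_power_pred_prime[OF p]) (use k in auto)
    also have "[1 = det X ^ (p - 1)] (mod int p)" by (rule cong_sym[OF fermat_theorem_int[OF p False]])
    finally show ?thesis unfolding h_def D_def by (rule cong_sym)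
  next
    case True
    \<comment> \<open>A surjective \<open>L\<close> would hit all unit vectors and yield a right
      inverse of \<open>X\<close> modulo \<open>p\<close>, contradicting the vanishing determinant.
      On a finite set \<open>L\<close> then also fails to be injective, and two vectors with equal
      image differ by a kernel vector.\<close>
    have "L ` ?W \<noteq> ?W"
    proof
      assume onto: "L ` ?W = ?W"
      have "\<exists>y\<in>?W. L y = (\<lambda>i\<in>{..<k}. of_bool (i = j))" for j
      proof -
        have "(\<lambda>i\<in>{..<k}. of_bool (i = j)) \<in> ?W" using p1 by (intro restrict_PiE_iff[THEN iffD2] ballI) simp
        then have "(\<lambda>i\<in>{..<k}. of_bool (i = j)) \<in> L ` ?W" by (simp only: onto)
        then obtain y where "(\<lambda>i\<in>{..<k}. of_bool (i = j)) = L y" "y \<in> ?W" by (rule imageE)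
        then show ?thesis by (intro bexI[of _ y]) simp_all
      qed
      then obtain Yv where Yv: "\<And>j. L (Yv j) = (\<lambda>i\<in>{..<k}. of_bool (i = j))" by metis
      define B where "B = mat k k (\<lambda>(l, j). int (Yv j l))"
      have B: "B \<in> carrier_mat k k" by (simp add: B_def)
      have "[det (X * B) = det (1\<^sub>m k :: int mat)] (mod int p)"
      proof (rule det_cong_mod)
        fix i j assume ij: "i < k" "j < k"
        have "(X * B) $$ (i, j) = D (\<lambda>l. int (Yv j l)) i"
          using X ij by (simp add: D_def B_def scalar_prod_def atLeast0LessThan)
        moreover have "int (L (Yv j) i) = D (\<lambda>l. int (Yv j l)) i mod int p" using ij p0 by (simp add: L_def)
        ultimately show "[(X * B) $$ (i, j) = 1\<^sub>m k $$ (i, j)] (mod int p)"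
          using ij p1 unfolding Yv by (cases "i = j") (simp_all add: cong_def)
      qed (use X B in auto)
      moreover have "int p dvd det (X * B)" using True by (simp add: det_mult[OF X B])
      ultimately have "int p dvd 1" by (simp add: cong_dvd_iff)
      then show False using p1 by simp
    qed
    moreover have "L ` ?W \<subseteq> ?W" using LW by auto
    ultimately have "\<not> inj_on L ?W" using endo_inj_surj[OF finW] by blast
    then obtain y y' where y: "y \<in> ?W" "y' \<in> ?W" "L y = L y'" "y \<noteq> y'" by (auto simp: inj_on_def)
    define v where "v = (\<lambda>j. int (y j) - int (y' j))"
    have Dv: "int p dvd D v i" if "i < k" for i using y(3) that unfolding L_eq v_def by simp
    obtain l where l: "l < k" "y l \<noteq> y' l" using PiE_ext[OF y(1,2)] y(4) by auto
    have "\<not> int p dvd v l"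
    proof
      assume "int p dvd v l"
      then have "[y l = y' l] (mod p)" by (simp add: v_def cong_iff_dvd_diff flip: cong_int_iff)
      then show False using words_lt[OF y(1)] words_lt[OF y(2)] l by (simp add: cong_def)
    qed
    then have "[(\<Sum>y\<in>?W. h y) = 0] (mod int p)"
    proof (rule sum_translation_invariant_mod_prime[OF p l(1)])
      fix z s assume "z \<in> ?W"
      show "[h (\<lambda>i\<in>{..<k}. nat ((int (z i) + int s * v i) mod int p)) = h z] (mod int p)"
        unfolding h_def
      proof (intro cong_prod cong_pow)
        fix i assume "i \<in> {..<k}"
        then have i: "i < k" by simp
        have "[D (\<lambda>j. int ((\<lambda>i\<in>{..<k}. nat ((int (z i) + int s * v i) mod int p)) j)) i = D (\<lambda>j. int (z j) + int s * v j) i] (mod int p)"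
          unfolding D_def by (intro cong_sum cong_mult cong_refl) (use p0 in \<open>simp add: cong_def\<close>)
        also have "D (\<lambda>j. int (z j) + int s * v j) i = D (\<lambda>j. int (z j)) i + int s * D v i"
          by (simp add: D_def sum.distrib sum_distrib_left algebra_simps)
        also have "[\<dots> = D (\<lambda>j. int (z j)) i] (mod int p)" using Dv[OF i] by (simp add: cong_iff_dvd_diff)
        finally show "[D (\<lambda>j. int ((\<lambda>i\<in>{..<k}. nat ((int (z i) + int s * v i) mod int p)) j)) i = D (\<lambda>j. int (z j)) i] (mod int p)" .
      qed
    qed
    moreover have "[det X ^ (p - 1) = 0] (mod int p)" using dvd_trans[OF True dvd_power[of "p - 1"]] p1 by (simp add: cong_0_iff)
    ultimately show ?thesis unfolding h_def D_def by (meson cong_sym cong_trans)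
  qed
qed

lemma code_inj_iff:
  assumes u: "\<And>a. a \<in> A \<Longrightarrow> u a < k"
  shows "inj_on (\<lambda>a. x a * k + u a) A \<longleftrightarrow> inj_on (\<lambda>a. (x a, u a :: nat)) A"
proof -
  have "x a * k + u a = x b * k + u b \<longleftrightarrow> (x a, u a) = (x b, u b)" if "a \<in> A" "b \<in> A" for a b
  proof
    assume eq: "x a * k + u a = x b * k + u b"
    have "x c = (x c * k + u c) div k" "u c = (x c * k + u c) mod k" if "c \<in> A" for c using u[OF that] by simp_all
    then show "(x a, u a) = (x b, u b)" using eq that by metis
  qed simp
  then show ?thesis unfolding inj_on_def by blast
qed

lemma sum_of_bool_card: "finite A \<Longrightarrow> (\<Sum>x\<in>A. of_bool (Q x)) = of_nat (card {x\<in>A. Q x})"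
  by (simp add: of_bool_def sum.If_cases Int_def)

lemma prod_of_bool: "finite A \<Longrightarrow> (\<Prod>x\<in>A. of_bool (Q x)) = (of_bool (\<forall>x\<in>A. Q x) :: 'a :: comm_semiring_1)"
  by (induction A rule: finite_induct) auto

text \<open>Each of the \<open>m\<close> blocks of \<open>k\<close> consecutive positions carries an
  arbitrary permutation of the letters.\<close>

lemma card_injective_rows:
  "card {S \<in> words {..<m * k} k. inj_on (\<lambda>a. (a div k, S a)) {..<m * k}} = fact k ^ m"
proof (cases "k = 0")
  case True
  have "{S \<in> words {..<m * k} k. inj_on (\<lambda>a. (a div k, S a)) {..<m * k}} = {\<lambda>_. undefined}"
    using True by auto
  then show ?thesis using True by simp
next
  case False
  then have k: "k > 0" by simp
  let ?I = "{..<m * k}"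
  define B where "B = (\<lambda>i. {i * k..<i * k + k})"
  have B_iff: "a \<in> B i \<longleftrightarrow> a div k = i" for a i
  proof
    show "a div k = i" if "a \<in> B i" using that by (intro div_nat_eqI) (simp_all add: B_def mult.commute add.commute)
    show "a \<in> B i" if "a div k = i"
      using div_mult_mod_eq[of a k] mod_less_divisor[OF k, of a] unfolding that B_def atLeastLessThan_iff by linarith
  qed
  have I: "?I = (\<Union>i\<in>{..<m}. B i)"
    using k by (auto simp: B_iff less_mult_imp_div_less div_less_iff_less_mult)
  have inj_iff: "inj_on (\<lambda>a. (a div k, S a)) ?I \<longleftrightarrow> (\<forall>i\<in>{..<m}. inj_on (restrict S (B i)) (B i))" for S :: "nat \<Rightarrow> nat"
    unfolding I inj_on_def by (auto simp: B_iff)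
  have "card {S \<in> words ?I k. inj_on (\<lambda>a. (a div k, S a)) ?I}
    = (\<Sum>S\<in>words ?I k. \<Prod>i\<in>{..<m}. of_bool (inj_on (restrict S (B i)) (B i)))"
    unfolding inj_iff prod_of_bool[OF finite_lessThan] sum_of_bool_card[OF finite_words[OF finite_lessThan]]
    by (simp only: of_nat_id)
  also have "\<dots> = (\<Prod>i\<in>{..<m}. \<Sum>s\<in>words (B i) k. of_bool (inj_on s (B i)))"
    unfolding I by (rule sum_prod_blocks) (auto simp: B_iff, simp_all add: B_def)
  also have "\<dots> = (\<Prod>i\<in>{..<m}. fact k)"
  proof (rule prod.cong[OF refl])
    fix i
    have fin: "finite (B i)" and cB: "card (B i) = k" by (simp_all add: B_def)
    have "(\<Sum>s\<in>words (B i) k. of_bool (inj_on s (B i))) = card {s \<in> words (B i) k. inj_on s (B i)}"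
      unfolding sum_of_bool_card[OF finite_words[OF fin]] by (simp only: of_nat_id)
    also have "\<dots> = (\<Prod>r\<in>{0..<k}. k - r)"
      using card_inj_on_subset_funcset[OF fin finite_lessThan subset_refl, of k] by (simp add: cB)
    finally show "(\<Sum>s\<in>words (B i) k. of_bool (inj_on s (B i))) = (fact k :: nat)" by (simp add: fact_prod_rev)
  qed
  finally show ?thesis by simp
qed

text \<open>
  Following Glynn, the coefficient of \<open>\<Prod> X\<^sub>i\<^sub>j\<close> in \<open>det X ^ (p - 1)\<close> is read off modulo \<open>p\<close> by summing
  \<open>\<Prod> X\<^sub>i\<^sub>j ^ (p - 2) * det X ^ (p - 1)\<close> over all matrices \<open>X\<close> modulo \<open>p\<close>.
\<close>

lemma glynn_sum_nonzero:
  assumes p: "prime p" "odd p"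
  shows "glynn_sum (p - 1) \<noteq> 0"
proof -
  define k where "k = p - 1"
  have evk: "even k" and k: "k > 0" using p prime_gt_1_nat[OF p(1)] by (auto simp: k_def)
  let ?I = "{..<k * k}"
  let ?W = "words ?I k"
  let ?x = "\<lambda>a\<in>?I. a div k" and ?z = "\<lambda>a\<in>?I. a mod k"
  note xw = standard_words(1)[where n = k and k = k] and zw = standard_words(2)[where n = k and k = k]
  \<comment> \<open>\<open>c u\<close> is the product of the column signs of \<open>u\<close>, or
    zero; \<open>R u a\<close> is the matrix cell in row \<open>a div k\<close> and column
    \<open>u a\<close>. The sum \<open>M\<close> over all matrices modulo \<open>p\<close> is
    evaluated twice: as \<open>g\<close> up to sign and as 1.\<close>
  define c where "c = (\<lambda>u. perm_sign (k * k) (\<lambda>a. u a * k + ?z a))"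
  define X where "X = (\<lambda>T :: nat \<Rightarrow> nat. mat k k (\<lambda>(i, j). int (T (i * k + j))))"
  define R where "R = (\<lambda>(u :: nat \<Rightarrow> nat) a. ?x a * k + u a)"
  define Q where "Q = (\<lambda>T :: nat \<Rightarrow> nat. \<Prod>a\<in>?I. int (T a) ^ (p - 2))"
  define M where "M = (\<Sum>T\<in>words ?I p. Q T * det (X T) ^ k)"
  define g where "g = (\<Sum>u\<in>?W. of_bool (inj_on (R u) ?I) * c u)"
  have R_I: "R u ` ?I \<subseteq> ?I" if "u \<in> ?W" for u
  proof (rule image_subsetI)
    fix a assume a: "a \<in> ?I"
    have "(?x a, u a) \<in> {..<k} \<times> {..<k}" using words_lt[OF xw a] words_lt[OF that a] by simp
    from bij_betw_apply[OF bij_code this] show "R u a \<in> ?I" by (simp add: R_def)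
  qed
  have R_inj: "inj_on (R u) ?I \<longleftrightarrow> Y k k u ?x \<noteq> 0" if u: "u \<in> ?W" for u
  proof -
    have "inj_on (R u) ?I \<longleftrightarrow> inj_on (\<lambda>a. (?x a, u a)) ?I"
      unfolding R_def by (rule code_inj_iff) (rule words_lt[OF u])
    also have "\<dots> \<longleftrightarrow> inj_on (\<lambda>a. (u a, ?x a)) ?I" unfolding inj_on_def prod.inject by (simp only: conj_commute)
    finally show ?thesis using Y_nonzero_iff[OF u xw] by simp
  qed
  have "glynn_sum k = of_int g"
    unfolding glynn_sum_def omega_def g_def of_int_sum
  proof (rule sum.cong[OF refl])
    fix u assume u: "u \<in> ?W"
    have "(\<Prod>l<3::nat. Y k k u (\<lambda>a. if l < 2 then a div k else a mod k))
      = Y k k u (\<lambda>a. a div k) * Y k k u (\<lambda>a. a div k) * Y k k u (\<lambda>a. a mod k)"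
      by (simp add: numeral_3_eq_3 lessThan_Suc)
    also have "Y k k u (\<lambda>a. a div k) = Y k k u ?x" by (rule Y_cong) simp_all
    also have "Y k k u (\<lambda>a. a mod k) = of_int (c u)"
      unfolding c_def Y_def[symmetric] by (rule Y_cong) simp_all
    also have "Y k k u ?x * Y k k u ?x * of_int (c u) = of_int (of_bool (inj_on (R u) ?I) * c u)"
      using Y_square[of k k u ?x] R_inj[OF u] by (cases "Y k k u ?x = 0") simp_all
    finally show "(\<Prod>l<3::nat. Y k k u (\<lambda>a. if l < 2 then a div k else a mod k)) = of_int (of_bool (inj_on (R u) ?I) * c u)" .
  qed
  moreover have "g \<noteq> 0"
  proof
    assume g0: "g = 0"
    \<comment> \<open>Covariance of the determinant form at the standard words expands
      \<open>det X ^ k\<close> into monomials with the coefficients \<open>c u\<close>, up to the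
      sign \<open>c ?x\<close>.\<close>
    have expand: "det (X T) ^ k * c ?x = (\<Sum>u\<in>?W. c u * (\<Prod>a\<in>?I. int (T (R u a))))" for T
    proof -
      let ?X = "map_mat of_int (X T) :: complex mat"
      have "det ?X ^ k * Y k k ?x ?z = (\<Sum>u\<in>?W. (\<Prod>a\<in>?I. ?X $$ (?x a, u a)) * Y k k u ?z)"
        by (rule Y_GL_left[OF _ xw zw, symmetric]) (simp add: X_def)
      also have "\<dots> = (\<Sum>u\<in>?W. of_int (c u) * of_int (\<Prod>a\<in>?I. int (T (R u a))))"
      proof (rule sum.cong[OF refl])
        fix u assume u: "u \<in> ?W"
        have "(\<Prod>a\<in>?I. ?X $$ (?x a, u a)) = (\<Prod>a\<in>?I. of_int (int (T (R u a))))"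
        proof (rule prod.cong[OF refl])
          fix a assume a: "a \<in> ?I"
          show "?X $$ (?x a, u a) = of_int (int (T (R u a)))"
            using words_lt[OF xw a] words_lt[OF u a] unfolding X_def R_def by simp
        qed
        then show "(\<Prod>a\<in>?I. ?X $$ (?x a, u a)) * Y k k u ?z = of_int (c u) * of_int (\<Prod>a\<in>?I. int (T (R u a)))"
          unfolding of_int_prod c_def Y_def by (simp only: mult.commute)
      qed
      finally have "of_int (det (X T) ^ k * c ?x) = (of_int (\<Sum>u\<in>?W. c u * (\<Prod>a\<in>?I. int (T (R u a)))) :: complex)"
        unfolding c_def Y_def of_int_hom.hom_det[symmetric] of_int_mult of_int_power of_int_sum .
      then show ?thesis unfolding of_int_eq_iff .
    qed
    \<comment> \<open>Weighting by \<open>Q\<close> and summing over all matrices keeps exactly the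
      monomials in which every entry occurs once.\<close>
    have select: "[(\<Sum>T\<in>words ?I p. Q T * (\<Prod>a\<in>?I. int (T (R u a)))) = of_bool (inj_on (R u) ?I)] (mod int p)"
      if "u \<in> ?W" for u
      using sum_monomial_mod_prime[OF p finite_lessThan finite_lessThan refl R_I[OF that]] evk
      by (cases "inj_on (R u) ?I") (simp_all add: Q_def)
    have "c ?x * M = (\<Sum>T\<in>words ?I p. \<Sum>u\<in>?W. c u * (Q T * (\<Prod>a\<in>?I. int (T (R u a)))))"
      unfolding M_def sum_distrib_left
    proof (rule sum.cong[OF refl])
      fix T
      have "c ?x * (Q T * det (X T) ^ k) = Q T * (det (X T) ^ k * c ?x)" by (simp only: ac_simps)
      then show "c ?x * (Q T * det (X T) ^ k) = (\<Sum>u\<in>?W. c u * (Q T * (\<Prod>a\<in>?I. int (T (R u a)))))"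
        unfolding expand sum_distrib_left by (simp only: ac_simps)
    qed
    also have "\<dots> = (\<Sum>u\<in>?W. c u * (\<Sum>T\<in>words ?I p. Q T * (\<Prod>a\<in>?I. int (T (R u a)))))"
      unfolding sum_distrib_left by (rule sum.swap)
    finally have 1: "c ?x * M = (\<Sum>u\<in>?W. c u * (\<Sum>T\<in>words ?I p. Q T * (\<Prod>a\<in>?I. int (T (R u a)))))" .
    have "[c ?x * M = (\<Sum>u\<in>?W. c u * of_bool (inj_on (R u) ?I))] (mod int p)"
      unfolding 1 by (intro cong_sum cong_mult cong_refl select)
    then have "[c ?x * M = g] (mod int p)" by (simp only: g_def mult.commute)
    then have dvd: "int p dvd c ?x * M" using g0 by (simp add: cong_0_iff)
    have "c ?x \<in> {1, -1}"
    proof -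
      have "c ?x \<noteq> 0" using Y_standard_nonzero[of k k] by (simp add: c_def Y_def)
      then show ?thesis using perm_sign_cases[of "k * k"] unfolding c_def by blast
    qed
    then have dvdM: "int p dvd M" using dvd by auto

    define V where "V = words {..<k} p"
    have row_card: "card {a\<in>?I. a div k = i} = k" if "i < k" for i
    proof -
      have "card {a\<in>?I. ?x a = i} = k" by (rule Y_balanced[OF xw zw Y_standard_nonzero that])
      moreover have "{a\<in>?I. ?x a = i} = {a\<in>?I. a div k = i}" by auto
      ultimately show ?thesis by simp
    qed
    have rows: "(\<Prod>i<k. e i ^ k) = (\<Prod>a\<in>?I. e (a div k))" for e :: "nat \<Rightarrow> int"
    proof -
      have "(\<Prod>a\<in>?I. e (a div k)) = (\<Prod>i<k. e i ^ card {a\<in>?I. a div k = i})"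
        by (rule prod_eq_prod_power_card) (auto simp: lt_square_div)
      also have "\<dots> = (\<Prod>i<k. e i ^ k)" by (rule prod.cong[OF refl], subst row_card) simp_all
      finally show ?thesis by (rule sym)
    qed
    have entry: "(\<Sum>j<k. X T $$ (i, j) * int (y j)) = (\<Sum>j<k. int (T (i * k + j)) * int (y j))" if "i < k" for T y i
      using that by (simp add: X_def)
    have pw: "(\<Prod>i<k. (\<Sum>j<k. X T $$ (i, j) * int (y j)) ^ (p - 1))
      = (\<Sum>S\<in>?W. (\<Prod>a\<in>?I. int (T (R S a))) * (\<Prod>a\<in>?I. int (y (S a))))" for T y
    proof -
      have "(\<Prod>i<k. (\<Sum>j<k. X T $$ (i, j) * int (y j)) ^ (p - 1))
        = (\<Prod>i<k. (\<Sum>j<k. int (T (i * k + j)) * int (y j)) ^ k)"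
        unfolding k_def[symmetric] by (intro prod.cong refl) (simp add: entry)
      also have "\<dots> = (\<Prod>a\<in>?I. \<Sum>j<k. int (T (?x a * k + j)) * int (y j))"
        unfolding rows by (intro prod.cong refl) simp
      also have "\<dots> = (\<Sum>S\<in>?W. \<Prod>a\<in>?I. int (T (?x a * k + S a)) * int (y (S a)))"
        by (rule prod_sum_PiE'[symmetric]) simp_all
      finally show ?thesis by (simp only: R_def prod.distrib)
    qed
    \<comment> \<open>The second evaluation writes the power of the determinant as a sum of products
      of linear forms. Only arrays \<open>S\<close> with a permutation in every row survive, each
      with weight 1, and Wilson's theorem evaluates their number.\<close>
    have "[M = (\<Sum>T\<in>words ?I p. Q T * (\<Sum>y\<in>V. \<Prod>i<k. (\<Sum>j<k. X T $$ (i, j) * int (y j)) ^ (p - 1)))] (mod int p)"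
      unfolding M_def V_def
    proof (intro cong_sum cong_mult cong_refl)
      fix T show "[det (X T) ^ k = (\<Sum>y\<in>words {..<k} p. \<Prod>i<k. (\<Sum>j<k. X T $$ (i, j) * int (y j)) ^ (p - 1))] (mod int p)"
        using det_power_pred_prime[OF p(1) _ evk, of "X T"] unfolding k_def[symmetric] by (simp add: X_def)
    qed
    also have "(\<Sum>T\<in>words ?I p. Q T * (\<Sum>y\<in>V. \<Prod>i<k. (\<Sum>j<k. X T $$ (i, j) * int (y j)) ^ (p - 1)))
      = (\<Sum>S\<in>?W. \<Sum>y\<in>V. (\<Sum>T\<in>words ?I p. Q T * (\<Prod>a\<in>?I. int (T (R S a)))) * (\<Prod>a\<in>?I. int (y (S a))))"
    proof -
      have "(\<Sum>T\<in>words ?I p. Q T * (\<Sum>y\<in>V. \<Prod>i<k. (\<Sum>j<k. X T $$ (i, j) * int (y j)) ^ (p - 1)))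
        = (\<Sum>T\<in>words ?I p. \<Sum>y\<in>V. \<Sum>S\<in>?W. Q T * (\<Prod>a\<in>?I. int (T (R S a))) * (\<Prod>a\<in>?I. int (y (S a))))"
        unfolding pw sum_distrib_left by (simp only: mult.assoc)
      also have "\<dots> = (\<Sum>T\<in>words ?I p. \<Sum>S\<in>?W. \<Sum>y\<in>V. Q T * (\<Prod>a\<in>?I. int (T (R S a))) * (\<Prod>a\<in>?I. int (y (S a))))"
        by (rule sum.cong[OF refl], rule sum.swap)
      also have "\<dots> = (\<Sum>S\<in>?W. \<Sum>T\<in>words ?I p. \<Sum>y\<in>V. Q T * (\<Prod>a\<in>?I. int (T (R S a))) * (\<Prod>a\<in>?I. int (y (S a))))"
        by (rule sum.swap)
      also have "\<dots> = (\<Sum>S\<in>?W. \<Sum>y\<in>V. \<Sum>T\<in>words ?I p. Q T * (\<Prod>a\<in>?I. int (T (R S a))) * (\<Prod>a\<in>?I. int (y (S a))))"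
        by (rule sum.cong[OF refl], rule sum.swap)
      finally show ?thesis unfolding sum_distrib_right .
    qed
    also have "[\<dots> = (\<Sum>S\<in>?W. of_bool (inj_on (R S) ?I) * 1)] (mod int p)"
    proof (rule cong_sum)
      fix S assume S: "S \<in> ?W"
      have "[(\<Sum>y\<in>V. (\<Sum>T\<in>words ?I p. Q T * (\<Prod>a\<in>?I. int (T (R S a)))) * (\<Prod>a\<in>?I. int (y (S a))))
        = (\<Sum>y\<in>V. of_bool (inj_on (R S) ?I) * (\<Prod>a\<in>?I. int (y (S a))))] (mod int p)"
        by (intro cong_sum cong_mult cong_refl select S)
      also have "[(\<Sum>y\<in>V. of_bool (inj_on (R S) ?I) * (\<Prod>a\<in>?I. int (y (S a))))
        = of_bool (inj_on (R S) ?I) * 1] (mod int p)"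
      proof (cases "inj_on (R S) ?I")
        case True
        have "(\<Prod>a\<in>?I. int (y (S a))) = (\<Prod>j<k. int (y j) ^ (p - 1))" for y
        proof -
          have nz: "Y k k S ?x \<noteq> 0" using True R_inj[OF S] by simp
          have "S ` ?I \<subseteq> {..<k}" using words_lt[OF S] by auto
          from prod_eq_prod_power_card[OF finite_lessThan finite_lessThan this, of "\<lambda>j. int (y j)"] show ?thesis
            using Y_balanced[OF S xw nz] by (simp add: k_def)
        qed
        moreover have "[(\<Sum>y\<in>V. \<Prod>j<k. int (y j) ^ (p - 1)) = 1] (mod int p)"
          unfolding V_def by (rule sum_prod_power_pred_prime[OF p(1)]) (use evk in simp_all)
        ultimately show ?thesis using True by (simp only: of_bool_eq(2) mult_1)
      qed simp
      finally show "[(\<Sum>y\<in>V. (\<Sum>T\<in>words ?I p. Q T * (\<Prod>a\<in>?I. int (T (R S a)))) * (\<Prod>a\<in>?I. int (y (S a))))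
        = of_bool (inj_on (R S) ?I) * 1] (mod int p)" .
    qed
    also have "(\<Sum>S\<in>?W. of_bool (inj_on (R S) ?I) * 1) = int (card {S\<in>?W. inj_on (R S) ?I})"
      unfolding mult_1_right by (rule sum_of_bool_card[OF finite_words[OF finite_lessThan]])
    also have "{S\<in>?W. inj_on (R S) ?I} = {S\<in>?W. inj_on (\<lambda>a. (a div k, S a)) ?I}"
    proof (rule Collect_cong, rule conj_cong[OF refl])
      fix S assume S: "S \<in> ?W"
      have "inj_on (R S) ?I \<longleftrightarrow> inj_on (\<lambda>a. (?x a, S a)) ?I"
        unfolding R_def by (rule code_inj_iff) (rule words_lt[OF S])
      also have "\<dots> \<longleftrightarrow> inj_on (\<lambda>a. (a div k, S a)) ?I" by (rule inj_on_cong) simp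
      finally show "inj_on (R S) ?I \<longleftrightarrow> inj_on (\<lambda>a. (a div k, S a)) ?I" .
    qed
    also have "int (card {S\<in>?W. inj_on (\<lambda>a. (a div k, S a)) ?I}) = fact k ^ k" by (simp add: card_injective_rows)
    also have "[fact k ^ k = (-1 :: int) ^ k] (mod int p)"
      using wilson_theorem[OF p(1)] unfolding k_def by (rule cong_pow)
    finally have "[M = 1] (mod int p)" using evk by simp
    then have "int p dvd 1" using dvdM cong_dvd_iff by blast
    then show False using prime_gt_1_nat[OF p(1)] by simp
  qed
  ultimately show ?thesis by (simp add: k_def)
qed

subsection \<open>Bertrand's postulate\<close>

lemma prod_primes_dvd:
  fixes m :: nat
  assumes "finite S" "\<And>p. p \<in> S \<Longrightarrow> prime p" "\<And>p. p \<in> S \<Longrightarrow> p dvd m"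
  shows "\<Prod>S dvd m"
  using assms
proof (induction S rule: finite_induct)
  case (insert p S)
  have "coprime p (\<Prod>S)"
    using insert.hyps insert.prems by (intro prod_coprime_right primes_coprime) auto
  then show ?case using insert by (simp add: divides_mult)
qed simp

text \<open>The coefficient occurs twice in row \<open>2 * m + 1\<close>, whose sum is
  \<open>2 * 4 ^ m\<close>.\<close>

lemma central_odd_binomial_le: "(2 * m + 1) choose m \<le> 4 ^ m"
proof -
  have "2 * ((2 * m + 1) choose m) = ((2 * m + 1) choose m) + ((2 * m + 1) choose (m + 1))"
    using binomial_symmetric[of m "2 * m + 1"] by simp
  also have "\<dots> = (\<Sum>i\<in>{m, m + 1}. (2 * m + 1) choose i)" by simp
  also have "\<dots> \<le> (\<Sum>i\<le>2 * m + 1. (2 * m + 1) choose i)" by (rule sum_mono2) auto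
  also have "\<dots> = 2 * 4 ^ m" unfolding choose_row_sum by (simp add: power_mult)
  finally show ?thesis by simp
qed

text \<open>For \<open>n = 2 * m + 1\<close> the primes above \<open>m + 1\<close> divide
  \<open>n choose m\<close>, which is at most \<open>4 ^ m\<close>, and the others are covered by
  induction. An even \<open>n > 2\<close> is not prime itself.\<close>

lemma primorial_le: "\<Prod>{p. prime p \<and> p \<le> n} \<le> (4 :: nat) ^ n"
proof (induction n rule: less_induct)
  case (less n)
  show ?case
  proof (cases "n \<le> 2")
    case True
    have "{p :: nat. prime p \<and> p \<le> n} \<subseteq> {2}"
    proof
      fix p assume "p \<in> {p. prime p \<and> p \<le> n}"
      then show "p \<in> {2}" using prime_ge_2_nat[of p] True by auto
    qed
    then have "{p :: nat. prime p \<and> p \<le> n} = {} \<or> {p. prime p \<and> p \<le> n} = {2}" by blast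
    then show ?thesis
    proof
      assume *: "{p :: nat. prime p \<and> p \<le> n} = {2}"
      then have "2 \<in> {p :: nat. prime p \<and> p \<le> n}" by simp
      then have "n = 2" using True by simp
      then show ?thesis unfolding * by simp
    next
      assume *: "{p :: nat. prime p \<and> p \<le> n} = {}"
      show ?thesis unfolding * by simp
    qed
  next
    case n2: False
    show ?thesis
    proof (cases "even n")
      case True
      have "\<not> prime n" using True n2 prime_odd_nat[of n] by auto
      then have "{p. prime p \<and> p \<le> n} = {p. prime p \<and> p \<le> n - 1}" using n2 by (auto simp: le_less)
      then have "\<Prod>{p. prime p \<and> p \<le> n} \<le> 4 ^ (n - 1)" using less[of "n - 1"] n2 by simp
      also have "\<dots> \<le> 4 ^ n" by (rule power_increasing) auto
      finally show ?thesis .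
    next
      case False
      then obtain m where m: "n = 2 * m + 1" by (elim oddE)
      let ?S = "{p. prime p \<and> m + 1 < p \<and> p \<le> n}"
      have "\<Prod>?S dvd (n choose m)"
      proof (rule prod_primes_dvd)
        fix p assume p: "p \<in> ?S"
        have eq: "fact n = fact m * fact (m + 1) * (n choose m)"
          using binomial_fact_lemma[of m n] m by simp
        have "p dvd fact n" using p by (simp add: prime_dvd_fact_iff)
        moreover have "\<not> p dvd fact m" "\<not> p dvd fact (m + 1)" using p prime_dvd_fact_iff[of p m] prime_dvd_fact_iff[of p "m + 1"] by auto
        ultimately show "p dvd (n choose m)" using p unfolding eq by (simp only: prime_dvd_mult_iff mem_Collect_eq) blast
      qed auto
      then have "\<Prod>?S \<le> n choose m" by (rule dvd_imp_le) (simp add: m)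
      also have "\<dots> \<le> 4 ^ m" unfolding m by (rule central_odd_binomial_le)
      finally have 1: "\<Prod>?S \<le> 4 ^ m" .
      have 2: "\<Prod>{p. prime p \<and> p \<le> m + 1} \<le> (4 :: nat) ^ (m + 1)" using n2 m by (intro less) simp
      have split: "{p. prime p \<and> p \<le> n} = {p. prime p \<and> p \<le> m + 1} \<union> ?S" using m by auto
      have "\<Prod>{p. prime p \<and> p \<le> n} = \<Prod>{p. prime p \<and> p \<le> m + 1} * \<Prod>?S"
        unfolding split by (rule prod.union_disjoint) auto
      also have "\<dots> \<le> 4 ^ (m + 1) * 4 ^ m" by (rule mult_le_mono[OF 2 1])
      also have "\<dots> = 4 ^ n" unfolding m by (simp flip: power_add)
      finally show ?thesis .
    qed
  qed
qed

text \<open>Legendre's formula, cut off at an \<open>M\<close> beyond which the quotients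
  vanish.\<close>

lemma multiplicity_fact:
  fixes p :: nat
  assumes p: "prime p" and n: "n < p ^ Suc M"
  shows "multiplicity p (fact n) = (\<Sum>i\<in>{1..M}. n div p ^ i)"
  using n
proof (induction n)
  case (Suc n)
  let ?v = "multiplicity p (Suc n)"
  have p1: "\<not> is_unit p" using prime_gt_1_nat[OF p] by simp
  have dvd_iff: "p ^ i dvd Suc n \<longleftrightarrow> i \<le> ?v" for i
    using power_dvd_iff_le_multiplicity[of "Suc n" p i] p1 by simp
  have "p ^ ?v \<le> Suc n" by (intro dvd_imp_le multiplicity_dvd) simp
  then have "p ^ ?v < p ^ Suc M" using Suc.prems by linarith
  from power_less_imp_less_exp[OF prime_gt_1_nat[OF p] this] have vM: "?v \<le> M" by simp
  have "(\<Sum>i\<in>{1..M}. Suc n div p ^ i) = (\<Sum>i\<in>{1..M}. n div p ^ i + of_bool (p ^ i dvd Suc n))"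
    by (intro sum.cong refl) (simp add: div_Suc dvd_eq_mod_eq_0)
  also have "\<dots> = (\<Sum>i\<in>{1..M}. n div p ^ i) + card {i\<in>{1..M}. i \<le> ?v}"
    by (simp add: sum.distrib dvd_iff of_bool_def sum.If_cases Int_def)
  also have "{i\<in>{1..M}. i \<le> ?v} = {1..?v}" using vM by auto
  also have "(\<Sum>i\<in>{1..M}. n div p ^ i) = multiplicity p (fact n)" using Suc by simp
  also have "multiplicity p (fact n) + card {1..?v} = multiplicity p (fact (Suc n))"
    unfolding fact_Suc using p by (subst prime_elem_multiplicity_mult_distrib) auto
  finally show ?case by simp
qed simp

lemma double_div_le: "2 * n div q \<le> 2 * (n div q) + (1 :: nat)"
proof (cases "q = 0")
  case False
  have "q * Suc (2 * (n div q) + 1) = 2 * (q * (n div q)) + 2 * q" by (simp add: algebra_simps)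
  then have "2 * n < Suc (2 * (n div q) + 1) * q"
    using mult_div_mod_eq[of q n] mod_less_divisor[of q n] False by (simp only: mult.commute) linarith
  from less_mult_imp_div_less[OF this] show ?thesis by simp
qed simp

lemma multiplicity_central_binomial:
  fixes p :: nat
  assumes p: "prime p" and n: "2 * n < p ^ Suc M"
  shows "multiplicity p ((2 * n) choose n) = (\<Sum>i\<in>{1..M}. 2 * n div p ^ i - 2 * (n div p ^ i))"
proof -
  have "fact (2 * n) = fact n * fact n * ((2 * n) choose n)"
    using binomial_fact_lemma[of n "2 * n"] by simp
  moreover have "(2 * n) choose n > 0" by (rule zero_less_binomial) simp
  ultimately have "multiplicity p (fact (2 * n)) = 2 * multiplicity p (fact n) + multiplicity p ((2 * n) choose n)"
    using p by (simp add: prime_elem_multiplicity_mult_distrib)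
  moreover have "multiplicity p (fact (2 * n)) = (\<Sum>i\<in>{1..M}. 2 * n div p ^ i)" by (rule multiplicity_fact[OF p n])
  moreover have "multiplicity p (fact n) = (\<Sum>i\<in>{1..M}. n div p ^ i)" using n by (intro multiplicity_fact p) simp
  moreover have "2 * (n div q) \<le> 2 * n div q" for q :: nat
    by (cases "q = 0") (simp_all add: less_eq_div_iff_mult_less_eq mult.assoc)
  ultimately show ?thesis by (simp add: sum_subtractf_nat sum_distrib_left)
qed

text \<open>In Legendre's formula each of the \<open>M\<close> terms is at most 1, where
  \<open>p ^ M\<close> is the largest power of \<open>p\<close> up to \<open>2 * n\<close>.\<close>

lemma prime_power_central_binomial_le:
  fixes p :: nat
  assumes p: "prime p" and n: "n > 0"
  shows "p ^ multiplicity p ((2 * n) choose n) \<le> 2 * n"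
proof -
  have p1: "p > 1" by (rule prime_gt_1_nat[OF p])
  obtain M where M: "p ^ M \<le> 2 * n" "2 * n < p ^ Suc M"
    using ex_power_ivl1[of p "2 * n"] p1 n by auto
  have "multiplicity p ((2 * n) choose n) = (\<Sum>i\<in>{1..M}. 2 * n div p ^ i - 2 * (n div p ^ i))"
    by (rule multiplicity_central_binomial[OF p M(2)])
  also have "\<dots> \<le> (\<Sum>i\<in>{1..M}. 1)" using double_div_le by (intro sum_mono) (simp add: le_diff_conv)
  also have "\<dots> = M" by simp
  finally have "p ^ multiplicity p ((2 * n) choose n) \<le> p ^ M" using p1 by (intro power_increasing) auto
  then show ?thesis using M(1) by simp
qed

text \<open>Here \<open>p\<close> and \<open>2 * p\<close> are the only multiples of
  \<open>p\<close> up to \<open>2 * n\<close>; their two factors \<open>p\<close> cancel against the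
  square of \<open>fact n\<close>, and \<open>p ^ 2\<close> exceeds \<open>2 * n\<close>.\<close>

lemma multiplicity_central_binomial_gap:
  fixes p :: nat
  assumes p: "prime p" and n: "n \<ge> 3" and pn: "p \<le> n" "2 * n < 3 * p"
  shows "multiplicity p ((2 * n) choose n) = 0"
proof -
  have p3: "p \<ge> 3" using pn n by linarith
  have "2 * n < p * p" using pn(2) mult_le_mono1[OF p3, of p] by linarith
  then have "multiplicity p ((2 * n) choose n) = (\<Sum>i\<in>{1..1}. 2 * n div p ^ i - 2 * (n div p ^ i))"
    by (intro multiplicity_central_binomial p) simp
  moreover have "n div p = 1" using pn by (intro div_nat_eqI) auto
  moreover have "2 * n div p = 2" using pn by (intro div_nat_eqI) auto
  ultimately show ?thesis by simp
qed

text \<open>Each step multiplies the left side by at most \<open>(32 / 31) ^ 6 < 2\<close>. At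
  \<open>s = 29\<close> the inequality still fails.\<close>

lemma power_6_less_power_2: "s \<ge> 30 \<Longrightarrow> (s + 1) ^ 6 < (2 :: nat) ^ s"
proof (induction s rule: nat_induct_at_least)
  case (Suc s)
  have "31 * (s + 2) \<le> 32 * (s + 1)" using Suc.hyps by simp
  then have "(31 * (s + 2)) ^ 6 \<le> (32 * (s + 1)) ^ 6" by (rule power_mono) simp
  then have "31 ^ 6 * (s + 2) ^ 6 \<le> 32 ^ 6 * (s + 1) ^ 6" unfolding power_mult_distrib .
  also have "\<dots> \<le> 31 ^ 6 * (2 * (s + 1) ^ 6)" by simp
  finally have "(s + 2) ^ 6 \<le> 2 * (s + 1) ^ 6" by simp
  then show ?case using Suc.IH by simp
qed simp

text \<open>Erdos's argument: without a prime in the interval, the central binomial coefficient has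
  only prime factors up to \<open>2 * n / 3\<close>, and those above \<open>s\<close> occur once,
  which makes it smaller than \<open>4 ^ n / (2 * n)\<close>. The bound 450 is half of
  \<open>30 ^ 2\<close>, so that \<open>s \<ge> 30\<close>.\<close>

lemma bertrand_large:
  fixes n :: nat
  assumes n: "n \<ge> 450"
  shows "\<exists>p. prime p \<and> n < p \<and> p \<le> 2 * n"
proof (rule ccontr)
  assume none: "\<not> ?thesis"
  define C where "C = (2 * n) choose n"
  define s where "s = floor_sqrt (2 * n)"
  define v where "v = (\<lambda>p. multiplicity p C)"
  have C0: "C > 0" unfolding C_def by (rule zero_less_binomial) simp
  have s2: "s ^ 2 \<le> 2 * n" by (simp add: s_def)
  have s3: "2 * n < (s + 1) ^ 2"
    unfolding s_def using Suc_floor_sqrt_power2_gt[of "2 * n"] by simp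
  have s30: "s \<ge> 30" unfolding s_def by (rule le_floor_sqrtI) (use n in simp)
  have le2n: "p \<le> 2 * n" if "p \<in> prime_factors C" for p
  proof -
    have p: "prime p" "v p > 0" using that by (auto simp: v_def prime_factors_multiplicity)
    have "p ^ 1 \<le> p ^ v p" using p prime_gt_0_nat[of p] by (intro power_increasing) auto
    then show ?thesis using prime_power_central_binomial_le[OF p(1), of n] n by (simp add: v_def C_def)
  qed
  let ?S = "{p \<in> prime_factors C. p \<le> s}" and ?B = "{p \<in> prime_factors C. s < p}"
  have fin: "finite ?S" "finite ?B" by simp_all
  have "C = (\<Prod>p\<in>prime_factors C. p ^ v p)" unfolding v_def by (rule prime_factorization_nat[OF C0])
  also have "prime_factors C = ?S \<union> ?B" by auto
  also have "(\<Prod>p\<in>?S \<union> ?B. p ^ v p) = (\<Prod>p\<in>?S. p ^ v p) * (\<Prod>p\<in>?B. p ^ v p)"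
    by (rule prod.union_disjoint[OF fin]) auto
  also have "(\<Prod>p\<in>?S. p ^ v p) \<le> (\<Prod>p\<in>?S. 2 * n)"
    using n by (intro prod_mono) (auto simp: v_def C_def intro!: prime_power_central_binomial_le dest: in_prime_factors_imp_prime)
  \<comment> \<open>As 1 is not prime there are at most \<open>s - 1\<close> small primes; the
    factor saved absorbs the \<open>2 * n\<close> of the lower bound for \<open>C\<close>.\<close>
  also have "(\<Prod>p\<in>?S. 2 * n) \<le> (2 * n) ^ (s - 1)"
  proof -
    have "?S \<subseteq> {2..s}" using prime_ge_2_nat by (auto dest: in_prime_factors_imp_prime)
    then have "card ?S \<le> card {2..s}" by (intro card_mono) auto
    then show ?thesis unfolding prod_constant using n by (intro power_increasing) simp_all
  qed
  also have "(\<Prod>p\<in>?B. p ^ v p) \<le> 4 ^ (2 * n div 3)"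
  proof -
    have B: "p ^ v p \<le> p \<and> prime p \<and> p \<le> 2 * n div 3" if "p \<in> ?B" for p
    proof -
      have p: "prime p" "v p > 0" "s < p" using that by (auto simp: v_def prime_factors_multiplicity)
      have p1: "p > 1" by (rule prime_gt_1_nat[OF p(1)])
      have "v p \<le> 1"
      proof (rule ccontr)
        assume "\<not> ?thesis"
        then have "p ^ 2 \<le> p ^ v p" using p1 by (intro power_increasing) auto
        also have "\<dots> \<le> 2 * n" unfolding v_def C_def using p(1) n by (intro prime_power_central_binomial_le) auto
        also have "\<dots> < (s + 1) ^ 2" by (rule s3)
        also have "\<dots> \<le> p ^ 2" using p(3) by (intro power_mono) auto
        finally show False by simp
      qed
      then have "p ^ v p \<le> p ^ 1" using p1 by (intro power_increasing) auto
      moreover have "p \<le> n" using none le2n[of p] that p(1) by (auto simp: not_less)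
      then have "\<not> 2 * n < 3 * p"
        using multiplicity_central_binomial_gap[OF p(1), of n] p(2) n by (auto simp: v_def C_def)
      ultimately show ?thesis using p(1) by (simp add: less_eq_div_iff_mult_less_eq)
    qed
    then have "(\<Prod>p\<in>?B. p ^ v p) \<le> (\<Prod>p\<in>?B. p)" by (intro prod_mono) auto
    also have "\<dots> \<le> \<Prod>{p. prime p \<and> p \<le> 2 * n div 3}"
    proof (intro dvd_imp_le prod_dvd_prod_subset)
      show "finite {p. prime p \<and> p \<le> 2 * n div 3}" by (rule finite_subset[of _ "{..2 * n div 3}"]) auto
      show "\<Prod>{p. prime p \<and> p \<le> 2 * n div 3} > 0" by (rule prod_pos) (simp add: prime_gt_0_nat)
    qed (use B in blast)
    also have "\<dots> \<le> 4 ^ (2 * n div 3)" by (rule primorial_le)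
    finally show ?thesis .
  qed
  finally have C_le: "C \<le> (2 * n) ^ (s - 1) * 4 ^ (2 * n div 3)" by (simp add: mult_le_mono)
  have "real (4 ^ n) \<le> real (2 * n * C)"
    using central_binomial_lower_bound[of n] n by (simp add: C_def field_simps)
  then have "4 ^ n \<le> 2 * n * C" unfolding of_nat_le_iff .
  also have "\<dots> \<le> 2 * n * ((2 * n) ^ (s - 1) * 4 ^ (2 * n div 3))" using C_le by simp
  also have "\<dots> = (2 * n) ^ s * 4 ^ (2 * n div 3)" using s30 by (cases s) simp_all
  finally have "4 ^ (n - 2 * n div 3) * 4 ^ (2 * n div 3) \<le> (2 * n) ^ s * 4 ^ (2 * n div 3)"
    unfolding power_add[symmetric] by simp
  then have "4 ^ (n - 2 * n div 3) \<le> (2 * n) ^ s" by simp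
  \<comment> \<open>Cubing removes the third from the exponent, as
    \<open>3 * (n - 2 * n div 3)\<close> is at least \<open>n\<close>.\<close>
  then have "(4 ^ (n - 2 * n div 3)) ^ 3 \<le> ((2 * n) ^ s) ^ 3" by (rule power_mono) simp
  then have *: "4 ^ (3 * (n - 2 * n div 3)) \<le> (2 * n) ^ (3 * s)" by (simp only: power_mult[symmetric] mult.commute)
  have "2 ^ (s * s) \<le> (2 :: nat) ^ (2 * n)" using s2 by (intro power_increasing) (simp_all add: power2_eq_square)
  also have "\<dots> = 4 ^ n" by (simp add: power_mult)
  also have "\<dots> \<le> 4 ^ (3 * (n - 2 * n div 3))" by (rule power_increasing) auto
  also have "\<dots> \<le> (2 * n) ^ (3 * s)" by (rule *)
  also have "\<dots> \<le> ((s + 1) ^ 2) ^ (3 * s)" using s3 by (intro power_mono) auto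
  also have "\<dots> = ((s + 1) ^ 6) ^ s" by (simp flip: power_mult)
  finally have "(2 ^ s) ^ s \<le> ((s + 1) ^ 6) ^ s" by (simp add: power_mult)
  moreover have "((s + 1) ^ 6) ^ s < (2 ^ s) ^ s" using s30 by (intro power_strict_mono power_6_less_power_2) auto
  ultimately show False by simp
qed

lemma bertrand_extend:
  assumes "\<forall>n\<in>{1..<q}. \<exists>p. prime p \<and> n < p \<and> p \<le> 2 * n" and r: "prime r" "r \<le> 2 * q"
  shows "\<forall>n\<in>{1..<r :: nat}. \<exists>p. prime p \<and> n < p \<and> p \<le> 2 * n"
proof
  fix n assume n: "n \<in> {1..<r}"
  show "\<exists>p. prime p \<and> n < p \<and> p \<le> 2 * n"
  proof (cases "n < q")
    case True
    then show ?thesis using assms(1) n by simp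
  next
    case False
    then show ?thesis using r n by (intro exI[of _ r]) simp
  qed
qed

lemma bertrand:
  fixes n :: nat
  assumes n: "n \<ge> 1"
  shows "\<exists>p. prime p \<and> n < p \<and> p \<le> 2 * n"
proof (cases "n < 450")
  case True
  \<comment> \<open>Primes from 2 up to 457, each at most twice the one before it.\<close>
  have "\<forall>n\<in>{1..<457 :: nat}. \<exists>p. prime p \<and> n < p \<and> p \<le> 2 * n"
    by (rule bertrand_extend[where q = 317], rule bertrand_extend[where q = 163], rule bertrand_extend[where q = 83],
      rule bertrand_extend[where q = 43], rule bertrand_extend[where q = 23], rule bertrand_extend[where q = 13],
      rule bertrand_extend[where q = 7], rule bertrand_extend[where q = 5], rule bertrand_extend[where q = 3],
      rule bertrand_extend[where q = 2], rule bertrand_extend[where q = 1]) simp_all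
  then show ?thesis using n True by simp
next
  case False
  then show ?thesis by (intro bertrand_large) simp
qed

text \<open>Bertrand's postulate for \<open>N\<close>, half of \<open>n\<close> rounded up, gives
  \<open>N \<le> p - 1\<close> and \<open>p \<le> 2 * N \<le> n + 1\<close>. For
  \<open>n = 2\<close> it would return the even prime, so 3 is taken instead.\<close>

lemma exists_prime_near:
  fixes n :: nat
  assumes n: "n \<ge> 2"
  shows "\<exists>p. prime p \<and> odd p \<and> p - 1 \<le> n \<and> n \<le> 2 * (p - 1)"
proof (cases "n = 2")
  case True
  then show ?thesis by (intro exI[of _ 3]) simp
next
  case False
  define N where "N = (n + 1) div 2"
  have N: "N \<ge> 2" using n False by (simp add: N_def)
  obtain p where p: "prime p" "N < p" "p \<le> 2 * N" using bertrand[of N] N by auto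
  have "p \<noteq> 2 * N" using p(1) N prime_odd_nat[of "2 * N"] by auto
  then have "p - 1 \<le> n" "n \<le> 2 * (p - 1)" using p(2,3) unfolding N_def by linarith+
  moreover have "odd p" using p N prime_odd_nat[of p] by auto
  ultimately show ?thesis using p(1) by blast
qed

subsection \<open>The degree of a fundamental invariant\<close>

lemma has_alternating_0:
  assumes d: "d > 0"
  shows "has_alternating d k 0"
  using has_alternating_complement[OF has_alternating_top[OF d] d order_refl] by simp

lemma has_alternating_add_even:
  "has_alternating d k n \<Longrightarrow> has_alternating (d + 2 * m) k n"
proof (induction m)
  case (Suc m)
  from has_alternating_add2[OF Suc.IH[OF Suc.prems]] show ?case by (simp add: algebra_simps)
qed simp

lemma has_alternating_1:
  assumes d: "odd d"
  shows "has_alternating d k 1"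
proof -
  obtain m where m: "d = 2 * m + 1" using d by (elim oddE)
  have "has_alternating 1 k 1" using has_alternating_top[of 1 k] by simp
  from has_alternating_add_even[OF this, of m] show ?thesis by (simp add: m add.commute)
qed

text \<open>Write \<open>n = q * k ^ (2 * m) + r\<close>. The case of three directions supplies
  columns of heights \<open>q\<close> and \<open>Suc q\<close>, and the induction hypothesis
  supplies a last row of \<open>r\<close> blocks.\<close>

lemma has_alternating_all:
  assumes k: "k > 0" and A: "\<And>q. q \<le> k ^ 2 \<Longrightarrow> has_alternating 3 k q"
    and d: "odd d" and n: "n \<le> k ^ (d - 1)"
  shows "has_alternating d k n"
proof -
  have "has_alternating (2 * m + 1) k n" if "n \<le> k ^ (2 * m)" for m n
    using that
  proof (induction m arbitrary: n)
    case 0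
    then consider "n = 0" | "n = 1" by fastforce
    then show ?case using has_alternating_0[of 1 k] has_alternating_1[of 1 k] by cases simp_all
  next
    case (Suc m)
    define K where "K = k ^ (2 * m)"
    have K: "K > 0" using k by (simp add: K_def)
    define q where "q = n div K"
    define r where "r = n mod K"
    have nqr: "n = q * K + r" by (simp add: q_def r_def)
    have nK: "n \<le> k ^ 2 * K" using Suc.prems by (simp add: K_def power2_eq_square mult.assoc)
    have "q \<le> k ^ 2 * K div K" unfolding q_def by (rule div_le_mono[OF nK])
    then have q: "q \<le> k ^ 2" using K by simp
    \<comment> \<open>A positive remainder forces \<open>q < k ^ 2\<close>, which leaves room for
      the taller columns.\<close>
    have q': "Suc q \<le> k ^ 2" if "r > 0"
    proof (rule ccontr)
      assume "\<not> ?thesis"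
      then have "q = k ^ 2" using q by simp
      then show False using nK that unfolding nqr by simp
    qed
    have rK: "r < k ^ (2 * m + 1 - 1)" using K by (simp add: r_def K_def)
    have "has_alternating (2 * m + 1 + 2) k (q * k ^ (2 * m + 1 - 1) + r)"
    proof (rule has_alternating_step[OF k _ rK _ A[OF q] A[OF q']])
      show "has_alternating (2 * m + 1) k r" using rK by (intro Suc.IH) simp
    qed simp_all
    then show ?case by (simp add: nqr K_def)
  qed
  moreover obtain m where "d = 2 * m + 1" using d by (elim oddE)
  ultimately show ?thesis using n by simp
qed

lemma has_alternating_3_prime:
  assumes p: "prime p" "odd p" and n: "n \<le> 2 * (p - 1)"
  shows "has_alternating 3 (p - 1) n"
proof (rule has_alternating_3[OF _ _ glynn_sum_nonzero[OF p] n])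
  show "p - 1 > 0" using prime_gt_1_nat[OF p(1)] by simp
  show "even (p - 1)" using p(2) by simp
qed

text \<open>For \<open>p = 3\<close> the bound \<open>2 * (p - 1)\<close> is already the full range
  \<open>2 ^ 2\<close> of three directions.\<close>

lemma has_alternating_2:
  assumes "odd d" "n \<le> 2 ^ (d - 1)"
  shows "has_alternating d 2 n"
proof (rule has_alternating_all[OF _ _ assms])
  fix q :: nat assume "q \<le> 2\<^sup>2"
  then show "has_alternating 3 2 q" using has_alternating_3_prime[of 3 q] by simp
qed simp

text \<open>For \<open>p = 5\<close> the bound \<open>2 * (p - 1) = 8\<close> is half of
  \<open>4 ^ 2\<close>, and complements supply the other half.\<close>

lemma has_alternating_4:
  assumes "odd d" "n \<le> 4 ^ (d - 1)"
  shows "has_alternating d 4 n"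
proof (rule has_alternating_all[OF _ _ assms])
  have small: "has_alternating 3 4 q" if "q \<le> 8" for q
    using has_alternating_3_prime[of 5 q] that by simp
  fix q :: nat assume q: "q \<le> 4\<^sup>2"
  show "has_alternating 3 4 q"
  proof (cases "q \<le> 8")
    case False
    then have "has_alternating 3 4 (4 ^ (3 - 1) - (16 - q))"
      using q by (intro has_alternating_complement small) simp_all
    then show ?thesis using q by simp
  qed (rule small)
qed simp

text \<open>Any \<open>k \<le> n\<close> is good enough for the bound \<open>n ^ 2\<close>, so it
  suffices to take three directions and append pairs of directions with \<open>n\<close> and
  \<open>k\<close> unchanged.\<close>

lemma exists_has_alternating_le:
  assumes d: "odd d" "d \<ge> 3" and n: "n \<ge> 1"
  shows "\<exists>k. 0 < k \<and> k \<le> n \<and> has_alternating d k n"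
proof (cases "n = 1")
  case True
  then show ?thesis using has_alternating_1[OF d(1), of 1] by (intro exI[of _ 1]) simp
next
  case False
  then obtain p where p: "prime p" "odd p" "p - 1 \<le> n" "n \<le> 2 * (p - 1)"
    using exists_prime_near[of n] n by auto
  obtain m where "d = 3 + 2 * m"
  proof -
    have "even (d - 3)" using d by simp
    then obtain m where "d - 3 = 2 * m" by (elim evenE)
    then show ?thesis using that[of m] d(2) by simp
  qed
  then have "has_alternating d (p - 1) n"
    using has_alternating_add_even[OF has_alternating_3_prime[OF p(1,2,4)], of m] by simp
  then show ?thesis using p(3) prime_gt_1_nat[OF p(1)] by (intro exI[of _ "p - 1"]) simp
qed

text \<open>Both halves meet here: a nonzero invariant of least degree restricts \<open>k\<close>
  from below, and every alternating tensor bounds it from above.\<close>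

lemma \<delta>_eq:
  assumes d: "odd d" "d \<ge> 3" and n: "n \<ge> 1"
  shows "\<exists>k>0. \<delta> d n = n * k \<and> n \<le> k ^ (d - 1) \<and> (\<forall>k'>0. has_alternating d k' n \<longrightarrow> k \<le> k')"
proof -
  let ?Q = "\<lambda>m. m > 0 \<and> invariants d n m \<noteq> {\<lambda>_. 0}"
  have Q: "?Q (n * k)" if "k > 0" "has_alternating d k n" for k
    using invariant_of_has_alternating[OF that(2) d(1) that(1)] that n by simp
  obtain k0 where "k0 > 0" "has_alternating d k0 n" using exists_has_alternating_le[OF assms] by blast
  from LeastI[of ?Q, OF Q[OF this]] have \<delta>: "\<delta> d n > 0" "invariants d n (\<delta> d n) \<noteq> {\<lambda>_. 0}"
    unfolding \<delta>_def by blast+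
  then obtain f where f: "f \<in> invariants d n (\<delta> d n)" "f \<noteq> (\<lambda>_. 0)"
    using zero_in_invariants[of d n "\<delta> d n"] by blast
  obtain k where k: "k > 0" "\<delta> d n = n * k" "n \<le> k ^ (d - 1)"
    using invariant_degree_lower[OF f \<delta>(1) _ d(1)] n by auto
  have "k \<le> k'" if "k' > 0" "has_alternating d k' n" for k'
  proof -
    have "\<delta> d n \<le> n * k'" unfolding \<delta>_def by (rule Least_le[of ?Q, OF Q[OF that]])
    then show ?thesis using k(2) n by simp
  qed
  then show ?thesis using k by blast
qed

section \<open>Ceilings of roots and the exact values\<close>

lemma ceiling_root_le:
  fixes n k m :: nat
  assumes m: "m > 0" and n: "n > 0" "n \<le> k ^ m"
  shows "\<lceil>real n powr (1 / real m)\<rceil> \<le> int k"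
proof -
  have "root m (real n) \<le> root m (real k ^ m)" using m n(2) by (simp flip: of_nat_power)
  then have "real n powr (1 / real m) \<le> real k"
    using m n(1) root_powr_inverse[of m "real n"] by (simp add: real_root_power_cancel)
  then show ?thesis by (simp add: ceiling_le_iff)
qed

lemma ceiling_root_eq:
  fixes n k m :: nat
  assumes m: "m > 0" and k: "k > 0" and n: "(k - 1) ^ m < n" "n \<le> k ^ m"
  shows "\<lceil>real n powr (1 / real m)\<rceil> = int k"
proof (rule antisym)
  have n0: "n > 0" using n(1) by simp
  show "\<lceil>real n powr (1 / real m)\<rceil> \<le> int k" by (rule ceiling_root_le[OF m n0 n(2)])
  have "real (k - 1) ^ m < real n" using n(1) unfolding of_nat_power[symmetric] of_nat_less_iff .
  then have "root m (real (k - 1) ^ m) < root m (real n)" using m by simp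
  then have "real (k - 1) < real n powr (1 / real m)"
    using m n0 root_powr_inverse[of m "real n"] by (simp add: real_root_power_cancel)
  then show "int k \<le> \<lceil>real n powr (1 / real m)\<rceil>" using k by (simp add: le_ceiling_iff of_nat_diff)
qed

text \<open>This keeps the ceiling at \<open>k\<close> for \<open>k ^ m - 1\<close>; for
  \<open>m = 1\<close> both sides would be equal.\<close>

lemma pred_power_less:
  fixes k m :: nat
  assumes k: "k \<ge> 2" and m: "m \<ge> 2"
  shows "(k - 1) ^ m < k ^ m - 1"
proof -
  obtain j where j: "k = j + 1" "j \<ge> 1" using k by (metis Suc_eq_plus1 Suc_le_D Suc_1 Suc_le_mono One_nat_def)
  obtain l where l: "m = l + 1" "l \<ge> 1" using m by (metis Suc_eq_plus1 Suc_le_D Suc_1 Suc_le_mono One_nat_def)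
  have "j ^ l < (j + 1) ^ l" using l by (intro power_strict_mono) auto
  then have "(j ^ l + 1) * (j + 1) \<le> (j + 1) ^ l * (j + 1)" by (intro mult_le_mono1) simp
  then have "j ^ m + j ^ l + j + 1 \<le> k ^ m" by (simp add: j(1) l(1) algebra_simps)
  moreover have "j ^ l > 0" using j by simp
  ultimately show ?thesis using j by simp
qed

theorem theorem1p1:
  fixes d :: nat
  assumes "d \<ge> 3" and "odd d"
  shows "(\<forall>n::nat. n \<ge> 1 \<longrightarrow>
            int n * \<lceil>real n powr (1 / (real d - 1))\<rceil> \<le> int (\<delta> d n) \<and> \<delta> d n \<le> n ^ 2) \<and>
         (\<forall>n \<in> {1..2 ^ (d - 1)} \<union> {3 ^ (d - 1)..4 ^ (d - 1)}
               \<union> (\<Union>k\<in>{2::nat..}. {k ^ (d - 1) - 1, k ^ (d - 1)}).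
            int (\<delta> d n) = int n * \<lceil>real n powr (1 / (real d - 1))\<rceil>) \<and>
         (\<forall>n \<in> {2 ^ (d - 1) + 1..3 ^ (d - 1)}. \<delta> d n \<in> {3 * n, 4 * n})"
proof -
  define m where "m = d - 1"
  have m: "m \<ge> 2" and d0: "d > 0" and dm: "real d - 1 = real m" using assms by (simp_all add: m_def of_nat_diff)
  note \<delta> = \<delta>_eq[OF assms(2,1), folded m_def]
  have lower: "int n * \<lceil>real n powr (1 / real m)\<rceil> \<le> int (\<delta> d n)" if n: "n \<ge> 1" for n
  proof -
    obtain k where k: "\<delta> d n = n * k" "n \<le> k ^ m" using \<delta>[OF n] by blast
    have "\<lceil>real n powr (1 / real m)\<rceil> \<le> int k" using m n k(2) by (intro ceiling_root_le) auto
    then show ?thesis unfolding k(1) of_nat_mult by (rule mult_left_mono) simp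
  qed
  have upper: "\<delta> d n \<le> n ^ 2" if n: "n \<ge> 1" for n
  proof -
    obtain k where k: "\<delta> d n = n * k" "\<forall>k'>0. has_alternating d k' n \<longrightarrow> k \<le> k'" using \<delta>[OF n] by blast
    obtain k' where k': "0 < k'" "k' \<le> n" "has_alternating d k' n"
      using exists_has_alternating_le[OF assms(2,1) n] by blast
    then have "k \<le> n" using k(2) by (meson le_trans)
    then show ?thesis unfolding k(1) power2_eq_square by simp
  qed
  \<comment> \<open>In this range the ceiling equals \<open>k\<close>, so an alternating tensor in
    dimension \<open>k\<close> meets the lower bound.\<close>
  have exact: "int (\<delta> d n) = int n * \<lceil>real n powr (1 / real m)\<rceil>"
    if A: "has_alternating d k n" and k: "k > 0" and n: "(k - 1) ^ m < n" "n \<le> k ^ m" for n k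
  proof -
    have c: "\<lceil>real n powr (1 / real m)\<rceil> = int k" using m by (intro ceiling_root_eq k n) simp
    have n1: "n \<ge> 1" using n(1) by simp
    obtain k0 where k0: "\<delta> d n = n * k0" "\<forall>k'>0. has_alternating d k' n \<longrightarrow> k0 \<le> k'" using \<delta>[OF n1] by blast
    have "\<delta> d n \<le> n * k" unfolding k0(1) using k0(2) A k by simp
    moreover have "n * k \<le> \<delta> d n" using lower[OF n1] unfolding c of_nat_mult[symmetric] of_nat_le_iff .
    ultimately show ?thesis unfolding c by simp
  qed
  have top: "int (\<delta> d n) = int n * \<lceil>real n powr (1 / real m)\<rceil>" if "k > 0" "n = k ^ m" for n k
    using that m has_alternating_top[OF d0, of k] by (intro exact[of k]) (auto simp: m_def intro!: power_strict_mono)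
  have two: "int (\<delta> d n) = int n * \<lceil>real n powr (1 / real m)\<rceil>" if n: "n \<in> {1..2 ^ m}" for n
  proof (cases "n = 1")
    case True
    then show ?thesis using top[of 1 n] by simp
  next
    case False
    then show ?thesis using n has_alternating_2[OF assms(2), of n] by (intro exact[of 2]) (auto simp: m_def)
  qed
  have four: "int (\<delta> d n) = int n * \<lceil>real n powr (1 / real m)\<rceil>" if n: "n \<in> {3 ^ m..4 ^ m}" for n
  proof (cases "n = 3 ^ m")
    case True
    then show ?thesis using top[of 3 n] by simp
  next
    case False
    then show ?thesis using n has_alternating_4[OF assms(2), of n] by (intro exact[of 4]) (auto simp: m_def)
  qed
  have powers: "int (\<delta> d n) = int n * \<lceil>real n powr (1 / real m)\<rceil>"
    if k: "k \<ge> 2" and n: "n \<in> {k ^ m - 1, k ^ m}" for n k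
  proof (cases "n = k ^ m")
    case True
    then show ?thesis using top[of k n] k by simp
  next
    case False
    then have n': "n = k ^ m - 1" using n by simp
    have "1 \<le> k ^ (d - 1)" using k by simp
    \<comment> \<open>The case \<open>k ^ m - 1\<close> is the complement of the case
      \<open>n = 1\<close>.\<close>
    from has_alternating_complement[OF has_alternating_1[OF assms(2)] d0 this]
    have "has_alternating d k n" by (simp add: n' m_def)
    then show ?thesis using pred_power_less[OF k m] k by (intro exact[of k]) (auto simp: n')
  qed
  \<comment> \<open>Dimension 4 always provides an alternating tensor here, and dimensions up to 2
    are excluded by \<open>n > 2 ^ m\<close>.\<close>
  have gap: "\<delta> d n \<in> {3 * n, 4 * n}" if n: "n \<in> {2 ^ m + 1..3 ^ m}" for n
  proof -
    obtain k where k: "\<delta> d n = n * k" "n \<le> k ^ m" "\<forall>k'>0. has_alternating d k' n \<longrightarrow> k \<le> k'"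
      using \<delta>[of n] n by auto
    have "(3 :: nat) ^ m \<le> 4 ^ m" by (rule power_mono) simp_all
    then have "has_alternating d 4 n" using n by (intro has_alternating_4[OF assms(2)]) (simp add: m_def)
    then have "k \<le> 4" using k(3) by simp
    moreover have "k > 2"
    proof (rule ccontr)
      assume "\<not> ?thesis"
      then have "k ^ m \<le> 2 ^ m" by (intro power_mono) simp_all
      then show False using k(2) n by simp
    qed
    ultimately have "k = 3 \<or> k = 4" by linarith
    then show ?thesis using k(1) by auto
  qed
  show ?thesis
    unfolding dm m_def[symmetric] using lower upper two four powers gap by blast
qed

end
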